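(* Let $d\ge 2$ and suppose the spontaneous magnetization is non-vanishing for some infinite-volume ground state. Then the transverse correlation $\omega_0(S_x^{(2)}S_y^{(2)})$ does not decay as $|\omega_0(S_x^{(2)}S_y^{(2)})|=o(|x-y|^{-(d-1)})$, i.e. it is not true that $|x-y|^{d-1}|\omega_0(S_x^{(2)}S_y^{(2)})|\to 0$ as $|x-y|\to\infty$.
   Context: Fix $d\ge 1$ and a spin magnitude $S\in\{1/2,1,\dots\}$; at each $x\in\mathbb{Z}^d$ spin-$S$ operators $S_x^{(1)},S_x^{(2)},S_x^{(3)}$ on $\mathbb{C}^{2S+1}$ with $[S_x^{(1)},S_x^{(2)}]=iS_x^{(3)}$ and cyclic permutations; quasi-local algebra built from $\mathfrak{A}_\Gamma=\bigotimes_{x\in\Gamma}M_{2S+1}(\mathbb{C})$, $\mathfrak{A}_{\rm loc}=\bigcup_\Gamma\mathfrak{A}_\Gamma$. For a positive integer $L$, $\Lambda=\Lambda_L=\{-L+1,\dots,L\}^d$ with periodic boundary conditions; $H_{0,{\rm p}}^{(\Lambda)}=\sum_{\{x,y\}\subset\Lambda:|x-y|=1}\mathbf{S}_x\cdot\mathbf{S}_y$, $O^{(\Lambda)}=\sum_{x\in\Lambda}(-1)^{x^{(1)}+\cdots+x^{(d)}}S_x^{(3)}$, $H_{\rm p}^{(\Lambda)}(B)=H_{0,{\rm p}}^{(\Lambda)}-BO^{(\Lambda)}$. Let $P_0^{(\Lambda)}(B)$ be the projection onto the ground-state space of $H_{\rm p}^{(\Lambda)}(B)$ and $\omega_B^{(\Lambda)}(\cdot)={\rm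 Tr}[P_0^{(\Lambda)}(B)(\cdot)]/{\rm Tr}P_0^{(\Lambda)}(B)$. Define $\omega_0={\rm weak}^\ast\text{-}\lim_{B\searrow 0}{\rm weak}^\ast\text{-}\lim_{L\to\infty}\omega_B^{(\Lambda_L)}$ (along suitable subsequences). A state $\omega$ is an infinite-volume ground state if $\lim_{L\to\infty}\omega(a^\ast[H_{0,{\rm p}}^{(\Lambda_L)},a])\ge0$ for all $a\in\mathfrak{A}_{\rm loc}$; its spontaneous magnetization is $\lim_{N\to\infty}\sup_{|\Lambda_L|\ge N}\frac{1}{|\Lambda_L|}\omega(O^{(\Lambda_L)})$. *)

theory Defs
  imports Complex_Main "HOL-Library.Extended_Real" "HOL-Library.Liminf_Limsup"
begin

text \<open>Sites of Z^d are integer lists of length d.  The single-site Hilbert space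
  C^(2S+1) has basis indexed by k in {0..n} with n = 2S, the state k having
  S^(3)-eigenvalue m = S - k.  A configuration of a finite region Gamma assigns
  to every site of Gamma a value in {0..n} and 0 to every other site.  An
  observable localised in Gamma is a matrix (kernel) indexed by configurations
  of Gamma.\<close>

type_synonym site = "int list"
type_synonym config = "site \<Rightarrow> nat"
type_synonym obs = "config \<Rightarrow> config \<Rightarrow> complex"

definition lattice :: "nat \<Rightarrow> site set" where
  "lattice d = {x. length x = d}"

definition box :: "nat \<Rightarrow> nat \<Rightarrow> site set" where
  "box d L = {x. length x = d \<and> (\<forall>i<d. - int L + 1 \<le> x ! i \<and> x ! i \<le> int L)}"

definition dist_site :: "site \<Rightarrow> site \<Rightarrow> real" where
  "dist_site x y = sqrt (\<Sum>i<length x. (real_of_int (x ! i - y ! i))^2)"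

definition configs :: "nat \<Rightarrow> site set \<Rightarrow> config set" where
  "configs n G = {\<sigma>. (\<forall>x\<in>G. \<sigma> x \<le> n) \<and> (\<forall>x. x \<notin> G \<longrightarrow> \<sigma> x = 0)}"

definition opmult :: "nat \<Rightarrow> site set \<Rightarrow> obs \<Rightarrow> obs \<Rightarrow> obs" where
  "opmult n G A B = (\<lambda>\<sigma> \<tau>. \<Sum>\<rho>\<in>configs n G. A \<sigma> \<rho> * B \<rho> \<tau>)"

definition opadj :: "obs \<Rightarrow> obs" where
  "opadj A = (\<lambda>\<sigma> \<tau>. cnj (A \<tau> \<sigma>))"

definition opid :: obs where
  "opid = (\<lambda>\<sigma> \<tau>. if \<sigma> = \<tau> then 1 else 0)"

definition opcomm :: "nat \<Rightarrow> site set \<Rightarrow> obs \<Rightarrow> obs \<Rightarrow> obs" where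
  "opcomm n G A B = (\<lambda>\<sigma> \<tau>. opmult n G A B \<sigma> \<tau> - opmult n G B A \<sigma> \<tau>)"

definition restr :: "config \<Rightarrow> site set \<Rightarrow> config" where
  "restr \<sigma> G = (\<lambda>x. if x \<in> G then \<sigma> x else 0)"

text \<open>Embedding A |-> A (x) 1 of the observables of Gamma into any larger region.\<close>
definition ext :: "site set \<Rightarrow> obs \<Rightarrow> obs" where
  "ext G A = (\<lambda>\<sigma> \<tau>. if (\<forall>x. x \<notin> G \<longrightarrow> \<sigma> x = \<tau> x)
                      then A (restr \<sigma> G) (restr \<tau> G) else 0)"

definition site_op :: "site \<Rightarrow> (nat \<Rightarrow> nat \<Rightarrow> complex) \<Rightarrow> obs" where
  "site_op x s = (\<lambda>\<sigma> \<tau>. if (\<forall>z. z \<noteq> x \<longrightarrow> \<sigma> z = \<tau> z) then s (\<sigma> x) (\<tau> x) else 0)"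

text \<open>Product s_x t_y of single-site operators at two distinct sites.\<close>
definition pair_op :: "site \<Rightarrow> (nat \<Rightarrow> nat \<Rightarrow> complex) \<Rightarrow> site \<Rightarrow> (nat \<Rightarrow> nat \<Rightarrow> complex) \<Rightarrow> obs" where
  "pair_op x s y t = (\<lambda>\<sigma> \<tau>. if (\<forall>z. z \<noteq> x \<and> z \<noteq> y \<longrightarrow> \<sigma> z = \<tau> z)
                              then s (\<sigma> x) (\<tau> x) * t (\<sigma> y) (\<tau> y) else 0)"

text \<open>Standard spin-S matrices (n = 2S); basis index k corresponds to m = S - k.\<close>
definition mval :: "nat \<Rightarrow> nat \<Rightarrow> real" where
  "mval n k = real n / 2 - real k"

definition splus :: "nat \<Rightarrow> nat \<Rightarrow> nat \<Rightarrow> complex" where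
  "splus n j k = (if j + 1 = k \<and> k \<le> n
     then complex_of_real (sqrt (real n / 2 * (real n / 2 + 1) - mval n k * (mval n k + 1)))
     else 0)"

definition sminus :: "nat \<Rightarrow> nat \<Rightarrow> nat \<Rightarrow> complex" where
  "sminus n j k = splus n k j"

definition spin1 :: "nat \<Rightarrow> nat \<Rightarrow> nat \<Rightarrow> complex" where
  "spin1 n j k = (splus n j k + sminus n j k) / 2"

definition spin2 :: "nat \<Rightarrow> nat \<Rightarrow> nat \<Rightarrow> complex" where
  "spin2 n j k = (splus n j k - sminus n j k) / (2 * \<i>)"

definition spin3 :: "nat \<Rightarrow> nat \<Rightarrow> nat \<Rightarrow> complex" where
  "spin3 n j k = (if j = k \<and> k \<le> n then complex_of_real (mval n k) else 0)"

definition spin :: "nat \<Rightarrow> nat \<Rightarrow> nat \<Rightarrow> nat \<Rightarrow> complex" where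
  "spin n a = (if a = 1 then spin1 n else if a = 2 then spin2 n else spin3 n)"

definition pnbr :: "nat \<Rightarrow> site \<Rightarrow> site \<Rightarrow> bool" where
  "pnbr L x y = (\<exists>i<length x.
      ((x ! i - y ! i) mod (2 * int L) = 1 \<or> (x ! i - y ! i) mod (2 * int L) = 2 * int L - 1)
      \<and> (\<forall>j<length x. j \<noteq> i \<longrightarrow> x ! j = y ! j))"

text \<open>H_{0,p} = sum over bonds {x,y}; written as 1/2 times the sum over ordered pairs.\<close>
definition H0p :: "nat \<Rightarrow> nat \<Rightarrow> nat \<Rightarrow> obs" where
  "H0p n d L = (\<lambda>\<sigma> \<tau>. (1/2) * (\<Sum>x\<in>box d L. \<Sum>y\<in>{y\<in>box d L. pnbr L x y}.
                    \<Sum>a\<in>{1,2,3::nat}. pair_op x (spin n a) y (spin n a) \<sigma> \<tau>))"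

definition stag :: "site \<Rightarrow> complex" where
  "stag x = (if even (sum_list x) then 1 else -1)"

definition Oop :: "nat \<Rightarrow> nat \<Rightarrow> nat \<Rightarrow> obs" where
  "Oop n d L = (\<lambda>\<sigma> \<tau>. \<Sum>x\<in>box d L. stag x * site_op x (spin3 n) \<sigma> \<tau>)"

definition Hp :: "nat \<Rightarrow> nat \<Rightarrow> nat \<Rightarrow> real \<Rightarrow> obs" where
  "Hp n d L B = (\<lambda>\<sigma> \<tau>. H0p n d L \<sigma> \<tau> - complex_of_real B * Oop n d L \<sigma> \<tau>)"

definition vecs :: "nat \<Rightarrow> site set \<Rightarrow> (config \<Rightarrow> complex) set" where
  "vecs n G = {v. \<forall>\<sigma>. \<sigma> \<notin> configs n G \<longrightarrow> v \<sigma> = 0}"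

definition apply_op :: "nat \<Rightarrow> site set \<Rightarrow> obs \<Rightarrow> (config \<Rightarrow> complex) \<Rightarrow> (config \<Rightarrow> complex)" where
  "apply_op n G A v = (\<lambda>\<sigma>. \<Sum>\<tau>\<in>configs n G. A \<sigma> \<tau> * v \<tau>)"

definition eigvals :: "nat \<Rightarrow> site set \<Rightarrow> obs \<Rightarrow> real set" where
  "eigvals n G H = {E. \<exists>v\<in>vecs n G. (\<exists>\<sigma>. v \<sigma> \<noteq> 0) \<and>
      (\<forall>\<sigma>\<in>configs n G. apply_op n G H v \<sigma> = complex_of_real E * v \<sigma>)}"

definition gs_energy :: "nat \<Rightarrow> site set \<Rightarrow> obs \<Rightarrow> real" where
  "gs_energy n G H = Min (eigvals n G H)"

definition gs_space :: "nat \<Rightarrow> site set \<Rightarrow> obs \<Rightarrow> (config \<Rightarrow> complex) set" where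
  "gs_space n G H = {v\<in>vecs n G.
      \<forall>\<sigma>\<in>configs n G. apply_op n G H v \<sigma> = complex_of_real (gs_energy n G H) * v \<sigma>}"

definition gs_proj :: "nat \<Rightarrow> site set \<Rightarrow> obs \<Rightarrow> obs" where
  "gs_proj n G H = (THE P.
      (\<forall>\<sigma> \<tau>. \<sigma> \<notin> configs n G \<or> \<tau> \<notin> configs n G \<longrightarrow> P \<sigma> \<tau> = 0) \<and>
      (\<forall>\<sigma> \<tau>. P \<sigma> \<tau> = cnj (P \<tau> \<sigma>)) \<and>
      (\<forall>v\<in>vecs n G. apply_op n G P v \<in> gs_space n G H) \<and>
      (\<forall>v\<in>gs_space n G H. apply_op n G P v = v))"

definition optrace :: "nat \<Rightarrow> site set \<Rightarrow> obs \<Rightarrow> complex" where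
  "optrace n G A = (\<Sum>\<sigma>\<in>configs n G. A \<sigma> \<sigma>)"

definition fv_gs :: "nat \<Rightarrow> site set \<Rightarrow> obs \<Rightarrow> obs \<Rightarrow> complex" where
  "fv_gs n G H A = optrace n G (opmult n G (gs_proj n G H) A) / optrace n G (gs_proj n G H)"

text \<open>A state on the quasi-local algebra, given by its (consistent) restrictions
  to the local algebras of finite regions of Z^d.\<close>
definition is_state :: "nat \<Rightarrow> nat \<Rightarrow> (site set \<Rightarrow> obs \<Rightarrow> complex) \<Rightarrow> bool" where
  "is_state n d \<omega> = (\<forall>G. finite G \<and> G \<subseteq> lattice d \<longrightarrow>
     (\<forall>A B. (\<forall>\<sigma>\<in>configs n G. \<forall>\<tau>\<in>configs n G. A \<sigma> \<tau> = B \<sigma> \<tau>) \<longrightarrow> \<omega> G A = \<omega> G B) \<and>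
     (\<forall>A B. \<omega> G (\<lambda>\<sigma> \<tau>. A \<sigma> \<tau> + B \<sigma> \<tau>) = \<omega> G A + \<omega> G B) \<and>
     (\<forall>c A. \<omega> G (\<lambda>\<sigma> \<tau>. c * A \<sigma> \<tau>) = c * \<omega> G A) \<and>
     (\<forall>A. Im (\<omega> G (opmult n G (opadj A) A)) = 0 \<and> Re (\<omega> G (opmult n G (opadj A) A)) \<ge> 0) \<and>
     \<omega> G opid = 1 \<and>
     (\<forall>G' A. finite G' \<and> G \<subseteq> G' \<and> G' \<subseteq> lattice d \<longrightarrow> \<omega> G' (ext G A) = \<omega> G A))"

definition is_iv_gs :: "nat \<Rightarrow> nat \<Rightarrow> (site set \<Rightarrow> obs \<Rightarrow> complex) \<Rightarrow> bool" where
  "is_iv_gs n d \<omega> = (\<forall>G A. finite G \<and> G \<subseteq> lattice d \<longrightarrow>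
     (\<exists>c. ((\<lambda>L. \<omega> (G \<union> box d L)
              (opmult n (G \<union> box d L) (opadj (ext G A))
                 (opcomm n (G \<union> box d L) (H0p n d L) (ext G A)))) \<longlonglongrightarrow> c)
          \<and> Im c = 0 \<and> Re c \<ge> 0))"

definition magnetization :: "nat \<Rightarrow> nat \<Rightarrow> (site set \<Rightarrow> obs \<Rightarrow> complex) \<Rightarrow> ereal" where
  "magnetization n d \<omega> =
     limsup (\<lambda>L. ereal (Re (\<omega> (box d L) (Oop n d L)) / real (card (box d L))))"

end

theory Submission
  imports "HOL-Analysis.Analysis" Defs
begin

text \<open>Suppose that \<open>|\<omega>\<^sub>0(S\<^sup>2\<^sub>x S\<^sup>2\<^sub>y)|\<close> were \<open>o(|x - y|\<^sup>-\<^sup>(\<^sup>d\<^sup>-\<^sup>1\<^sup>))\<close>.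

  A ground state minimises the energy of every block up to a boundary term, both in infinite volume without
  field and in the torus with field \<open>B\<close>. Comparing the two shows that the spontaneous magnetization of some
  infinite-volume ground state forces a staggered magnetization at least \<open>e > 0\<close> in the torus, uniformly in \<open>B\<close>.

  Rotate about the first axis by angles \<open>f\<^sub>x = \<Sum>\<^sub>y (g\<^sub>x + g\<^sub>y)\<close>, the sum running over the neighbours of \<open>x\<close>, where
  \<open>g\<close> is a pyramid of height \<open>R\<close> over a box of radius \<open>R\<close>. The generator \<open>Q = \<Sum> f\<^sub>x S\<^sup>1\<^sub>x\<close> and the staggered sum
  \<open>C\<close> of the \<open>S\<^sup>2\<^sub>x\<close> over the box satisfy \<open>(e \<Sum> f\<^sub>x)\<^sup>2 \<le> 4 \<langle>Q\<^sup>2\<rangle> \<langle>C\<^sup>2\<rangle>\<close>. Gaussian domination, a consequence of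
  reflection positivity, gives \<open>\<langle>Q\<^sup>2\<rangle>\<^sup>2 \<le> 1/2 \<langle>[Q, [H, Q]]\<rangle> \<cdot> 1/2 \<Sum> (g\<^sub>x + g\<^sub>y)\<^sup>2\<close> over the bonds, which is
  \<open>O(R\<^sup>d) O(R\<^sup>d\<^sup>+\<^sup>2)\<close> as \<open>B\<close> tends to 0. The decay makes \<open>\<langle>C\<^sup>2\<rangle>\<close> of order \<open>o(R\<^sup>d\<^sup>+\<^sup>1)\<close>, while \<open>\<Sum> f\<^sub>x\<close> is at least
  of order \<open>R\<^sup>d\<^sup>+\<^sup>1\<close>: a contradiction for large \<open>R\<close>.\<close>

section \<open>Hermitian kernels on finite sets\<close>

text \<open>The magnetized state and \<open>\<omega>0\<close> are unrelated, and
  \<open>\<omega>0\<close> is reached only through limits; energy is the only link between them. All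
  inequalities are therefore proved in finite tori, with constants independent of the volume. No
  spectral gap is available, so the double commutator alone does not bound the fluctuation of
  \<open>Q\<close>. What helps is that no field \<open>t g\<close> lowers the ground energy once the
  bond terms are completed to squares; second order perturbation theory turns this into the bound.
  It reaches only those \<open>f\<close> that are linear responses to some \<open>g\<close>, which
  is why the angles are given through \<open>g\<close>. In powers of R the inequality reads
  (R^(d+1))^4 \<le> const * R^d * R^(d+2) * c^2, where c is the fluctuation of \<open>C\<close>, so
  c is at least of order R^(d+1). A correlation that is o(r^(-(d-1))) sums to o(R) per site and to
  o(R^(d+1)) over the box, so the assumed decay is exactly at the borderline. The field breaks the
  rotation symmetry and costs a further term of order B R^(d+2) in the double commutator. It
  disappears because R stays fixed while first L tends to infinity and then B to 0; R grows
  last.\<close>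

definition cinn :: "'a set \<Rightarrow> ('a \<Rightarrow> complex) \<Rightarrow> ('a \<Rightarrow> complex) \<Rightarrow> complex" where
  "cinn X u v = (\<Sum>x\<in>X. cnj (u x) * v x)"

definition kapply :: "'a set \<Rightarrow> ('a \<Rightarrow> 'a \<Rightarrow> complex) \<Rightarrow> ('a \<Rightarrow> complex) \<Rightarrow> 'a \<Rightarrow> complex" where
  "kapply X A v = (\<lambda>x. \<Sum>y\<in>X. A x y * v y)"

definition supp_on :: "'a set \<Rightarrow> ('a \<Rightarrow> complex) \<Rightarrow> bool" where
  "supp_on X v = (\<forall>x. x \<notin> X \<longrightarrow> v x = 0)"

definition herm_on :: "'a set \<Rightarrow> ('a \<Rightarrow> 'a \<Rightarrow> complex) \<Rightarrow> bool" where
  "herm_on X A = (\<forall>x\<in>X. \<forall>y\<in>X. A x y = cnj (A y x))"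

definition orthonormal :: "'a set \<Rightarrow> nat \<Rightarrow> (nat \<Rightarrow> 'a \<Rightarrow> complex) \<Rightarrow> bool" where
  "orthonormal X k e = (\<forall>i<k. \<forall>j<k. cinn X (e i) (e j) = (if i = j then 1 else 0))"

text \<open>The common last step of the variational arguments: the residual of an eigenvector, the
  uncertainty relation and the fluctuation bound all end with a real quadratic polynomial that is
  nowhere negative. The leading coefficient may vanish, so that case is included.\<close>

lemma nonneg_quadratic_discriminant:
  fixes a b c :: real
  assumes "\<And>t. 0 \<le> a + b * t + c * t\<^sup>2"
  shows "b\<^sup>2 \<le> 4 * a * c"
proof (cases "c = 0")
  case True
  show ?thesis
  proof (cases "b = 0")
    case False
    \<comment> \<open>At this point the affine function takes the value -1.\<close>
    then show ?thesis using assms[of "- (a + 1) / b"] True by simp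
  qed (use True in simp)
next
  case False
  have a0: "0 \<le> a" using assms[of 0] by simp
  have c0: "c > 0"
  proof (rule ccontr)
    assume "\<not> c > 0"
    then have c: "c < 0" using False by simp
    have "0 \<le> (a + b * t + c * t\<^sup>2) + (a + b * (-t) + c * (-t)\<^sup>2)" for t
      using assms[of t] assms[of "-t"] by linarith
    then have *: "0 \<le> a + c * t\<^sup>2" for t by (smt (verit) power2_minus mult_minus_right)
    have "t\<^sup>2 \<le> a / (-c)" for t
      using *[of t] c by (simp add: field_simps)
    from this[of "sqrt (a / (-c) + 1)"] show False
      using a0 c by (simp add: divide_nonneg_neg)
  qed
  have "0 \<le> a - b\<^sup>2 / (4 * c)"
    using assms[of "- b / (2 * c)"] c0 by (simp add: power2_eq_square field_simps)
  then show ?thesis using c0 by (simp add: field_simps)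
qed

section \<open>Sesquilinear algebra of kernels\<close>

lemma cinn_add: "cinn X u (\<lambda>x. v x + w x) = cinn X u v + cinn X u w"
  "cinn X (\<lambda>x. v x + w x) u = cinn X v u + cinn X w u"
  by (simp_all add: cinn_def sum.distrib algebra_simps)

lemma cinn_diff: "cinn X u (\<lambda>x. v x - w x) = cinn X u v - cinn X u w"
  "cinn X (\<lambda>x. v x - w x) u = cinn X v u - cinn X w u"
  by (simp_all add: cinn_def sum_subtractf algebra_simps)

lemma cinn_scale: "cinn X u (\<lambda>x. c * v x) = c * cinn X u v"
  "cinn X (\<lambda>x. c * v x) u = cnj c * cinn X v u"
  by (simp_all add: cinn_def sum_distrib_left algebra_simps)

lemma cinn_sum: "cinn X u (\<lambda>x. \<Sum>i\<in>I. v i x) = (\<Sum>i\<in>I. cinn X u (v i))"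
  "cinn X (\<lambda>x. \<Sum>i\<in>I. v i x) u = (\<Sum>i\<in>I. cinn X (v i) u)"
  unfolding cinn_def cnj_sum sum_distrib_left sum_distrib_right
  by (rule sum.swap)+

lemma cinn_cnj: "cinn X u v = cnj (cinn X v u)"
  by (simp add: cinn_def mult.commute)

lemma cinn_cong: "(\<And>x. x \<in> X \<Longrightarrow> u x = u' x) \<Longrightarrow> (\<And>x. x \<in> X \<Longrightarrow> v x = v' x) \<Longrightarrow>
  cinn X u v = cinn X u' v'"
  by (auto simp: cinn_def intro!: sum.cong)

lemma cinn_self: "cinn X v v = of_real (\<Sum>x\<in>X. (cmod (v x))\<^sup>2)"
  by (simp add: cinn_def complex_norm_square mult.commute del: of_real_power)

lemma cinn_self_Re: "cinn X v v = of_real (Re (cinn X v v))"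
  by (simp add: cinn_self)

lemma cinn_self_nonneg: "0 \<le> Re (cinn X v v)"
  by (simp add: cinn_self sum_nonneg)

lemma cinn_self_zero: "finite X \<Longrightarrow> cinn X v v = 0 \<Longrightarrow> x \<in> X \<Longrightarrow> v x = 0"
  unfolding cinn_self of_real_eq_0_iff by (subst (asm) sum_nonneg_eq_0_iff) auto

lemma kapply_add: "kapply X A (\<lambda>x. v x + w x) = (\<lambda>x. kapply X A v x + kapply X A w x)"
  by (simp add: kapply_def sum.distrib algebra_simps)

lemma kapply_diff: "kapply X A (\<lambda>x. v x - w x) = (\<lambda>x. kapply X A v x - kapply X A w x)"
  by (simp add: kapply_def sum_subtractf algebra_simps)

lemma kapply_scale: "kapply X A (\<lambda>x. c * v x) = (\<lambda>x. c * kapply X A v x)"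
  by (simp add: kapply_def sum_distrib_left algebra_simps)

lemma kapply_cong: "(\<And>y. y \<in> X \<Longrightarrow> v y = v' y) \<Longrightarrow> (\<And>y. y \<in> X \<Longrightarrow> A x y = B x y) \<Longrightarrow> kapply X A v x = kapply X B v' x"
  by (auto simp: kapply_def intro!: sum.cong)

lemma herm_kapply:
  assumes "herm_on X A"
  shows "cinn X u (kapply X A v) = cinn X (kapply X A u) v"
proof -
  have "cinn X u (kapply X A v) = (\<Sum>x\<in>X. \<Sum>y\<in>X. cnj (u x) * A x y * v y)"
    by (simp add: cinn_def kapply_def sum_distrib_left mult.assoc)
  also have "\<dots> = (\<Sum>x\<in>X. \<Sum>y\<in>X. cnj (u x) * cnj (A y x) * v y)"
    using assms unfolding herm_on_def by (intro sum.cong refl) metis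
  also have "\<dots> = (\<Sum>y\<in>X. \<Sum>x\<in>X. cnj (u x) * cnj (A y x) * v y)"
    by (rule sum.swap)
  also have "\<dots> = cinn X (kapply X A u) v"
    by (simp add: cinn_def kapply_def sum_distrib_right sum_distrib_left mult_ac)
  finally show ?thesis .
qed

text \<open>Vectors are functions on the whole type, so the coordinates outside \<open>X\<close> are
  pinned to 0; every factor is then compact and Tychonoff applies. The unit sphere of the vectors
  supported on \<open>X\<close> is a closed part of this set.\<close>

lemma compact_box_fun:
  fixes X :: "'a set"
  shows "compact {v :: 'a \<Rightarrow> complex. \<forall>x. v x \<in> (if x \<in> X then cball 0 1 else {0})}"
proof -
  let ?S = "\<lambda>x. if x \<in> X then cball 0 1 else {0 :: complex}"
  have "compactin (product_topology (\<lambda>i. euclidean) UNIV) (PiE UNIV ?S)"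
    by (subst compactin_PiE) auto
  moreover have "PiE UNIV ?S = {v. \<forall>x. v x \<in> ?S x}" by (auto simp: PiE_def Pi_def extensional_def)
  ultimately show ?thesis by (simp add: euclidean_product_topology)
qed

lemma continuous_coord: "continuous_on S (\<lambda>v :: 'a \<Rightarrow> complex. v x)"
  by (rule continuous_on_subset[OF continuous_on_product_coordinates]) simp

text \<open>A continuous function attains its minimum on the unit sphere of the orthogonal
  complement of the \<open>e i\<close>. The vector \<open>v0\<close> certifies that this complement
  is not zero. The conclusion is homogeneous in \<open>v\<close>, so perturbations of
  \<open>w\<close> need not be normalised later.\<close>

lemma rayleigh_minimizer:
  assumes "finite X"
    and v0: "supp_on X v0" "cinn X v0 v0 \<noteq> 0" "\<And>i. i < (k::nat) \<Longrightarrow> cinn X (e i) v0 = 0"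
  obtains w where "supp_on X w" "cinn X w w = 1" "\<forall>i<k. cinn X (e i) w = 0"
    "\<forall>v. supp_on X v \<longrightarrow> (\<forall>i<k. cinn X (e i) v = 0) \<longrightarrow>
      Re (cinn X v (kapply X A v)) \<ge> Re (cinn X w (kapply X A w)) * Re (cinn X v v)"
proof -
  define K where "K = {v. \<forall>x. v x \<in> (if x \<in> X then cball 0 1 else {0 :: complex})}"
  define T where "T = K \<inter> ({v. cinn X v v = 1} \<inter> (\<Inter>i\<in>{..<k}. {v. cinn X (e i) v = 0}))"
  have cont: "continuous_on UNIV (\<lambda>v. cinn X v v)" "continuous_on UNIV (cinn X u)"
    "continuous_on UNIV (\<lambda>v. cinn X v (kapply X A v))" for u
    unfolding cinn_def kapply_def by (intro continuous_intros continuous_coord)+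
  have "compact T"
    unfolding T_def K_def
    by (intro compact_Int_closed compact_box_fun closed_Int closed_INT ballI closed_Collect_eq cont continuous_intros)
  define nrm where "nrm v = (\<lambda>x. of_real (1 / sqrt (Re (cinn X v v))) * v x)" for v
  have nrmT: "nrm v \<in> T" if "supp_on X v" "cinn X v v \<noteq> 0" "\<And>i. i < k \<Longrightarrow> cinn X (e i) v = 0" for v
  proof -
    have pos: "Re (cinn X v v) > 0"
      using that(2) cinn_self_nonneg[of X v] cinn_self_Re[of X v]
      by (metis less_eq_real_def of_real_0)
    have 1: "cinn X (nrm v) (nrm v) = 1"
    proof -
      have "cinn X (nrm v) (nrm v) = of_real (1 / sqrt (Re (cinn X v v))) * of_real (1 / sqrt (Re (cinn X v v))) * cinn X v v"
        unfolding nrm_def cinn_scale by simp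
      also have "\<dots> = of_real ((1 / sqrt (Re (cinn X v v))) * (1 / sqrt (Re (cinn X v v))) * Re (cinn X v v))"
        by (subst (3) cinn_self_Re) (simp only: of_real_mult)
      also have "(1 / sqrt (Re (cinn X v v))) * (1 / sqrt (Re (cinn X v v))) * Re (cinn X v v) = 1"
        using pos by simp
      finally show ?thesis by simp
    qed
    have "cmod (nrm v x) \<le> 1" if "x \<in> X" for x
    proof -
      have "(cmod (nrm v x))\<^sup>2 \<le> (\<Sum>x\<in>X. (cmod (nrm v x))\<^sup>2)"
        by (rule member_le_sum) (use that assms in auto)
      also have "\<dots> = 1" using 1 unfolding cinn_self by (metis of_real_eq_1_iff)
      finally show ?thesis by (simp add: power_le_one_iff abs_square_le_1)
    qed
    moreover have "cinn X (e i) (nrm v) = 0" if "i < k" for i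
      unfolding nrm_def cinn_scale using \<open>\<And>i. i < k \<Longrightarrow> cinn X (e i) v = 0\<close> that by simp
    moreover have "nrm v x = 0" if "x \<notin> X" for x
      using \<open>supp_on X v\<close> that by (simp add: nrm_def supp_on_def)
    ultimately show ?thesis using 1 by (auto simp: T_def K_def)
  qed
  have "T \<noteq> {}" using nrmT[OF v0] by auto
  then obtain w where w: "w \<in> T" "\<And>v. v \<in> T \<Longrightarrow> Re (cinn X w (kapply X A w)) \<le> Re (cinn X v (kapply X A v))"
    using continuous_attains_inf[OF \<open>compact T\<close>, of "\<lambda>v. Re (cinn X v (kapply X A v))"]
      continuous_on_subset[OF continuous_on_Re[OF cont(3)] subset_UNIV] by blast
  show ?thesis
  proof (rule that[of w])
    show "supp_on X w" "cinn X w w = 1" "\<forall>i<k. cinn X (e i) w = 0"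
      using w(1) by (auto simp: T_def K_def supp_on_def split: if_splits)
    have "Re (cinn X v (kapply X A v)) \<ge> Re (cinn X w (kapply X A w)) * Re (cinn X v v)"
      if v: "supp_on X v" "\<forall>i<k. cinn X (e i) v = 0" for v
    proof (cases "cinn X v v = 0")
      case True
      then have "\<And>x. x \<in> X \<Longrightarrow> v x = 0" using assms cinn_self_zero by metis
      then have "cinn X v (kapply X A v) = 0" by (simp add: cinn_def)
      with True show ?thesis by simp
    next
      case False
      have pos: "Re (cinn X v v) > 0"
        using False cinn_self_nonneg[of X v] cinn_self_Re[of X v]
        by (metis less_eq_real_def of_real_0)
      have "Re (cinn X w (kapply X A w)) \<le> Re (cinn X (nrm v) (kapply X A (nrm v)))"
        using w(2) nrmT[OF v(1) False] v(2) by blast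
      also have "cinn X (nrm v) (kapply X A (nrm v)) = of_real ((1 / sqrt (Re (cinn X v v))) * (1 / sqrt (Re (cinn X v v)))) * cinn X v (kapply X A v)"
        unfolding nrm_def cinn_scale kapply_scale complex_cnj_complex_of_real of_real_mult by (simp only: mult_ac)
      also have "(1 / sqrt (Re (cinn X v v))) * (1 / sqrt (Re (cinn X v v))) = 1 / Re (cinn X v v)"
        using pos by simp
      finally have "Re (cinn X w (kapply X A w)) \<le> (1 / Re (cinn X v v)) * Re (cinn X v (kapply X A v))"
        by (metis scaleR_complex.simps(1) scaleR_conv_of_real)
      then show ?thesis using pos by (simp add: field_simps)
    qed
    then show "\<forall>v. supp_on X v \<longrightarrow> (\<forall>i<k. cinn X (e i) v = 0) \<longrightarrow>
      Re (cinn X v (kapply X A v)) \<ge> Re (cinn X w (kapply X A w)) * Re (cinn X v v)" by blast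
  qed
qed

text \<open>\<open>r x\<close> is the basis vector at \<open>x\<close> projected onto the orthogonal
  complement of the system. Its norm tells whether that basis vector lies in the span.\<close>

lemma orthonormal_residual:
  assumes "finite X" "orthonormal X k e" "\<forall>i<k. supp_on X (e i)"
  defines "r \<equiv> \<lambda>x y. (if y = x then 1 else 0) - (\<Sum>i<k. cnj (e i x) * e i y)"
  shows "x \<in> X \<Longrightarrow> supp_on X (r x)" "x \<in> X \<Longrightarrow> j < k \<Longrightarrow> cinn X (e j) (r x) = 0"
    "x \<in> X \<Longrightarrow> cinn X (r x) (r x) = of_real (1 - (\<Sum>i<k. (cmod (e i x))\<^sup>2))"
proof -
  assume x: "x \<in> X"
  show "supp_on X (r x)" using assms(3) x by (auto simp: r_def supp_on_def intro!: sum.neutral)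
  have d: "cinn X u (\<lambda>y. if y = x then 1 else 0) = cnj (u x)" for u
    using x assms(1) by (simp add: cinn_def if_distrib[of "\<lambda>z. _ * z"] cong: if_cong)
  show o: "cinn X (e j) (r x) = 0" if "j < k" for j
  proof -
    have "cinn X (e j) (r x) = cnj (e j x) - (\<Sum>i<k. cnj (e i x) * cinn X (e j) (e i))"
      unfolding r_def cinn_diff cinn_sum cinn_scale d ..
    also have "(\<Sum>i<k. cnj (e i x) * cinn X (e j) (e i)) = (\<Sum>i<k. if i = j then cnj (e i x) else 0)"
      using assms(2) that by (intro sum.cong) (auto simp: orthonormal_def)
    finally show ?thesis using that by simp
  qed
  have "cinn X (r x) (r x) = cinn X (r x) (\<lambda>y. if y = x then 1 else 0) - (\<Sum>i<k. cnj (e i x) * cinn X (r x) (e i))"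
    by (subst (2) r_def) (simp only: cinn_diff cinn_sum cinn_scale)
  also have "(\<Sum>i<k. cnj (e i x) * cinn X (r x) (e i)) = 0"
    by (intro sum.neutral) (metis o cinn_cnj complex_cnj_zero lessThan_iff mult_zero_right)
  also have "cinn X (r x) (\<lambda>y. if y = x then 1 else 0) = of_real (1 - (\<Sum>i<k. (cmod (e i x))\<^sup>2))"
    unfolding d r_def by (simp add: complex_norm_square mult.commute del: of_real_power)
  finally show "cinn X (r x) (r x) = of_real (1 - (\<Sum>i<k. (cmod (e i x))\<^sup>2))" by simp
qed

text \<open>The trace of the projection onto the complement. If it is positive, some residual is a
  non-zero vector by which the system can be extended; if it is 0, all residuals vanish and the
  system is complete.\<close>

lemma orthonormal_count:
  assumes "finite X" "orthonormal X k e"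
  shows "(\<Sum>x\<in>X. 1 - (\<Sum>i<k. (cmod (e i x))\<^sup>2)) = real (card X) - real k"
proof -
  have "(\<Sum>x\<in>X. (cmod (e i x))\<^sup>2) = 1" if "i < k" for i
    using assms(2) that unfolding orthonormal_def by (metis cinn_self of_real_eq_1_iff)
  then have "(\<Sum>i<k. \<Sum>x\<in>X. (cmod (e i x))\<^sup>2) = real k" by simp
  then show ?thesis by (subst (asm) sum.swap) (simp add: sum_subtractf)
qed

text \<open>Induction on \<open>k\<close>: the minimiser of the Rayleigh quotient on the complement
  of the first \<open>k\<close> eigenvectors is the next one. Hermiticity keeps its residual in that
  complement, so the residual is an admissible direction of variation.\<close>

lemma eigen_system:
  assumes "finite X" "herm_on X A" "k \<le> card X"
  shows "\<exists>e l. orthonormal X k e \<and> (\<forall>i<k. supp_on X (e i)) \<and>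
    (\<forall>i<k. \<forall>x\<in>X. kapply X A (e i) x = complex_of_real (l i) * e i x)"
  using assms(3)
proof (induction k)
  case 0
  then show ?case by (auto simp: orthonormal_def)
next
  case (Suc k)
  then obtain e l where e: "orthonormal X k e" "\<forall>i<k. supp_on X (e i)"
    "\<forall>i<k. \<forall>x\<in>X. kapply X A (e i) x = complex_of_real (l i) * e i x" by (meson Suc_leD)
  note R = orthonormal_residual[OF assms(1) e(1,2)]
  have "0 < (\<Sum>x\<in>X. 1 - (\<Sum>i<k. (cmod (e i x))\<^sup>2))"
    unfolding orthonormal_count[OF assms(1) e(1)] using Suc.prems by simp
  then obtain x where x: "x \<in> X" "1 - (\<Sum>i<k. (cmod (e i x))\<^sup>2) > 0"
    by (meson linorder_not_less sum_nonpos)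
  define v0 where "v0 = (\<lambda>y. (if y = x then 1 else 0) - (\<Sum>i<k. cnj (e i x) * e i y))"
  have v0: "supp_on X v0" "cinn X v0 v0 \<noteq> 0" "\<And>i. i < k \<Longrightarrow> cinn X (e i) v0 = 0"
  proof -
    show "supp_on X v0" "\<And>i. i < k \<Longrightarrow> cinn X (e i) v0 = 0"
      unfolding v0_def by (fact R(1)[OF x(1)]) (fact R(2)[OF x(1)])
    show "cinn X v0 v0 \<noteq> 0"
      unfolding v0_def R(3)[OF x(1)] of_real_eq_0_iff using x(2) by linarith
  qed
  obtain w where w: "supp_on X w" "cinn X w w = 1" "\<forall>i<k. cinn X (e i) w = 0"
    "\<forall>v. supp_on X v \<longrightarrow> (\<forall>i<k. cinn X (e i) v = 0) \<longrightarrow>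
      Re (cinn X v (kapply X A v)) \<ge> Re (cinn X w (kapply X A w)) * Re (cinn X v v)"
    by (rule rayleigh_minimizer[OF assms(1) v0, where A = A])
  define m where "m = Re (cinn X w (kapply X A w))"
  \<comment> \<open>The cut-off is needed because \<open>kapply\<close> may be anything outside
    \<open>X\<close>.\<close>
  define u where "u = (\<lambda>x. if x \<in> X then kapply X A w x - of_real m * w x else 0)"
  have usub: "cinn X z u = cinn X z (kapply X A w) - of_real m * cinn X z w" for z
  proof -
    have "cinn X z u = cinn X z (\<lambda>x. kapply X A w x - of_real m * w x)"
      by (rule cinn_cong) (auto simp: u_def)
    then show ?thesis by (simp only: cinn_diff cinn_scale)
  qed
  have su: "supp_on X u" by (simp add: u_def supp_on_def)
  have ou: "cinn X (e i) u = 0" if "i < k" for i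
  proof -
    have "cinn X (e i) (kapply X A w) = cinn X (\<lambda>x. of_real (l i) * e i x) w"
      unfolding herm_kapply[OF assms(2)] using e(3) that by (intro cinn_cong) auto
    then show ?thesis using w(3) that by (simp add: usub cinn_scale)
  qed
  define U where "U = Re (cinn X u u)"
  define c where "c = Re (cinn X u (kapply X A u)) - m * U"
  \<comment> \<open>Varying \<open>w\<close> in the direction of its own residual changes the energy
    by -2 U t to first order, while the constant term is 0. Such a polynomial stays non-negative
    only if U = 0.\<close>
  have quad: "0 \<le> 0 + (- 2 * U) * t + c * t\<^sup>2" for t
  proof -
    define v where "v = (\<lambda>x. w x - of_real t * u x)"
    have sv: "supp_on X v" using w(1) su by (auto simp: v_def supp_on_def)
    have ov: "cinn X (e i) v = 0" if "i < k" for i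
      unfolding v_def cinn_diff cinn_scale using w(3) ou that by simp
    have 1: "cinn X v v = 1 - of_real t * (cinn X w u + cinn X u w) + of_real (t\<^sup>2) * cinn X u u"
      unfolding v_def cinn_diff cinn_scale w(2) by (simp add: algebra_simps power2_eq_square)
    have 2: "cinn X v (kapply X A v) = cinn X w (kapply X A w) - of_real t * (cinn X w (kapply X A u) + cinn X u (kapply X A w)) + of_real (t\<^sup>2) * cinn X u (kapply X A u)"
      unfolding v_def cinn_diff cinn_scale kapply_diff kapply_scale by (simp add: algebra_simps power2_eq_square)
    have 3: "cinn X u (kapply X A w) = cinn X u u + of_real m * cinn X u w" by (simp add: usub)
    have 4: "Re (cinn X w (kapply X A u)) = Re (cinn X u (kapply X A w))"
      by (subst herm_kapply[OF assms(2)], subst cinn_cnj) simp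
    have 5: "Re (cinn X w u) = Re (cinn X u w)" by (subst cinn_cnj) simp
    have "m * Re (cinn X v v) \<le> Re (cinn X v (kapply X A v))" using w(4) sv ov unfolding m_def by blast
    moreover have "Re (cinn X v v) = 1 - t * (2 * Re (cinn X u w)) + t\<^sup>2 * U"
      unfolding 1 U_def using 5 by simp
    moreover have "Re (cinn X v (kapply X A v)) = m - t * (2 * (U + m * Re (cinn X u w))) + t\<^sup>2 * Re (cinn X u (kapply X A u))"
      unfolding 2 U_def using 4 3 by (simp add: m_def)
    ultimately show ?thesis by (simp add: c_def algebra_simps)
  qed
  have "U = 0" using nonneg_quadratic_discriminant[OF quad] by simp
  then have "cinn X u u = 0" unfolding U_def by (subst cinn_self_Re) simp
  then have "\<And>x. x \<in> X \<Longrightarrow> u x = 0" using cinn_self_zero assms(1) by metis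
  then have eig: "\<And>x. x \<in> X \<Longrightarrow> kapply X A w x = of_real m * w x" unfolding u_def by (metis eq_iff_diff_eq_0)
  have sym: "cinn X w (e i) = 0" if "i < k" for i using w(3) that by (subst cinn_cnj) simp
  show ?case
    apply (rule exI[of _ "e(k := w)"], rule exI[of _ "l(k := m)"])
    using e w(1,2,3) eig sym by (auto simp: orthonormal_def less_Suc_eq)
qed

text \<open>With \<open>card X\<close> vectors the squared norms of the residuals are non-negative
  and sum to 0, so every basis vector lies in the span of the eigenvectors.\<close>

theorem spectral:
  assumes "finite X" "herm_on X A"
  obtains e l where "orthonormal X (card X) e" "\<forall>i<card X. supp_on X (e i)"
    "\<forall>i<card X. \<forall>x\<in>X. kapply X A (e i) x = complex_of_real (l i) * e i x"
    "\<forall>v. supp_on X v \<longrightarrow> v = (\<lambda>x. \<Sum>i<card X. cinn X (e i) v * e i x)"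
proof -
  obtain e l where e: "orthonormal X (card X) e" "\<forall>i<card X. supp_on X (e i)"
    "\<forall>i<card X. \<forall>x\<in>X. kapply X A (e i) x = complex_of_real (l i) * e i x"
    using eigen_system[OF assms order.refl] by blast
  note R = orthonormal_residual[OF assms(1) e(1,2)]
  have nn: "0 \<le> 1 - (\<Sum>i<card X. (cmod (e i x))\<^sup>2)" if "x \<in> X" for x
    using cinn_self_nonneg[of X "\<lambda>y. (if y = x then 1 else 0) - (\<Sum>i<card X. cnj (e i x) * e i y)"]
    unfolding R(3)[OF that] Re_complex_of_real .
  have "(\<Sum>x\<in>X. 1 - (\<Sum>i<card X. (cmod (e i x))\<^sup>2)) = 0"
    unfolding orthonormal_count[OF assms(1) e(1)] by simp
  then have z: "1 - (\<Sum>i<card X. (cmod (e i x))\<^sup>2) = 0" if "x \<in> X" for x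
    using sum_nonneg_eq_0_iff[OF assms(1), of "\<lambda>x. 1 - (\<Sum>i<card X. (cmod (e i x))\<^sup>2)"] nn that by blast
  have comp: "(\<Sum>i<card X. cnj (e i x) * e i y) = (if y = x then 1 else 0)" if "x \<in> X" "y \<in> X" for x y
    using cinn_self_zero[OF assms(1) _ that(2), of "\<lambda>y. (if y = x then 1 else 0) - (\<Sum>i<card X. cnj (e i x) * e i y)"]
    using R(3)[OF that(1)] z[OF that(1)] by simp
  show ?thesis
  proof (rule that[of e l])
    have "v = (\<lambda>x. \<Sum>i<card X. cinn X (e i) v * e i x)" if v: "supp_on X v" for v
    proof
      fix x
      show "v x = (\<Sum>i<card X. cinn X (e i) v * e i x)"
      proof (cases "x \<in> X")
        case False
        then show ?thesis using v e(2) by (simp add: supp_on_def)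
      next
        case True
        have "(\<Sum>i<card X. cinn X (e i) v * e i x) = (\<Sum>i<card X. \<Sum>y\<in>X. v y * (cnj (e i y) * e i x))"
          by (simp add: cinn_def sum_distrib_right sum_distrib_left mult_ac)
        also have "\<dots> = (\<Sum>y\<in>X. v y * (\<Sum>i<card X. cnj (e i y) * e i x))"
          by (subst sum.swap) (simp add: sum_distrib_left)
        also have "\<dots> = (\<Sum>y\<in>X. v y * (if x = y then 1 else 0))"
          using comp True by (intro sum.cong) auto
        also have "\<dots> = v x" using True assms(1) by (simp add: if_distrib[of "\<lambda>z. _ * z"] cong: if_cong)
        finally show ?thesis by simp
      qed
    qed
    then show "\<forall>v. supp_on X v \<longrightarrow> v = (\<lambda>x. \<Sum>i<card X. cinn X (e i) v * e i x)" by blast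
  qed (use e in auto)
qed

lemma kapply_sum: "kapply X A (\<lambda>x. \<Sum>i\<in>I. v i x) = (\<lambda>x. \<Sum>i\<in>I. kapply X A (v i) x)"
proof
  fix x
  show "kapply X A (\<lambda>x. \<Sum>i\<in>I. v i x) x = (\<Sum>i\<in>I. kapply X A (v i) x)"
    unfolding kapply_def sum_distrib_left by (rule sum.swap)
qed

section \<open>Singular values and reflection positivity\<close>

definition rid :: "'a \<Rightarrow> 'a \<Rightarrow> complex" where
  "rid = (\<lambda>x y. if x = y then 1 else 0)"

lemma kapply_rid: "finite X \<Longrightarrow> x \<in> X \<Longrightarrow> kapply X rid v x = v x"
  by (simp add: kapply_def rid_def if_distrib[of "\<lambda>z. z * _"] cong: if_cong)

lemma cinn_kapply_rid: "finite X \<Longrightarrow> cinn X u (kapply X rid v) = cinn X u v"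
  by (rule cinn_cong) (simp_all add: kapply_rid)

text \<open>Diagonalise the Gram kernel \<open>A\<close> of the columns of \<open>M\<close>. Its
  eigenvalues are the squared singular values, the left vectors are the normalised images of the
  eigenvectors, and the right vectors are their conjugates because the expansion is bilinear. Only
  positive eigenvalues are kept, since the others have image 0 and could not be normalised.\<close>

lemma svd:
  fixes M :: "'a \<times> 'b \<Rightarrow> complex"
  assumes "finite X" "finite Y"
  obtains J :: "nat set" and s u v where "finite J" "\<forall>i\<in>J. (0::real) \<le> s i"
    "\<forall>i\<in>J. \<forall>j\<in>J. cinn X (u i) (u j) = (if i = j then 1 else 0)"
    "\<forall>i\<in>J. \<forall>j\<in>J. cinn Y (v i) (v j) = (if i = j then 1 else 0)"
    "\<forall>x\<in>X. \<forall>y\<in>Y. M (x, y) = (\<Sum>i\<in>J. of_real (s i) * (u i x * v i y))"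
proof -
  define A where "A = (\<lambda>y y'. \<Sum>x\<in>X. cnj (M (x, y)) * M (x, y'))"
  define m where "m w = (\<lambda>x. \<Sum>y\<in>Y. M (x, y) * w y)" for w
  have "herm_on Y A" by (simp add: herm_on_def A_def mult.commute)
  then obtain e l where e: "orthonormal Y (card Y) e" "\<forall>i<card Y. supp_on Y (e i)"
    "\<forall>i<card Y. \<forall>x\<in>Y. kapply Y A (e i) x = complex_of_real (l i) * e i x"
    "\<forall>v. supp_on Y v \<longrightarrow> v = (\<lambda>x. \<Sum>i<card Y. cinn Y (e i) v * e i x)"
    by (rule spectral[OF assms(2)])
  have m_inn: "cinn X (m w) (m z) = cinn Y w (kapply Y A z)" for w z
  proof -
    have "cinn X (m w) (m z) = (\<Sum>x\<in>X. \<Sum>y\<in>Y. \<Sum>y'\<in>Y. cnj (w y) * (cnj (M (x, y)) * M (x, y') * z y'))"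
      unfolding cinn_def m_def cnj_sum complex_cnj_mult sum_product by (simp only: mult_ac)
    also have "\<dots> = (\<Sum>y\<in>Y. \<Sum>x\<in>X. \<Sum>y'\<in>Y. cnj (w y) * (cnj (M (x, y)) * M (x, y') * z y'))"
      by (rule sum.swap)
    also have "\<dots> = (\<Sum>y\<in>Y. \<Sum>y'\<in>Y. \<Sum>x\<in>X. cnj (w y) * (cnj (M (x, y)) * M (x, y') * z y'))"
      by (intro sum.cong refl sum.swap)
    also have "\<dots> = cinn Y w (kapply Y A z)"
      by (simp add: cinn_def kapply_def A_def sum_distrib_left sum_distrib_right mult_ac)
    finally show ?thesis .
  qed
  have mm: "cinn X (m (e i)) (m (e j)) = of_real (l j) * (if i = j then 1 else 0)"
    if "i < card Y" "j < card Y" for i j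
  proof -
    have "cinn X (m (e i)) (m (e j)) = cinn Y (e i) (\<lambda>x. of_real (l j) * e j x)"
      unfolding m_inn by (rule cinn_cong) (use e(3) that in auto)
    then show ?thesis using e(1) that by (simp add: cinn_scale orthonormal_def)
  qed
  have l0: "l i \<ge> 0" if "i < card Y" for i
    using mm[OF that that] cinn_self_nonneg[of X "m (e i)"] by simp
  have mz: "m (e i) x = 0" if "i < card Y" "l i = 0" "x \<in> X" for i x
    by (rule cinn_self_zero[OF assms(1) _ that(3)]) (use mm that in auto)
  have exp: "M (x, y) = (\<Sum>i<card Y. cnj (e i y) * m (e i) x)" if "y \<in> Y" for x y
  proof -
    define d where "d = (\<lambda>z. if z = y then 1 else 0 :: complex)"
    have d: "cinn Y w d = cnj (w y)" for w
      using that assms(2) by (simp add: d_def cinn_def if_distrib[of "\<lambda>z. _ * z"] cong: if_cong)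
    have "d = (\<lambda>z. \<Sum>i<card Y. cnj (e i y) * e i z)"
      using e(4)[rule_format, of d] that unfolding d by (auto simp: d_def supp_on_def)
    then have "m d x = (\<Sum>i<card Y. cnj (e i y) * m (e i) x)"
      by (simp only: m_def sum_distrib_left) (subst sum.swap, simp only: mult.left_commute)
    moreover have "m d x = M (x, y)"
      using that assms(2) by (simp add: d_def m_def if_distrib[of "\<lambda>z. _ * z"] cong: if_cong)
    ultimately show ?thesis by simp
  qed
  define J where "J = {i. i < card Y \<and> l i > 0}"
  show ?thesis
  proof (rule that[of J "\<lambda>i. sqrt (l i)" "\<lambda>i x. of_real (1 / sqrt (l i)) * m (e i) x" "\<lambda>i y. cnj (e i y)"])
    show "finite J" "\<forall>i\<in>J. 0 \<le> sqrt (l i)" by (auto simp: J_def)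
    show "\<forall>i\<in>J. \<forall>j\<in>J. cinn X (\<lambda>x. of_real (1 / sqrt (l i)) * m (e i) x) (\<lambda>x. of_real (1 / sqrt (l j)) * m (e j) x) = (if i = j then 1 else 0)"
    proof (intro ballI)
      fix i j assume ij: "i \<in> J" "j \<in> J"
      have "complex_of_real (1 / sqrt (l j)) * (complex_of_real (1 / sqrt (l j)) * complex_of_real (l j)) = complex_of_real 1"
        unfolding of_real_mult[symmetric] by (rule arg_cong[of _ _ complex_of_real]) (use ij in \<open>auto simp: J_def field_simps\<close>)
      then show "cinn X (\<lambda>x. of_real (1 / sqrt (l i)) * m (e i) x) (\<lambda>x. of_real (1 / sqrt (l j)) * m (e j) x) = (if i = j then 1 else 0)"
        unfolding cinn_scale using mm[of i j] ij by (auto simp: J_def simp del: of_real_divide)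
    qed
    show "\<forall>i\<in>J. \<forall>j\<in>J. cinn Y (\<lambda>y. cnj (e i y)) (\<lambda>y. cnj (e j y)) = (if i = j then 1 else 0)"
    proof (intro ballI)
      fix i j assume ij: "i \<in> J" "j \<in> J"
      have "cinn Y (\<lambda>y. cnj (e i y)) (\<lambda>y. cnj (e j y)) = cinn Y (e j) (e i)"
        by (simp add: cinn_def mult.commute)
      then show "cinn Y (\<lambda>y. cnj (e i y)) (\<lambda>y. cnj (e j y)) = (if i = j then 1 else 0)"
        using e(1) ij by (auto simp: orthonormal_def J_def)
    qed
    show "\<forall>x\<in>X. \<forall>y\<in>Y. M (x, y) = (\<Sum>i\<in>J. of_real (sqrt (l i)) * (of_real (1 / sqrt (l i)) * m (e i) x * cnj (e i y)))"
    proof (intro ballI)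
      fix x y assume xy: "x \<in> X" "y \<in> Y"
      have "M (x, y) = (\<Sum>i<card Y. cnj (e i y) * m (e i) x)" by (rule exp[OF xy(2)])
      also have "\<dots> = (\<Sum>i\<in>J. cnj (e i y) * m (e i) x)"
        using mz[OF _ _ xy(1)] l0 by (intro sum.mono_neutral_right) (auto simp: J_def less_le)
      also have "\<dots> = (\<Sum>i\<in>J. of_real (sqrt (l i)) * (of_real (1 / sqrt (l i)) * m (e i) x * cnj (e i y)))"
        by (intro sum.cong) (auto simp: J_def)
      finally show "M (x, y) = (\<Sum>i\<in>J. of_real (sqrt (l i)) * (of_real (1 / sqrt (l i)) * m (e i) x * cnj (e i y)))" .
    qed
  qed
qed

definition tens :: "('a \<Rightarrow> 'a \<Rightarrow> complex) \<Rightarrow> ('b \<Rightarrow> 'b \<Rightarrow> complex) \<Rightarrow> 'a \<times> 'b \<Rightarrow> 'a \<times> 'b \<Rightarrow> complex" where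
  "tens A D p q = A (fst p) (fst q) * D (snd p) (snd q)"

lemma cinn_tens:
  "cinn (X \<times> Y) (\<lambda>z. p (fst z) * q (snd z)) (kapply (X \<times> Y) (tens A D) (\<lambda>z. p' (fst z) * q' (snd z)))
    = cinn X p (kapply X A p') * cinn Y q (kapply Y D q')"
proof -
  have "kapply (X \<times> Y) (tens A D) (\<lambda>z. p' (fst z) * q' (snd z)) z = kapply X A p' (fst z) * kapply Y D q' (snd z)" for z
    by (simp add: kapply_def tens_def sum_product sum.cartesian_product[symmetric] mult_ac
        flip: sum.cartesian_product) (simp add: sum.cartesian_product case_prod_beta)
  then show ?thesis
    unfolding cinn_def sum_product sum.cartesian_product by (intro sum.cong) (auto simp: mult_ac)
qed

text \<open>A product observable becomes a double sum of products of matrix elements, one factor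
  from each Schmidt family, with the weights \<open>s i * s j\<close>.\<close>

lemma cinn_schmidt:
  assumes "\<forall>x\<in>X. \<forall>y\<in>Y. M (x, y) = (\<Sum>i\<in>J. of_real (s i) * (p i x * q i y))"
  shows "cinn (X \<times> Y) M (kapply (X \<times> Y) (tens A D) M) =
    (\<Sum>i\<in>J. \<Sum>j\<in>J. of_real (s i * s j) * (cinn X (p i) (kapply X A (p j)) * cinn Y (q i) (kapply Y D (q j))))"
proof -
  define M' where "M' = (\<lambda>z. \<Sum>i\<in>J. of_real (s i) * (p i (fst z) * q i (snd z)))"
  have "M z = M' z" if "z \<in> X \<times> Y" for z using assms that by (auto simp: M'_def)
  then have "cinn (X \<times> Y) M (kapply (X \<times> Y) (tens A D) M) = cinn (X \<times> Y) M' (kapply (X \<times> Y) (tens A D) M')"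
    by (intro cinn_cong kapply_cong) auto
  also have "\<dots> = (\<Sum>i\<in>J. \<Sum>j\<in>J. of_real (s i * s j) * (cinn X (p i) (kapply X A (p j)) * cinn Y (q i) (kapply Y D (q j))))"
    unfolding M'_def kapply_sum cinn_sum kapply_scale cinn_scale cinn_tens
    by (subst sum.swap) (simp add: mult_ac sum_distrib_left)
  finally show ?thesis .
qed

definition real_ker :: "'a set \<Rightarrow> ('a \<Rightarrow> 'a \<Rightarrow> complex) \<Rightarrow> bool" where
  "real_ker X A = (\<forall>x\<in>X. \<forall>y\<in>X. Im (A x y) = 0)"

text \<open>The reason for insisting on real kernels: conjugating a Schmidt family conjugates its
  matrix elements, so that mirrored vectors produce squared moduli.\<close>

lemma real_ker_cnj:
  assumes "real_ker X A"
  shows "cinn X (\<lambda>x. cnj (u x)) (kapply X A (\<lambda>x. cnj (v x))) = cnj (cinn X u (kapply X A v))"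
proof -
  have "cnj (A x y) = A x y" if "x \<in> X" "y \<in> X" for x y
    using assms that by (simp add: real_ker_def complex_eq_iff)
  then show ?thesis by (auto simp: cinn_def kapply_def intro!: sum.cong)
qed

text \<open>The energy of A \<otimes> 1 + 1 \<otimes> D - \<Sum> C \<otimes> C'. The minus sign is
  essential: the elementary inequality between products and squares points the right way only for
  such a coupling.\<close>

definition rpform :: "'a set \<Rightarrow> 'r set \<Rightarrow> ('a \<Rightarrow> 'a \<Rightarrow> complex) \<Rightarrow> ('a \<Rightarrow> 'a \<Rightarrow> complex) \<Rightarrow>
    ('r \<Rightarrow> 'a \<Rightarrow> 'a \<Rightarrow> complex) \<Rightarrow> ('r \<Rightarrow> 'a \<Rightarrow> 'a \<Rightarrow> complex) \<Rightarrow> ('a \<times> 'a \<Rightarrow> complex) \<Rightarrow> real" where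
  "rpform X R A D C C' M = Re (cinn (X \<times> X) M (kapply (X \<times> X) (tens A rid) M))
     + Re (cinn (X \<times> X) M (kapply (X \<times> X) (tens rid D) M))
     - (\<Sum>r\<in>R. Re (cinn (X \<times> X) M (kapply (X \<times> X) (tens (C r) (C' r)) M)))"

text \<open>Writing \<open>M = \<Sum> s\<^sub>i u\<^sub>i \<otimes> v\<^sub>i\<close> with \<open>s\<^sub>i \<ge> 0\<close>, one takes
  \<open>M\<^sub>1 = \<Sum> s\<^sub>i u\<^sub>i \<otimes> cnj u\<^sub>i\<close> and \<open>M\<^sub>2 = \<Sum> s\<^sub>i cnj v\<^sub>i \<otimes> v\<^sub>i\<close>. The one-sided terms then agree on average, and
  \<open>2 Re (c c') \<le> |c|\<^sup>2 + |c'|\<^sup>2\<close> applies to each product of matrix elements of the coupling terms.\<close>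
theorem reflection_positivity:
  fixes M :: "'a \<times> 'a \<Rightarrow> complex"
  assumes fin: "finite X" "finite R" and re: "real_ker X A" "real_ker X D" "\<forall>r\<in>R. real_ker X (C r)" "\<forall>r\<in>R. real_ker X (C' r)"
  obtains M1 M2 where "Re (cinn (X \<times> X) M1 M1) = Re (cinn (X \<times> X) M M)" "Re (cinn (X \<times> X) M2 M2) = Re (cinn (X \<times> X) M M)"
    "rpform X R A A C C M1 + rpform X R D D C' C' M2 \<le> 2 * rpform X R A D C C' M"
proof -
  obtain J :: "nat set" and s u v where J: "finite J" "\<forall>i\<in>J. (0::real) \<le> s i"
    and u: "\<forall>i\<in>J. \<forall>j\<in>J. cinn X (u i) (u j) = (if i = j then 1 else 0)"
    and v: "\<forall>i\<in>J. \<forall>j\<in>J. cinn X (v i) (v j) = (if i = j then 1 else 0)"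
    and M: "\<forall>x\<in>X. \<forall>y\<in>X. M (x, y) = (\<Sum>i\<in>J. of_real (s i) * (u i x * v i y))"
    by (rule svd[OF fin(1) fin(1), of M])
  define cu where "cu = (\<lambda>i x. cnj (u i x))"
  define cv where "cv = (\<lambda>i x. cnj (v i x))"
  define M1 where "M1 = (\<lambda>z. \<Sum>i\<in>J. of_real (s i) * (u i (fst z) * cu i (snd z)))"
  define M2 where "M2 = (\<lambda>z. \<Sum>i\<in>J. of_real (s i) * (cv i (fst z) * v i (snd z)))"
  have M1: "\<forall>x\<in>X. \<forall>y\<in>X. M1 (x, y) = (\<Sum>i\<in>J. of_real (s i) * (u i x * cu i y))"
    and M2: "\<forall>x\<in>X. \<forall>y\<in>X. M2 (x, y) = (\<Sum>i\<in>J. of_real (s i) * (cv i x * v i y))"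
    by (auto simp: M1_def M2_def)
  have cu: "\<forall>i\<in>J. \<forall>j\<in>J. cinn X (cu i) (cu j) = (if i = j then 1 else 0)"
  proof (intro ballI)
    fix i j assume "i \<in> J" "j \<in> J"
    moreover have "cinn X (cu i) (cu j) = cinn X (u j) (u i)" by (simp add: cinn_def cu_def mult.commute)
    ultimately show "cinn X (cu i) (cu j) = (if i = j then 1 else 0)" using u by auto
  qed
  have cv: "\<forall>i\<in>J. \<forall>j\<in>J. cinn X (cv i) (cv j) = (if i = j then 1 else 0)"
  proof (intro ballI)
    fix i j assume "i \<in> J" "j \<in> J"
    moreover have "cinn X (cv i) (cv j) = cinn X (v j) (v i)" by (simp add: cinn_def cv_def mult.commute)
    ultimately show "cinn X (cv i) (cv j) = (if i = j then 1 else 0)" using v by auto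
  qed
  \<comment> \<open>Orthonormality of the second family removes the off-diagonal terms, so a
    one-sided observable sees only its own Schmidt family. The second family may then be exchanged
    for any other orthonormal one.\<close>
  have left: "cinn (X \<times> X) N (kapply (X \<times> X) (tens B rid) N) = (\<Sum>i\<in>J. of_real ((s i)\<^sup>2) * cinn X (p i) (kapply X B (p i)))"
    if N: "\<forall>x\<in>X. \<forall>y\<in>X. N (x, y) = (\<Sum>i\<in>J. of_real (s i) * (p i x * q i y))"
      and q: "\<forall>i\<in>J. \<forall>j\<in>J. cinn X (q i) (q j) = (if i = j then 1 else 0)" for N p q B
  proof -
    have "cinn (X \<times> X) N (kapply (X \<times> X) (tens B rid) N) = (\<Sum>i\<in>J. \<Sum>j\<in>J. if i = j then of_real ((s i)\<^sup>2) * cinn X (p i) (kapply X B (p i)) else 0)"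
      unfolding cinn_schmidt[OF N] cinn_kapply_rid[OF fin(1)] using q by (intro sum.cong) (auto simp: power2_eq_square)
    then show ?thesis using J(1) by simp
  qed
  have right: "cinn (X \<times> X) N (kapply (X \<times> X) (tens rid B) N) = (\<Sum>i\<in>J. of_real ((s i)\<^sup>2) * cinn X (q i) (kapply X B (q i)))"
    if N: "\<forall>x\<in>X. \<forall>y\<in>X. N (x, y) = (\<Sum>i\<in>J. of_real (s i) * (p i x * q i y))"
      and p: "\<forall>i\<in>J. \<forall>j\<in>J. cinn X (p i) (p j) = (if i = j then 1 else 0)" for N p q B
  proof -
    have "cinn (X \<times> X) N (kapply (X \<times> X) (tens rid B) N) = (\<Sum>i\<in>J. \<Sum>j\<in>J. if i = j then of_real ((s i)\<^sup>2) * cinn X (q i) (kapply X B (q i)) else 0)"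
      unfolding cinn_schmidt[OF N] cinn_kapply_rid[OF fin(1)] using p by (intro sum.cong) (auto simp: power2_eq_square)
    then show ?thesis using J(1) by simp
  qed
  have nrm: "cinn (X \<times> X) N N = (\<Sum>i\<in>J. of_real ((s i)\<^sup>2))"
    if N: "\<forall>x\<in>X. \<forall>y\<in>X. N (x, y) = (\<Sum>i\<in>J. of_real (s i) * (p i x * q i y))"
      and p: "\<forall>i\<in>J. \<forall>j\<in>J. cinn X (p i) (p j) = (if i = j then 1 else 0)"
      and q: "\<forall>i\<in>J. \<forall>j\<in>J. cinn X (q i) (q j) = (if i = j then 1 else 0)" for N p q
  proof -
    have "tens (rid :: 'a \<Rightarrow> 'a \<Rightarrow> complex) (rid :: 'a \<Rightarrow> 'a \<Rightarrow> complex) = rid"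
      by (auto simp: tens_def rid_def fun_eq_iff prod_eq_iff)
    then have "cinn (X \<times> X) N N = cinn (X \<times> X) N (kapply (X \<times> X) (tens rid rid) N)"
      using fin(1) by (simp add: cinn_kapply_rid)
    also have "\<dots> = (\<Sum>i\<in>J. of_real ((s i)\<^sup>2))"
      unfolding left[OF N q] cinn_kapply_rid[OF fin(1)] using p by (intro sum.cong) auto
    finally show ?thesis .
  qed
  have cross: "Re (cinn (X \<times> X) M1 (kapply (X \<times> X) (tens (C r) (C r)) M1)) + Re (cinn (X \<times> X) M2 (kapply (X \<times> X) (tens (C' r) (C' r)) M2))
     \<ge> 2 * Re (cinn (X \<times> X) M (kapply (X \<times> X) (tens (C r) (C' r)) M))" if r: "r \<in> R" for r
  proof -
    define c where "c i j = cinn X (u i) (kapply X (C r) (u j))" for i j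
    define d where "d i j = cinn X (v i) (kapply X (C' r) (v j))" for i j
    have cc: "cinn X (cu i) (kapply X (C r) (cu j)) = cnj (c i j)" for i j
      unfolding cu_def c_def using re(3) r by (intro real_ker_cnj) auto
    have dd: "cinn X (cv i) (kapply X (C' r) (cv j)) = cnj (d i j)" for i j
      unfolding cv_def d_def using re(4) r by (intro real_ker_cnj) auto
    have key: "2 * Re (of_real (s i * s j) * (c i j * d i j)) \<le> Re (of_real (s i * s j) * (c i j * cnj (c i j))) + Re (of_real (s i * s j) * (cnj (d i j) * d i j))"
      if "i \<in> J" "j \<in> J" for i j
    proof -
      have "2 * (Re (c i j) * Re (d i j) - Im (c i j) * Im (d i j)) \<le> (Re (c i j))\<^sup>2 + (Im (c i j))\<^sup>2 + (Re (d i j))\<^sup>2 + (Im (d i j))\<^sup>2"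
        using sum_squares_ge_zero[of "Re (c i j) - Re (d i j)" "Im (c i j) + Im (d i j)"] by (simp add: algebra_simps power2_eq_square)
      then have "s i * s j * (2 * (Re (c i j) * Re (d i j) - Im (c i j) * Im (d i j))) \<le> s i * s j * ((Re (c i j))\<^sup>2 + (Im (c i j))\<^sup>2 + (Re (d i j))\<^sup>2 + (Im (d i j))\<^sup>2)"
        using J(2) that by (intro mult_left_mono) auto
      then show ?thesis by (simp add: algebra_simps power2_eq_square)
    qed
    show ?thesis
      unfolding cinn_schmidt[OF M] cinn_schmidt[OF M1] cinn_schmidt[OF M2] cc dd c_def[symmetric] d_def[symmetric]
        Re_sum sum_distrib_left sum.distrib[symmetric]
      using key by (intro sum_mono) auto
  qed
  \<comment> \<open>Conjugation does not change real parts, so \<open>M1\<close> carries the term of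
    \<open>A\<close> twice and \<open>M2\<close> that of \<open>D\<close> twice.\<close>
  have rA: "cinn X (cu i) (kapply X A (cu i)) = cnj (cinn X (u i) (kapply X A (u i)))" for i
    unfolding cu_def by (rule real_ker_cnj[OF re(1)])
  have rD: "cinn X (cv i) (kapply X D (cv i)) = cnj (cinn X (v i) (kapply X D (v i)))" for i
    unfolding cv_def by (rule real_ker_cnj[OF re(2)])
  have "2 * (\<Sum>r\<in>R. Re (cinn (X \<times> X) M (kapply (X \<times> X) (tens (C r) (C' r)) M)))
     \<le> (\<Sum>r\<in>R. Re (cinn (X \<times> X) M1 (kapply (X \<times> X) (tens (C r) (C r)) M1))) + (\<Sum>r\<in>R. Re (cinn (X \<times> X) M2 (kapply (X \<times> X) (tens (C' r) (C' r)) M2)))"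
    unfolding sum_distrib_left sum.distrib[symmetric] by (rule sum_mono) (rule cross)
  then have "rpform X R A A C C M1 + rpform X R D D C' C' M2 \<le> 2 * rpform X R A D C C' M"
    unfolding rpform_def left[OF M v] right[OF M u] left[OF M1 cu] right[OF M1 u] left[OF M2 v] right[OF M2 cv] rA rD
    by (simp add: Re_sum)
  then show ?thesis
    using that[of M1 M2] nrm[OF M u v] nrm[OF M1 u cu] nrm[OF M2 cv v] by simp
qed

section \<open>Ground states in finite volume\<close>

lemma finite_configs: "finite G \<Longrightarrow> finite (configs n G)"
  using finite_set_of_finite_funs[of G "{..n}" 0] by (rule rev_finite_subset) (auto simp: configs_def)

lemma configs_nonempty: "configs n G \<noteq> {}"
  by (auto simp: configs_def intro!: exI[of _ "\<lambda>_. 0"])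

lemma apply_op_kapply: "apply_op n G A v = kapply (configs n G) A v"
  by (simp add: apply_op_def kapply_def)

lemma vecs_supp_on: "v \<in> vecs n G \<longleftrightarrow> supp_on (configs n G) v"
  by (auto simp: vecs_def supp_on_def)

lemma kapply_opmult: "kapply (configs n G) (opmult n G A B) v = kapply (configs n G) A (kapply (configs n G) B v)"
proof
  fix \<sigma>
  have "kapply (configs n G) (opmult n G A B) v \<sigma> = (\<Sum>\<tau>\<in>configs n G. \<Sum>\<rho>\<in>configs n G. A \<sigma> \<rho> * (B \<rho> \<tau> * v \<tau>))"
    by (simp add: kapply_def opmult_def sum_distrib_right mult.assoc)
  also have "\<dots> = (\<Sum>\<rho>\<in>configs n G. \<Sum>\<tau>\<in>configs n G. A \<sigma> \<rho> * (B \<rho> \<tau> * v \<tau>))"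
    by (rule sum.swap)
  also have "\<dots> = kapply (configs n G) A (kapply (configs n G) B v) \<sigma>"
    by (simp add: kapply_def sum_distrib_left)
  finally show "kapply (configs n G) (opmult n G A B) v \<sigma> = kapply (configs n G) A (kapply (configs n G) B v) \<sigma>" .
qed

text \<open>The property under the definite description of \<open>gs_proj\<close>, named so that
  existence and uniqueness can be stated.\<close>

definition is_gs_proj :: "nat \<Rightarrow> site set \<Rightarrow> obs \<Rightarrow> obs \<Rightarrow> bool" where
  "is_gs_proj n G H P \<longleftrightarrow>
      (\<forall>\<sigma> \<tau>. \<sigma> \<notin> configs n G \<or> \<tau> \<notin> configs n G \<longrightarrow> P \<sigma> \<tau> = 0) \<and>
      (\<forall>\<sigma> \<tau>. P \<sigma> \<tau> = cnj (P \<tau> \<sigma>)) \<and>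
      (\<forall>v\<in>vecs n G. apply_op n G P v \<in> gs_space n G H) \<and>
      (\<forall>v\<in>gs_space n G H. apply_op n G P v = v)"

text \<open>The range of \<open>P'\<close> consists of ground vectors, which \<open>P\<close> fixes;
  hence P P' = P', and likewise P' P = P. Taking adjoints in the first identity gives P' P =
  P'.\<close>

lemma is_gs_proj_unique:
  assumes "finite G" "is_gs_proj n G H P" "is_gs_proj n G H P'"
  shows "P = P'"
proof -
  let ?X = "configs n G"
  have fin: "finite ?X" by (rule finite_configs[OF assms(1)])
  have comp: "(\<Sum>\<rho>\<in>?X. P \<sigma> \<rho> * P' \<rho> \<tau>) = P' \<sigma> \<tau>"
    if P: "is_gs_proj n G H P" and P': "is_gs_proj n G H P'" and \<tau>: "\<tau> \<in> ?X" for P P' \<sigma> \<tau>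
  proof -
    define d where "d = (\<lambda>\<rho>. if \<rho> = \<tau> then 1 else 0 :: complex)"
    have "d \<in> vecs n G" using \<tau> by (auto simp: d_def vecs_def)
    then have "apply_op n G P (apply_op n G P' d) = apply_op n G P' d"
      using P P' unfolding is_gs_proj_def by blast
    moreover have "apply_op n G P' d = (\<lambda>\<rho>. P' \<rho> \<tau>)"
      using \<tau> fin by (auto simp: apply_op_def d_def if_distrib[of "\<lambda>z. _ * z"] cong: if_cong)
    ultimately show ?thesis by (simp add: apply_op_def fun_eq_iff)
  qed
  have "P' \<sigma> \<tau> = P \<sigma> \<tau>" if "\<sigma> \<in> ?X" "\<tau> \<in> ?X" for \<sigma> \<tau>
  proof -
    have h: "P \<sigma> \<tau> = cnj (P \<tau> \<sigma>)" "P' \<sigma> \<tau> = cnj (P' \<tau> \<sigma>)" for \<sigma> \<tau>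
      using assms(2,3) unfolding is_gs_proj_def by blast+
    have "P' \<sigma> \<tau> = cnj (\<Sum>\<rho>\<in>?X. P \<tau> \<rho> * P' \<rho> \<sigma>)"
      using h(2)[of \<sigma> \<tau>] comp[OF assms(2,3) that(1), of \<tau>] by simp
    also have "\<dots> = (\<Sum>\<rho>\<in>?X. P' \<sigma> \<rho> * P \<rho> \<tau>)"
      unfolding cnj_sum complex_cnj_mult h(1)[symmetric] h(2)[symmetric] by (simp only: mult.commute)
    also have "\<dots> = P \<sigma> \<tau>" by (rule comp[OF assms(3,2) that(2)])
    finally show ?thesis .
  qed
  then show ?thesis using assms(2,3) unfolding is_gs_proj_def fun_eq_iff by metis
qed

lemma gs_proj_eqI: "finite G \<Longrightarrow> is_gs_proj n G H P \<Longrightarrow> gs_proj n G H = P"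
  unfolding gs_proj_def using is_gs_proj_unique
  by (intro the_equality) (unfold is_gs_proj_def[symmetric], auto)

text \<open>Select from a complete system of eigenvectors those with the lowest eigenvalue.
  Completeness is what shows that nothing else lies in the ground space and that the energy bound
  holds for all vectors.\<close>

lemma gs_exists:
  assumes "finite G" "herm_on (configs n G) H"
  obtains I :: "nat set" and e where "finite I" "I \<noteq> {}"
    "\<forall>i\<in>I. \<forall>j\<in>I. cinn (configs n G) (e i) (e j) = (if i = j then 1 else 0)"
    "\<forall>i\<in>I. e i \<in> gs_space n G H"
    "is_gs_proj n G H (\<lambda>\<sigma> \<tau>. \<Sum>i\<in>I. e i \<sigma> * cnj (e i \<tau>))"
    "\<forall>v\<in>vecs n G. gs_energy n G H * Re (cinn (configs n G) v v) \<le> Re (cinn (configs n G) v (apply_op n G H v))"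
proof -
  let ?X = "configs n G"
  define N where "N = card ?X"
  have fin: "finite ?X" by (rule finite_configs[OF assms(1)])
  obtain e l where e: "orthonormal ?X N e" "\<forall>i<N. supp_on ?X (e i)"
    "\<forall>i<N. \<forall>x\<in>?X. kapply ?X H (e i) x = complex_of_real (l i) * e i x"
    "\<forall>v. supp_on ?X v \<longrightarrow> v = (\<lambda>x. \<Sum>i<N. cinn ?X (e i) v * e i x)"
    unfolding N_def by (rule spectral[OF fin assms(2)])
  have N0: "N > 0" using fin configs_nonempty[of n G] by (simp add: N_def card_gt_0_iff)
  have on: "cinn ?X (e i) (e j) = (if i = j then 1 else 0)" if "i < N" "j < N" for i j
    using e(1) that by (simp add: orthonormal_def)
  have coef: "of_real (l i) * cinn ?X (e i) v = cinn ?X (e i) (kapply ?X H v)" if "i < N" for i v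
  proof -
    have "cinn ?X (e i) (kapply ?X H v) = cinn ?X (\<lambda>x. of_real (l i) * e i x) v"
      unfolding herm_kapply[OF assms(2)] by (rule cinn_cong) (use e(3) that in auto)
    then show ?thesis by (simp add: cinn_scale)
  qed
  have coef_eig: "l i = E \<or> cinn ?X (e i) v = 0"
    if "i < N" "\<forall>\<sigma>\<in>?X. kapply ?X H v \<sigma> = of_real E * v \<sigma>" for i v E
  proof -
    have "cinn ?X (e i) (kapply ?X H v) = cinn ?X (e i) (\<lambda>x. of_real E * v x)"
      by (rule cinn_cong) (use that in auto)
    then have "of_real (l i) * cinn ?X (e i) v = of_real E * cinn ?X (e i) v"
      unfolding coef[OF that(1), symmetric] cinn_scale .
    then show ?thesis by auto
  qed
  \<comment> \<open>The set of eigenvalues is therefore finite and non-empty, which gives the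
    \<open>Min\<close> in \<open>gs_energy\<close> its meaning.\<close>
  have eig: "eigvals n G H = l ` {..<N}"
  proof (intro equalityI subsetI)
    fix E assume "E \<in> eigvals n G H"
    then obtain v where v: "supp_on ?X v" "\<exists>\<sigma>. v \<sigma> \<noteq> 0" "\<forall>\<sigma>\<in>?X. kapply ?X H v \<sigma> = of_real E * v \<sigma>"
      unfolding eigvals_def apply_op_kapply mem_Collect_eq Bex_def vecs_supp_on by blast
    show "E \<in> l ` {..<N}"
    proof (rule ccontr)
      assume "E \<notin> l ` {..<N}"
      then have "cinn ?X (e i) v = 0" if "i < N" for i using coef_eig[OF that v(3)] that by auto
      then have "v \<sigma> = 0" for \<sigma>
        using e(4)[rule_format, OF v(1)] by (metis (no_types, lifting) lessThan_iff mult_zero_left sum.neutral)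
      with v(2) show False by blast
    qed
  next
    fix E assume "E \<in> l ` {..<N}"
    then obtain i where i: "i < N" "E = l i" by auto
    have "\<exists>\<sigma>. e i \<sigma> \<noteq> 0" using on[OF i(1) i(1)] by (metis (no_types, lifting) cinn_def mult_zero_right sum.neutral zero_neq_one)
    then show "E \<in> eigvals n G H"
      using e(2,3) i by (auto simp: eigvals_def apply_op_kapply vecs_supp_on)
  qed
  define E where "E = gs_energy n G H"
  have E: "E = Min (l ` {..<N})" by (simp add: E_def gs_energy_def eig)
  have El: "E \<le> l i" if "i < N" for i unfolding E using that by (intro Min_le) auto
  have "E \<in> l ` {..<N}" unfolding E using N0 by (intro Min_in) auto
  define I where "I = {i. i < N \<and> l i = E}"
  have I: "finite I" "I \<noteq> {}" using \<open>E \<in> l ` {..<N}\<close> by (auto simp: I_def)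
  have gsI: "e i \<in> gs_space n G H" if "i \<in> I" for i
    using that e(2,3) by (auto simp: I_def gs_space_def vecs_supp_on apply_op_kapply E_def)
  have gs_lin: "(\<lambda>\<sigma>. \<Sum>i\<in>I. c i * e i \<sigma>) \<in> gs_space n G H" for c
  proof -
    have "kapply ?X H (\<lambda>\<sigma>. \<Sum>i\<in>I. c i * e i \<sigma>) \<sigma> = of_real E * (\<Sum>i\<in>I. c i * e i \<sigma>)" if "\<sigma> \<in> ?X" for \<sigma>
      unfolding kapply_sum kapply_scale sum_distrib_left using e(3) that by (intro sum.cong) (auto simp: I_def)
    moreover have "supp_on ?X (\<lambda>\<sigma>. \<Sum>i\<in>I. c i * e i \<sigma>)"
      using e(2) by (auto simp: supp_on_def I_def intro!: sum.neutral)
    ultimately show ?thesis by (auto simp: gs_space_def vecs_supp_on apply_op_kapply E_def)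
  qed
  have Pap: "apply_op n G (\<lambda>\<sigma> \<tau>. \<Sum>i\<in>I. e i \<sigma> * cnj (e i \<tau>)) v = (\<lambda>\<sigma>. \<Sum>i\<in>I. cinn ?X (e i) v * e i \<sigma>)" for v
  proof
    fix \<sigma>
    show "apply_op n G (\<lambda>\<sigma> \<tau>. \<Sum>i\<in>I. e i \<sigma> * cnj (e i \<tau>)) v \<sigma> = (\<Sum>i\<in>I. cinn ?X (e i) v * e i \<sigma>)"
      unfolding apply_op_def cinn_def sum_distrib_right by (subst sum.swap) (simp only: mult_ac)
  qed
  have proj: "is_gs_proj n G H (\<lambda>\<sigma> \<tau>. \<Sum>i\<in>I. e i \<sigma> * cnj (e i \<tau>))"
    unfolding is_gs_proj_def
  proof (intro conjI allI impI ballI)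
    fix \<sigma> \<tau> assume "\<sigma> \<notin> ?X \<or> \<tau> \<notin> ?X"
    then show "(\<Sum>i\<in>I. e i \<sigma> * cnj (e i \<tau>)) = 0"
      using e(2) by (auto simp: supp_on_def I_def intro!: sum.neutral)
  next
    fix \<sigma> \<tau> show "(\<Sum>i\<in>I. e i \<sigma> * cnj (e i \<tau>)) = cnj (\<Sum>i\<in>I. e i \<tau> * cnj (e i \<sigma>))"
      by (simp add: mult.commute)
  next
    fix v show "apply_op n G (\<lambda>\<sigma> \<tau>. \<Sum>i\<in>I. e i \<sigma> * cnj (e i \<tau>)) v \<in> gs_space n G H"
      unfolding Pap by (rule gs_lin)
  next
    fix v assume v: "v \<in> gs_space n G H"
    then have v': "supp_on ?X v" "\<forall>\<sigma>\<in>?X. kapply ?X H v \<sigma> = of_real E * v \<sigma>"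
      by (auto simp: gs_space_def vecs_supp_on apply_op_kapply E_def)
    have "(\<Sum>i<N. cinn ?X (e i) v * e i \<sigma>) = (\<Sum>i\<in>I. cinn ?X (e i) v * e i \<sigma>)" for \<sigma>
      using coef_eig[OF _ v'(2)] by (intro sum.mono_neutral_right) (auto simp: I_def)
    then show "apply_op n G (\<lambda>\<sigma> \<tau>. \<Sum>i\<in>I. e i \<sigma> * cnj (e i \<tau>)) v = v"
      unfolding Pap using e(4)[rule_format, OF v'(1)] by simp
  qed
  have ray: "E * Re (cinn ?X v v) \<le> Re (cinn ?X v (kapply ?X H v))" if v: "supp_on ?X v" for v
  proof -
    have 1: "cinn ?X v w = (\<Sum>i<N. cnj (cinn ?X (e i) v) * cinn ?X (e i) w)" for w
      by (subst e(4)[rule_format, OF v]) (simp only: cinn_sum cinn_scale)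
    have 2: "Re (cinn ?X v v) = (\<Sum>i<N. (cmod (cinn ?X (e i) v))\<^sup>2)"
      unfolding 1 Re_sum by (intro sum.cong refl) (simp add: cmod_power2, simp add: power2_eq_square)
    have 3: "Re (cinn ?X v (kapply ?X H v)) = (\<Sum>i<N. l i * (cmod (cinn ?X (e i) v))\<^sup>2)"
      unfolding 1 Re_sum coef[symmetric]
      by (intro sum.cong refl, subst coef[symmetric]) (simp_all add: cmod_power2, simp add: power2_eq_square algebra_simps)
    show ?thesis unfolding 2 3 sum_distrib_left using El by (intro sum_mono mult_right_mono) auto
  qed
  show ?thesis
  proof (rule that[of I e])
    show "\<forall>i\<in>I. \<forall>j\<in>I. cinn ?X (e i) (e j) = (if i = j then 1 else 0)" using on by (auto simp: I_def)
    show "\<forall>v\<in>vecs n G. gs_energy n G H * Re (cinn ?X v v) \<le> Re (cinn ?X v (apply_op n G H v))"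
      using ray unfolding E_def apply_op_kapply by (simp add: vecs_supp_on)
  qed (use I gsI proj in auto)
qed

text \<open>The variational principle without a support condition: cutting \<open>v\<close> off
  outside the configurations changes neither side.\<close>

lemma gs_energy_le:
  assumes "finite G" "herm_on (configs n G) H"
  shows "gs_energy n G H * Re (cinn (configs n G) v v) \<le> Re (cinn (configs n G) v (kapply (configs n G) H v))"
proof -
  let ?X = "configs n G"
  obtain I :: "nat set" and e where *: "\<forall>v\<in>vecs n G. gs_energy n G H * Re (cinn ?X v v) \<le> Re (cinn ?X v (apply_op n G H v))"
    by (rule gs_exists[OF assms]) blast
  define w where "w = (\<lambda>\<sigma>. if \<sigma> \<in> ?X then v \<sigma> else 0)"
  have "w \<in> vecs n G" by (auto simp: w_def vecs_def)
  then have "gs_energy n G H * Re (cinn ?X w w) \<le> Re (cinn ?X w (kapply ?X H w))"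
    using * unfolding apply_op_kapply by blast
  moreover have "cinn ?X w w = cinn ?X v v" "cinn ?X w (kapply ?X H w) = cinn ?X v (kapply ?X H v)"
    by (intro cinn_cong kapply_cong; simp add: w_def)+
  ultimately show ?thesis by simp
qed

definition ev :: "'a set \<Rightarrow> ('a \<Rightarrow> complex) \<Rightarrow> ('a \<Rightarrow> 'a \<Rightarrow> complex) \<Rightarrow> complex" where
  "ev X v A = cinn X v (kapply X A v)"

text \<open>The ground state is the uniform mixture of the vector states of an orthonormal basis of
  the ground space. Estimates for single ground vectors are averaged with this formula.\<close>

lemma fv_gs_expand:
  assumes "finite G" "herm_on (configs n G) H"
  obtains I :: "nat set" and e where "finite I" "I \<noteq> {}"
    "\<forall>i\<in>I. \<forall>j\<in>I. cinn (configs n G) (e i) (e j) = (if i = j then 1 else 0)"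
    "\<forall>i\<in>I. \<forall>\<sigma>\<in>configs n G. kapply (configs n G) H (e i) \<sigma> = complex_of_real (gs_energy n G H) * e i \<sigma>"
    "\<forall>A. fv_gs n G H A = (\<Sum>i\<in>I. ev (configs n G) (e i) A) / of_nat (card I)"
proof -
  let ?X = "configs n G"
  obtain I :: "nat set" and e where I: "finite I" "I \<noteq> {}"
    and on: "\<forall>i\<in>I. \<forall>j\<in>I. cinn (configs n G) (e i) (e j) = (if i = j then 1 else 0)"
    and gs: "\<forall>i\<in>I. e i \<in> gs_space n G H"
    and P: "is_gs_proj n G H (\<lambda>\<sigma> \<tau>. \<Sum>i\<in>I. e i \<sigma> * cnj (e i \<tau>))"
    by (rule gs_exists[OF assms]) blast
  have Peq: "gs_proj n G H = (\<lambda>\<sigma> \<tau>. \<Sum>i\<in>I. e i \<sigma> * cnj (e i \<tau>))"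
    by (rule gs_proj_eqI[OF assms(1) P])
  have tr: "optrace n G (gs_proj n G H) = of_nat (card I)"
  proof -
    have "optrace n G (gs_proj n G H) = (\<Sum>i\<in>I. cinn ?X (e i) (e i))"
      unfolding optrace_def Peq cinn_def by (subst sum.swap) (simp only: mult.commute)
    then show ?thesis using on by simp
  qed
  have trA: "optrace n G (opmult n G (gs_proj n G H) A) = (\<Sum>i\<in>I. ev ?X (e i) A)" for A
  proof -
    have "optrace n G (opmult n G (gs_proj n G H) A) = (\<Sum>\<sigma>\<in>?X. \<Sum>\<rho>\<in>?X. \<Sum>i\<in>I. cnj (e i \<rho>) * (A \<rho> \<sigma> * e i \<sigma>))"
      unfolding optrace_def opmult_def Peq sum_distrib_right by (simp only: mult_ac)
    also have "\<dots> = (\<Sum>\<rho>\<in>?X. \<Sum>\<sigma>\<in>?X. \<Sum>i\<in>I. cnj (e i \<rho>) * (A \<rho> \<sigma> * e i \<sigma>))"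
      by (rule sum.swap)
    also have "\<dots> = (\<Sum>\<rho>\<in>?X. \<Sum>i\<in>I. \<Sum>\<sigma>\<in>?X. cnj (e i \<rho>) * (A \<rho> \<sigma> * e i \<sigma>))"
      by (intro sum.cong refl sum.swap)
    also have "\<dots> = (\<Sum>i\<in>I. \<Sum>\<rho>\<in>?X. \<Sum>\<sigma>\<in>?X. cnj (e i \<rho>) * (A \<rho> \<sigma> * e i \<sigma>))"
      by (rule sum.swap)
    also have "\<dots> = (\<Sum>i\<in>I. ev ?X (e i) A)"
      by (simp add: ev_def cinn_def kapply_def sum_distrib_left)
    finally show ?thesis .
  qed
  show ?thesis
  proof (rule that[of I e])
    show "\<forall>i\<in>I. \<forall>\<sigma>\<in>?X. kapply ?X H (e i) \<sigma> = complex_of_real (gs_energy n G H) * e i \<sigma>"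
      using gs by (auto simp: gs_space_def apply_op_kapply)
    show "\<forall>A. fv_gs n G H A = (\<Sum>i\<in>I. ev ?X (e i) A) / of_nat (card I)"
      by (simp add: fv_gs_def tr trA)
  qed (use I on in auto)
qed

text \<open>Transporting the projection along \<pi> gives a kernel with the same characterising
  property, because H is invariant. By uniqueness the projection itself is invariant, and the trace
  can be reindexed.\<close>

lemma fv_gs_symmetry:
  assumes fin: "finite G" and herm: "herm_on (configs n G) H" and bij: "bij_betw \<pi> (configs n G) (configs n G)"
    and inv: "\<And>\<sigma> \<tau>. \<sigma> \<in> configs n G \<Longrightarrow> \<tau> \<in> configs n G \<Longrightarrow> H (\<pi> \<sigma>) (\<pi> \<tau>) = H \<sigma> \<tau>"
  shows "fv_gs n G H (\<lambda>\<sigma> \<tau>. A (\<pi> \<sigma>) (\<pi> \<tau>)) = fv_gs n G H A"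
proof -
  let ?X = "configs n G"
  have X: "finite ?X" by (rule finite_configs[OF fin])
  have \<pi>X: "\<pi> \<sigma> \<in> ?X" if "\<sigma> \<in> ?X" for \<sigma> using bij that by (auto simp: bij_betw_def)
  obtain \<theta> where \<theta>: "\<And>\<sigma>. \<sigma> \<in> ?X \<Longrightarrow> \<theta> \<sigma> \<in> ?X \<and> \<pi> (\<theta> \<sigma>) = \<sigma>" "\<And>\<sigma>. \<sigma> \<in> ?X \<Longrightarrow> \<theta> (\<pi> \<sigma>) = \<sigma>"
  proof (rule that[of "inv_into ?X \<pi>"])
    show "inv_into ?X \<pi> \<sigma> \<in> ?X \<and> \<pi> (inv_into ?X \<pi> \<sigma>) = \<sigma>" if "\<sigma> \<in> ?X" for \<sigma>
      using bij_betw_apply[OF bij_betw_inv_into[OF bij] that] bij_betw_inv_into_right[OF bij that] by simp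
    show "inv_into ?X \<pi> (\<pi> \<sigma>) = \<sigma>" if "\<sigma> \<in> ?X" for \<sigma>
      by (rule bij_betw_inv_into_left[OF bij that])
  qed
  have reidx: "(\<Sum>\<sigma>\<in>?X. f (\<pi> \<sigma>)) = (\<Sum>\<sigma>\<in>?X. f \<sigma>)" for f :: "config \<Rightarrow> complex"
    by (rule sum.reindex_bij_betw[OF bij])
  obtain I :: "nat set" and e where P: "is_gs_proj n G H (\<lambda>\<sigma> \<tau>. \<Sum>i\<in>I. e i \<sigma> * cnj (e i \<tau>))"
    by (rule gs_exists[OF fin herm]) blast
  define P where "P = gs_proj n G H"
  have P: "is_gs_proj n G H P"
    using P gs_proj_eqI[OF fin P] by (simp add: P_def)
  \<comment> \<open>Cut off outside the configurations, since the characterisation demands that the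
    kernel vanish there.\<close>
  define P2 where "P2 = (\<lambda>\<sigma> \<tau>. if \<sigma> \<in> ?X \<and> \<tau> \<in> ?X then P (\<pi> \<sigma>) (\<pi> \<tau>) else 0)"
  have gs_pull: "(\<lambda>\<sigma>. if \<sigma> \<in> ?X then w (\<pi> \<sigma>) else 0) \<in> gs_space n G H" if "w \<in> gs_space n G H" for w
  proof -
    have "apply_op n G H (\<lambda>\<sigma>. if \<sigma> \<in> ?X then w (\<pi> \<sigma>) else 0) \<sigma> = apply_op n G H w (\<pi> \<sigma>)" if "\<sigma> \<in> ?X" for \<sigma>
      unfolding apply_op_def using inv that by (subst (2) reidx[symmetric]) (intro sum.cong, auto)
    then show ?thesis using that \<pi>X by (auto simp: gs_space_def vecs_def)
  qed
  have gs_push: "(\<lambda>\<sigma>. if \<sigma> \<in> ?X then w (\<theta> \<sigma>) else 0) \<in> gs_space n G H" if "w \<in> gs_space n G H" for w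
  proof -
    have "apply_op n G H (\<lambda>\<sigma>. if \<sigma> \<in> ?X then w (\<theta> \<sigma>) else 0) \<sigma> = apply_op n G H w (\<theta> \<sigma>)" if s: "\<sigma> \<in> ?X" for \<sigma>
    proof -
      have "apply_op n G H (\<lambda>\<sigma>. if \<sigma> \<in> ?X then w (\<theta> \<sigma>) else 0) \<sigma> = (\<Sum>\<tau>\<in>?X. H \<sigma> (\<pi> \<tau>) * w \<tau>)"
        unfolding apply_op_def by (subst reidx[symmetric]) (intro sum.cong, auto simp: \<theta> \<pi>X)
      also have "\<dots> = (\<Sum>\<tau>\<in>?X. H (\<theta> \<sigma>) \<tau> * w \<tau>)"
        using inv[of "\<theta> \<sigma>"] \<theta>(1)[OF s] by (intro sum.cong) auto
      finally show ?thesis by (simp add: apply_op_def)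
    qed
    then show ?thesis using that \<theta>(1) by (auto simp: gs_space_def vecs_def)
  qed
  have P0: "P \<sigma> \<tau> = 0" if "\<sigma> \<notin> ?X \<or> \<tau> \<notin> ?X" for \<sigma> \<tau> using P that unfolding is_gs_proj_def by blast
  have ap: "apply_op n G P2 v = (\<lambda>\<sigma>. if \<sigma> \<in> ?X then apply_op n G P (\<lambda>\<tau>. if \<tau> \<in> ?X then v (\<theta> \<tau>) else 0) (\<pi> \<sigma>) else 0)" for v
  proof
    fix \<sigma>
    show "apply_op n G P2 v \<sigma> = (if \<sigma> \<in> ?X then apply_op n G P (\<lambda>\<tau>. if \<tau> \<in> ?X then v (\<theta> \<tau>) else 0) (\<pi> \<sigma>) else 0)"
    proof (cases "\<sigma> \<in> ?X")
      case True
      have "apply_op n G P (\<lambda>\<tau>. if \<tau> \<in> ?X then v (\<theta> \<tau>) else 0) (\<pi> \<sigma>) = (\<Sum>\<tau>\<in>?X. P (\<pi> \<sigma>) (\<pi> \<tau>) * v \<tau>)"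
        unfolding apply_op_def by (subst reidx[symmetric]) (intro sum.cong, auto simp: \<theta> \<pi>X)
      then show ?thesis using True by (simp add: apply_op_def P2_def)
    qed (simp add: apply_op_def P2_def)
  qed
  have P2: "is_gs_proj n G H P2"
    unfolding is_gs_proj_def
  proof (intro conjI allI impI ballI)
    fix \<sigma> \<tau> assume "\<sigma> \<notin> ?X \<or> \<tau> \<notin> ?X" then show "P2 \<sigma> \<tau> = 0" by (auto simp: P2_def)
  next
    fix \<sigma> \<tau>
    have "P (\<pi> \<sigma>) (\<pi> \<tau>) = cnj (P (\<pi> \<tau>) (\<pi> \<sigma>))" using P unfolding is_gs_proj_def by blast
    then show "P2 \<sigma> \<tau> = cnj (P2 \<tau> \<sigma>)" by (auto simp: P2_def)
  next
    fix v assume "v \<in> vecs n G"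
    have "(\<lambda>\<tau>. if \<tau> \<in> ?X then v (\<theta> \<tau>) else 0) \<in> vecs n G" by (auto simp: vecs_def)
    then have "apply_op n G P (\<lambda>\<tau>. if \<tau> \<in> ?X then v (\<theta> \<tau>) else 0) \<in> gs_space n G H"
      using P unfolding is_gs_proj_def by blast
    then show "apply_op n G P2 v \<in> gs_space n G H" unfolding ap by (rule gs_pull)
  next
    fix v assume v: "v \<in> gs_space n G H"
    have "apply_op n G P (\<lambda>\<tau>. if \<tau> \<in> ?X then v (\<theta> \<tau>) else 0) = (\<lambda>\<tau>. if \<tau> \<in> ?X then v (\<theta> \<tau>) else 0)"
      using gs_push[OF v] P unfolding is_gs_proj_def by blast
    then show "apply_op n G P2 v = v" unfolding ap using v \<theta>(2) \<pi>X by (intro ext) (auto simp: gs_space_def vecs_def)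
  qed
  have "P2 = P" by (rule is_gs_proj_unique[OF fin P2 P])
  then have sym: "P \<sigma> \<tau> = P (\<pi> \<sigma>) (\<pi> \<tau>)" if "\<sigma> \<in> ?X" "\<tau> \<in> ?X" for \<sigma> \<tau>
    using that unfolding P2_def fun_eq_iff by metis
  have "optrace n G (opmult n G P (\<lambda>\<sigma> \<tau>. A (\<pi> \<sigma>) (\<pi> \<tau>))) = (\<Sum>\<sigma>\<in>?X. \<Sum>\<rho>\<in>?X. P (\<pi> \<sigma>) (\<pi> \<rho>) * A (\<pi> \<rho>) (\<pi> \<sigma>))"
    unfolding optrace_def opmult_def using sym by (intro sum.cong) auto
  also have "\<dots> = (\<Sum>\<sigma>\<in>?X. \<Sum>\<rho>\<in>?X. P (\<pi> \<sigma>) \<rho> * A \<rho> (\<pi> \<sigma>))"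
    by (intro sum.cong refl reidx)
  also have "\<dots> = optrace n G (opmult n G P A)"
    unfolding optrace_def opmult_def by (rule reidx)
  finally show ?thesis by (simp add: fv_gs_def P_def)
qed

section \<open>Spin matrices and local states\<close>

text \<open>Observables are functions on all pairs of configurations, but only the entries over
  configurations of the region count. Identities between operators are therefore stated in this
  weaker form.\<close>

definition kernel_eq :: "'a set \<Rightarrow> ('a \<Rightarrow> 'a \<Rightarrow> complex) \<Rightarrow> ('a \<Rightarrow> 'a \<Rightarrow> complex) \<Rightarrow> bool" where
  "kernel_eq X A B = (\<forall>\<sigma>\<in>X. \<forall>\<tau>\<in>X. A \<sigma> \<tau> = B \<sigma> \<tau>)"

section \<open>Commutation relations and the Casimir identity\<close>

definition smul :: "nat \<Rightarrow> (nat \<Rightarrow> nat \<Rightarrow> complex) \<Rightarrow> (nat \<Rightarrow> nat \<Rightarrow> complex) \<Rightarrow> nat \<Rightarrow> nat \<Rightarrow> complex" where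
  "smul n s t j k = (\<Sum>l\<le>n. s j l * t l k)"

lemma splus_eq: "splus n j k = (if j + 1 = k \<and> k \<le> n then of_real (sqrt (real k * (real n + 1 - real k))) else 0)"
proof -
  have "real n / 2 * (real n / 2 + 1) - mval n k * (mval n k + 1) = real k * (real n + 1 - real k)"
    by (simp add: mval_def field_simps power2_eq_square)
  then show ?thesis by (simp add: splus_def)
qed

lemma splus_sq:
  assumes "k \<le> n"
  shows "of_real (sqrt (real k * (real n + 1 - real k))) * of_real (sqrt (real k * (real n + 1 - real k))) = (of_real (real k * (real n + 1 - real k)) :: complex)"
proof -
  have "0 \<le> real k * (real n + 1 - real k)" using assms by (intro mult_nonneg_nonneg) auto
  then show ?thesis by (simp only: of_real_mult[symmetric] real_sqrt_mult_self abs_of_nonneg)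
qed

lemma smul_pm:
  assumes "j \<le> n"
  shows "smul n (splus n) (sminus n) j k = (if j = k then of_real (real (j + 1) * (real n - real j)) else 0)"
proof -
  have *: "splus n j l * splus n k l = (if l = j + 1 then (if j = k \<and> j + 1 \<le> n then of_real (real (j+1) * (real n - real j)) else 0) else 0)" for l
    using splus_sq[of "j + 1" n] by (auto simp: splus_eq)
  have "smul n (splus n) (sminus n) j k = (\<Sum>l\<le>n. (if l = j + 1 then (if j = k \<and> j + 1 \<le> n then of_real (real (j+1) * (real n - real j)) else 0) else 0))"
    unfolding smul_def sminus_def * ..
  \<comment> \<open>For j = n the only candidate l = n + 1 lies outside the range, which agrees with
    the factor n - j.\<close>
  also have "\<dots> = (if j = k then of_real (real (j + 1) * (real n - real j)) else 0)"
    using assms by (subst sum.delta) auto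
  finally show ?thesis .
qed

lemma smul_mp:
  assumes "j \<le> n"
  shows "smul n (sminus n) (splus n) j k = (if j = k then of_real (real j * (real n + 1 - real j)) else 0)"
proof -
  \<comment> \<open>For j = 0 the truncated predecessor is 0 itself; the claim stays true because
    the factor \<open>real j\<close> vanishes.\<close>
  have *: "splus n l j * splus n l k = (if l = j - 1 then (if j = k then of_real (real j * (real n + 1 - real j)) else 0) else 0)" for l
    using splus_sq[OF assms] assms by (cases j) (auto simp: splus_eq)
  have "smul n (sminus n) (splus n) j k = (\<Sum>l\<le>n. (if l = j - 1 then (if j = k then of_real (real j * (real n + 1 - real j)) else 0) else 0))"
    unfolding smul_def sminus_def * ..
  also have "\<dots> = (if j = k then of_real (real j * (real n + 1 - real j)) else 0)"
    using assms by (subst sum.delta) auto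
  finally show ?thesis .
qed

lemma smul_spin3_left: "j \<le> n \<Longrightarrow> smul n (spin3 n) t j k = of_real (mval n j) * t j k"
proof -
  assume j: "j \<le> n"
  have "spin3 n j l * t l k = (if l = j then of_real (mval n j) * t j k else 0)" for l
    using j by (auto simp: spin3_def)
  then show ?thesis using j by (simp add: smul_def)
qed

lemma smul_spin3_right: "k \<le> n \<Longrightarrow> smul n t (spin3 n) j k = t j k * of_real (mval n k)"
proof -
  assume k: "k \<le> n"
  have "t j l * spin3 n l k = (if l = k then t j k * of_real (mval n k) else 0)" for l
    using k by (auto simp: spin3_def)
  then show ?thesis using k by (simp add: smul_def)
qed

lemma smul_12: "smul n (spin1 n) (spin2 n) j k =
   (smul n (splus n) (splus n) j k - smul n (splus n) (sminus n) j k + smul n (sminus n) (splus n) j k - smul n (sminus n) (sminus n) j k) / (4 * \<i>)"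
  unfolding smul_def sum_subtractf[symmetric] sum.distrib[symmetric] sum_divide_distrib
  by (intro sum.cong refl) (simp add: spin1_def spin2_def field_simps)

lemma smul_21: "smul n (spin2 n) (spin1 n) j k =
   (smul n (splus n) (splus n) j k + smul n (splus n) (sminus n) j k - smul n (sminus n) (splus n) j k - smul n (sminus n) (sminus n) j k) / (4 * \<i>)"
  unfolding smul_def sum_subtractf[symmetric] sum.distrib[symmetric] sum_divide_distrib
  by (intro sum.cong refl) (simp add: spin1_def spin2_def field_simps)

lemma smul_11_22: "smul n (spin1 n) (spin1 n) j k + smul n (spin2 n) (spin2 n) j k =
   (smul n (splus n) (sminus n) j k + smul n (sminus n) (splus n) j k) / 2"
  unfolding smul_def sum_subtractf[symmetric] sum.distrib[symmetric] sum_divide_distrib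
  by (intro sum.cong refl) (simp add: spin1_def spin2_def field_simps)

lemma comm_12:
  assumes "j \<le> n" "k \<le> n"
  shows "smul n (spin1 n) (spin2 n) j k - smul n (spin2 n) (spin1 n) j k = \<i> * spin3 n j k"
proof -
  have "smul n (spin1 n) (spin2 n) j k - smul n (spin2 n) (spin1 n) j k = \<i> / 2 * (smul n (splus n) (sminus n) j k - smul n (sminus n) (splus n) j k)"
    unfolding smul_12 smul_21 by (simp add: field_simps)
  also have "\<dots> = \<i> * spin3 n j k"
    using assms by (simp add: smul_pm smul_mp spin3_def mval_def field_simps flip: of_real_mult of_real_diff of_real_add) (simp add: field_simps)
  finally show ?thesis .
qed

text \<open>\<open>spin3\<close> is diagonal, so the commutator multiplies the entry at j, k by m_j
  - m_k = k - j, which is 1 or -1 wherever \<open>spin1\<close> does not vanish.\<close>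

lemma comm_31:
  assumes "j \<le> n" "k \<le> n"
  shows "smul n (spin3 n) (spin1 n) j k - smul n (spin1 n) (spin3 n) j k = \<i> * spin2 n j k"
proof -
  have "smul n (spin3 n) (spin1 n) j k - smul n (spin1 n) (spin3 n) j k = of_real (mval n j - mval n k) * spin1 n j k"
    using assms by (simp add: smul_spin3_left smul_spin3_right algebra_simps)
  also have "mval n j - mval n k = real k - real j" by (simp add: mval_def)
  also have "of_real (real k - real j) * spin1 n j k = \<i> * spin2 n j k"
  proof -
    consider "k = j + 1" | "j = k + 1" | "k \<noteq> j + 1" "j \<noteq> k + 1" by blast
    then show ?thesis
    proof cases
      case 1
      then have "splus n k j = 0" by (simp add: splus_eq)
      then show ?thesis using 1 by (simp add: spin1_def spin2_def sminus_def)
    next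
      case 2
      then have "splus n j k = 0" by (simp add: splus_eq)
      then show ?thesis using 2 by (simp add: spin1_def spin2_def sminus_def)
    next
      case 3
      then have "splus n j k = 0" "splus n k j = 0" by (auto simp: splus_eq)
      then show ?thesis by (simp add: spin1_def spin2_def sminus_def)
    qed
  qed
  finally show ?thesis .
qed

lemma casimir:
  assumes "j \<le> n" "k \<le> n"
  shows "smul n (spin1 n) (spin1 n) j k + smul n (spin2 n) (spin2 n) j k + smul n (spin3 n) (spin3 n) j k
    = (if j = k then of_real (real n / 2 * (real n / 2 + 1)) else 0)"
proof -
  have "real (j + 1) * (real n - real j) + real j * (real n + 1 - real j) + 2 * (mval n j * mval n j) = 2 * (real n / 2 * (real n / 2 + 1))"
    by (simp add: mval_def field_simps)
  then have "(complex_of_real (real (j + 1) * (real n - real j)) + complex_of_real (real j * (real n + 1 - real j))) / 2 + complex_of_real (mval n j) * complex_of_real (mval n j)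
     = complex_of_real (real n / 2 * (real n / 2 + 1))"
  proof -
    have arith: "a + b + 2 * c = 2 * d \<Longrightarrow> (a + b) / 2 + c = d" for a b c d :: real by (simp add: field_simps)
    assume "real (j + 1) * (real n - real j) + real j * (real n + 1 - real j) + 2 * (mval n j * mval n j) = 2 * (real n / 2 * (real n / 2 + 1))"
    then have "(real (j + 1) * (real n - real j) + real j * (real n + 1 - real j)) / 2 + mval n j * mval n j = real n / 2 * (real n / 2 + 1)"
      using arith[of "real (j + 1) * (real n - real j)" "real j * (real n + 1 - real j)" "mval n j * mval n j" "real n / 2 * (real n / 2 + 1)"] by blast
    moreover have "(complex_of_real A + of_real B) / 2 + of_real m * of_real m = of_real ((A + B) / 2 + m * m)" for A B m by simp
    ultimately show ?thesis by presburger
  qed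
  then show ?thesis
    unfolding smul_11_22 using assms by (cases "j = k") (simp_all add: smul_pm smul_mp smul_spin3_left spin3_def)
qed

lemma splus_cnj: "cnj (splus n j k) = splus n j k" by (simp add: splus_eq)

lemma spin_herm: "cnj (spin n a j k) = spin n a k j"
  by (auto simp: spin_def spin1_def spin2_def spin3_def sminus_def splus_cnj field_simps)

lemma spin_simps: "spin n 1 = spin1 n" "spin n 2 = spin2 n" "spin n 3 = spin3 n" "spin n (Suc 0) = spin1 n"
  by (simp_all add: spin_def fun_eq_iff)

lemma sum123: "(\<Sum>a\<in>{1,2,3::nat}. f a) = f 1 + f 2 + f 3" for f :: "nat \<Rightarrow> 'b::comm_monoid_add"
  by (simp add: add.assoc)

section \<open>Products of operators at one or two sites\<close>

lemma agree_iff: "(\<forall>z. z \<noteq> x \<longrightarrow> \<sigma> z = \<rho> z) \<longleftrightarrow> \<rho> = \<sigma>(x := \<rho> x)"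
  by (auto simp: fun_eq_iff)

lemma configs_upd: "\<sigma> \<in> configs n G \<Longrightarrow> x \<in> G \<Longrightarrow> l \<le> n \<Longrightarrow> \<sigma>(x := l) \<in> configs n G"
  by (auto simp: configs_def)

lemma configs_le: "\<sigma> \<in> configs n G \<Longrightarrow> \<sigma> x \<le> n"
  by (cases "x \<in> G") (auto simp: configs_def)

lemma sum_agree:
  fixes F :: "config \<Rightarrow> complex"
  assumes "finite G" "\<sigma> \<in> configs n G" "x \<in> G"
  shows "(\<Sum>\<rho>\<in>configs n G. if \<forall>z. z \<noteq> x \<longrightarrow> \<sigma> z = \<rho> z then F \<rho> else 0) = (\<Sum>l\<le>n. F (\<sigma>(x := l)))"
proof -
  have "(\<Sum>\<rho>\<in>configs n G. if \<forall>z. z \<noteq> x \<longrightarrow> \<sigma> z = \<rho> z then F \<rho> else 0) = (\<Sum>\<rho>\<in>(\<lambda>l. \<sigma>(x := l)) ` {..n}. F \<rho>)"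
  proof (rule sum.mono_neutral_cong_right)
    show "finite (configs n G)" by (rule finite_configs[OF assms(1)])
    show "(\<lambda>l. \<sigma>(x := l)) ` {..n} \<subseteq> configs n G" using configs_upd[OF assms(2,3)] by auto
    show "\<forall>\<rho>\<in>configs n G - (\<lambda>l. \<sigma>(x := l)) ` {..n}. (if \<forall>z. z \<noteq> x \<longrightarrow> \<sigma> z = \<rho> z then F \<rho> else 0) = 0"
    proof
      fix \<rho> assume r: "\<rho> \<in> configs n G - (\<lambda>l. \<sigma>(x := l)) ` {..n}"
      then have "\<rho> x \<le> n" using configs_le by blast
      then have "\<rho> \<noteq> \<sigma>(x := \<rho> x)" using r by auto
      then show "(if \<forall>z. z \<noteq> x \<longrightarrow> \<sigma> z = \<rho> z then F \<rho> else 0) = 0" unfolding agree_iff by simp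
    qed
  qed auto
  also have "\<dots> = (\<Sum>l\<le>n. F (\<sigma>(x := l)))"
    by (subst sum.reindex) (auto simp: inj_on_def dest: fun_cong[of _ _ x])
  finally show ?thesis .
qed

lemma opmult_site_left:
  assumes "finite G" "\<sigma> \<in> configs n G" "x \<in> G"
  shows "opmult n G (site_op x s) A \<sigma> \<tau> = (\<Sum>l\<le>n. s (\<sigma> x) l * A (\<sigma>(x := l)) \<tau>)"
proof -
  have "opmult n G (site_op x s) A \<sigma> \<tau> = (\<Sum>\<rho>\<in>configs n G. if \<forall>z. z \<noteq> x \<longrightarrow> \<sigma> z = \<rho> z then s (\<sigma> x) (\<rho> x) * A \<rho> \<tau> else 0)"
    unfolding opmult_def site_op_def by (intro sum.cong) auto
  then show ?thesis using sum_agree[OF assms, of "\<lambda>\<rho>. s (\<sigma> x) (\<rho> x) * A \<rho> \<tau>"] by simp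
qed

lemma opmult_site_right:
  assumes "finite G" "\<tau> \<in> configs n G" "x \<in> G"
  shows "opmult n G A (site_op x s) \<sigma> \<tau> = (\<Sum>l\<le>n. A \<sigma> (\<tau>(x := l)) * s l (\<tau> x))"
proof -
  have "opmult n G A (site_op x s) \<sigma> \<tau> = (\<Sum>\<rho>\<in>configs n G. if \<forall>z. z \<noteq> x \<longrightarrow> \<tau> z = \<rho> z then A \<sigma> \<rho> * s (\<rho> x) (\<tau> x) else 0)"
    unfolding opmult_def site_op_def by (intro sum.cong) auto
  then show ?thesis using sum_agree[OF assms, of "\<lambda>\<rho>. A \<sigma> \<rho> * s (\<rho> x) (\<tau> x)"] by simp
qed

lemma opmult_site_same:
  assumes "finite G" "x \<in> G"
  shows "kernel_eq (configs n G) (opmult n G (site_op x s) (site_op x t)) (site_op x (smul n s t))"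
  unfolding kernel_eq_def
proof (intro ballI)
  fix \<sigma> \<tau> assume "\<sigma> \<in> configs n G"
  then show "opmult n G (site_op x s) (site_op x t) \<sigma> \<tau> = site_op x (smul n s t) \<sigma> \<tau>"
    using assms by (subst opmult_site_left) (auto simp: site_op_def smul_def intro!: sum.neutral)
qed

lemma opmult_site_diff:
  assumes "finite G" "x \<in> G" "x \<noteq> y"
  shows "kernel_eq (configs n G) (opmult n G (site_op x s) (site_op y t)) (pair_op x s y t)"
  unfolding kernel_eq_def
proof (intro ballI)
  fix \<sigma> \<tau> assume s: "\<sigma> \<in> configs n G" "\<tau> \<in> configs n G"
  have "s (\<sigma> x) l * site_op y t (\<sigma>(x := l)) \<tau> = (if l = \<tau> x then pair_op x s y t \<sigma> \<tau> else 0)" for l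
    using assms(3) by (auto simp: site_op_def pair_op_def)
  then show "opmult n G (site_op x s) (site_op y t) \<sigma> \<tau> = pair_op x s y t \<sigma> \<tau>"
    using assms s configs_le[OF s(2)] by (subst opmult_site_left) auto
qed

lemma pair_op_sym: "pair_op x s y t = pair_op y t x s"
  by (auto simp: pair_op_def fun_eq_iff conj_commute mult.commute)

lemma opmult_site_pair:
  assumes "finite G" "x \<in> G" "x \<noteq> y"
  shows "kernel_eq (configs n G) (opmult n G (site_op x s) (pair_op x t y u)) (pair_op x (smul n s t) y u)"
  unfolding kernel_eq_def
proof (intro ballI)
  fix \<sigma> \<tau> assume "\<sigma> \<in> configs n G"
  then show "opmult n G (site_op x s) (pair_op x t y u) \<sigma> \<tau> = pair_op x (smul n s t) y u \<sigma> \<tau>"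
    using assms by (subst opmult_site_left) (auto simp: pair_op_def smul_def sum_distrib_right mult.assoc intro!: sum.neutral)
qed

lemma opmult_pair_site:
  assumes "finite G" "x \<in> G" "x \<noteq> y"
  shows "kernel_eq (configs n G) (opmult n G (pair_op x t y u) (site_op x s)) (pair_op x (smul n t s) y u)"
  unfolding kernel_eq_def
proof (intro ballI)
  fix \<sigma> \<tau> assume \<tau>: "\<tau> \<in> configs n G"
  have *: "pair_op x t y u \<sigma> (\<tau>(x := l)) * s l (\<tau> x) = (if \<forall>z. z \<noteq> x \<and> z \<noteq> y \<longrightarrow> \<sigma> z = \<tau> z then t (\<sigma> x) l * s l (\<tau> x) * u (\<sigma> y) (\<tau> y) else 0)" for l
    using assms(3) by (auto simp: pair_op_def)
  show "opmult n G (pair_op x t y u) (site_op x s) \<sigma> \<tau> = pair_op x (smul n t s) y u \<sigma> \<tau>"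
  proof (cases "\<forall>z. z \<noteq> x \<and> z \<noteq> y \<longrightarrow> \<sigma> z = \<tau> z")
    case True
    show ?thesis
      unfolding opmult_site_right[OF assms(1) \<tau> assms(2)] * unfolding if_P[OF True] pair_op_def smul_def sum_distrib_right ..
  next
    case False
    show ?thesis
      unfolding opmult_site_right[OF assms(1) \<tau> assms(2)] * unfolding if_not_P[OF False] pair_op_def by simp
  qed
qed

lemma site_pair_commute:
  assumes "finite G" "z \<in> G" "z \<noteq> x" "z \<noteq> y"
  shows "kernel_eq (configs n G) (opmult n G (pair_op x t y u) (site_op z s)) (opmult n G (site_op z s) (pair_op x t y u))"
  unfolding kernel_eq_def
proof (intro ballI)
  fix \<sigma> \<tau> assume st: "\<sigma> \<in> configs n G" "\<tau> \<in> configs n G"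
  define c where "c = (if \<forall>w. w \<noteq> x \<and> w \<noteq> y \<and> w \<noteq> z \<longrightarrow> \<sigma> w = \<tau> w then s (\<sigma> z) (\<tau> z) * (t (\<sigma> x) (\<tau> x) * u (\<sigma> y) (\<tau> y)) else 0)"
  have 1: "pair_op x t y u \<sigma> (\<tau>(z := l)) * s l (\<tau> z) = (if l = \<sigma> z then c else 0)" for l
    using assms by (auto simp: pair_op_def c_def)
  have 2: "s (\<sigma> z) l * pair_op x t y u (\<sigma>(z := l)) \<tau> = (if l = \<tau> z then c else 0)" for l
    using assms by (auto simp: pair_op_def c_def)
  show "opmult n G (pair_op x t y u) (site_op z s) \<sigma> \<tau> = opmult n G (site_op z s) (pair_op x t y u) \<sigma> \<tau>"
    unfolding opmult_site_right[OF assms(1) st(2) assms(2)] opmult_site_left[OF assms(1) st(1) assms(2)] 1 2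
    using configs_le[OF st(1), of z] configs_le[OF st(2), of z] by simp
qed

lemma site_commute:
  assumes "finite G" "x \<in> G" "y \<in> G" "x \<noteq> y"
  shows "kernel_eq (configs n G) (opmult n G (site_op x s) (site_op y t)) (opmult n G (site_op y t) (site_op x s))"
  using opmult_site_diff[OF assms(1,2,4), of n s t] opmult_site_diff[OF assms(1,3) assms(4)[symmetric], of n t s]
  unfolding kernel_eq_def pair_op_sym[of x] by simp

lemma opmult_sum_left: "opmult n G (\<lambda>\<sigma> \<tau>. \<Sum>i\<in>I. c i * A i \<sigma> \<tau>) B = (\<lambda>\<sigma> \<tau>. \<Sum>i\<in>I. c i * opmult n G (A i) B \<sigma> \<tau>)"
  unfolding opmult_def sum_distrib_right sum_distrib_left
  by (intro ext, subst sum.swap) (simp only: mult.assoc)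

lemma opmult_sum_right: "opmult n G B (\<lambda>\<sigma> \<tau>. \<Sum>i\<in>I. c i * A i \<sigma> \<tau>) = (\<lambda>\<sigma> \<tau>. \<Sum>i\<in>I. c i * opmult n G B (A i) \<sigma> \<tau>)"
  unfolding opmult_def sum_distrib_right sum_distrib_left
  by (intro ext, subst sum.swap) (simp only: mult.left_commute)

lemma opmult_add: "opmult n G (\<lambda>\<sigma> \<tau>. A \<sigma> \<tau> + B \<sigma> \<tau>) C = (\<lambda>\<sigma> \<tau>. opmult n G A C \<sigma> \<tau> + opmult n G B C \<sigma> \<tau>)"
  "opmult n G C (\<lambda>\<sigma> \<tau>. A \<sigma> \<tau> + B \<sigma> \<tau>) = (\<lambda>\<sigma> \<tau>. opmult n G C A \<sigma> \<tau> + opmult n G C B \<sigma> \<tau>)"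
  by (simp_all add: opmult_def sum.distrib algebra_simps fun_eq_iff)

lemma opmult_scale: "opmult n G (\<lambda>\<sigma> \<tau>. c * A \<sigma> \<tau>) C = (\<lambda>\<sigma> \<tau>. c * opmult n G A C \<sigma> \<tau>)"
  "opmult n G C (\<lambda>\<sigma> \<tau>. c * A \<sigma> \<tau>) = (\<lambda>\<sigma> \<tau>. c * opmult n G C A \<sigma> \<tau>)"
  by (simp_all add: opmult_def sum_distrib_left algebra_simps fun_eq_iff)

lemma opmult_cong: "kernel_eq (configs n G) A A' \<Longrightarrow> kernel_eq (configs n G) B B' \<Longrightarrow> kernel_eq (configs n G) (opmult n G A B) (opmult n G A' B')"
  by (auto simp: kernel_eq_def opmult_def intro!: sum.cong)

lemma opmult_assoc: "opmult n G (opmult n G A B) C = opmult n G A (opmult n G B C)"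
proof (intro ext)
  fix \<sigma> \<tau>
  show "opmult n G (opmult n G A B) C \<sigma> \<tau> = opmult n G A (opmult n G B C) \<sigma> \<tau>"
    unfolding opmult_def sum_distrib_left sum_distrib_right by (subst sum.swap) (simp only: mult.assoc)
qed

lemma kernel_eq_sym: "kernel_eq X A B \<Longrightarrow> kernel_eq X B A" by (simp add: kernel_eq_def)
lemma kernel_eq_trans: "kernel_eq X A B \<Longrightarrow> kernel_eq X B C \<Longrightarrow> kernel_eq X A C" by (simp add: kernel_eq_def)
lemma kernel_eq_refl: "kernel_eq X A A" by (simp add: kernel_eq_def)

text \<open>The conditions of \<open>is_state\<close> for one region, without consistency between
  regions. Restrictions of infinite-volume states, ground states of the torus and states altered in
  a block can then be treated alike.\<close>

definition local_state :: "nat \<Rightarrow> site set \<Rightarrow> (obs \<Rightarrow> complex) \<Rightarrow> bool" where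
  "local_state n G \<phi> \<longleftrightarrow>
     (\<forall>A B. kernel_eq (configs n G) A B \<longrightarrow> \<phi> A = \<phi> B) \<and>
     (\<forall>A B. \<phi> (\<lambda>\<sigma> \<tau>. A \<sigma> \<tau> + B \<sigma> \<tau>) = \<phi> A + \<phi> B) \<and>
     (\<forall>c A. \<phi> (\<lambda>\<sigma> \<tau>. c * A \<sigma> \<tau>) = c * \<phi> A) \<and>
     (\<forall>A. Im (\<phi> (opmult n G (opadj A) A)) = 0 \<and> Re (\<phi> (opmult n G (opadj A) A)) \<ge> 0) \<and>
     \<phi> opid = 1"

lemma local_stateD:
  assumes "local_state n G \<phi>"
  shows "kernel_eq (configs n G) A B \<Longrightarrow> \<phi> A = \<phi> B"
    "\<phi> (\<lambda>\<sigma> \<tau>. A \<sigma> \<tau> + B \<sigma> \<tau>) = \<phi> A + \<phi> B"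
    "\<phi> (\<lambda>\<sigma> \<tau>. c * A \<sigma> \<tau>) = c * \<phi> A"
    "Im (\<phi> (opmult n G (opadj A) A)) = 0" "Re (\<phi> (opmult n G (opadj A) A)) \<ge> 0"
    "\<phi> opid = 1"
  using assms unfolding local_state_def by auto

lemma local_state_sum:
  assumes "local_state n G \<phi>" "finite I"
  shows "\<phi> (\<lambda>\<sigma> \<tau>. \<Sum>i\<in>I. A i \<sigma> \<tau>) = (\<Sum>i\<in>I. \<phi> (A i))"
  using assms(2)
proof (induction I)
  case empty
  have "\<phi> (\<lambda>\<sigma> \<tau>. 0 * opid \<sigma> \<tau>) = 0" by (subst local_stateD(3)[OF assms(1)]) simp
  then show ?case by simp
next
  case (insert i I)
  then show ?case using local_stateD(2)[OF assms(1), of "A i" "\<lambda>\<sigma> \<tau>. \<Sum>i\<in>I. A i \<sigma> \<tau>"] by simp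
qed

lemma local_state_lincomb:
  assumes "local_state n G \<phi>" "finite I"
  shows "\<phi> (\<lambda>\<sigma> \<tau>. \<Sum>i\<in>I. c i * A i \<sigma> \<tau>) = (\<Sum>i\<in>I. c i * \<phi> (A i))"
  using local_state_sum[OF assms, of "\<lambda>i \<sigma> \<tau>. c i * A i \<sigma> \<tau>"] by (simp add: local_stateD(3)[OF assms(1)])

lemma local_state_diff:
  assumes "local_state n G \<phi>"
  shows "\<phi> (\<lambda>\<sigma> \<tau>. A \<sigma> \<tau> - B \<sigma> \<tau>) = \<phi> A - \<phi> B"
  using local_stateD(2)[OF assms, of A "\<lambda>\<sigma> \<tau>. (-1) * B \<sigma> \<tau>"] local_stateD(3)[OF assms, of "-1" B] by simp

lemma local_state_state:
  assumes "is_state n d \<omega>" "finite G" "G \<subseteq> lattice d"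
  shows "local_state n G (\<omega> G)"
  using assms(1)[unfolded is_state_def, THEN spec[of _ G], THEN mp, OF conjI[OF assms(2,3)]]
  unfolding local_state_def kernel_eq_def by - (elim conjE, intro conjI; assumption)

lemma opadj_site: "opadj (site_op x (spin n a)) = site_op x (spin n a)"
  by (auto simp: opadj_def site_op_def fun_eq_iff spin_herm)

lemma site_sq:
  assumes p: "local_state n G \<phi>" and G: "finite G" "x \<in> G"
  shows "Re (\<phi> (site_op x (smul n (spin n a) (spin n a)))) \<ge> 0"
  using local_stateD(5)[OF p, of "site_op x (spin n a)"]
  unfolding opadj_site local_stateD(1)[OF p opmult_site_same[OF G]] .

text \<open>S(S + 1) with n = 2S, the value of the squared spin at a site. It bounds the
  expectations of all local terms below.\<close>

definition cas :: "nat \<Rightarrow> real" where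
  "cas n = real n / 2 * (real n / 2 + 1)"

lemma site_casimir:
  assumes p: "local_state n G \<phi>" and G: "finite G" "x \<in> G"
  shows "(\<Sum>a\<in>{1,2,3}. \<phi> (site_op x (smul n (spin n a) (spin n a)))) = of_real (cas n)"
proof -
  have "kernel_eq (configs n G) (\<lambda>\<sigma> \<tau>. \<Sum>a\<in>{1,2,3}. site_op x (smul n (spin n a) (spin n a)) \<sigma> \<tau>) (\<lambda>\<sigma> \<tau>. of_real (cas n) * opid \<sigma> \<tau>)"
    unfolding kernel_eq_def
  proof (intro ballI)
    fix \<sigma> \<tau> assume st: "\<sigma> \<in> configs n G" "\<tau> \<in> configs n G"
    show "(\<Sum>a\<in>{1,2,3}. site_op x (smul n (spin n a) (spin n a)) \<sigma> \<tau>) = of_real (cas n) * opid \<sigma> \<tau>"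
    proof (cases "\<forall>z. z \<noteq> x \<longrightarrow> \<sigma> z = \<tau> z")
      case True
      then have "\<sigma> = \<tau> \<longleftrightarrow> \<sigma> x = \<tau> x" by (auto simp: fun_eq_iff)
      moreover have "site_op x s \<sigma> \<tau> = s (\<sigma> x) (\<tau> x)" for s unfolding site_op_def using True by (rule if_P)
      ultimately show ?thesis
        unfolding sum123 opid_def spin_simps cas_def
        using casimir[OF configs_le[OF st(1), of x] configs_le[OF st(2), of x]] by simp
    next
      case False
      then have "\<sigma> \<noteq> \<tau>" by auto
      moreover have "site_op x s \<sigma> \<tau> = 0" for s using False by (simp only: site_op_def if_False)
      ultimately show ?thesis by (simp add: opid_def)
    qed
  qed
  from local_stateD(1)[OF p this] show ?thesis
    by (subst (asm) local_state_sum[OF p]) (simp_all add: local_stateD(3,6)[OF p])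
qed

text \<open>The three squares have non-negative expectations, and their sum is fixed by the Casimir
  identity.\<close>

lemma site_sq_le:
  assumes p: "local_state n G \<phi>" and G: "finite G" "x \<in> G" and a: "a \<in> {1,2,3}"
  shows "Re (\<phi> (site_op x (smul n (spin n a) (spin n a)))) \<le> cas n"
proof -
  have "Re (\<phi> (site_op x (smul n (spin n a) (spin n a)))) \<le> (\<Sum>a\<in>{1,2,3}. Re (\<phi> (site_op x (smul n (spin n a) (spin n a)))))"
    using a by (intro member_le_sum) (auto intro: site_sq[OF p G])
  also have "\<dots> = cas n" using arg_cong[OF site_casimir[OF p G], of Re] by (simp only: Re_sum Re_complex_of_real)
  finally show ?thesis .
qed

text \<open>Positivity for the square of S_x + \<epsilon> S_y with both signs of \<epsilon>;
  operators at distinct sites commute, so both cross terms are the pair operator.\<close>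

lemma pair_bound:
  assumes p: "local_state n G \<phi>" and G: "finite G" "x \<in> G" "y \<in> G" "x \<noteq> y" and a: "a \<in> {1,2,3}"
  shows "\<bar>Re (\<phi> (pair_op x (spin n a) y (spin n a)))\<bar> \<le> cas n"
proof -
  let ?s = "spin n a"
  have *: "0 \<le> Re (\<phi> (site_op x (smul n ?s ?s))) + Re (\<phi> (site_op y (smul n ?s ?s))) + 2 * \<epsilon> * Re (\<phi> (pair_op x ?s y ?s))"
    if \<epsilon>: "\<epsilon> * \<epsilon> = 1" for \<epsilon> :: real
  proof -
    define A where "A = (\<lambda>\<sigma> \<tau>. site_op x ?s \<sigma> \<tau> + of_real \<epsilon> * site_op y ?s \<sigma> \<tau>)"
    have adj: "opadj A = A"
    proof -
      have "cnj (site_op z ?s \<tau> \<sigma>) = site_op z ?s \<sigma> \<tau>" for z \<sigma> \<tau>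
        using opadj_site[of z n a] unfolding opadj_def fun_eq_iff by blast
      then show ?thesis by (simp add: A_def opadj_def)
    qed
    have e2: "complex_of_real \<epsilon> * complex_of_real \<epsilon> = 1" by (metis \<epsilon> of_real_1 of_real_mult)
    have "kernel_eq (configs n G) (opmult n G A A) (\<lambda>\<sigma> \<tau>. (site_op x (smul n ?s ?s) \<sigma> \<tau> + site_op y (smul n ?s ?s) \<sigma> \<tau>) + of_real (2 * \<epsilon>) * pair_op x ?s y ?s \<sigma> \<tau>)"
      unfolding kernel_eq_def
    proof (intro ballI)
      fix \<sigma> \<tau> assume st: "\<sigma> \<in> configs n G" "\<tau> \<in> configs n G"
      have k: "opmult n G (site_op x ?s) (site_op x ?s) \<sigma> \<tau> = site_op x (smul n ?s ?s) \<sigma> \<tau>"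
        "opmult n G (site_op y ?s) (site_op y ?s) \<sigma> \<tau> = site_op y (smul n ?s ?s) \<sigma> \<tau>"
        "opmult n G (site_op x ?s) (site_op y ?s) \<sigma> \<tau> = pair_op x ?s y ?s \<sigma> \<tau>"
        "opmult n G (site_op y ?s) (site_op x ?s) \<sigma> \<tau> = pair_op x ?s y ?s \<sigma> \<tau>"
        using opmult_site_same[OF G(1,2), of n ?s ?s] opmult_site_same[OF G(1,3), of n ?s ?s]
          opmult_site_diff[OF G(1,2,4), of n ?s ?s] opmult_site_diff[OF G(1,3) G(4)[symmetric], of n ?s ?s] st
        unfolding kernel_eq_def pair_op_sym[of y] by blast+
      have "opmult n G A A \<sigma> \<tau> = (site_op x (smul n ?s ?s) \<sigma> \<tau> + of_real \<epsilon> * pair_op x ?s y ?s \<sigma> \<tau>) + of_real \<epsilon> * (pair_op x ?s y ?s \<sigma> \<tau> + of_real \<epsilon> * site_op y (smul n ?s ?s) \<sigma> \<tau>)"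
        unfolding A_def opmult_add opmult_scale k by (simp only: algebra_simps)
      then show "opmult n G A A \<sigma> \<tau> = (site_op x (smul n ?s ?s) \<sigma> \<tau> + site_op y (smul n ?s ?s) \<sigma> \<tau>) + of_real (2 * \<epsilon>) * pair_op x ?s y ?s \<sigma> \<tau>"
        unfolding of_real_mult of_real_numeral using e2 by algebra
    qed
    from local_stateD(1)[OF p this] local_stateD(5)[OF p, of A] show ?thesis
      unfolding adj by (simp add: local_stateD(2,3)[OF p])
  qed
  show ?thesis
    using *[of 1] *[of "-1"] site_sq_le[OF p G(1,2) a] site_sq_le[OF p G(1,3) a] by (simp add: abs_le_iff)
qed

text \<open>As for pairs, now with the square of 1 + \<epsilon> S_x. A factor 1/2 is given
  away.\<close>

lemma site_bound:
  assumes p: "local_state n G \<phi>" and G: "finite G" "x \<in> G" and a: "a \<in> {1,2,3}"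
  shows "\<bar>Re (\<phi> (site_op x (spin n a)))\<bar> \<le> cas n + 1"
proof -
  let ?s = "spin n a"
  have *: "0 \<le> Re (\<phi> (site_op x (smul n ?s ?s))) + 1 + 2 * \<epsilon> * Re (\<phi> (site_op x ?s))"
    if \<epsilon>: "\<epsilon> * \<epsilon> = 1" for \<epsilon> :: real
  proof -
    define A where "A = (\<lambda>\<sigma> \<tau>. opid \<sigma> \<tau> + of_real \<epsilon> * site_op x ?s \<sigma> \<tau>)"
    have adj: "opadj A = A"
    proof -
      have "cnj (site_op z ?s \<tau> \<sigma>) = site_op z ?s \<sigma> \<tau>" for z \<sigma> \<tau>
        using opadj_site[of z n a] unfolding opadj_def fun_eq_iff by blast
      moreover have "cnj (opid \<tau> \<sigma>) = opid \<sigma> \<tau>" for \<sigma> \<tau> by (simp add: opid_def)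
      ultimately show ?thesis by (simp add: A_def opadj_def)
    qed
    have id: "kernel_eq (configs n G) (opmult n G opid B) B" "kernel_eq (configs n G) (opmult n G B opid) B" for B
      using finite_configs[OF G(1), of n]
      by (auto simp: kernel_eq_def opmult_def opid_def if_distrib[of "\<lambda>z. z * _"] if_distrib[of "\<lambda>z. _ * z"] cong: if_cong)
    have e2: "complex_of_real \<epsilon> * complex_of_real \<epsilon> = 1" by (metis \<epsilon> of_real_1 of_real_mult)
    have "kernel_eq (configs n G) (opmult n G A A) (\<lambda>\<sigma> \<tau>. (site_op x (smul n ?s ?s) \<sigma> \<tau> + opid \<sigma> \<tau>) + of_real (2 * \<epsilon>) * site_op x ?s \<sigma> \<tau>)"
      unfolding kernel_eq_def
    proof (intro ballI)
      fix \<sigma> \<tau> assume st: "\<sigma> \<in> configs n G" "\<tau> \<in> configs n G"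
      have k: "opmult n G (site_op x ?s) (site_op x ?s) \<sigma> \<tau> = site_op x (smul n ?s ?s) \<sigma> \<tau>"
        "opmult n G opid opid \<sigma> \<tau> = opid \<sigma> \<tau>"
        "opmult n G (site_op x ?s) opid \<sigma> \<tau> = site_op x ?s \<sigma> \<tau>"
        "opmult n G opid (site_op x ?s) \<sigma> \<tau> = site_op x ?s \<sigma> \<tau>"
        using opmult_site_same[OF G(1,2), of n ?s ?s] id(1)[of opid] id[of "site_op x ?s"] st
        unfolding kernel_eq_def by blast+
      have "opmult n G A A \<sigma> \<tau> = (opid \<sigma> \<tau> + of_real \<epsilon> * site_op x ?s \<sigma> \<tau>) + of_real \<epsilon> * (site_op x ?s \<sigma> \<tau> + of_real \<epsilon> * site_op x (smul n ?s ?s) \<sigma> \<tau>)"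
        unfolding A_def opmult_add opmult_scale k by (simp only: algebra_simps)
      then show "opmult n G A A \<sigma> \<tau> = (site_op x (smul n ?s ?s) \<sigma> \<tau> + opid \<sigma> \<tau>) + of_real (2 * \<epsilon>) * site_op x ?s \<sigma> \<tau>"
        unfolding of_real_mult of_real_numeral using e2 by algebra
    qed
    from local_stateD(1)[OF p this] local_stateD(5)[OF p, of A] show ?thesis
      unfolding adj by (simp add: local_stateD(2,3,6)[OF p])
  qed
  show ?thesis
    using *[of 1] *[of "-1"] site_sq_le[OF p G a] by (simp add: abs_le_iff)
qed

text \<open>Robertson's inequality: positivity at A + i t C for every real t, followed by the
  discriminant.\<close>

lemma uncertainty:
  assumes p: "local_state n G \<phi>" and adj: "opadj A = A" "opadj C = C"
  shows "(Im (\<phi> (opcomm n G A C)))\<^sup>2 \<le> 4 * Re (\<phi> (opmult n G A A)) * Re (\<phi> (opmult n G C C))"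
proof -
  have "0 \<le> Re (\<phi> (opmult n G A A)) + (- Im (\<phi> (opcomm n G A C))) * t + Re (\<phi> (opmult n G C C)) * t\<^sup>2" for t
  proof -
    define D where "D = (\<lambda>\<sigma> \<tau>. A \<sigma> \<tau> + (\<i> * of_real t) * C \<sigma> \<tau>)"
    have "cnj (A \<tau> \<sigma>) = A \<sigma> \<tau>" "cnj (C \<tau> \<sigma>) = C \<sigma> \<tau>" for \<sigma> \<tau>
      using adj unfolding opadj_def fun_eq_iff by blast+
    then have Dadj: "opadj D = (\<lambda>\<sigma> \<tau>. A \<sigma> \<tau> + (- (\<i> * of_real t)) * C \<sigma> \<tau>)"
      by (simp add: D_def opadj_def)
    have "opmult n G (opadj D) D = (\<lambda>\<sigma> \<tau>. (opmult n G A A \<sigma> \<tau> + (\<i> * of_real t) * opcomm n G A C \<sigma> \<tau>) + of_real (t\<^sup>2) * opmult n G C C \<sigma> \<tau>)"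
      unfolding Dadj unfolding D_def opmult_add opmult_scale opcomm_def by (simp add: algebra_simps power2_eq_square fun_eq_iff)
    with local_stateD(5)[OF p, of D] show ?thesis by (simp add: local_stateD(2,3)[OF p] mult.commute)
  qed
  from nonneg_quadratic_discriminant[OF this] show ?thesis by simp
qed

section \<open>Gaussian domination\<close>

text \<open>On a bipartite lattice \<open>v x + v y\<close> is, up to sign, the difference of
  \<open>stag z * v z\<close> along the bond. It takes the place of the gradient of a ferromagnetic
  field, and alternating fields cost nothing.\<close>

definition bond :: "nat \<Rightarrow> (site \<Rightarrow> real) \<Rightarrow> site \<Rightarrow> site \<Rightarrow> obs" where
  "bond n v x y = (\<lambda>\<sigma> \<tau>. (\<Sum>a\<in>{1,2,3}. pair_op x (spin n a) y (spin n a) \<sigma> \<tau>)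
     + of_real (v x + v y) * (site_op x (spin n 1) \<sigma> \<tau> + site_op y (spin n 1) \<sigma> \<tau>)
     + of_real ((v x + v y)\<^sup>2 / 2) * opid \<sigma> \<tau>)"

text \<open>The Hamiltonian whose bond term is the completed square
  \<open>1/2 (S\<^sub>x + S\<^sub>y + (v x + v y) e\<^sub>1)\<^sup>2\<close> up to a multiple of the identity.\<close>
definition Hfield :: "nat \<Rightarrow> site set \<Rightarrow> (site \<Rightarrow> site \<Rightarrow> bool) \<Rightarrow> real \<Rightarrow> (site \<Rightarrow> real) \<Rightarrow> obs" where
  "Hfield n V nb B v = (\<lambda>\<sigma> \<tau>. 1/2 * (\<Sum>x\<in>V. \<Sum>y\<in>{y\<in>V. nb x y}. bond n v x y \<sigma> \<tau>)
     - of_real B * (\<Sum>x\<in>V. stag x * site_op x (spin n 3) \<sigma> \<tau>))"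

text \<open>\<open>W\<close> is one half of the lattice and \<theta> the mirror. Only mirror images
  are joined across the cut, so each coupling between the halves is a product of an operator and its
  image. The sign change of \<open>stag\<close> compensates the sign that the rotation gives to the
  third spin component.\<close>

definition reflection :: "site set \<Rightarrow> (site \<Rightarrow> site \<Rightarrow> bool) \<Rightarrow> (site \<Rightarrow> site) \<Rightarrow> site set \<Rightarrow> bool" where
  "reflection V nb \<theta> W \<longleftrightarrow> W \<subseteq> V \<and> (\<forall>x\<in>V. \<theta> x \<in> V \<and> \<theta> (\<theta> x) = x \<and> (\<theta> x \<in> W \<longleftrightarrow> x \<notin> W) \<and> stag (\<theta> x) = - stag x)
     \<and> (\<forall>x\<in>V. \<forall>y\<in>V. nb (\<theta> x) (\<theta> y) \<longleftrightarrow> nb x y)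
     \<and> (\<forall>x\<in>W. \<forall>y\<in>V - W. nb x y \<longrightarrow> y = \<theta> x)"

lemma bond_sym: "bond n v x y = bond n v y x"
  by (simp add: bond_def pair_op_sym[of x] add.commute)

lemma bond_herm: "bond n v x y \<sigma> \<tau> = cnj (bond n v x y \<tau> \<sigma>)"
proof -
  have "cnj (pair_op x (spin n a) y (spin n a) \<tau> \<sigma>) = pair_op x (spin n a) y (spin n a) \<sigma> \<tau>" for a
    by (auto simp: pair_op_def spin_herm)
  moreover have "cnj (site_op x (spin n a) \<tau> \<sigma>) = site_op x (spin n a) \<sigma> \<tau>" for a x
    by (auto simp: site_op_def spin_herm)
  moreover have "cnj (opid \<tau> \<sigma>) = opid \<sigma> \<tau>" by (simp add: opid_def)
  ultimately show ?thesis by (simp add: bond_def)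
qed

lemma stag_cases: "stag x = 1 \<or> stag x = -1"
  by (simp add: stag_def)

lemma Hfield_herm: "herm_on X (Hfield n V nb B v)"
proof -
  have "cnj (site_op x (spin n a) \<tau> \<sigma>) = site_op x (spin n a) \<sigma> \<tau>" for a x \<sigma> \<tau>
    by (auto simp: site_op_def spin_herm)
  moreover have "cnj (stag x) = stag x" for x using stag_cases[of x] by auto
  ultimately show ?thesis
    by (simp add: herm_on_def Hfield_def bond_herm[symmetric])
qed

text \<open>Rotation by \<open>\<pi>\<close> about the second axis, composed with the identification of the two halves.\<close>
definition srot :: "nat \<Rightarrow> (nat \<Rightarrow> nat \<Rightarrow> complex) \<Rightarrow> nat \<Rightarrow> nat \<Rightarrow> complex" where
  "srot n s j k = (-1) ^ (j + k) * s (n - j) (n - k)"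

lemma splus_flip: "j \<le> n \<Longrightarrow> k \<le> n \<Longrightarrow> splus n (n - j) (n - k) = splus n k j"
  by (auto simp: splus_eq of_nat_diff algebra_simps)

text \<open>Exchanging m and -m without phases is the rotation by \<pi> about the first
  axis.\<close>

lemma spin_flip:
  assumes "j \<le> n" "k \<le> n"
  shows "spin n a (n - j) (n - k) = (if a = 1 then 1 else -1) * spin n a j k"
proof -
  have "spin3 n (n - j) (n - k) = - spin3 n j k"
    using assms by (auto simp: spin3_def mval_def of_nat_diff)
  then show ?thesis using assms
    by (simp add: spin_def spin1_def spin2_def sminus_def splus_flip) (simp add: field_simps)
qed

text \<open>The factor (-1)^(j + k) is -1 on the entries of \<open>spin1\<close> and
  \<open>spin2\<close>, which change m by one, and 1 on the diagonal \<open>spin3\<close>. Together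
  with the flip, the second component is the one that is kept.\<close>

lemma srot_spin:
  assumes "j \<le> n" "k \<le> n" "a \<in> {1,2,3}"
  shows "srot n (spin n a) j k = (if a = 2 then 1 else -1) * spin n a j k"
proof (cases "a = 3")
  case True
  then have "srot n (spin n a) j k = (-1) ^ (j + k) * (- spin n a j k)"
    using assms by (simp add: srot_def spin_flip)
  moreover have "spin n a j k = 0 \<or> j = k" using True by (simp add: spin_simps spin3_def)
  ultimately show ?thesis using True by (auto simp flip: mult_2)
next
  case False
  have "spin n a j k = 0 \<or> odd (j + k)"
  proof (cases "even (j + k)")
    case True
    then have "j + 1 \<noteq> k" "k + 1 \<noteq> j" by presburger+
    then show ?thesis
      using assms(3) False by (auto simp: spin_simps spin1_def spin2_def sminus_def splus_eq)
  qed simp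
  then show ?thesis using assms False by (auto simp: srot_def spin_flip)
qed

locale reflected =
  fixes n :: nat and V W :: "site set" and nb :: "site \<Rightarrow> site \<Rightarrow> bool" and \<theta> :: "site \<Rightarrow> site"
  assumes finV: "finite V" and is_refl: "reflection V nb \<theta> W"
    and nb_sym: "\<And>x y. x \<in> V \<Longrightarrow> y \<in> V \<Longrightarrow> nb x y \<Longrightarrow> nb y x"
    and nb_irr: "\<And>x. x \<in> V \<Longrightarrow> \<not> nb x x"
begin

lemma WV: "x \<in> W \<Longrightarrow> x \<in> V" using is_refl unfolding reflection_def by blast
lemma finW: "finite W" using finV WV by (meson finite_subset subsetI)
lemma \<theta>V: "x \<in> V \<Longrightarrow> \<theta> x \<in> V" "x \<in> V \<Longrightarrow> \<theta> (\<theta> x) = x" "x \<in> V \<Longrightarrow> \<theta> x \<in> W \<longleftrightarrow> x \<notin> W" "x \<in> V \<Longrightarrow> stag (\<theta> x) = - stag x"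
  using is_refl unfolding reflection_def by blast+
lemma \<theta>nb: "x \<in> V \<Longrightarrow> y \<in> V \<Longrightarrow> nb (\<theta> x) (\<theta> y) \<longleftrightarrow> nb x y" using is_refl unfolding reflection_def by blast
lemma \<theta>cross: "x \<in> W \<Longrightarrow> y \<in> V \<Longrightarrow> y \<notin> W \<Longrightarrow> nb x y \<Longrightarrow> y = \<theta> x" using is_refl unfolding reflection_def by blast
lemma \<theta>W: "x \<in> W \<Longrightarrow> \<theta> x \<in> V" "x \<in> W \<Longrightarrow> \<theta> x \<notin> W" "x \<in> W \<Longrightarrow> \<theta> (\<theta> x) = x"
  using \<theta>V WV by blast+

lemma split_V: "V = W \<union> \<theta> ` W" "W \<inter> \<theta> ` W = {}" "inj_on \<theta> W"
proof -
  show "V = W \<union> \<theta> ` W" using \<theta>V WV by (auto simp: image_iff) metis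
  show "W \<inter> \<theta> ` W = {}" using \<theta>W by auto
  show "inj_on \<theta> W" by (metis \<theta>W(3) inj_onI)
qed

lemma sum_V: "(\<Sum>x\<in>V. f x) = (\<Sum>x\<in>W. f x + f (\<theta> x))" for f :: "site \<Rightarrow> 'b::comm_monoid_add"
  using split_V finW by (subst split_V(1), subst sum.union_disjoint) (auto simp: sum.reindex sum.distrib)

text \<open>Configurations of \<open>V\<close> correspond to pairs of configurations of \<open>W\<close>: the second half is read through
  the reflection and the rotation by \<open>\<pi>\<close> about the second axis, whose phase on the basis is \<open>sg\<close> below.\<close>
definition join :: "config \<Rightarrow> config \<Rightarrow> config" where
  "join a b = (\<lambda>x. if x \<in> W then a x else if x \<in> V then n - b (\<theta> x) else 0)"

abbreviation X where "X \<equiv> configs n W"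

lemma join_in: "a \<in> X \<Longrightarrow> b \<in> X \<Longrightarrow> join a b \<in> configs n V"
  using WV by (auto simp: join_def configs_def)

lemma join_val: "x \<in> W \<Longrightarrow> join a b x = a x" "x \<in> W \<Longrightarrow> join a b (\<theta> x) = n - b x"
  using \<theta>W by (auto simp: join_def)

lemma bij_join: "bij_betw (\<lambda>p. join (fst p) (snd p)) (X \<times> X) (configs n V)"
proof (rule bij_betwI[of _ _ _ "\<lambda>\<sigma>. (restr \<sigma> W, \<lambda>x. if x \<in> W then n - \<sigma> (\<theta> x) else 0)"])
  show "(\<lambda>p. join (fst p) (snd p)) \<in> X \<times> X \<rightarrow> configs n V" using join_in by auto
  show "(\<lambda>\<sigma>. (restr \<sigma> W, \<lambda>x. if x \<in> W then n - \<sigma> (\<theta> x) else 0)) \<in> configs n V \<rightarrow> X \<times> X"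
    using WV by (auto simp: configs_def restr_def)
  fix p assume "p \<in> X \<times> X"
  then obtain a b where p: "p = (a, b)" "a \<in> X" "b \<in> X" by auto
  have "a x = 0" "b x = 0" if "x \<notin> W" for x using p that by (auto simp: configs_def)
  moreover have "b x \<le> n" for x using p configs_le by blast
  ultimately show "(restr (join (fst p) (snd p)) W, \<lambda>x. if x \<in> W then n - join (fst p) (snd p) (\<theta> x) else 0) = p"
    by (auto simp: p restr_def fun_eq_iff join_val)
next
  fix \<sigma> assume s: "\<sigma> \<in> configs n V"
  then have "\<sigma> x \<le> n" "x \<notin> V \<Longrightarrow> \<sigma> x = 0" for x using configs_le by (blast, simp add: configs_def)
  then show "join (fst (restr \<sigma> W, \<lambda>x. if x \<in> W then n - \<sigma> (\<theta> x) else 0)) (snd (restr \<sigma> W, \<lambda>x. if x \<in> W then n - \<sigma> (\<theta> x) else 0)) = \<sigma>"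
    using \<theta>V by (auto simp: join_def restr_def fun_eq_iff)
qed

text \<open>The supports of all local operators are translated through this equivalence. The
  truncated subtraction in \<open>join\<close> loses nothing because the values do not exceed
  n.\<close>

lemma join_agree:
  assumes "a \<in> X" "b \<in> X" "a' \<in> X" "b' \<in> X" "S \<subseteq> W" "T \<subseteq> W"
  shows "(\<forall>z. z \<notin> S \<union> \<theta> ` T \<longrightarrow> join a b z = join a' b' z) \<longleftrightarrow> (\<forall>z. z \<notin> S \<longrightarrow> a z = a' z) \<and> (\<forall>z. z \<notin> T \<longrightarrow> b z = b' z)"
    (is "?L \<longleftrightarrow> ?R")
proof
  assume L: ?L
  have "a z = a' z" if "z \<notin> S" for z
  proof (cases "z \<in> W")
    case True
    then have "z \<notin> S \<union> \<theta> ` T" using that assms(6) \<theta>W(2) by auto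
    then show ?thesis using L True join_val(1) by metis
  qed (use assms in \<open>auto simp: configs_def\<close>)
  moreover have "b z = b' z" if "z \<notin> T" for z
  proof (cases "z \<in> W")
    case True
    have "\<theta> z \<notin> S" using True assms(5) \<theta>W(2) by auto
    moreover have "\<theta> z \<notin> \<theta> ` T" using that True assms(6) split_V(3) by (auto simp: inj_on_def)
    ultimately have "n - b z = n - b' z" using L True join_val(2) by (metis Un_iff)
    then show ?thesis using configs_le[OF assms(2), of z] configs_le[OF assms(4), of z] by linarith
  qed (use assms in \<open>auto simp: configs_def\<close>)
  ultimately show ?R by blast
next
  assume R: ?R
  show ?L
  proof (intro allI impI)
    fix z assume z: "z \<notin> S \<union> \<theta> ` T"
    consider "z \<in> W" | w where "w \<in> W" "z = \<theta> w" | "z \<notin> V" using split_V(1) by blast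
    then show "join a b z = join a' b' z"
    proof cases
      case 1 then show ?thesis using R z by (simp add: join_val)
    next
      case 2 then show ?thesis using R z by (auto simp: join_val)
    next
      case 3 then show ?thesis using WV by (auto simp: join_def)
    qed
  qed
qed

definition sg :: "config \<Rightarrow> complex" where
  "sg b = (\<Prod>x\<in>W. (-1) ^ b x)"

text \<open>The phases cancel wherever the configurations agree. What remains on the support of a
  local operator is the factor in \<open>srot\<close>.\<close>

lemma sg_agree:
  assumes "T \<subseteq> W" "\<forall>z. z \<notin> T \<longrightarrow> b z = b' z"
  shows "sg b * sg b' = (\<Prod>x\<in>T. (-1) ^ (b x + b' x))"
proof -
  have "sg b * sg b' = (\<Prod>x\<in>W. (-1) ^ (b x + b' x))"
    by (simp add: sg_def prod.distrib power_add)
  also have "\<dots> = (\<Prod>x\<in>T. (-1) ^ (b x + b' x))"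
    using assms finW by (intro prod.mono_neutral_right) (auto simp flip: mult_2)
  finally show ?thesis .
qed

lemma sg_sq: "sg b * sg b = 1" using sg_agree[of "{}" b b] by simp

definition tr :: "obs \<Rightarrow> config \<times> config \<Rightarrow> config \<times> config \<Rightarrow> complex" where
  "tr K p q = sg (snd p) * sg (snd q) * K (join (fst p) (snd p)) (join (fst q) (snd q))"

lemma cnj_sg: "cnj (sg b) = sg b" by (simp add: sg_def)

text \<open>The passage to pairs of configurations is unitary: a bijection of basis vectors combined
  with signs.\<close>

lemma cinn_tr:
  "cinn (X \<times> X) (\<lambda>p. sg (snd p) * \<psi> (join (fst p) (snd p))) (kapply (X \<times> X) (tr K) (\<lambda>p. sg (snd p) * \<psi> (join (fst p) (snd p))))
    = cinn (configs n V) \<psi> (kapply (configs n V) K \<psi>)"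
  "cinn (X \<times> X) (\<lambda>p. sg (snd p) * \<psi> (join (fst p) (snd p))) (\<lambda>p. sg (snd p) * \<psi> (join (fst p) (snd p))) = cinn (configs n V) \<psi> \<psi>"
proof -
  have s2: "a * sg b * k * (sg b * z) = a * (k * z)" for a b k z using sg_sq[of b] by algebra
  have s3: "sg b * y * (sg b * z) = y * z" for b y z using sg_sq[of b] by algebra
  have c: "kapply (X \<times> X) (tr K) (\<lambda>p. sg (snd p) * \<psi> (join (fst p) (snd p))) p = sg (snd p) * kapply (configs n V) K \<psi> (join (fst p) (snd p))" for p
  proof -
    have "kapply (X \<times> X) (tr K) (\<lambda>p. sg (snd p) * \<psi> (join (fst p) (snd p))) p = sg (snd p) * (\<Sum>q\<in>X \<times> X. K (join (fst p) (snd p)) (join (fst q) (snd q)) * \<psi> (join (fst q) (snd q)))"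
      unfolding kapply_def tr_def sum_distrib_left by (rule sum.cong[OF refl], rule s2)
    also have "(\<Sum>q\<in>X \<times> X. K (join (fst p) (snd p)) (join (fst q) (snd q)) * \<psi> (join (fst q) (snd q))) = kapply (configs n V) K \<psi> (join (fst p) (snd p))"
      unfolding kapply_def by (rule sum.reindex_bij_betw[OF bij_join, of "\<lambda>\<rho>. K (join (fst p) (snd p)) \<rho> * \<psi> \<rho>"])
    finally show ?thesis .
  qed
  have "cinn (X \<times> X) (\<lambda>p. sg (snd p) * f (join (fst p) (snd p))) (\<lambda>p. sg (snd p) * g (join (fst p) (snd p))) = cinn (configs n V) f g" for f g
  proof -
    have "cinn (X \<times> X) (\<lambda>p. sg (snd p) * f (join (fst p) (snd p))) (\<lambda>p. sg (snd p) * g (join (fst p) (snd p)))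
      = (\<Sum>p\<in>X \<times> X. cnj (f (join (fst p) (snd p))) * g (join (fst p) (snd p)))"
      unfolding cinn_def complex_cnj_mult cnj_sg by (rule sum.cong[OF refl], rule s3)
    also have "\<dots> = cinn (configs n V) f g"
      unfolding cinn_def by (rule sum.reindex_bij_betw[OF bij_join, of "\<lambda>\<rho>. cnj (f \<rho>) * g \<rho>"])
    finally show ?thesis .
  qed
  from this[of \<psi> "kapply (configs n V) K \<psi>"] this[of \<psi> \<psi>]
  show "cinn (X \<times> X) (\<lambda>p. sg (snd p) * \<psi> (join (fst p) (snd p))) (kapply (X \<times> X) (tr K) (\<lambda>p. sg (snd p) * \<psi> (join (fst p) (snd p))))
    = cinn (configs n V) \<psi> (kapply (configs n V) K \<psi>)"
    "cinn (X \<times> X) (\<lambda>p. sg (snd p) * \<psi> (join (fst p) (snd p))) (\<lambda>p. sg (snd p) * \<psi> (join (fst p) (snd p))) = cinn (configs n V) \<psi> \<psi>"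
    unfolding c by auto
qed

text \<open>The converse passage. It makes trial vectors on \<open>V\<close> out of the mirrored
  Schmidt sums that reflection positivity supplies.\<close>

lemma tr_lift:
  fixes M :: "config \<times> config \<Rightarrow> complex"
  obtains \<psi> where "cinn (configs n V) \<psi> \<psi> = cinn (X \<times> X) M M"
    "\<forall>K. cinn (configs n V) \<psi> (kapply (configs n V) K \<psi>) = cinn (X \<times> X) M (kapply (X \<times> X) (tr K) M)"
proof -
  define j where "j = inv_into (X \<times> X) (\<lambda>p. join (fst p) (snd p))"
  define \<psi> where "\<psi> = (\<lambda>\<sigma>. sg (snd (j \<sigma>)) * M (j \<sigma>))"
  have jj: "j (join (fst p) (snd p)) = p" if "p \<in> X \<times> X" for p
    unfolding j_def using bij_betw_inv_into_left[OF bij_join that] by simp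
  have s2: "sg b * (sg b * z) = z" for b z using sg_sq[of b] by (simp add: mult.assoc[symmetric])
  have M: "sg (snd p) * \<psi> (join (fst p) (snd p)) = M p" if "p \<in> X \<times> X" for p
    unfolding \<psi>_def jj[OF that] s2 ..
  show ?thesis
  proof (rule that[of \<psi>])
    show "cinn (configs n V) \<psi> \<psi> = cinn (X \<times> X) M M"
      unfolding cinn_tr(2)[symmetric] by (intro cinn_cong M)
    show "\<forall>K. cinn (configs n V) \<psi> (kapply (configs n V) K \<psi>) = cinn (X \<times> X) M (kapply (X \<times> X) (tr K) M)"
      unfolding cinn_tr(1)[symmetric] using M by (auto intro!: cinn_cong kapply_cong)
  qed
qed

section \<open>Local operators as tensor products over the two halves\<close>

lemma tr_site_left:
  assumes "x \<in> W" "p \<in> X \<times> X" "q \<in> X \<times> X"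
  shows "tr (site_op x s) p q = tens (site_op x s) rid p q"
proof -
  have pq: "fst p \<in> X" "snd p \<in> X" "fst q \<in> X" "snd q \<in> X" using assms by auto
  have "(\<forall>z. z \<noteq> x \<longrightarrow> join (fst p) (snd p) z = join (fst q) (snd q) z) \<longleftrightarrow> (\<forall>z. z \<noteq> x \<longrightarrow> fst p z = fst q z) \<and> snd p = snd q"
    using join_agree[OF pq, of "{x}" "{}"] assms(1) by (auto simp: fun_eq_iff)
  then show ?thesis
    using assms(1) sg_sq by (auto simp: tr_def tens_def rid_def site_op_def join_val)
qed

lemma tr_site_right:
  assumes "x \<in> W" "p \<in> X \<times> X" "q \<in> X \<times> X"
  shows "tr (site_op (\<theta> x) s) p q = tens rid (site_op x (srot n s)) p q"
proof -
  have pq: "fst p \<in> X" "snd p \<in> X" "fst q \<in> X" "snd q \<in> X" using assms by auto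
  have A: "(\<forall>z. z \<noteq> \<theta> x \<longrightarrow> join (fst p) (snd p) z = join (fst q) (snd q) z) \<longleftrightarrow> fst p = fst q \<and> (\<forall>z. z \<noteq> x \<longrightarrow> snd p z = snd q z)"
    using join_agree[OF pq, of "{}" "{x}"] assms(1) by (auto simp: fun_eq_iff)
  show ?thesis
    using sg_agree[of "{x}" "snd p" "snd q"] assms(1) unfolding tr_def tens_def rid_def site_op_def A
    by (auto simp: join_val srot_def)
qed

lemma tr_pair_left:
  assumes "x \<in> W" "y \<in> W" "p \<in> X \<times> X" "q \<in> X \<times> X"
  shows "tr (pair_op x s y t) p q = tens (pair_op x s y t) rid p q"
proof -
  have pq: "fst p \<in> X" "snd p \<in> X" "fst q \<in> X" "snd q \<in> X" using assms by auto
  have A: "(\<forall>z. z \<noteq> x \<and> z \<noteq> y \<longrightarrow> join (fst p) (snd p) z = join (fst q) (snd q) z) \<longleftrightarrow> (\<forall>z. z \<noteq> x \<and> z \<noteq> y \<longrightarrow> fst p z = fst q z) \<and> snd p = snd q"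
    using join_agree[OF pq, of "{x,y}" "{}"] assms(1,2) by (auto simp: fun_eq_iff)
  show ?thesis
    using assms(1,2) sg_sq unfolding tr_def tens_def rid_def pair_op_def A by (auto simp: join_val)
qed

lemma tr_pair_right:
  assumes "x \<in> W" "y \<in> W" "x \<noteq> y" "p \<in> X \<times> X" "q \<in> X \<times> X"
  shows "tr (pair_op (\<theta> x) s (\<theta> y) t) p q = tens rid (pair_op x (srot n s) y (srot n t)) p q"
proof -
  have pq: "fst p \<in> X" "snd p \<in> X" "fst q \<in> X" "snd q \<in> X" using assms by auto
  have A: "(\<forall>z. z \<noteq> \<theta> x \<and> z \<noteq> \<theta> y \<longrightarrow> join (fst p) (snd p) z = join (fst q) (snd q) z) \<longleftrightarrow> fst p = fst q \<and> (\<forall>z. z \<noteq> x \<and> z \<noteq> y \<longrightarrow> snd p z = snd q z)"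
    using join_agree[OF pq, of "{}" "{x,y}"] assms(1,2) by (auto simp: fun_eq_iff)
  show ?thesis
    using sg_agree[of "{x,y}" "snd p" "snd q"] assms(1,2,3) unfolding tr_def tens_def rid_def pair_op_def A
    by (auto simp: join_val srot_def mult_ac)
qed

lemma tr_pair_cross:
  assumes "x \<in> W" "y \<in> W" "p \<in> X \<times> X" "q \<in> X \<times> X"
  shows "tr (pair_op x s (\<theta> y) t) p q = tens (site_op x s) (site_op y (srot n t)) p q"
proof -
  have pq: "fst p \<in> X" "snd p \<in> X" "fst q \<in> X" "snd q \<in> X" using assms by auto
  have A: "(\<forall>z. z \<noteq> x \<and> z \<noteq> \<theta> y \<longrightarrow> join (fst p) (snd p) z = join (fst q) (snd q) z) \<longleftrightarrow> (\<forall>z. z \<noteq> x \<longrightarrow> fst p z = fst q z) \<and> (\<forall>z. z \<noteq> y \<longrightarrow> snd p z = snd q z)"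
    using join_agree[OF pq, of "{x}" "{y}"] assms(1,2) by (auto simp: fun_eq_iff)
  show ?thesis
    using sg_agree[of "{y}" "snd p" "snd q"] assms(1,2) unfolding tr_def tens_def site_op_def pair_op_def A
    by (auto simp: join_val srot_def mult_ac)
qed

lemma tr_opid:
  assumes "p \<in> X \<times> X" "q \<in> X \<times> X"
  shows "tr opid p q = tens rid rid p q"
proof -
  have pq: "fst p \<in> X" "snd p \<in> X" "fst q \<in> X" "snd q \<in> X" using assms by auto
  have A: "join (fst p) (snd p) = join (fst q) (snd q) \<longleftrightarrow> fst p = fst q \<and> snd p = snd q"
    using join_agree[OF pq, of "{}" "{}"] by (auto simp: fun_eq_iff)
  show ?thesis unfolding tr_def tens_def rid_def opid_def A using sg_sq by auto
qed

end

lemma site_op_spin2_real: "Im (site_op x (\<lambda>j k. \<i> * spin n 2 j k) \<sigma> \<tau>) = 0"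
  by (simp add: site_op_def spin_simps spin2_def splus_eq sminus_def)

lemma site_op_spin13_real: "a \<noteq> 2 \<Longrightarrow> Im (site_op x (spin n a) \<sigma> \<tau>) = 0"
  by (simp add: site_op_def spin_def spin1_def spin3_def splus_eq sminus_def)

lemma pair_op_spin_real: "Im (pair_op x (spin n a) y (spin n a) \<sigma> \<tau>) = 0"
proof -
  have "Re (spin n 2 j k) = 0" for j k
    by (simp add: spin_simps spin2_def splus_eq sminus_def)
  moreover have "a \<noteq> 2 \<Longrightarrow> Im (spin n a j k) = 0" for j k
    by (simp add: spin_def spin1_def spin3_def splus_eq sminus_def)
  ultimately show ?thesis by (cases "a = 2") (simp_all add: pair_op_def)
qed

lemma bond_real: "Im (bond n v x y \<sigma> \<tau>) = 0"
  using site_op_spin13_real[of 1] by (simp add: bond_def pair_op_spin_real opid_def)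

context reflected
begin

text \<open>In these coordinates the Hamiltonian is \<open>AL \<otimes> 1 + 1 \<otimes> AL' - \<Sum> CC \<otimes> CC'\<close> over the bonds between the halves.
  The rotation turns the antiferromagnetic coupling of the first and third components into a ferromagnetic one;
  for the second component the sign comes from the factor \<open>\<i>\<close>, which also makes all kernels real.\<close>
definition AL :: "real \<Rightarrow> (site \<Rightarrow> real) \<Rightarrow> obs" where
  "AL B u = (\<lambda>\<sigma> \<tau>. 1/2 * (\<Sum>x\<in>W. \<Sum>y\<in>{y\<in>W. nb x y}. bond n u x y \<sigma> \<tau>)
     - of_real B * (\<Sum>x\<in>W. stag x * site_op x (spin n 3) \<sigma> \<tau>)
     + (\<Sum>x\<in>{x\<in>W. nb x (\<theta> x)}. of_real (u x) * site_op x (spin n 1) \<sigma> \<tau> + of_real ((u x)\<^sup>2 / 2) * rid \<sigma> \<tau>))"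

definition CC :: "(site \<Rightarrow> real) \<Rightarrow> site \<times> nat \<Rightarrow> obs" where
  "CC u r = (\<lambda>\<sigma> \<tau>. if snd r = 1 then site_op (fst r) (spin n 1) \<sigma> \<tau> + of_real (u (fst r)) * rid \<sigma> \<tau>
     else if snd r = 2 then site_op (fst r) (\<lambda>j k. \<i> * spin n 2 j k) \<sigma> \<tau>
     else site_op (fst r) (spin n 3) \<sigma> \<tau>)"

definition RR :: "(site \<times> nat) set" where "RR = {x\<in>W. nb x (\<theta> x)} \<times> {1,2,3}"

lemma stag_real: "Im (stag x) = 0" using stag_cases[of x] by auto

lemma AL_real: "real_ker X (AL B u)"
  unfolding real_ker_def AL_def using site_op_spin13_real
  by (simp add: bond_real stag_real rid_def)

lemma CC_real: "real_ker X (CC u r)"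
  unfolding real_ker_def CC_def using site_op_spin13_real[of 1] site_op_spin13_real[of 3] site_op_spin2_real
  by (simp add: rid_def)

lemma AL_cong: "(\<And>x. x \<in> W \<Longrightarrow> u x = u' x) \<Longrightarrow> AL B u = AL B u'"
  unfolding AL_def bond_def by (intro ext arg_cong2[of _ _ _ _ "(+)"] arg_cong2[of _ _ _ _ "(-)"] arg_cong2[of _ _ _ _ "(*)"] refl sum.cong) auto

lemma CC_cong: "r \<in> RR \<Longrightarrow> (\<And>x. x \<in> W \<Longrightarrow> u x = u' x) \<Longrightarrow> CC u r = CC u' r"
  unfolding CC_def RR_def by auto

lemma site_op_srot:
  assumes "\<sigma> \<in> X" "\<tau> \<in> X" "a \<in> {1,2,3}"
  shows "site_op x (srot n (spin n a)) \<sigma> \<tau> = (if a = 2 then 1 else -1) * site_op x (spin n a) \<sigma> \<tau>"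
  using srot_spin[OF configs_le[OF assms(1), of x] configs_le[OF assms(2), of x] assms(3)]
  unfolding site_op_def by auto

lemma pair_op_srot:
  assumes "\<sigma> \<in> X" "\<tau> \<in> X" "a \<in> {1,2,3}"
  shows "pair_op x (srot n (spin n a)) y (srot n (spin n a)) \<sigma> \<tau> = pair_op x (spin n a) y (spin n a) \<sigma> \<tau>"
  using srot_spin[OF configs_le[OF assms(1), of x] configs_le[OF assms(2), of x] assms(3)]
    srot_spin[OF configs_le[OF assms(1), of y] configs_le[OF assms(2), of y] assms(3)]
  unfolding pair_op_def by auto

lemma tr_bond: "tr (bond n v x y) p q = (\<Sum>a\<in>{1,2,3}. tr (pair_op x (spin n a) y (spin n a)) p q)
     + of_real (v x + v y) * (tr (site_op x (spin n 1)) p q + tr (site_op y (spin n 1)) p q)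
     + of_real ((v x + v y)\<^sup>2 / 2) * tr opid p q"
  unfolding tr_def bond_def distrib_left sum_distrib_left by (simp add: mult_ac)

lemma tr_bond_left:
  assumes "x \<in> W" "y \<in> W" "p \<in> X \<times> X" "q \<in> X \<times> X"
  shows "tr (bond n v x y) p q = tens (bond n v x y) rid p q"
  unfolding tr_bond tr_pair_left[OF assms] tr_site_left[OF assms(1,3,4)] tr_site_left[OF assms(2,3,4)] tr_opid[OF assms(3,4)]
  by (simp add: tens_def bond_def algebra_simps opid_def rid_def)

text \<open>The rotation reverses the first spin component and the hypothesis reverses the field, so
  a bond of the second half keeps its form with the field \<open>w\<close>.\<close>

lemma tr_bond_right:
  assumes "x \<in> W" "y \<in> W" "x \<noteq> y" "p \<in> X \<times> X" "q \<in> X \<times> X" and w: "\<And>x. x \<in> W \<Longrightarrow> v (\<theta> x) = - w x"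
  shows "tr (bond n v (\<theta> x) (\<theta> y)) p q = tens rid (bond n w x y) p q"
proof -
  have s: "snd p \<in> X" "snd q \<in> X" using assms by auto
  have 1: "(\<Sum>a\<in>{1,2,3}. tr (pair_op (\<theta> x) (spin n a) (\<theta> y) (spin n a)) p q) = (\<Sum>a\<in>{1,2,3}. rid (fst p) (fst q) * pair_op x (spin n a) y (spin n a) (snd p) (snd q))"
    unfolding tr_pair_right[OF assms(1-5)] tens_def using pair_op_srot[OF s] by (intro sum.cong) auto
  have 2: "tr (site_op (\<theta> z) (spin n 1)) p q = - (rid (fst p) (fst q) * site_op z (spin n 1) (snd p) (snd q))" if "z \<in> W" for z
    unfolding tr_site_right[OF that assms(4,5)] tens_def using site_op_srot[OF s, of 1] by simp
  have 3: "tr opid p q = rid (fst p) (fst q) * opid (snd p) (snd q)"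
    unfolding tr_opid[OF assms(4,5)] tens_def by (simp add: opid_def rid_def)
  show ?thesis
    unfolding tr_bond 1 2[OF assms(1)] 2[OF assms(2)] 3 w[OF assms(1)] w[OF assms(2)] unfolding tens_def bond_def sum_distrib_left[symmetric]
    by (simp add: algebra_simps power2_eq_square)
qed

text \<open>With fields v and -w at the two ends, the completed square produces the product -(S + v)
  \<otimes> (S + w) for the first component S. What is left over, v S + v^2/2 and w S + w^2/2, is
  one-sided and is assigned to the halves.\<close>

lemma tr_bond_cross:
  assumes "x \<in> W" "p \<in> X \<times> X" "q \<in> X \<times> X" and w: "\<And>x. x \<in> W \<Longrightarrow> v (\<theta> x) = - w x"
  shows "tr (bond n v x (\<theta> x)) p q = - (\<Sum>a\<in>{1,2,3}. tens (CC v (x, a)) (CC w (x, a)) p q)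
     + tens (\<lambda>\<sigma> \<tau>. of_real (v x) * site_op x (spin n 1) \<sigma> \<tau> + of_real ((v x)\<^sup>2 / 2) * rid \<sigma> \<tau>) rid p q
     + tens rid (\<lambda>\<sigma> \<tau>. of_real (w x) * site_op x (spin n 1) \<sigma> \<tau> + of_real ((w x)\<^sup>2 / 2) * rid \<sigma> \<tau>) p q"
proof -
  have s: "snd p \<in> X" "snd q \<in> X" using assms by auto
  have i2: "site_op x (\<lambda>j k. \<i> * spin n 2 j k) \<sigma> \<tau> = \<i> * site_op x (spin n 2) \<sigma> \<tau>" for \<sigma> \<tau>
    unfolding site_op_def by auto
  have 1: "tr (pair_op x (spin n a) (\<theta> x) (spin n a)) p q = (if a = 2 then 1 else -1) * (site_op x (spin n a) (fst p) (fst q) * site_op x (spin n a) (snd p) (snd q))"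
    if "a \<in> {1,2,3}" for a
    unfolding tr_pair_cross[OF assms(1,1-3)] tens_def using site_op_srot[OF s that] by simp
  have 2: "tr (site_op (\<theta> x) (spin n 1)) p q = - (rid (fst p) (fst q) * site_op x (spin n 1) (snd p) (snd q))"
    unfolding tr_site_right[OF assms(1-3)] tens_def using site_op_srot[OF s, of 1] by simp
  have c: "CC u (x, 1) = (\<lambda>\<sigma> \<tau>. site_op x (spin n 1) \<sigma> \<tau> + of_real (u x) * rid \<sigma> \<tau>)"
    "CC u (x, 2) = (\<lambda>\<sigma> \<tau>. \<i> * site_op x (spin n 2) \<sigma> \<tau>)"
    "CC u (x, 3) = (\<lambda>\<sigma> \<tau>. site_op x (spin n 3) \<sigma> \<tau>)" for u
    by (simp_all add: CC_def i2)
  have 3: "tr (pair_op x (spin n 1) (\<theta> x) (spin n 1)) p q = - (site_op x (spin n 1) (fst p) (fst q) * site_op x (spin n 1) (snd p) (snd q))"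
    "tr (pair_op x (spin n 2) (\<theta> x) (spin n 2)) p q = site_op x (spin n 2) (fst p) (fst q) * site_op x (spin n 2) (snd p) (snd q)"
    "tr (pair_op x (spin n 3) (\<theta> x) (spin n 3)) p q = - (site_op x (spin n 3) (fst p) (fst q) * site_op x (spin n 3) (snd p) (snd q))"
    using 1[of 1] 1[of 2] 1[of 3] by simp_all
  show ?thesis
    unfolding tr_bond sum123 c 3 2 tr_site_left[OF assms(1-3)] tr_opid[OF assms(2,3)] w[OF assms(1)] tens_def
    by (simp add: algebra_simps power2_eq_square add_divide_distrib diff_divide_distrib)
qed

text \<open>A sum over ordered pairs meets each bond between the halves twice, and such a bond joins
  a site to its mirror image.\<close>

lemma sum_bonds:
  fixes f :: "site \<Rightarrow> site \<Rightarrow> complex"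
  assumes sym: "\<And>x y. f x y = f y x"
  shows "(\<Sum>x\<in>V. \<Sum>y\<in>{y\<in>V. nb x y}. f x y) = (\<Sum>x\<in>W. \<Sum>y\<in>{y\<in>W. nb x y}. f x y)
    + (\<Sum>x\<in>W. \<Sum>y\<in>{y\<in>W. nb x y}. f (\<theta> x) (\<theta> y)) + 2 * (\<Sum>x\<in>{x\<in>W. nb x (\<theta> x)}. f x (\<theta> x))"
proof -
  define g where "g x y = (if nb x y then f x y else 0)" for x y
  have filt: "(\<Sum>y\<in>{y\<in>S. P y}. h y) = (\<Sum>y\<in>S. if P y then h y else 0)" if "finite S" for S :: "site set" and P and h :: "site \<Rightarrow> complex"
    by (rule sum.inter_filter[OF that])
  have c1: "(\<Sum>y\<in>W. g x (\<theta> y)) = g x (\<theta> x)" if x: "x \<in> W" for x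
  proof -
    have "g x (\<theta> y) = 0" if "y \<in> W" "y \<noteq> x" for y
      using \<theta>cross[OF x \<theta>W(1)[OF that(1)] \<theta>W(2)[OF that(1)]] that x split_V(3) by (auto simp: g_def inj_on_def)
    then have "(\<Sum>y\<in>W. g x (\<theta> y)) = (\<Sum>y\<in>{x}. g x (\<theta> y))"
      using x finW by (intro sum.mono_neutral_right) auto
    then show ?thesis by simp
  qed
  have nbs: "nb (\<theta> x) y \<longleftrightarrow> nb x (\<theta> y)" if "x \<in> W" "y \<in> W" for x y
    using \<theta>nb[of x "\<theta> y"] that WV \<theta>W by auto
  have c2: "(\<Sum>y\<in>W. g (\<theta> x) y) = g x (\<theta> x)" if x: "x \<in> W" for x
  proof -
    have "g (\<theta> x) y = (if nb x (\<theta> y) then f (\<theta> x) y else 0)" if "y \<in> W" for y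
      using nbs[OF x that] by (simp add: g_def)
    moreover have "nb x (\<theta> y) \<Longrightarrow> y = x" if "y \<in> W" for y
      using \<theta>cross[OF x \<theta>W(1)[OF that] \<theta>W(2)[OF that]] that x split_V(3) by (auto simp: inj_on_def)
    ultimately have "(\<Sum>y\<in>W. g (\<theta> x) y) = (\<Sum>y\<in>{x}. g (\<theta> x) y)"
      using x finW by (intro sum.mono_neutral_right) auto
    then show ?thesis using nbs[OF x x] sym[of "\<theta> x" x] by (simp add: g_def)
  qed
  have "(\<Sum>x\<in>V. \<Sum>y\<in>{y\<in>V. nb x y}. f x y) = (\<Sum>x\<in>V. \<Sum>y\<in>V. g x y)"
    unfolding filt[OF finV] g_def ..
  also have "\<dots> = (\<Sum>x\<in>W. (\<Sum>y\<in>W. g x y) + (\<Sum>y\<in>W. g x (\<theta> y)) + ((\<Sum>y\<in>W. g (\<theta> x) y) + (\<Sum>y\<in>W. g (\<theta> x) (\<theta> y))))"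
    by (simp add: sum_V sum.distrib add_ac)
  also have "\<dots> = (\<Sum>x\<in>W. (\<Sum>y\<in>W. g x y) + g x (\<theta> x) + (g x (\<theta> x) + (\<Sum>y\<in>W. g (\<theta> x) (\<theta> y))))"
    using c1 c2 by (intro sum.cong refl) simp
  also have "\<dots> = (\<Sum>x\<in>W. \<Sum>y\<in>W. g x y) + (\<Sum>x\<in>W. \<Sum>y\<in>W. g (\<theta> x) (\<theta> y)) + 2 * (\<Sum>x\<in>W. g x (\<theta> x))"
    by (simp add: sum.distrib algebra_simps sum_distrib_left)
  also have "(\<Sum>x\<in>W. \<Sum>y\<in>W. g (\<theta> x) (\<theta> y)) = (\<Sum>x\<in>W. \<Sum>y\<in>{y\<in>W. nb x y}. f (\<theta> x) (\<theta> y))"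
    unfolding filt[OF finW] using \<theta>nb WV by (intro sum.cong refl) (auto simp: g_def)
  finally show ?thesis unfolding filt[OF finW] by (simp add: g_def)
qed

lemma tr_Hfield:
  assumes "p \<in> X \<times> X" "q \<in> X \<times> X" and w: "\<And>x. x \<in> W \<Longrightarrow> v (\<theta> x) = - w x"
  shows "tr (Hfield n V nb B v) p q = tens (AL B v) rid p q + tens rid (AL B w) p q - (\<Sum>r\<in>RR. tens (CC v r) (CC w r) p q)"
proof -
  have s: "snd p \<in> X" "snd q \<in> X" using assms by auto
  have "tr (Hfield n V nb B v) p q = 1/2 * (\<Sum>x\<in>V. \<Sum>y\<in>{y\<in>V. nb x y}. tr (bond n v x y) p q)
     - of_real B * (\<Sum>x\<in>V. stag x * tr (site_op x (spin n 3)) p q)"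
    unfolding tr_def Hfield_def right_diff_distrib sum_distrib_left by (simp add: mult_ac)
  also have "(\<Sum>x\<in>V. \<Sum>y\<in>{y\<in>V. nb x y}. tr (bond n v x y) p q) =
      (\<Sum>x\<in>W. \<Sum>y\<in>{y\<in>W. nb x y}. tens (bond n v x y) rid p q)
    + (\<Sum>x\<in>W. \<Sum>y\<in>{y\<in>W. nb x y}. tens rid (bond n w x y) p q)
    + 2 * (\<Sum>x\<in>{x\<in>W. nb x (\<theta> x)}. tr (bond n v x (\<theta> x)) p q)"
  proof -
    have "tr (bond n v x y) p q = tr (bond n v y x) p q" for x y by (subst bond_sym) simp
    moreover have "tr (bond n v x y) p q = tens (bond n v x y) rid p q" if "x \<in> W" "y \<in> W" for x y
      using tr_bond_left[OF that assms(1,2)] .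
    moreover have "tr (bond n v (\<theta> x) (\<theta> y)) p q = tens rid (bond n w x y) p q" if "x \<in> W" "y \<in> W" "nb x y" for x y
      using tr_bond_right[where v = v and w = w, OF that(1,2) _ assms(1,2) w] that nb_irr WV by metis
    ultimately show ?thesis by (subst sum_bonds) simp_all
  qed
  also have "(\<Sum>x\<in>{x\<in>W. nb x (\<theta> x)}. tr (bond n v x (\<theta> x)) p q) =
     (\<Sum>x\<in>{x\<in>W. nb x (\<theta> x)}. - (\<Sum>a\<in>{1,2,3}. tens (CC v (x, a)) (CC w (x, a)) p q)
     + tens (\<lambda>\<sigma> \<tau>. of_real (v x) * site_op x (spin n 1) \<sigma> \<tau> + of_real ((v x)\<^sup>2 / 2) * rid \<sigma> \<tau>) rid p q
     + tens rid (\<lambda>\<sigma> \<tau>. of_real (w x) * site_op x (spin n 1) \<sigma> \<tau> + of_real ((w x)\<^sup>2 / 2) * rid \<sigma> \<tau>) p q)"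
    using tr_bond_cross[where v = v and w = w, OF _ assms(1,2) w] by (intro sum.cong) auto
  also have "\<dots> = - (\<Sum>r\<in>RR. tens (CC v r) (CC w r) p q)
     + (\<Sum>x\<in>{x\<in>W. nb x (\<theta> x)}. tens (\<lambda>\<sigma> \<tau>. of_real (v x) * site_op x (spin n 1) \<sigma> \<tau> + of_real ((v x)\<^sup>2 / 2) * rid \<sigma> \<tau>) rid p q)
     + (\<Sum>x\<in>{x\<in>W. nb x (\<theta> x)}. tens rid (\<lambda>\<sigma> \<tau>. of_real (w x) * site_op x (spin n 1) \<sigma> \<tau> + of_real ((w x)\<^sup>2 / 2) * rid \<sigma> \<tau>) p q)"
    unfolding sum.distrib sum_negf RR_def sum.cartesian_product by (simp add: case_prod_beta)
  \<comment> \<open>Both the rotation and the mirror reverse the sign, so the staggered field has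
    the same form in the two halves.\<close>
  also have "(\<Sum>x\<in>V. stag x * tr (site_op x (spin n 3)) p q) = (\<Sum>x\<in>W. stag x * tens (site_op x (spin n 3)) rid p q) + (\<Sum>x\<in>W. stag x * tens rid (site_op x (spin n 3)) p q)"
  proof -
    have "tr (site_op (\<theta> x) (spin n 3)) p q = - tens rid (site_op x (spin n 3)) p q" if "x \<in> W" for x
      unfolding tr_site_right[OF that assms(1,2)] tens_def using site_op_srot[OF s, of 3] by simp
    then show ?thesis
      unfolding sum_V sum.distrib[symmetric] using tr_site_left[OF _ assms(1,2)] \<theta>V(4) WV by (intro sum.cong) auto
  qed
  finally show ?thesis
    unfolding AL_def tens_def
    by (simp add: algebra_simps sum_distrib_left sum_distrib_right sum.distrib)
qed

lemma kapply_sum_ker: "kapply Y (\<lambda>p q. \<Sum>r\<in>I. K r p q) M = (\<lambda>p. \<Sum>r\<in>I. kapply Y (K r) M p)"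
  unfolding kapply_def sum_distrib_right by (rule ext, rule sum.swap)

lemma rpform_Hfield:
  assumes w: "\<And>x. x \<in> W \<Longrightarrow> v (\<theta> x) = - w x"
  shows "rpform X RR (AL B v) (AL B w) (CC v) (CC w) M = Re (cinn (X \<times> X) M (kapply (X \<times> X) (tr (Hfield n V nb B v)) M))"
proof -
  have "cinn (X \<times> X) M (kapply (X \<times> X) (tr (Hfield n V nb B v)) M) =
     cinn (X \<times> X) M (kapply (X \<times> X) (\<lambda>p q. tens (AL B v) rid p q + tens rid (AL B w) p q - (\<Sum>r\<in>RR. tens (CC v r) (CC w r) p q)) M)"
    using tr_Hfield[where v = v and w = w, OF _ _ w] by (intro cinn_cong refl kapply_cong) auto
  also have "kapply (X \<times> X) (\<lambda>p q. tens (AL B v) rid p q + tens rid (AL B w) p q - (\<Sum>r\<in>RR. tens (CC v r) (CC w r) p q)) M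
    = (\<lambda>p. kapply (X \<times> X) (tens (AL B v) rid) M p + kapply (X \<times> X) (tens rid (AL B w)) M p - (\<Sum>r\<in>RR. kapply (X \<times> X) (tens (CC v r) (CC w r)) M p))"
    unfolding fun_cong[OF kapply_sum_ker, symmetric] by (simp add: kapply_def algebra_simps sum.distrib sum_subtractf)
  finally show ?thesis unfolding rpform_def by (simp add: cinn_add cinn_diff cinn_sum)
qed

text \<open>The mirrored field with opposite sign, so that every bond between the halves becomes
  balanced.\<close>

definition lift :: "(site \<Rightarrow> real) \<Rightarrow> site \<Rightarrow> real" where
  "lift u = (\<lambda>x. if x \<in> W then u x else if x \<in> V then - u (\<theta> x) else 0)"

lemma lift_val: "x \<in> W \<Longrightarrow> lift u x = u x" "x \<in> W \<Longrightarrow> lift u (\<theta> x) = - u x"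
  using \<theta>W by (auto simp: lift_def)

text \<open>Reflection positivity in terms of fields: up to the choice of trial vectors, the energy
  at \<open>v\<close> is at least the mean of the energies at its two symmetrisations, one made from
  each half.\<close>

lemma reflection_step:
  obtains \<psi>1 \<psi>2 where
    "Re (cinn (configs n V) \<psi>1 \<psi>1) = Re (cinn (configs n V) \<psi> \<psi>)"
    "Re (cinn (configs n V) \<psi>2 \<psi>2) = Re (cinn (configs n V) \<psi> \<psi>)"
    "Re (ev (configs n V) \<psi>1 (Hfield n V nb B (lift v))) + Re (ev (configs n V) \<psi>2 (Hfield n V nb B (lift (\<lambda>x. - v (\<theta> x)))))
      \<le> 2 * Re (ev (configs n V) \<psi> (Hfield n V nb B v))"
proof -
  define w where "w = (\<lambda>x. - v (\<theta> x))"
  define M where "M = (\<lambda>p. sg (snd p) * \<psi> (join (fst p) (snd p)))"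
  have fin: "finite X" "finite RR" using finite_configs[OF finW] finW by (auto simp: RR_def)
  obtain M1 M2 where M1: "Re (cinn (X \<times> X) M1 M1) = Re (cinn (X \<times> X) M M)" and M2: "Re (cinn (X \<times> X) M2 M2) = Re (cinn (X \<times> X) M M)"
    and le: "rpform X RR (AL B v) (AL B v) (CC v) (CC v) M1 + rpform X RR (AL B w) (AL B w) (CC w) (CC w) M2 \<le> 2 * rpform X RR (AL B v) (AL B w) (CC v) (CC w) M"
    by (rule reflection_positivity[OF fin AL_real[of B v] AL_real[of B w] ballI[OF CC_real[of v]] ballI[OF CC_real[of w]], of M])
  obtain \<psi>1 where p1: "cinn (configs n V) \<psi>1 \<psi>1 = cinn (X \<times> X) M1 M1"
    "\<forall>K. cinn (configs n V) \<psi>1 (kapply (configs n V) K \<psi>1) = cinn (X \<times> X) M1 (kapply (X \<times> X) (tr K) M1)"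
    by (rule tr_lift)
  obtain \<psi>2 where p2: "cinn (configs n V) \<psi>2 \<psi>2 = cinn (X \<times> X) M2 M2"
    "\<forall>K. cinn (configs n V) \<psi>2 (kapply (configs n V) K \<psi>2) = cinn (X \<times> X) M2 (kapply (X \<times> X) (tr K) M2)"
    by (rule tr_lift)
  have lifted: "rpform X RR (AL B u) (AL B u) (CC u) (CC u) N = Re (cinn (X \<times> X) N (kapply (X \<times> X) (tr (Hfield n V nb B (lift u))) N))" for u N
  proof -
    have "AL B (lift u) = AL B u" by (rule AL_cong) (rule lift_val)
    moreover have "\<forall>r\<in>RR. CC (lift u) r = CC u r" by (intro ballI CC_cong lift_val(1))
    ultimately show ?thesis
      by (subst rpform_Hfield[of "lift u" "lift u", symmetric]) (simp_all add: lift_val rpform_def)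
  qed
  have "rpform X RR (AL B v) (AL B w) (CC v) (CC w) M = Re (cinn (X \<times> X) M (kapply (X \<times> X) (tr (Hfield n V nb B v)) M))"
    by (rule rpform_Hfield) (simp add: w_def)
  also have "\<dots> = Re (ev (configs n V) \<psi> (Hfield n V nb B v))"
    unfolding M_def cinn_tr(1) ev_def ..
  finally have orig: "rpform X RR (AL B v) (AL B w) (CC v) (CC w) M = Re (ev (configs n V) \<psi> (Hfield n V nb B v))" .
  have nM: "cinn (X \<times> X) M M = cinn (configs n V) \<psi> \<psi>" unfolding M_def by (rule cinn_tr(2))
  show ?thesis
  proof (rule that[of \<psi>1 \<psi>2])
    show "Re (cinn (configs n V) \<psi>1 \<psi>1) = Re (cinn (configs n V) \<psi> \<psi>)" "Re (cinn (configs n V) \<psi>2 \<psi>2) = Re (cinn (configs n V) \<psi> \<psi>)"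
      using M1 M2 p1(1) p2(1) nM by simp_all
    show "Re (ev (configs n V) \<psi>1 (Hfield n V nb B (lift v))) + Re (ev (configs n V) \<psi>2 (Hfield n V nb B (lift (\<lambda>x. - v (\<theta> x)))))
      \<le> 2 * Re (ev (configs n V) \<psi> (Hfield n V nb B v))"
      using le unfolding lifted orig p1(2)[rule_format, symmetric] p2(2)[rule_format, symmetric]
      unfolding ev_def w_def .
  qed
qed

definition bad :: "(site \<Rightarrow> real) \<Rightarrow> nat" where
  "bad v = (\<Sum>x\<in>V. \<Sum>y\<in>V. if nb x y \<and> v x + v y \<noteq> 0 then 1 else 0)"

text \<open>A symmetrised field has twice the unbalanced bonds of the half it is made from and none
  across the cut. The two counts therefore add up to twice that of \<open>v\<close> minus twice the
  crossing contribution, which \<open>x0\<close> makes positive.\<close>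

lemma bad_lift:
  assumes x0: "x0 \<in> W" "nb x0 (\<theta> x0)" "v x0 + v (\<theta> x0) \<noteq> 0"
  shows "bad (lift v) < bad v \<or> bad (lift (\<lambda>x. - v (\<theta> x))) < bad v"
proof -
  define N where "N v x y = (if nb x y \<and> v x + v y \<noteq> 0 then 1 else 0 :: nat)" for v :: "site \<Rightarrow> real" and x y
  have bad_eq: "bad v = (\<Sum>x\<in>W. \<Sum>y\<in>W. N v x y) + (\<Sum>x\<in>W. \<Sum>y\<in>W. N v x (\<theta> y)) + ((\<Sum>x\<in>W. \<Sum>y\<in>W. N v (\<theta> x) y) + (\<Sum>x\<in>W. \<Sum>y\<in>W. N v (\<theta> x) (\<theta> y)))" for v
    unfolding bad_def N_def[symmetric] sum_V sum.distrib by simp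
  have nbs: "nb (\<theta> x) y \<longleftrightarrow> nb x (\<theta> y)" "nb (\<theta> x) (\<theta> y) \<longleftrightarrow> nb x y" if "x \<in> W" "y \<in> W" for x y
    using \<theta>nb[of x "\<theta> y"] \<theta>nb[of x y] that WV \<theta>W by auto
  have cr: "nb x (\<theta> y) \<Longrightarrow> y = x" if "x \<in> W" "y \<in> W" for x y
    using \<theta>cross[OF that(1) \<theta>W(1)[OF that(2)] \<theta>W(2)[OF that(2)]] that split_V(3) by (auto simp: inj_on_def)
  have bl: "bad (lift u) = 2 * (\<Sum>x\<in>W. \<Sum>y\<in>W. N u x y)" for u
  proof -
    have "N (lift u) x (\<theta> y) = 0" "N (lift u) (\<theta> x) y = 0" if "x \<in> W" "y \<in> W" for x y
      using cr[OF that] nbs(1)[OF that] that by (auto simp: N_def lift_val)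
    moreover have "N (lift u) x y = N u x y" "N (lift u) (\<theta> x) (\<theta> y) = N u x y" if "x \<in> W" "y \<in> W" for x y
      using nbs(2)[OF that] that by (auto simp: N_def lift_val)
    ultimately show ?thesis unfolding bad_eq by simp
  qed
  have "(\<Sum>x\<in>W. \<Sum>y\<in>W. N v (\<theta> x) (\<theta> y)) = (\<Sum>x\<in>W. \<Sum>y\<in>W. N (\<lambda>x. - v (\<theta> x)) x y)"
    using nbs(2) by (intro sum.cong refl) (auto simp: N_def)
  moreover have "0 < (\<Sum>x\<in>W. \<Sum>y\<in>W. N v x (\<theta> y))"
  proof -
    have "1 \<le> N v x0 (\<theta> x0)" using x0 by (simp add: N_def)
    also have "\<dots> \<le> (\<Sum>y\<in>W. N v x0 (\<theta> y))" using x0 finW by (intro member_le_sum) auto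
    also have "\<dots> \<le> (\<Sum>x\<in>W. \<Sum>y\<in>W. N v x (\<theta> y))" using x0 finW by (intro member_le_sum[of x0 W "\<lambda>x. \<Sum>y\<in>W. N v x (\<theta> y)"]) auto
    finally show ?thesis by simp
  qed
  ultimately show ?thesis using bad_eq[of v] bl[of v] bl[of "\<lambda>x. - v (\<theta> x)"] by linarith
qed

end

text \<open>Among the minimisers of the energy in a finite set of fields closed under reflections,
  one with the fewest unbalanced bonds has none, since each reflection through such a bond yields
  two minimisers, one of which has fewer.\<close>
theorem gaussian_domination:
  assumes fin: "finite V" and sym: "\<And>x y. x \<in> V \<Longrightarrow> y \<in> V \<Longrightarrow> nb x y \<Longrightarrow> nb y x" and irr: "\<And>x. x \<in> V \<Longrightarrow> \<not> nb x x"
    and refl: "\<And>x y. x \<in> V \<Longrightarrow> y \<in> V \<Longrightarrow> nb x y \<Longrightarrow> \<exists>\<theta> W. reflection V nb \<theta> W \<and> x \<in> W \<and> y \<notin> W"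
  shows "gs_energy n V (Hfield n V nb B (\<lambda>_. 0)) * Re (cinn (configs n V) \<psi> \<psi>) \<le> Re (ev (configs n V) \<psi> (Hfield n V nb B v))"
proof -
  let ?X = "configs n V"
  define E where "E u = gs_energy n V (Hfield n V nb B u)" for u
  define bd where "bd u = (\<Sum>x\<in>V. \<Sum>y\<in>V. if nb x y \<and> u x + u y \<noteq> 0 then 1 else 0 :: nat)" for u :: "site \<Rightarrow> real"
  have E: "E u * Re (cinn ?X \<psi> \<psi>) \<le> Re (ev ?X \<psi> (Hfield n V nb B u))" for u \<psi>
    unfolding E_def ev_def by (rule gs_energy_le[OF fin Hfield_herm])
  have E_attained: "\<exists>\<psi>. Re (cinn ?X \<psi> \<psi>) = 1 \<and> Re (ev ?X \<psi> (Hfield n V nb B u)) = E u" for u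
  proof -
    obtain I :: "nat set" and e where I: "I \<noteq> {}"
      "\<forall>i\<in>I. \<forall>j\<in>I. cinn ?X (e i) (e j) = (if i = j then 1 else 0)"
      "\<forall>i\<in>I. \<forall>\<sigma>\<in>?X. kapply ?X (Hfield n V nb B u) (e i) \<sigma> = complex_of_real (gs_energy n V (Hfield n V nb B u)) * e i \<sigma>"
      by (rule fv_gs_expand[OF fin Hfield_herm[of "configs n V" n V nb B u]]) blast
    then obtain i where i: "i \<in> I" by auto
    have "ev ?X (e i) (Hfield n V nb B u) = cinn ?X (e i) (\<lambda>\<sigma>. of_real (E u) * e i \<sigma>)"
      unfolding ev_def E_def using I(3) i by (intro cinn_cong) auto
    then show ?thesis using I(2) i by (intro exI[of _ "e i"]) (simp add: cinn_scale)
  qed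
  define v' where "v' = (\<lambda>x. if x \<in> V then v x else 0)"
  \<comment> \<open>Symmetrising only copies values and changes their sign. Fields with values in
    this set form a finite set closed under all reflections, so a minimiser exists without any
    compactness in the field.\<close>
  define S where "S = insert 0 (v ` V \<union> uminus ` v ` V)"
  define F where "F = {u. \<forall>x. (x \<in> V \<longrightarrow> u x \<in> S) \<and> (x \<notin> V \<longrightarrow> u x = 0)}"
  have "finite S" using fin by (simp add: S_def)
  have finF: "finite F" unfolding F_def by (rule finite_set_of_finite_funs[OF fin \<open>finite S\<close>])
  have v'F: "v' \<in> F" by (auto simp: F_def v'_def S_def)
  have Sneg: "- s \<in> S" if "s \<in> S" for s using that by (auto simp: S_def)
  define m where "m = Min (E ` F)"
  have mle: "m \<le> E u" if "u \<in> F" for u unfolding m_def using that finF by auto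
  have "m \<in> E ` F" unfolding m_def using finF v'F by (intro Min_in) auto
  then have "\<exists>u. u \<in> F \<and> E u = m" by auto
  then obtain u where u: "u \<in> F" "E u = m" "\<And>u'. u' \<in> F \<Longrightarrow> E u' = m \<Longrightarrow> bd u \<le> bd u'"
    using ex_has_least_nat[of "\<lambda>u. u \<in> F \<and> E u = m" _ bd] by metis
  have bal: "u x + u y = 0" if xy: "x \<in> V" "y \<in> V" "nb x y" for x y
  proof (rule ccontr)
    assume ne: "u x + u y \<noteq> 0"
    obtain \<theta> W where r: "reflection V nb \<theta> W" "x \<in> W" "y \<notin> W" using refl[OF xy] by blast
    interpret reflected n V W nb \<theta>
      using fin r(1) sym irr by unfold_locales
    have y: "y = \<theta> x" using \<theta>cross[OF r(2) xy(2) r(3) xy(3)] .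
    have F1: "lift z \<in> F" if "\<And>x. x \<in> W \<Longrightarrow> z x \<in> S" for z
      using that \<theta>V Sneg WV by (auto simp: F_def lift_def)
    have uS: "u z \<in> S" if "z \<in> V" for z using u(1) that by (auto simp: F_def)
    have L1: "lift u \<in> F" using uS WV by (intro F1) auto
    have L2: "lift (\<lambda>x. - u (\<theta> x)) \<in> F" using uS \<theta>W Sneg by (intro F1) auto
    obtain \<psi> where \<psi>: "Re (cinn ?X \<psi> \<psi>) = 1" "Re (ev ?X \<psi> (Hfield n V nb B u)) = E u" using E_attained by blast
    obtain \<psi>1 \<psi>2 where s: "Re (cinn ?X \<psi>1 \<psi>1) = Re (cinn ?X \<psi> \<psi>)" "Re (cinn ?X \<psi>2 \<psi>2) = Re (cinn ?X \<psi> \<psi>)"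
      "Re (ev ?X \<psi>1 (Hfield n V nb B (lift u))) + Re (ev ?X \<psi>2 (Hfield n V nb B (lift (\<lambda>x. - u (\<theta> x))))) \<le> 2 * Re (ev ?X \<psi> (Hfield n V nb B u))"
      by (rule reflection_step)
    have "E (lift u) + E (lift (\<lambda>x. - u (\<theta> x))) \<le> 2 * m"
      using E[of "lift u" \<psi>1] E[of "lift (\<lambda>x. - u (\<theta> x))" \<psi>2] s \<psi> u(2) by simp
    then have "E (lift u) = m" "E (lift (\<lambda>x. - u (\<theta> x))) = m" using mle[OF L1] mle[OF L2] by linarith+
    then have "bd u \<le> bd (lift u)" "bd u \<le> bd (lift (\<lambda>x. - u (\<theta> x)))" using u(3) L1 L2 by auto
    moreover have "bad = bd" by (simp add: fun_eq_iff bad_def bd_def)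
    ultimately show False using bad_lift[OF r(2), of u] xy(3) ne y by auto
  qed
  \<comment> \<open>A field that balances every bond is invisible to the Hamiltonian, so the minimum
    is the energy at zero field.\<close>
  have "bond n u x y = bond n (\<lambda>_. 0) x y" if "x \<in> V" "y \<in> V" "nb x y" for x y
    using bal[OF that] by (simp add: bond_def)
  then have "Hfield n V nb B u = Hfield n V nb B (\<lambda>_. 0)"
    unfolding Hfield_def by (intro ext arg_cong2[of _ _ _ _ "(-)"] arg_cong2[of _ _ _ _ "(*)"] refl sum.cong) auto
  then have "E (\<lambda>_. 0) = m" using u(2) by (simp add: E_def)
  then have "E (\<lambda>_. 0) \<le> E v'" using mle[OF v'F] by simp
  moreover have "bond n v' x y = bond n v x y" if "x \<in> V" "y \<in> V" for x y
    using that by (simp add: bond_def v'_def)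
  then have "Hfield n V nb B v' = Hfield n V nb B v"
    unfolding Hfield_def by (intro ext arg_cong2[of _ _ _ _ "(-)"] arg_cong2[of _ _ _ _ "(*)"] refl sum.cong) auto
  ultimately have "E (\<lambda>_. 0) \<le> E v" by (simp add: E_def)
  then have "E (\<lambda>_. 0) * Re (cinn ?X \<psi> \<psi>) \<le> E v * Re (cinn ?X \<psi> \<psi>)"
    by (rule mult_right_mono) (rule cinn_self_nonneg)
  also have "\<dots> \<le> Re (ev ?X \<psi> (Hfield n V nb B v))" by (rule E)
  finally show ?thesis by (simp add: E_def)
qed

section \<open>Fluctuations of generators of rotations\<close>

text \<open>Adding the values at t and -t removes the odd powers; for small t the quadratic term
  dominates the quartic one.\<close>

lemma even_coefficient_nonneg:
  fixes b k m r :: real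
  assumes "\<And>t. 0 \<le> b * t + k * t\<^sup>2 + m * t ^ 3 + r * t ^ 4"
  shows "0 \<le> k"
proof (rule ccontr)
  assume "\<not> 0 \<le> k"
  then have k: "k < 0" by simp
  \<comment> \<open>Small enough that the quartic term compensates at most half of
    \<open>k\<close>.\<close>
  define t where "t = sqrt (- k / (2 * (\<bar>r\<bar> + 1)))"
  have t2: "t\<^sup>2 = - k / (2 * (\<bar>r\<bar> + 1))" unfolding t_def using k by (intro real_sqrt_pow2 divide_nonneg_nonneg) auto
  have tp: "t\<^sup>2 > 0" unfolding t2 using k by (intro divide_pos_pos) auto
  have "0 \<le> (b * t + k * t\<^sup>2 + m * t ^ 3 + r * t ^ 4) + (b * (-t) + k * (-t)\<^sup>2 + m * (-t) ^ 3 + r * (-t) ^ 4)"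
    using assms[of t] assms[of "-t"] by linarith
  also have "\<dots> = 2 * t\<^sup>2 * (k + r * t\<^sup>2)" by (simp add: power2_eq_square power3_eq_cube power4_eq_xxxx algebra_simps)
  finally have "0 \<le> k + r * t\<^sup>2" using tp by (simp add: zero_le_mult_iff)
  moreover have "r * t\<^sup>2 \<le> - k / 2"
  proof -
    have "r * t\<^sup>2 \<le> (\<bar>r\<bar> + 1) * t\<^sup>2" using tp by (intro mult_right_mono) auto
    also have "\<dots> = - k / 2" unfolding t2 by (simp add: field_simps)
    finally show ?thesis .
  qed
  ultimately show False using k by linarith
qed

definition fieldop :: "nat \<Rightarrow> site set \<Rightarrow> nat \<Rightarrow> (site \<Rightarrow> real) \<Rightarrow> obs" where
  "fieldop n V a f = (\<lambda>\<sigma> \<tau>. \<Sum>x\<in>V. of_real (f x) * site_op x (spin n a) \<sigma> \<tau>)"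

lemma fieldop_adj: "opadj (fieldop n V a f) = fieldop n V a f"
proof -
  have "cnj (site_op x (spin n a) \<tau> \<sigma>) = site_op x (spin n a) \<sigma> \<tau>" for x \<sigma> \<tau>
    using opadj_site[of x n a] unfolding opadj_def fun_eq_iff by blast
  then show ?thesis by (simp add: opadj_def fieldop_def)
qed

lemma adj_herm: "opadj A = A \<Longrightarrow> herm_on X A"
  unfolding herm_on_def opadj_def by metis

text \<open>The signless Laplacian of \<open>g\<close>: the coefficient of the first spin component
  at \<open>x\<close> when the field \<open>g\<close> is switched on to first order.\<close>

definition dfield :: "site set \<Rightarrow> (site \<Rightarrow> site \<Rightarrow> bool) \<Rightarrow> (site \<Rightarrow> real) \<Rightarrow> site \<Rightarrow> real" where
  "dfield V nb g x = (\<Sum>y\<in>{y\<in>V. nb x y}. g x + g y)"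

text \<open>The constant of second order in the field. One factor 1/2 comes from the completed
  square, the other from counting ordered pairs.\<close>

definition gfield :: "site set \<Rightarrow> (site \<Rightarrow> site \<Rightarrow> bool) \<Rightarrow> (site \<Rightarrow> real) \<Rightarrow> real" where
  "gfield V nb g = (\<Sum>x\<in>V. \<Sum>y\<in>{y\<in>V. nb x y}. (g x + g y)\<^sup>2) / 4"

lemma sum_nb_swap:
  assumes fin: "finite V" and sym: "\<And>x y. x \<in> V \<Longrightarrow> y \<in> V \<Longrightarrow> nb x y \<Longrightarrow> nb y x"
  shows "(\<Sum>x\<in>V. \<Sum>y\<in>{y\<in>V. nb x y}. f x y) = (\<Sum>x\<in>V. \<Sum>y\<in>{y\<in>V. nb x y}. f y x)"
proof -
  have "(\<Sum>x\<in>V. \<Sum>y\<in>{y\<in>V. nb x y}. f x y) = (\<Sum>x\<in>V. \<Sum>y\<in>V. if nb x y then f x y else 0)"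
    by (intro sum.cong refl sum.inter_filter fin)
  also have "\<dots> = (\<Sum>y\<in>V. \<Sum>x\<in>V. if nb x y then f x y else 0)" by (rule sum.swap)
  also have "\<dots> = (\<Sum>y\<in>V. \<Sum>x\<in>V. if nb y x then f x y else 0)"
    using sym by (intro sum.cong refl) metis
  also have "\<dots> = (\<Sum>x\<in>V. \<Sum>y\<in>{y\<in>V. nb x y}. f y x)"
    by (intro sum.cong refl sum.inter_filter[symmetric] fin)
  finally show ?thesis .
qed

text \<open>The field enters quadratically, so this expansion is exact. Exchanging x and y
  identifies the two linear sums, and their doubling cancels the factor 1/2.\<close>

lemma Hfield_shift:
  assumes fin: "finite V" and sym: "\<And>x y. x \<in> V \<Longrightarrow> y \<in> V \<Longrightarrow> nb x y \<Longrightarrow> nb y x"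
  shows "Hfield n V nb B (\<lambda>x. t * g x) = (\<lambda>\<sigma> \<tau>. Hfield n V nb B (\<lambda>_. 0) \<sigma> \<tau>
     + of_real t * fieldop n V 1 (dfield V nb g) \<sigma> \<tau> + of_real (t\<^sup>2 * gfield V nb g) * opid \<sigma> \<tau>)"
proof (intro ext)
  fix \<sigma> \<tau>
  let ?S = "\<lambda>x. site_op x (spin n 1) \<sigma> \<tau>"
  have b: "bond n (\<lambda>x. t * g x) x y \<sigma> \<tau> = bond n (\<lambda>_. 0) x y \<sigma> \<tau> + of_real t * (of_real (g x + g y) * ?S x)
      + of_real t * (of_real (g y + g x) * ?S y) + of_real (t\<^sup>2) * of_real ((g x + g y)\<^sup>2) / 2 * opid \<sigma> \<tau>" for x y
    by (simp add: bond_def algebra_simps power2_eq_square add_divide_distrib)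
  have "(\<Sum>x\<in>V. \<Sum>y\<in>{y\<in>V. nb x y}. bond n (\<lambda>x. t * g x) x y \<sigma> \<tau>) = (\<Sum>x\<in>V. \<Sum>y\<in>{y\<in>V. nb x y}. bond n (\<lambda>_. 0) x y \<sigma> \<tau>)
     + of_real t * (\<Sum>x\<in>V. \<Sum>y\<in>{y\<in>V. nb x y}. of_real (g x + g y) * ?S x)
     + of_real t * (\<Sum>x\<in>V. \<Sum>y\<in>{y\<in>V. nb x y}. of_real (g y + g x) * ?S y)
     + of_real (t\<^sup>2) * of_real (\<Sum>x\<in>V. \<Sum>y\<in>{y\<in>V. nb x y}. (g x + g y)\<^sup>2) / 2 * opid \<sigma> \<tau>"
    unfolding b sum.distrib sum_distrib_left sum_distrib_right sum_divide_distrib of_real_sum ..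
  also have "(\<Sum>x\<in>V. \<Sum>y\<in>{y\<in>V. nb x y}. of_real (g y + g x) * ?S y) = (\<Sum>x\<in>V. \<Sum>y\<in>{y\<in>V. nb x y}. of_real (g x + g y) * ?S x)"
    by (rule sum_nb_swap[OF fin sym])
  also have "(\<Sum>x\<in>V. \<Sum>y\<in>{y\<in>V. nb x y}. of_real (g x + g y) * ?S x) = fieldop n V 1 (dfield V nb g) \<sigma> \<tau>"
    unfolding fieldop_def dfield_def of_real_sum sum_distrib_right ..
  finally show "Hfield n V nb B (\<lambda>x. t * g x) \<sigma> \<tau> = Hfield n V nb B (\<lambda>_. 0) \<sigma> \<tau>
     + of_real t * fieldop n V 1 (dfield V nb g) \<sigma> \<tau> + of_real (t\<^sup>2 * gfield V nb g) * opid \<sigma> \<tau>"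
    unfolding Hfield_def gfield_def by (simp add: algebra_simps)
qed

lemma kapply_ker_add: "kapply X (\<lambda>\<sigma> \<tau>. A \<sigma> \<tau> + B \<sigma> \<tau>) v = (\<lambda>x. kapply X A v x + kapply X B v x)"
  by (simp add: kapply_def sum.distrib algebra_simps)

lemma kapply_ker_scale: "kapply X (\<lambda>\<sigma> \<tau>. c * A \<sigma> \<tau>) v = (\<lambda>x. c * kapply X A v x)"
  by (simp add: kapply_def sum_distrib_left algebra_simps)

lemma opid_rid: "opid = rid" by (simp add: opid_def rid_def)

text \<open>Second order perturbation theory: the trial vector \<open>\<psi> + t s Q \<psi>\<close> in the bound for the field \<open>t g\<close>, to order \<open>t\<^sup>2\<close>.\<close>
lemma susceptibility_bound:
  assumes X: "finite X" and H: "herm_on X H" and Q: "herm_on X Q"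
    and \<psi>: "cinn X \<psi> \<psi> = 1" "\<forall>\<sigma>\<in>X. kapply X H \<psi> \<sigma> = complex_of_real E * \<psi> \<sigma>"
    and dom: "\<And>t \<phi>. E * Re (cinn X \<phi> \<phi>) \<le> Re (ev X \<phi> (\<lambda>\<sigma> \<tau>. H \<sigma> \<tau> + of_real t * Q \<sigma> \<tau> + of_real (t\<^sup>2 * G) * rid \<sigma> \<tau>))"
  defines "u \<equiv> kapply X Q \<psi>"
  shows "0 \<le> s\<^sup>2 * (Re (cinn X u (kapply X H u)) - E * Re (cinn X u u)) + 2 * s * Re (cinn X u u) + G"
proof -
  define b where "b = Re (cinn X \<psi> u)"
  define q where "q = Re (cinn X u u)"
  define c where "c = Re (cinn X u (kapply X Q u))"
  define a where "a = Re (cinn X u (kapply X H u)) - E * q"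
  \<comment> \<open>The order 0 cancels because \<psi> has energy E. The first order need not
    vanish, but it is odd in t and drops out.\<close>
  have "0 \<le> b * t + (s\<^sup>2 * a + 2 * s * q + G) * t\<^sup>2 + (s\<^sup>2 * c + 2 * s * b * G) * t ^ 3 + (s\<^sup>2 * q * G) * t ^ 4" for t
  proof -
    define \<phi> where "\<phi> = (\<lambda>x. \<psi> x + of_real (t * s) * u x)"
    have bu: "Re (cinn X u \<psi>) = b" unfolding b_def by (subst cinn_cnj) simp
    have nrm: "Re (cinn X \<phi> \<phi>) = 1 + 2 * (t * s) * b + (t * s)\<^sup>2 * q"
      unfolding \<phi>_def cinn_add cinn_scale \<psi>(1) using bu by (simp add: b_def q_def power2_eq_square algebra_simps)
    have H1: "cinn X w (kapply X H \<psi>) = of_real E * cinn X w \<psi>" for w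
      by (subst cinn_scale(1)[symmetric], rule cinn_cong) (use \<psi>(2) in auto)
    have H2: "cinn X \<psi> (kapply X H u) = of_real E * cinn X \<psi> u"
      using H1[of u] unfolding herm_kapply[OF H, of \<psi> u] by (subst cinn_cnj, subst (2) cinn_cnj) simp
    have Hex: "Re (cinn X \<phi> (kapply X H \<phi>)) = E * (1 + 2 * (t * s) * b) + (t * s)\<^sup>2 * (a + E * q)"
      unfolding \<phi>_def kapply_add kapply_scale cinn_add cinn_scale H1 H2 \<psi>(1) using bu
      by (simp add: b_def a_def power2_eq_square algebra_simps)
    have Q2: "cinn X \<psi> (kapply X Q u) = cinn X u u" unfolding herm_kapply[OF Q] by (simp add: u_def)
    have Qex: "Re (cinn X \<phi> (kapply X Q \<phi>)) = b + 2 * (t * s) * q + (t * s)\<^sup>2 * c"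
      unfolding \<phi>_def kapply_add kapply_scale cinn_add cinn_scale Q2 u_def[symmetric]
      by (simp add: b_def q_def c_def power2_eq_square algebra_simps)
    have "Re (ev X \<phi> (\<lambda>\<sigma> \<tau>. H \<sigma> \<tau> + of_real t * Q \<sigma> \<tau> + of_real (t\<^sup>2 * G) * rid \<sigma> \<tau>))
      = Re (cinn X \<phi> (kapply X H \<phi>)) + t * Re (cinn X \<phi> (kapply X Q \<phi>)) + t\<^sup>2 * G * Re (cinn X \<phi> \<phi>)"
      unfolding ev_def kapply_ker_add kapply_ker_scale cinn_add cinn_scale cinn_kapply_rid[OF X] by simp
    with dom[of \<phi> t] have "0 \<le> (E * (1 + 2 * (t * s) * b) + (t * s)\<^sup>2 * (a + E * q)) + t * (b + 2 * (t * s) * q + (t * s)\<^sup>2 * c)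
        + t\<^sup>2 * G * (1 + 2 * (t * s) * b + (t * s)\<^sup>2 * q) - E * (1 + 2 * (t * s) * b + (t * s)\<^sup>2 * q)"
      unfolding nrm Hex Qex by linarith
    also have "\<dots> = b * t + (s\<^sup>2 * a + 2 * s * q + G) * t\<^sup>2 + (s\<^sup>2 * c + 2 * s * b * G) * t ^ 3 + (s\<^sup>2 * q * G) * t ^ 4"
      by (simp add: power2_eq_square power3_eq_cube power4_eq_xxxx algebra_simps)
    finally show ?thesis .
  qed
  from even_coefficient_nonneg[OF this] show ?thesis by (simp add: a_def q_def)
qed

lemma ev_linear:
  "ev X v (\<lambda>\<sigma> \<tau>. A \<sigma> \<tau> + B \<sigma> \<tau>) = ev X v A + ev X v B"
  "ev X v (\<lambda>\<sigma> \<tau>. c * A \<sigma> \<tau>) = c * ev X v A"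
  by (simp_all add: ev_def kapply_ker_add kapply_ker_scale cinn_add cinn_scale)

lemma ev_diff: "ev X v (\<lambda>\<sigma> \<tau>. A \<sigma> \<tau> - B \<sigma> \<tau>) = ev X v A - ev X v B"
  using ev_linear(1)[of X v A "\<lambda>\<sigma> \<tau>. (-1) * B \<sigma> \<tau>"] ev_linear(2)[of X v "-1" B] by simp

lemma cinn_adj: "cinn X u (kapply X (opadj A) v) = cinn X (kapply X A u) v"
proof -
  have "cinn X u (kapply X (opadj A) v) = (\<Sum>x\<in>X. \<Sum>y\<in>X. cnj (u x) * cnj (A y x) * v y)"
    by (simp add: cinn_def kapply_def sum_distrib_left mult.assoc opadj_def)
  also have "\<dots> = (\<Sum>y\<in>X. \<Sum>x\<in>X. cnj (u x) * cnj (A y x) * v y)"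
    by (rule sum.swap)
  also have "\<dots> = cinn X (kapply X A u) v"
    by (simp add: cinn_def kapply_def sum_distrib_right sum_distrib_left mult_ac)
  finally show ?thesis .
qed

lemma local_state_fv_gs:
  assumes "finite G" "herm_on (configs n G) H"
  shows "local_state n G (fv_gs n G H)"
proof -
  let ?X = "configs n G"
  obtain I :: "nat set" and e where I: "finite I" "I \<noteq> {}"
    and on: "\<forall>i\<in>I. \<forall>j\<in>I. cinn ?X (e i) (e j) = (if i = j then 1 else 0)"
    and ex: "\<forall>A. fv_gs n G H A = (\<Sum>i\<in>I. ev ?X (e i) A) / of_nat (card I)"
    by (rule fv_gs_expand[OF assms]) blast
  have c: "card I > 0" using I by (simp add: card_gt_0_iff)
  show ?thesis
    unfolding local_state_def ex[rule_format]
  proof (intro conjI allI impI)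
    fix A B assume "kernel_eq ?X A B"
    then have "ev ?X (e i) A = ev ?X (e i) B" for i
      unfolding ev_def kernel_eq_def by (intro cinn_cong kapply_cong) auto
    then show "(\<Sum>i\<in>I. ev ?X (e i) A) / of_nat (card I) = (\<Sum>i\<in>I. ev ?X (e i) B) / of_nat (card I)" by simp
  next
    fix A B show "(\<Sum>i\<in>I. ev ?X (e i) (\<lambda>\<sigma> \<tau>. A \<sigma> \<tau> + B \<sigma> \<tau>)) / of_nat (card I) = (\<Sum>i\<in>I. ev ?X (e i) A) / of_nat (card I) + (\<Sum>i\<in>I. ev ?X (e i) B) / of_nat (card I)"
      by (simp add: ev_linear sum.distrib add_divide_distrib)
  next
    fix c A show "(\<Sum>i\<in>I. ev ?X (e i) (\<lambda>\<sigma> \<tau>. c * A \<sigma> \<tau>)) / of_nat (card I) = c * ((\<Sum>i\<in>I. ev ?X (e i) A) / of_nat (card I))"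
      by (simp add: ev_linear sum_distrib_left)
  next
    fix A
    have *: "ev ?X v (opmult n G (opadj A) A) = cinn ?X (kapply ?X A v) (kapply ?X A v)" for v
      unfolding ev_def kapply_opmult cinn_adj ..
    have "(\<Sum>i\<in>I. ev ?X (e i) (opmult n G (opadj A) A)) / of_nat (card I) = of_real ((\<Sum>i\<in>I. Re (cinn ?X (kapply ?X A (e i)) (kapply ?X A (e i)))) / real (card I))"
      unfolding * by (subst cinn_self_Re) simp
    then show "Im ((\<Sum>i\<in>I. ev ?X (e i) (opmult n G (opadj A) A)) / of_nat (card I)) = 0"
      "0 \<le> Re ((\<Sum>i\<in>I. ev ?X (e i) (opmult n G (opadj A) A)) / of_nat (card I))"
      by (simp_all add: divide_nonneg_nonneg sum_nonneg cinn_self_nonneg del: of_real_divide of_real_sum)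
  next
    show "(\<Sum>i\<in>I. ev ?X (e i) opid) / of_nat (card I) = 1"
      using c on unfolding ev_def opid_rid cinn_kapply_rid[OF finite_configs[OF assms(1)]] by simp
  qed
qed

text \<open>The quadratic polynomial in \<open>s\<close> of the previous lemma is averaged over an orthonormal basis of ground vectors.
  Its leading coefficient is the expectation of \<open>1/2 [Q, [H, Q]]\<close>.\<close>
lemma fv_gs_fluctuation:
  assumes V: "finite V" and H: "herm_on (configs n V) H" and Q: "opadj Q = Q"
    and dom: "\<And>t \<phi>. gs_energy n V H * Re (cinn (configs n V) \<phi> \<phi>) \<le> Re (ev (configs n V) \<phi> (\<lambda>\<sigma> \<tau>. H \<sigma> \<tau> + of_real t * Q \<sigma> \<tau> + of_real (t\<^sup>2 * G) * rid \<sigma> \<tau>))"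
  shows "(Re (fv_gs n V H (opmult n V Q Q)))\<^sup>2 \<le> Re (fv_gs n V H (opcomm n V Q (opcomm n V H Q))) / 2 * G"
proof -
  let ?X = "configs n V"
  define E where "E = gs_energy n V H"
  have X: "finite ?X" by (rule finite_configs[OF V])
  obtain I :: "nat set" and e where I: "finite I" "I \<noteq> {}"
    and on: "\<forall>i\<in>I. \<forall>j\<in>I. cinn ?X (e i) (e j) = (if i = j then 1 else 0)"
    and gs: "\<forall>i\<in>I. \<forall>\<sigma>\<in>?X. kapply ?X H (e i) \<sigma> = complex_of_real E * e i \<sigma>"
    and ex: "\<forall>A. fv_gs n V H A = (\<Sum>i\<in>I. ev ?X (e i) A) / of_nat (card I)"
    unfolding E_def by (rule fv_gs_expand[OF V H])
  have c: "real (card I) > 0" using I by (simp add: card_gt_0_iff)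
  have hQ: "herm_on ?X Q" by (rule adj_herm[OF Q])
  define a where "a i = Re (cinn ?X (kapply ?X Q (e i)) (kapply ?X H (kapply ?X Q (e i)))) - E * Re (cinn ?X (kapply ?X Q (e i)) (kapply ?X Q (e i)))" for i
  define q where "q i = Re (cinn ?X (kapply ?X Q (e i)) (kapply ?X Q (e i)))" for i
  have quad: "0 \<le> s\<^sup>2 * a i + 2 * s * q i + G" if "i \<in> I" for i s
    unfolding a_def q_def using susceptibility_bound[OF X H hQ, of "e i" E G s] on gs dom that unfolding E_def by auto
  have qQ: "ev ?X (e i) (opmult n V Q Q) = cinn ?X (kapply ?X Q (e i)) (kapply ?X Q (e i))" for i
    unfolding ev_def kapply_opmult by (subst herm_kapply[OF hQ]) simp
  \<comment> \<open>In two of the four terms H stands at an outer position and acts on the ground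
    vector as the number E.\<close>
  have DC: "Re (ev ?X (e i) (opcomm n V Q (opcomm n V H Q))) = 2 * a i" if i: "i \<in> I" for i
  proof -
    have eq: "opcomm n V Q (opcomm n V H Q) = (\<lambda>\<sigma> \<tau>. (opmult n V Q (opmult n V H Q) \<sigma> \<tau> + opmult n V (opmult n V Q H) Q \<sigma> \<tau>) - (opmult n V Q (opmult n V Q H) \<sigma> \<tau> + opmult n V (opmult n V H Q) Q \<sigma> \<tau>))"
    proof -
      have 1: "opcomm n V H Q = (\<lambda>\<sigma> \<tau>. opmult n V H Q \<sigma> \<tau> + (-1) * opmult n V Q H \<sigma> \<tau>)" by (simp add: opcomm_def)
      show ?thesis unfolding opcomm_def[of n V Q] unfolding 1 opmult_add opmult_scale by (simp add: algebra_simps fun_eq_iff)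
    qed
    have g: "cinn ?X w (kapply ?X H (e i)) = of_real E * cinn ?X w (e i)" for w
      by (subst cinn_scale(1)[symmetric], rule cinn_cong) (use gs i in auto)
    have g': "cinn ?X (kapply ?X H (e i)) w = of_real E * cinn ?X (e i) w" for w
      by (subst cinn_cnj, unfold g, subst (2) cinn_cnj) simp
    have gc: "kapply ?X Q (kapply ?X H (e i)) = kapply ?X Q (\<lambda>\<sigma>. of_real E * e i \<sigma>)"
      using gs i by (intro ext kapply_cong) auto
    have t1: "ev ?X (e i) (opmult n V Q (opmult n V H Q)) = cinn ?X (kapply ?X Q (e i)) (kapply ?X H (kapply ?X Q (e i)))"
      unfolding ev_def kapply_opmult by (subst herm_kapply[OF hQ]) simp
    have t2: "ev ?X (e i) (opmult n V (opmult n V Q H) Q) = cinn ?X (kapply ?X Q (e i)) (kapply ?X H (kapply ?X Q (e i)))"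
      unfolding ev_def kapply_opmult by (subst herm_kapply[OF hQ]) simp
    have t3: "ev ?X (e i) (opmult n V Q (opmult n V Q H)) = of_real E * cinn ?X (kapply ?X Q (e i)) (kapply ?X Q (e i))"
      unfolding ev_def kapply_opmult gc kapply_scale cinn_scale by (subst herm_kapply[OF hQ]) simp
    have t4: "ev ?X (e i) (opmult n V (opmult n V H Q) Q) = of_real E * cinn ?X (kapply ?X Q (e i)) (kapply ?X Q (e i))"
      unfolding ev_def kapply_opmult by (subst herm_kapply[OF H], unfold g', subst herm_kapply[OF hQ]) simp
    show ?thesis unfolding eq ev_diff ev_linear t1 t2 t3 t4 a_def by simp
  qed
  have RQ: "Re (fv_gs n V H (opmult n V Q Q)) = (\<Sum>i\<in>I. q i) / real (card I)"
    unfolding ex[rule_format] qQ q_def by simp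
  have RD: "Re (fv_gs n V H (opcomm n V Q (opcomm n V H Q))) = 2 * (\<Sum>i\<in>I. a i) / real (card I)"
    unfolding ex[rule_format] using DC by (simp add: sum_distrib_left)
  \<comment> \<open>Using the discriminant in \<open>s\<close> avoids dividing by the leading
    coefficient, which may be 0.\<close>
  have "0 \<le> G + 2 * ((\<Sum>i\<in>I. q i) / real (card I)) * s + ((\<Sum>i\<in>I. a i) / real (card I)) * s\<^sup>2" for s
  proof -
    have "0 \<le> (\<Sum>i\<in>I. s\<^sup>2 * a i + 2 * s * q i + G)" using quad by (intro sum_nonneg) auto
    also have "\<dots> = s\<^sup>2 * (\<Sum>i\<in>I. a i) + 2 * s * (\<Sum>i\<in>I. q i) + real (card I) * G"
      by (simp add: sum.distrib sum_distrib_left)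
    finally have "0 \<le> (s\<^sup>2 * (\<Sum>i\<in>I. a i) + 2 * s * (\<Sum>i\<in>I. q i) + real (card I) * G) / real (card I)"
      using c by simp
    also have "\<dots> = G + 2 * ((\<Sum>i\<in>I. q i) / real (card I)) * s + ((\<Sum>i\<in>I. a i) / real (card I)) * s\<^sup>2"
      using c by (simp add: field_simps)
    finally show ?thesis .
  qed
  from nonneg_quadratic_discriminant[OF this] have "(2 * ((\<Sum>i\<in>I. q i) / real (card I)))\<^sup>2 \<le> 4 * (((\<Sum>i\<in>I. a i) / real (card I)) * G)"
    by (simp only: mult_ac)
  then have "((\<Sum>i\<in>I. q i) / real (card I))\<^sup>2 \<le> ((\<Sum>i\<in>I. a i) / real (card I)) * G"
    unfolding power_mult_distrib by simp
  then show ?thesis unfolding RQ RD by simp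
qed

section \<open>Commutators of local operators\<close>

lemma opcomm_kernel_eq0:
  assumes "kernel_eq (configs n V) (opmult n V A B) (opmult n V B A)"
  shows "kernel_eq (configs n V) (opcomm n V A B) (\<lambda>\<sigma> \<tau>. 0)"
  using assms by (simp add: kernel_eq_def opcomm_def)

lemma opcomm_sum_right: "opcomm n V A (\<lambda>\<sigma> \<tau>. \<Sum>i\<in>I. c i * D i \<sigma> \<tau>) = (\<lambda>\<sigma> \<tau>. \<Sum>i\<in>I. c i * opcomm n V A (D i) \<sigma> \<tau>)"
  unfolding opcomm_def opmult_sum_left opmult_sum_right by (simp add: sum_subtractf right_diff_distrib)

lemma opcomm_sum_left: "opcomm n V (\<lambda>\<sigma> \<tau>. \<Sum>i\<in>I. c i * D i \<sigma> \<tau>) A = (\<lambda>\<sigma> \<tau>. \<Sum>i\<in>I. c i * opcomm n V (D i) A \<sigma> \<tau>)"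
  unfolding opcomm_def opmult_sum_left opmult_sum_right by (simp add: sum_subtractf right_diff_distrib)

lemma opcomm_add: "opcomm n V (\<lambda>\<sigma> \<tau>. A \<sigma> \<tau> + B \<sigma> \<tau>) C = (\<lambda>\<sigma> \<tau>. opcomm n V A C \<sigma> \<tau> + opcomm n V B C \<sigma> \<tau>)"
  "opcomm n V C (\<lambda>\<sigma> \<tau>. A \<sigma> \<tau> + B \<sigma> \<tau>) = (\<lambda>\<sigma> \<tau>. opcomm n V C A \<sigma> \<tau> + opcomm n V C B \<sigma> \<tau>)"
  unfolding opcomm_def opmult_add by (simp_all add: algebra_simps)

lemma opcomm_scale: "opcomm n V (\<lambda>\<sigma> \<tau>. c * A \<sigma> \<tau>) C = (\<lambda>\<sigma> \<tau>. c * opcomm n V A C \<sigma> \<tau>)"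
  "opcomm n V C (\<lambda>\<sigma> \<tau>. c * A \<sigma> \<tau>) = (\<lambda>\<sigma> \<tau>. c * opcomm n V C A \<sigma> \<tau>)"
  unfolding opcomm_def opmult_scale by (simp_all add: algebra_simps)

lemma opcomm_cong: "kernel_eq (configs n G) A A' \<Longrightarrow> kernel_eq (configs n G) B B' \<Longrightarrow> kernel_eq (configs n G) (opcomm n G A B) (opcomm n G A' B')"
  using opmult_cong[of n G A A' B B'] opmult_cong[of n G B B' A A'] by (simp add: kernel_eq_def opcomm_def)

lemma site_comm:
  assumes "finite V" "x \<in> V" and c: "\<And>j k. j \<le> n \<Longrightarrow> k \<le> n \<Longrightarrow> smul n s t j k - smul n t s j k = c * r j k"
  shows "kernel_eq (configs n V) (opcomm n V (site_op x s) (site_op x t)) (\<lambda>\<sigma> \<tau>. c * site_op x r \<sigma> \<tau>)"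
  unfolding kernel_eq_def
proof (intro ballI)
  fix \<sigma> \<tau> assume st: "\<sigma> \<in> configs n V" "\<tau> \<in> configs n V"
  have "opcomm n V (site_op x s) (site_op x t) \<sigma> \<tau> = site_op x (smul n s t) \<sigma> \<tau> - site_op x (smul n t s) \<sigma> \<tau>"
    using opmult_site_same[OF assms(1,2), of n s t] opmult_site_same[OF assms(1,2), of n t s] st unfolding kernel_eq_def opcomm_def by simp
  also have "\<dots> = c * site_op x r \<sigma> \<tau>"
    unfolding site_op_def using c[OF configs_le[OF st(1), of x] configs_le[OF st(2), of x]] by auto
  finally show "opcomm n V (site_op x s) (site_op x t) \<sigma> \<tau> = c * site_op x r \<sigma> \<tau>" .
qed

lemma pair_comm:
  assumes "finite V" "x \<in> V" "x \<noteq> y" and c: "\<And>j k. j \<le> n \<Longrightarrow> k \<le> n \<Longrightarrow> smul n t s j k - smul n s t j k = c * r j k"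
  shows "kernel_eq (configs n V) (opcomm n V (pair_op x t y u) (site_op x s)) (\<lambda>\<sigma> \<tau>. c * pair_op x r y u \<sigma> \<tau>)"
  unfolding kernel_eq_def
proof (intro ballI)
  fix \<sigma> \<tau> assume st: "\<sigma> \<in> configs n V" "\<tau> \<in> configs n V"
  have "opcomm n V (pair_op x t y u) (site_op x s) \<sigma> \<tau> = pair_op x (smul n t s) y u \<sigma> \<tau> - pair_op x (smul n s t) y u \<sigma> \<tau>"
    using opmult_site_pair[OF assms(1-3), of n s t u] opmult_pair_site[OF assms(1-3), of n t u s] st unfolding kernel_eq_def opcomm_def by simp
  also have "\<dots> = c * pair_op x r y u \<sigma> \<tau>"
  proof (cases "\<forall>z. z \<noteq> x \<and> z \<noteq> y \<longrightarrow> \<sigma> z = \<tau> z")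
    case True
    have "smul n t s (\<sigma> x) (\<tau> x) * u (\<sigma> y) (\<tau> y) - smul n s t (\<sigma> x) (\<tau> x) * u (\<sigma> y) (\<tau> y) = (c * r (\<sigma> x) (\<tau> x)) * u (\<sigma> y) (\<tau> y)"
      unfolding left_diff_distrib[symmetric] c[OF configs_le[OF st(1), of x] configs_le[OF st(2), of x]] ..
    then show ?thesis unfolding pair_op_def if_P[OF True] by (simp add: mult.assoc)
  next
    case False
    then show ?thesis unfolding pair_op_def if_not_P[OF False] by simp
  qed
  finally show "opcomm n V (pair_op x t y u) (site_op x s) \<sigma> \<tau> = c * pair_op x r y u \<sigma> \<tau>" .
qed

lemma pair_comm_other:
  assumes "finite V" "z \<in> V" "z \<noteq> x" "z \<noteq> y"
  shows "kernel_eq (configs n V) (opcomm n V (pair_op x t y u) (site_op z s)) (\<lambda>\<sigma> \<tau>. 0)"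
  by (rule opcomm_kernel_eq0) (rule site_pair_commute[OF assms])

lemma opcomm_antisym: "opcomm n V A B \<sigma> \<tau> = - opcomm n V B A \<sigma> \<tau>"
  by (simp add: opcomm_def)

lemma sum_two:
  fixes d :: "'a \<Rightarrow> 'b::comm_monoid_add"
  assumes "finite V" "x \<in> V" "y \<in> V" "x \<noteq> y" "\<And>z. z \<in> V \<Longrightarrow> z \<noteq> x \<Longrightarrow> z \<noteq> y \<Longrightarrow> d z = 0"
  shows "(\<Sum>z\<in>V. d z) = d x + d y"
proof -
  have "(\<Sum>z\<in>V. d z) = (\<Sum>z\<in>{x, y}. d z)"
    using assms by (intro sum.mono_neutral_right) auto
  then show ?thesis using assms(4) by simp
qed

lemma spin_comm:
  assumes "j \<le> n" "k \<le> n"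
  shows "smul n (spin n 1) (spin n 2) j k - smul n (spin n 2) (spin n 1) j k = \<i> * spin n 3 j k"
    "smul n (spin n 2) (spin n 1) j k - smul n (spin n 1) (spin n 2) j k = (-\<i>) * spin n 3 j k"
    "smul n (spin n 3) (spin n 1) j k - smul n (spin n 1) (spin n 3) j k = \<i> * spin n 2 j k"
  using comm_12[OF assms] comm_31[OF assms] by (simp_all add: spin_simps algebra_simps)

lemma opcomm_fieldop: "opcomm n V K (fieldop n V a f) \<sigma> \<tau> = (\<Sum>z\<in>V. of_real (f z) * opcomm n V K (site_op z (spin n a)) \<sigma> \<tau>)"
  unfolding fieldop_def opcomm_sum_right ..

text \<open>A common rotation of both spins leaves the scalar product invariant, so only
  \<open>f x - f y\<close> can enter, once for each commutator. \<open>W\<close> is i times the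
  first component of the vector product of the two spins.\<close>

lemma double_comm_pair:
  fixes n :: nat
  assumes V: "finite V" "x \<in> V" "y \<in> V" "x \<noteq> y"
  defines "h \<equiv> \<lambda>\<sigma> \<tau>. \<Sum>a\<in>{1,2,3}. pair_op x (spin n a) y (spin n a) \<sigma> \<tau>"
  shows "kernel_eq (configs n V) (opcomm n V (fieldop n V 1 f) (opcomm n V h (fieldop n V 1 f)))
    (\<lambda>\<sigma> \<tau>. of_real (- ((f x - f y)\<^sup>2)) * (pair_op x (spin n 2) y (spin n 2) \<sigma> \<tau> + pair_op x (spin n 3) y (spin n 3) \<sigma> \<tau>))"
proof -
  let ?X = "configs n V"
  let ?p = "\<lambda>a b. pair_op x (spin n a) y (spin n b)"
  let ?Q = "fieldop n V 1 f"
  define W where "W = (\<lambda>\<sigma> \<tau>. \<i> * ?p 2 3 \<sigma> \<tau> + (-\<i>) * ?p 3 2 \<sigma> \<tau>)"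
  have V': "finite V" "y \<in> V" "y \<noteq> x" using V by auto
  have h: "h = (\<lambda>\<sigma> \<tau>. ?p 1 1 \<sigma> \<tau> + (?p 2 2 \<sigma> \<tau> + ?p 3 3 \<sigma> \<tau>))"
    by (simp add: h_def add.assoc)
  have 11: "smul n (spin n 1) (spin n 1) j k - smul n (spin n 1) (spin n 1) j k = 0 * spin n 1 j k" for j k by simp
  have px: "kernel_eq ?X (opcomm n V (?p 1 b) (site_op x (spin n 1))) (\<lambda>\<sigma> \<tau>. 0 * ?p 1 b \<sigma> \<tau>)"
    "kernel_eq ?X (opcomm n V (?p 2 b) (site_op x (spin n 1))) (\<lambda>\<sigma> \<tau>. (-\<i>) * ?p 3 b \<sigma> \<tau>)"
    "kernel_eq ?X (opcomm n V (?p 3 b) (site_op x (spin n 1))) (\<lambda>\<sigma> \<tau>. \<i> * ?p 2 b \<sigma> \<tau>)" for b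
    using pair_comm[OF V(1,2,4) 11] pair_comm[OF V(1,2,4) spin_comm(2)] pair_comm[OF V(1,2,4) spin_comm(3)] by blast+
  have py: "kernel_eq ?X (opcomm n V (?p b 1) (site_op y (spin n 1))) (\<lambda>\<sigma> \<tau>. 0 * ?p b 1 \<sigma> \<tau>)"
    "kernel_eq ?X (opcomm n V (?p b 2) (site_op y (spin n 1))) (\<lambda>\<sigma> \<tau>. (-\<i>) * ?p b 3 \<sigma> \<tau>)"
    "kernel_eq ?X (opcomm n V (?p b 3) (site_op y (spin n 1))) (\<lambda>\<sigma> \<tau>. \<i> * ?p b 2 \<sigma> \<tau>)" for b
    unfolding pair_op_sym[of x]
    using pair_comm[OF V' 11] pair_comm[OF V' spin_comm(2)] pair_comm[OF V' spin_comm(3)] by blast+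
  have pz: "kernel_eq ?X (opcomm n V (?p a b) (site_op z (spin n 1))) (\<lambda>\<sigma> \<tau>. 0)" if "z \<in> V" "z \<noteq> x" "z \<noteq> y" for z a b
    by (rule pair_comm_other[OF V(1) that])
  have hQ: "kernel_eq ?X (opcomm n V h ?Q) (\<lambda>\<sigma> \<tau>. of_real (f x - f y) * W \<sigma> \<tau>)"
    unfolding kernel_eq_def
  proof (intro ballI)
    fix \<sigma> \<tau> assume st: "\<sigma> \<in> ?X" "\<tau> \<in> ?X"
    have e: "opcomm n V h (site_op z (spin n 1)) \<sigma> \<tau> = opcomm n V (?p 1 1) (site_op z (spin n 1)) \<sigma> \<tau> + (opcomm n V (?p 2 2) (site_op z (spin n 1)) \<sigma> \<tau> + opcomm n V (?p 3 3) (site_op z (spin n 1)) \<sigma> \<tau>)" for z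
      unfolding h opcomm_add ..
    have x: "opcomm n V h (site_op x (spin n 1)) \<sigma> \<tau> = W \<sigma> \<tau>"
      unfolding e W_def using px[unfolded kernel_eq_def] st by simp
    have y: "opcomm n V h (site_op y (spin n 1)) \<sigma> \<tau> = - W \<sigma> \<tau>"
      unfolding e W_def using py[unfolded kernel_eq_def] st by simp
    have z: "opcomm n V h (site_op z (spin n 1)) \<sigma> \<tau> = 0" if "z \<in> V" "z \<noteq> x" "z \<noteq> y" for z
      unfolding e using pz[OF that, unfolded kernel_eq_def] st by simp
    show "opcomm n V h ?Q \<sigma> \<tau> = of_real (f x - f y) * W \<sigma> \<tau>"
      unfolding opcomm_fieldop by (subst sum_two[OF V]) (simp_all add: x y z algebra_simps del: One_nat_def)
  qed
  have WQ: "kernel_eq ?X (opcomm n V W ?Q) (\<lambda>\<sigma> \<tau>. of_real (f x - f y) * (?p 2 2 \<sigma> \<tau> + ?p 3 3 \<sigma> \<tau>))"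
    unfolding kernel_eq_def
  proof (intro ballI)
    fix \<sigma> \<tau> assume st: "\<sigma> \<in> ?X" "\<tau> \<in> ?X"
    have e: "opcomm n V W (site_op z (spin n 1)) \<sigma> \<tau> = \<i> * opcomm n V (?p 2 3) (site_op z (spin n 1)) \<sigma> \<tau> + (-\<i>) * opcomm n V (?p 3 2) (site_op z (spin n 1)) \<sigma> \<tau>" for z
      unfolding W_def opcomm_add opcomm_scale ..
    have x: "opcomm n V W (site_op x (spin n 1)) \<sigma> \<tau> = ?p 2 2 \<sigma> \<tau> + ?p 3 3 \<sigma> \<tau>"
      unfolding e using px[unfolded kernel_eq_def] st by (simp add: algebra_simps flip: mult.assoc)
    have y: "opcomm n V W (site_op y (spin n 1)) \<sigma> \<tau> = - (?p 2 2 \<sigma> \<tau> + ?p 3 3 \<sigma> \<tau>)"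
      unfolding e using py[unfolded kernel_eq_def] st by (simp add: algebra_simps flip: mult.assoc)
    have z: "opcomm n V W (site_op z (spin n 1)) \<sigma> \<tau> = 0" if "z \<in> V" "z \<noteq> x" "z \<noteq> y" for z
      unfolding e using pz[OF that, unfolded kernel_eq_def] st by simp
    show "opcomm n V W ?Q \<sigma> \<tau> = of_real (f x - f y) * (?p 2 2 \<sigma> \<tau> + ?p 3 3 \<sigma> \<tau>)"
      unfolding opcomm_fieldop by (subst sum_two[OF V]) (simp_all add: x y z algebra_simps del: One_nat_def)
  qed
  have "kernel_eq ?X (opcomm n V ?Q (opcomm n V h ?Q)) (opcomm n V ?Q (\<lambda>\<sigma> \<tau>. of_real (f x - f y) * W \<sigma> \<tau>))"
    by (rule opcomm_cong[OF kernel_eq_refl hQ])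
  moreover have "opcomm n V ?Q (\<lambda>\<sigma> \<tau>. of_real (f x - f y) * W \<sigma> \<tau>) \<sigma> \<tau> = - of_real (f x - f y) * opcomm n V W ?Q \<sigma> \<tau>" for \<sigma> \<tau>
    unfolding opcomm_scale by (subst opcomm_antisym) (simp add: algebra_simps)
  moreover have "complex_of_real (- (d\<^sup>2)) * z = - of_real d * (of_real d * z)" for d z by (simp add: power2_eq_square)
  ultimately show ?thesis using WQ unfolding kernel_eq_def by presburger
qed

text \<open>The magnetic term is not invariant under rotation, so it costs \<open>f x\<close> itself
  instead of a difference. This is harmless because it always comes with the factor B.\<close>

lemma double_comm_site:
  assumes V: "finite V" "x \<in> V"
  shows "kernel_eq (configs n V) (opcomm n V (fieldop n V 1 f) (opcomm n V (site_op x (spin n 3)) (fieldop n V 1 f)))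
    (\<lambda>\<sigma> \<tau>. of_real (- ((f x)\<^sup>2)) * site_op x (spin n 3) \<sigma> \<tau>)"
proof -
  let ?X = "configs n V"
  let ?Q = "fieldop n V 1 f"
  have one: "kernel_eq ?X (opcomm n V (site_op x s) ?Q) (\<lambda>\<sigma> \<tau>. of_real (f x) * (c * site_op x r \<sigma> \<tau>))"
    if c: "\<And>j k. j \<le> n \<Longrightarrow> k \<le> n \<Longrightarrow> smul n s (spin n 1) j k - smul n (spin n 1) s j k = c * r j k" for s c r
    unfolding kernel_eq_def
  proof (intro ballI)
    fix \<sigma> \<tau> assume st: "\<sigma> \<in> ?X" "\<tau> \<in> ?X"
    have z: "opcomm n V (site_op x s) (site_op z (spin n 1)) \<sigma> \<tau> = 0" if "z \<in> V" "z \<noteq> x" for z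
      using opcomm_kernel_eq0[OF site_commute[OF V that(1) that(2)[symmetric]], of n s "spin n 1"] st unfolding kernel_eq_def by blast
    have x: "opcomm n V (site_op x s) (site_op x (spin n 1)) \<sigma> \<tau> = c * site_op x r \<sigma> \<tau>"
      using site_comm[OF V c] st unfolding kernel_eq_def by blast
    have "(\<Sum>z\<in>V. of_real (f z) * opcomm n V (site_op x s) (site_op z (spin n 1)) \<sigma> \<tau>) = (\<Sum>z\<in>{x}. of_real (f z) * opcomm n V (site_op x s) (site_op z (spin n 1)) \<sigma> \<tau>)"
      using V z by (intro sum.mono_neutral_right) auto
    then show "opcomm n V (site_op x s) ?Q \<sigma> \<tau> = of_real (f x) * (c * site_op x r \<sigma> \<tau>)"
      unfolding opcomm_fieldop by (simp add: x del: One_nat_def)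
  qed
  note k3 = one[OF spin_comm(3)] and k2 = one[OF spin_comm(2)]
  have "kernel_eq ?X (opcomm n V ?Q (opcomm n V (site_op x (spin n 3)) ?Q)) (opcomm n V ?Q (\<lambda>\<sigma> \<tau>. of_real (f x) * (\<i> * site_op x (spin n 2) \<sigma> \<tau>)))"
    by (rule opcomm_cong[OF kernel_eq_refl k3])
  moreover have "opcomm n V ?Q (\<lambda>\<sigma> \<tau>. of_real (f x) * (\<i> * site_op x (spin n 2) \<sigma> \<tau>)) \<sigma> \<tau> = - (of_real (f x) * (\<i> * opcomm n V (site_op x (spin n 2)) ?Q \<sigma> \<tau>))" for \<sigma> \<tau>
    unfolding opcomm_scale by (subst opcomm_antisym) simp
  moreover have "- (of_real r * (\<i> * (of_real r * (- \<i> * z)))) = complex_of_real (- (r\<^sup>2)) * z" for r z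
    unfolding of_real_minus of_real_power using i_squared by algebra
  ultimately show ?thesis using k2 unfolding kernel_eq_def by presburger
qed

text \<open>A bond contributes two pair expectations of size at most \<open>cas n\<close>; the
  factor 1/2 for ordered pairs reduces this to the coefficient \<open>cas n\<close>.\<close>

lemma double_comm_bound:
  assumes V: "finite V" and irr: "\<And>x. x \<in> V \<Longrightarrow> \<not> nb x x" and p: "local_state n V \<phi>" and B: "0 \<le> B"
  shows "Re (\<phi> (opcomm n V (fieldop n V 1 f) (opcomm n V (Hfield n V nb B (\<lambda>_. 0)) (fieldop n V 1 f))))
    \<le> cas n * (\<Sum>x\<in>V. \<Sum>y\<in>{y\<in>V. nb x y}. (f x - f y)\<^sup>2) + B * (cas n + 1) * (\<Sum>x\<in>V. (f x)\<^sup>2)"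
proof -
  let ?Q = "fieldop n V 1 f"
  let ?h = "\<lambda>x y. (\<lambda>\<sigma> \<tau>. \<Sum>a\<in>{1,2,3}. pair_op x (spin n a) y (spin n a) \<sigma> \<tau>)"
  define D where "D K = \<phi> (opcomm n V ?Q (opcomm n V K ?Q))" for K
  have H: "Hfield n V nb B (\<lambda>_. 0) = (\<lambda>\<sigma> \<tau>. (1/2) * (\<Sum>x\<in>V. 1 * (\<Sum>y\<in>{y\<in>V. nb x y}. 1 * ?h x y \<sigma> \<tau>)) + (- of_real B) * (\<Sum>x\<in>V. stag x * site_op x (spin n 3) \<sigma> \<tau>))"
    by (simp add: Hfield_def bond_def)
  have Dsum: "D (\<lambda>\<sigma> \<tau>. \<Sum>i\<in>I. c i * K i \<sigma> \<tau>) = (\<Sum>i\<in>I. c i * D (K i))" if "finite I" for I :: "'i set" and c K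
    unfolding D_def opcomm_sum_left opcomm_sum_right by (rule local_state_lincomb[OF p that])
  have "D (Hfield n V nb B (\<lambda>_. 0)) = (1/2) * D (\<lambda>\<sigma> \<tau>. \<Sum>x\<in>V. 1 * (\<Sum>y\<in>{y\<in>V. nb x y}. 1 * ?h x y \<sigma> \<tau>)) + (- of_real B) * D (\<lambda>\<sigma> \<tau>. \<Sum>x\<in>V. stag x * site_op x (spin n 3) \<sigma> \<tau>)"
    unfolding H D_def opcomm_add opcomm_scale local_stateD(2,3)[OF p] ..
  also have "D (\<lambda>\<sigma> \<tau>. \<Sum>x\<in>V. 1 * (\<Sum>y\<in>{y\<in>V. nb x y}. 1 * ?h x y \<sigma> \<tau>)) = (\<Sum>x\<in>V. \<Sum>y\<in>{y\<in>V. nb x y}. D (?h x y))"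
    using Dsum[OF V, of "\<lambda>_. 1" "\<lambda>x \<sigma> \<tau>. \<Sum>y\<in>{y\<in>V. nb x y}. 1 * ?h x y \<sigma> \<tau>"] Dsum[of "{y\<in>V. nb _ y}" "\<lambda>_. 1" "?h _"] V by simp
  also have "D (\<lambda>\<sigma> \<tau>. \<Sum>x\<in>V. stag x * site_op x (spin n 3) \<sigma> \<tau>) = (\<Sum>x\<in>V. stag x * D (site_op x (spin n 3)))"
    by (rule Dsum[OF V])
  finally have DH: "Re (D (Hfield n V nb B (\<lambda>_. 0))) = (\<Sum>x\<in>V. \<Sum>y\<in>{y\<in>V. nb x y}. Re (D (?h x y))) / 2 - B * (\<Sum>x\<in>V. Re (stag x * D (site_op x (spin n 3))))"
    by simp
  have c: "cas n \<ge> 0" by (simp add: cas_def)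
  have b1: "Re (D (?h x y)) \<le> 2 * cas n * (f x - f y)\<^sup>2" if "x \<in> V" "y \<in> V" "nb x y" for x y
  proof -
    have ne: "x \<noteq> y" using that irr by auto
    have Dh: "D (?h x y) = of_real (- ((f x - f y)\<^sup>2)) * (\<phi> (pair_op x (spin n 2) y (spin n 2)) + \<phi> (pair_op x (spin n 3) y (spin n 3)))"
      unfolding D_def local_stateD(1)[OF p double_comm_pair[OF V that(1,2) ne]] local_stateD(2,3)[OF p] ..
    have re: "Re (complex_of_real r * z) = r * Re z" for r z by simp
    have "Re (D (?h x y)) = (f x - f y)\<^sup>2 * (- (Re (\<phi> (pair_op x (spin n 2) y (spin n 2))) + Re (\<phi> (pair_op x (spin n 3) y (spin n 3)))))"
      unfolding Dh re plus_complex.sel by (simp only: mult_minus_left mult_minus_right)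
    also have "\<dots> \<le> (f x - f y)\<^sup>2 * (2 * cas n)"
    proof (rule mult_left_mono)
      have "\<bar>Re (\<phi> (pair_op x (spin n 2) y (spin n 2)))\<bar> \<le> cas n" "\<bar>Re (\<phi> (pair_op x (spin n 3) y (spin n 3)))\<bar> \<le> cas n"
        by (rule pair_bound[OF p V that(1,2) ne]; simp)+
      then show "- (Re (\<phi> (pair_op x (spin n 2) y (spin n 2))) + Re (\<phi> (pair_op x (spin n 3) y (spin n 3)))) \<le> 2 * cas n" by linarith
    qed simp
    finally show ?thesis by (simp add: mult_ac)
  qed
  have b2: "- Re (stag x * D (site_op x (spin n 3))) \<le> (cas n + 1) * (f x)\<^sup>2" if "x \<in> V" for x
  proof -
    have "D (site_op x (spin n 3)) = of_real (- ((f x)\<^sup>2)) * \<phi> (site_op x (spin n 3))"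
      unfolding D_def local_stateD(1)[OF p double_comm_site[OF V that]] local_stateD(3)[OF p] ..
    then have "Re (D (site_op x (spin n 3))) = - ((f x)\<^sup>2 * Re (\<phi> (site_op x (spin n 3))))" by simp
    moreover have "(f x)\<^sup>2 * Re (\<phi> (site_op x (spin n 3))) \<le> (f x)\<^sup>2 * \<bar>Re (\<phi> (site_op x (spin n 3)))\<bar>"
      "(f x)\<^sup>2 * (- Re (\<phi> (site_op x (spin n 3)))) \<le> (f x)\<^sup>2 * \<bar>Re (\<phi> (site_op x (spin n 3)))\<bar>"
      by (intro mult_left_mono; simp)+
    moreover have "- Re (stag x * D (site_op x (spin n 3))) = - Re (D (site_op x (spin n 3))) \<or> - Re (stag x * D (site_op x (spin n 3))) = Re (D (site_op x (spin n 3)))"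
      using stag_cases[of x] by auto
    ultimately have "- Re (stag x * D (site_op x (spin n 3))) \<le> (f x)\<^sup>2 * \<bar>Re (\<phi> (site_op x (spin n 3)))\<bar>"
      by auto
    also have "\<dots> \<le> (f x)\<^sup>2 * (cas n + 1)" using site_bound[OF p V that, of 3] by (intro mult_left_mono) auto
    finally show ?thesis by (simp add: mult_ac)
  qed
  have "(\<Sum>x\<in>V. \<Sum>y\<in>{y\<in>V. nb x y}. Re (D (?h x y))) \<le> (\<Sum>x\<in>V. \<Sum>y\<in>{y\<in>V. nb x y}. 2 * cas n * (f x - f y)\<^sup>2)"
    using b1 by (intro sum_mono) auto
  moreover have "B * (- (\<Sum>x\<in>V. Re (stag x * D (site_op x (spin n 3))))) \<le> B * (\<Sum>x\<in>V. (cas n + 1) * (f x)\<^sup>2)"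
    unfolding sum_negf[symmetric] using b2 B by (intro mult_left_mono sum_mono) auto
  moreover have "(\<Sum>x\<in>V. \<Sum>y\<in>{y\<in>V. nb x y}. 2 * cas n * (f x - f y)\<^sup>2) = 2 * (cas n * (\<Sum>x\<in>V. \<Sum>y\<in>{y\<in>V. nb x y}. (f x - f y)\<^sup>2))"
    by (simp only: sum_distrib_left mult.assoc)
  moreover have "B * (\<Sum>x\<in>V. (cas n + 1) * (f x)\<^sup>2) = B * (cas n + 1) * (\<Sum>x\<in>V. (f x)\<^sup>2)"
    by (simp only: sum_distrib_left mult.assoc)
  ultimately show ?thesis unfolding D_def[symmetric] DH by linarith
qed

definition stagop :: "nat \<Rightarrow> site set \<Rightarrow> obs" where
  "stagop n T = (\<lambda>\<sigma> \<tau>. \<Sum>x\<in>T. stag x * site_op x (spin n 2) \<sigma> \<tau>)"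

lemma stagop_adj: "opadj (stagop n T) = stagop n T"
proof -
  have "cnj (site_op x (spin n a) \<tau> \<sigma>) = site_op x (spin n a) \<sigma> \<tau>" for x a \<sigma> \<tau>
    using opadj_site[of x n a] unfolding opadj_def fun_eq_iff by blast
  moreover have "cnj (stag x) = stag x" for x using stag_cases[of x] by auto
  ultimately show ?thesis by (simp add: opadj_def stagop_def)
qed

text \<open>Distinct sites commute, and at equal sites the commutator is i times the third
  component. This factor i is why the imaginary part appears.\<close>

lemma comm_fieldop_stagop:
  assumes V: "finite V" and T: "T \<subseteq> V" and p: "local_state n V \<phi>"
  shows "Im (\<phi> (opcomm n V (fieldop n V 1 f) (stagop n T))) = (\<Sum>x\<in>T. f x * Re (stag x * \<phi> (site_op x (spin n 3))))"
proof -
  let ?Q = "fieldop n V 1 f"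
  have fT: "finite T" using V T finite_subset by blast
  have one: "kernel_eq (configs n V) (opcomm n V ?Q (site_op x (spin n 2))) (\<lambda>\<sigma> \<tau>. of_real (f x) * (\<i> * site_op x (spin n 3) \<sigma> \<tau>))" if xT: "x \<in> T" for x
    unfolding kernel_eq_def
  proof (intro ballI)
    fix \<sigma> \<tau> assume st: "\<sigma> \<in> configs n V" "\<tau> \<in> configs n V"
    have xV: "x \<in> V" using xT T by auto
    have z: "opcomm n V (site_op z (spin n 1)) (site_op x (spin n 2)) \<sigma> \<tau> = 0" if "z \<in> V" "z \<noteq> x" for z
      using opcomm_kernel_eq0[OF site_commute[OF V that(1) xV that(2)], of n "spin n 1" "spin n 2"] st unfolding kernel_eq_def by blast
    have x: "opcomm n V (site_op x (spin n 1)) (site_op x (spin n 2)) \<sigma> \<tau> = \<i> * site_op x (spin n 3) \<sigma> \<tau>"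
      using site_comm[OF V xV spin_comm(1)] st unfolding kernel_eq_def by blast
    have "(\<Sum>z\<in>V. of_real (f z) * opcomm n V (site_op z (spin n 1)) (site_op x (spin n 2)) \<sigma> \<tau>) = (\<Sum>z\<in>{x}. of_real (f z) * opcomm n V (site_op z (spin n 1)) (site_op x (spin n 2)) \<sigma> \<tau>)"
      using V z xV by (intro sum.mono_neutral_right) auto
    then show "opcomm n V ?Q (site_op x (spin n 2)) \<sigma> \<tau> = of_real (f x) * (\<i> * site_op x (spin n 3) \<sigma> \<tau>)"
      unfolding fieldop_def opcomm_sum_left by (simp add: x del: One_nat_def)
  qed
  have "\<phi> (opcomm n V ?Q (stagop n T)) = (\<Sum>x\<in>T. stag x * \<phi> (opcomm n V ?Q (site_op x (spin n 2))))"
    unfolding stagop_def opcomm_sum_right by (rule local_state_lincomb[OF p fT])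
  also have "\<dots> = (\<Sum>x\<in>T. stag x * (of_real (f x) * (\<i> * \<phi> (site_op x (spin n 3)))))"
    using local_stateD(1)[OF p one] by (intro sum.cong) (auto simp: local_stateD(3)[OF p])
  also have "\<dots> = \<i> * (\<Sum>x\<in>T. of_real (f x) * (stag x * \<phi> (site_op x (spin n 3))))"
    by (simp add: sum_distrib_left mult_ac)
  finally show ?thesis by simp
qed

lemma stagop_sq:
  assumes "local_state n V \<phi>" "finite T"
  shows "\<phi> (opmult n V (stagop n T) (stagop n T)) = (\<Sum>x\<in>T. \<Sum>y\<in>T. stag x * stag y * \<phi> (opmult n V (site_op x (spin n 2)) (site_op y (spin n 2))))"
  unfolding stagop_def opmult_sum_left opmult_sum_right
  by (subst local_state_lincomb[OF assms], subst local_state_lincomb[OF assms]) (simp add: sum_distrib_left mult.assoc)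

text \<open>The generator \<open>Q = \<Sum> f\<^sub>x S\<^sub>x\<^sup>1\<close> of rotations and the staggered sum of \<open>S\<^sup>2\<close> over \<open>T\<close> have the staggered
  magnetization as commutator. The uncertainty relation bounds it by their fluctuations, and that of \<open>Q\<close> is
  controlled by Gaussian domination since \<open>f\<close> is the linear response to the field \<open>g\<close>.\<close>
theorem finite_volume_bound:
  fixes n :: nat and g :: "site \<Rightarrow> real"
  assumes V: "finite V" and sym: "\<And>x y. x \<in> V \<Longrightarrow> y \<in> V \<Longrightarrow> nb x y \<Longrightarrow> nb y x" and irr: "\<And>x. x \<in> V \<Longrightarrow> \<not> nb x x"
    and refl: "\<And>x y. x \<in> V \<Longrightarrow> y \<in> V \<Longrightarrow> nb x y \<Longrightarrow> \<exists>\<theta> W. reflection V nb \<theta> W \<and> x \<in> W \<and> y \<notin> W"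
    and T: "T \<subseteq> V" and B: "0 \<le> B"
  defines "\<phi> \<equiv> fv_gs n V (Hfield n V nb B (\<lambda>_. 0))" and "f \<equiv> dfield V nb g"
  shows "(\<Sum>x\<in>T. f x * Re (stag x * \<phi> (site_op x (spin n 3)))) ^ 4
    \<le> 8 * (cas n * (\<Sum>x\<in>V. \<Sum>y\<in>{y\<in>V. nb x y}. (f x - f y)\<^sup>2) + B * (cas n + 1) * (\<Sum>x\<in>V. (f x)\<^sup>2)) * gfield V nb g
      * (\<Sum>x\<in>T. \<Sum>y\<in>T. Re (stag x * stag y * \<phi> (opmult n V (site_op x (spin n 2)) (site_op y (spin n 2)))))\<^sup>2"
proof -
  let ?H = "Hfield n V nb B (\<lambda>_. 0)"
  let ?Q = "fieldop n V 1 f" and ?C = "stagop n T"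
  have p: "local_state n V \<phi>" unfolding \<phi>_def by (rule local_state_fv_gs[OF V Hfield_herm])
  have fT: "finite T" using V T finite_subset by blast
  define q where "q = Re (\<phi> (opmult n V ?Q ?Q))"
  define c where "c = Re (\<phi> (opmult n V ?C ?C))"
  define m where "m = Im (\<phi> (opcomm n V ?Q ?C))"
  have "gs_energy n V ?H * Re (cinn (configs n V) \<psi> \<psi>) \<le> Re (ev (configs n V) \<psi> (\<lambda>\<sigma> \<tau>. ?H \<sigma> \<tau> + of_real t * ?Q \<sigma> \<tau> + of_real (t\<^sup>2 * gfield V nb g) * rid \<sigma> \<tau>))" for t \<psi>
  proof -
    have "gs_energy n V ?H * Re (cinn (configs n V) \<psi> \<psi>) \<le> Re (ev (configs n V) \<psi> (Hfield n V nb B (\<lambda>x. t * g x)))"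
      by (rule gaussian_domination[OF V]) (use sym irr refl in blast)+
    also have "Hfield n V nb B (\<lambda>x. t * g x) = (\<lambda>\<sigma> \<tau>. ?H \<sigma> \<tau> + of_real t * ?Q \<sigma> \<tau> + of_real (t\<^sup>2 * gfield V nb g) * rid \<sigma> \<tau>)"
      unfolding f_def opid_rid[symmetric] by (rule Hfield_shift[OF V]) (rule sym)
    finally show ?thesis .
  qed
  from fv_gs_fluctuation[OF V Hfield_herm fieldop_adj this]
  have q2: "q\<^sup>2 \<le> Re (\<phi> (opcomm n V ?Q (opcomm n V ?H ?Q))) / 2 * gfield V nb g"
    unfolding q_def \<phi>_def .
  have gpos: "gfield V nb g \<ge> 0" by (simp add: gfield_def sum_nonneg)
  have q2': "q\<^sup>2 \<le> (cas n * (\<Sum>x\<in>V. \<Sum>y\<in>{y\<in>V. nb x y}. (f x - f y)\<^sup>2) + B * (cas n + 1) * (\<Sum>x\<in>V. (f x)\<^sup>2)) / 2 * gfield V nb g"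
  proof -
    have "Re (\<phi> (opcomm n V ?Q (opcomm n V ?H ?Q))) \<le> cas n * (\<Sum>x\<in>V. \<Sum>y\<in>{y\<in>V. nb x y}. (f x - f y)\<^sup>2) + B * (cas n + 1) * (\<Sum>x\<in>V. (f x)\<^sup>2)"
      by (rule double_comm_bound[OF V _ p B]) (rule irr)
    then show ?thesis by (intro order.trans[OF q2] mult_right_mono[OF _ gpos]) simp
  qed
  have m2: "m\<^sup>2 \<le> 4 * q * c" unfolding m_def q_def c_def by (rule uncertainty[OF p fieldop_adj stagop_adj])
  \<comment> \<open>Gaussian domination controls q^2 rather than q, hence the fourth power of the
    magnetization.\<close>
  have "(m\<^sup>2)\<^sup>2 \<le> (4 * q * c)\<^sup>2" by (rule power_mono[OF m2]) simp
  also have "\<dots> = 16 * c\<^sup>2 * q\<^sup>2" by (simp add: power2_eq_square)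
  also have "\<dots> \<le> 16 * c\<^sup>2 * ((cas n * (\<Sum>x\<in>V. \<Sum>y\<in>{y\<in>V. nb x y}. (f x - f y)\<^sup>2) + B * (cas n + 1) * (\<Sum>x\<in>V. (f x)\<^sup>2)) / 2 * gfield V nb g)"
    by (rule mult_left_mono[OF q2']) simp
  finally have "m ^ 4 \<le> 8 * (cas n * (\<Sum>x\<in>V. \<Sum>y\<in>{y\<in>V. nb x y}. (f x - f y)\<^sup>2) + B * (cas n + 1) * (\<Sum>x\<in>V. (f x)\<^sup>2)) * gfield V nb g * c\<^sup>2"
  proof -
    assume *: "(m\<^sup>2)\<^sup>2 \<le> 16 * c\<^sup>2 * ((cas n * (\<Sum>x\<in>V. \<Sum>y\<in>{y\<in>V. nb x y}. (f x - f y)\<^sup>2) + B * (cas n + 1) * (\<Sum>x\<in>V. (f x)\<^sup>2)) / 2 * gfield V nb g)"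
    have "16 * c2 * (D / 2 * G) = 8 * D * G * c2" for c2 D G :: real by simp
    with * show ?thesis by (simp only:) simp
  qed
  then show ?thesis
    unfolding m_def c_def comm_fieldop_stagop[OF V T p] stagop_sq[OF p fT] Re_sum .
qed

section \<open>Ground states and the energy of blocks\<close>

text \<open>The variational principle for arbitrary positive functionals, which need not be mixtures
  given by vectors: \<phi> assigns non-negative weights with sum 1 to the eigenprojections of
  H.\<close>

lemma local_state_ge_gs:
  assumes fin: "finite G" and H: "herm_on (configs n G) H" and p: "local_state n G \<phi>"
  shows "gs_energy n G H \<le> Re (\<phi> H)"
proof -
  let ?X = "configs n G"
  define N where "N = card ?X"
  have X: "finite ?X" by (rule finite_configs[OF fin])
  obtain e l where e: "orthonormal ?X N e" "\<forall>i<N. supp_on ?X (e i)"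
    "\<forall>i<N. \<forall>x\<in>?X. kapply ?X H (e i) x = complex_of_real (l i) * e i x"
    "\<forall>v. supp_on ?X v \<longrightarrow> v = (\<lambda>x. \<Sum>i<N. cinn ?X (e i) v * e i x)"
    unfolding N_def by (rule spectral[OF X H])
  have on: "cinn ?X (e i) (e j) = (if i = j then 1 else 0)" if "i < N" "j < N" for i j
    using e(1) that by (simp add: orthonormal_def)
  define P where "P i = (\<lambda>\<sigma> \<tau>. e i \<sigma> * cnj (e i \<tau>))" for i
  have comp: "(\<Sum>i<N. P i \<sigma> \<tau>) = opid \<sigma> \<tau>" if "\<sigma> \<in> ?X" "\<tau> \<in> ?X" for \<sigma> \<tau>
  proof -
    define d where "d = (\<lambda>\<rho>. if \<rho> = \<tau> then 1 else 0 :: complex)"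
    have c: "cinn ?X w d = cnj (w \<tau>)" for w
      using that X by (simp add: d_def cinn_def if_distrib[of "\<lambda>z. _ * z"] cong: if_cong)
    have "supp_on ?X d" using that by (auto simp: d_def supp_on_def)
    from e(4)[rule_format, OF this] have "d \<sigma> = (\<Sum>i<N. cnj (e i \<tau>) * e i \<sigma>)" unfolding c by metis
    then show ?thesis by (simp add: P_def opid_def d_def mult.commute)
  qed
  have PP: "kernel_eq ?X (opmult n G (opadj (P i)) (P i)) (P i)" if "i < N" for i
    unfolding kernel_eq_def
  proof (intro ballI)
    fix \<sigma> \<tau>
    have "opmult n G (opadj (P i)) (P i) \<sigma> \<tau> = e i \<sigma> * cinn ?X (e i) (e i) * cnj (e i \<tau>)"
      unfolding opmult_def opadj_def P_def cinn_def sum_distrib_left sum_distrib_right by (simp add: mult_ac)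
    then show "opmult n G (opadj (P i)) (P i) \<sigma> \<tau> = P i \<sigma> \<tau>" using on[OF that that] by (simp add: P_def)
  qed
  have pos: "0 \<le> Re (\<phi> (P i))" if "i < N" for i
    using local_stateD(5)[OF p, of "P i"] unfolding local_stateD(1)[OF p PP[OF that]] .
  have "kernel_eq ?X H (\<lambda>\<sigma> \<tau>. \<Sum>i<N. of_real (l i) * P i \<sigma> \<tau>)"
    unfolding kernel_eq_def
  proof (intro ballI)
    fix \<sigma> \<tau> assume st: "\<sigma> \<in> ?X" "\<tau> \<in> ?X"
    have "(\<Sum>i<N. of_real (l i) * P i \<sigma> \<tau>) = (\<Sum>i<N. kapply ?X H (e i) \<sigma> * cnj (e i \<tau>))"
      using e(3) st by (intro sum.cong) (auto simp: P_def mult.assoc)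
    also have "\<dots> = (\<Sum>i<N. \<Sum>\<rho>\<in>?X. H \<sigma> \<rho> * P i \<rho> \<tau>)"
      by (simp add: kapply_def P_def sum_distrib_right mult.assoc)
    also have "\<dots> = (\<Sum>\<rho>\<in>?X. H \<sigma> \<rho> * (\<Sum>i<N. P i \<rho> \<tau>))"
      unfolding sum_distrib_left by (rule sum.swap)
    also have "\<dots> = (\<Sum>\<rho>\<in>?X. H \<sigma> \<rho> * opid \<rho> \<tau>)" using comp st by (intro sum.cong) auto
    also have "\<dots> = H \<sigma> \<tau>" using st X by (simp add: opid_def if_distrib[of "\<lambda>z. _ * z"] cong: if_cong)
    finally show "H \<sigma> \<tau> = (\<Sum>i<N. of_real (l i) * P i \<sigma> \<tau>)" by simp
  qed
  from local_stateD(1)[OF p this] have hH: "Re (\<phi> H) = (\<Sum>i<N. l i * Re (\<phi> (P i)))"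
    by (simp add: local_state_lincomb[OF p])
  have "kernel_eq ?X opid (\<lambda>\<sigma> \<tau>. \<Sum>i<N. P i \<sigma> \<tau>)" using comp by (simp add: kernel_eq_def)
  from arg_cong[OF local_stateD(1)[OF p this], of Re] have one: "(\<Sum>i<N. Re (\<phi> (P i))) = 1"
    by (simp add: local_state_sum[OF p] local_stateD(6)[OF p])
  have "gs_energy n G H \<le> l i" if "i < N" for i
  proof -
    have "cinn ?X (e i) (kapply ?X H (e i)) = cinn ?X (e i) (\<lambda>\<sigma>. of_real (l i) * e i \<sigma>)"
      using e(3) that by (intro cinn_cong) auto
    then show ?thesis using gs_energy_le[OF fin H, of "e i"] on[OF that that] by (simp add: cinn_scale)
  qed
  then have "(\<Sum>i<N. gs_energy n G H * Re (\<phi> (P i))) \<le> (\<Sum>i<N. l i * Re (\<phi> (P i)))"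
    using pos by (intro sum_mono mult_right_mono) auto
  then show ?thesis unfolding hH sum_distrib_left[symmetric] one by simp
qed

section \<open>Local observables inside a larger region\<close>

definition glue :: "site set \<Rightarrow> config \<Rightarrow> config \<Rightarrow> config" where
  "glue b \<rho> \<alpha> = (\<lambda>x. if x \<in> b then \<alpha> x else \<rho> x)"

lemma glue_in: "b \<subseteq> G \<Longrightarrow> \<rho> \<in> configs n G \<Longrightarrow> \<alpha> \<in> configs n b \<Longrightarrow> glue b \<rho> \<alpha> \<in> configs n G"
  by (auto simp: glue_def configs_def)

lemma restr_in: "b \<subseteq> G \<Longrightarrow> \<rho> \<in> configs n G \<Longrightarrow> restr \<rho> b \<in> configs n b"
  by (auto simp: restr_def configs_def)

lemma restr_glue: "\<alpha> \<in> configs n b \<Longrightarrow> restr (glue b \<rho> \<alpha>) b = \<alpha>"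
  by (auto simp: restr_def glue_def configs_def fun_eq_iff)

lemma sum_glue:
  fixes F :: "config \<Rightarrow> complex"
  assumes "finite G" "b \<subseteq> G" "\<tau> \<in> configs n G"
  shows "(\<Sum>\<mu>\<in>configs n G. if \<forall>x. x \<notin> b \<longrightarrow> \<mu> x = \<tau> x then F \<mu> else 0) = (\<Sum>\<alpha>\<in>configs n b. F (glue b \<tau> \<alpha>))"
proof -
  have inj: "inj_on (glue b \<tau>) (configs n b)"
    by (rule inj_onI) (metis restr_glue)
  have "(\<Sum>\<mu>\<in>configs n G. if \<forall>x. x \<notin> b \<longrightarrow> \<mu> x = \<tau> x then F \<mu> else 0) = (\<Sum>\<mu>\<in>glue b \<tau> ` configs n b. F \<mu>)"
  proof (rule sum.mono_neutral_cong_right)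
    show "finite (configs n G)" by (rule finite_configs[OF assms(1)])
    show "glue b \<tau> ` configs n b \<subseteq> configs n G" using glue_in[OF assms(2,3)] by auto
    show "\<forall>\<mu>\<in>configs n G - glue b \<tau> ` configs n b. (if \<forall>x. x \<notin> b \<longrightarrow> \<mu> x = \<tau> x then F \<mu> else 0) = 0"
    proof
      fix \<mu> assume m: "\<mu> \<in> configs n G - glue b \<tau> ` configs n b"
      have "\<not> (\<forall>x. x \<notin> b \<longrightarrow> \<mu> x = \<tau> x)"
      proof
        assume "\<forall>x. x \<notin> b \<longrightarrow> \<mu> x = \<tau> x"
        then have "\<mu> = glue b \<tau> (restr \<mu> b)" by (auto simp: glue_def restr_def fun_eq_iff)
        moreover have "restr \<mu> b \<in> configs n b" using restr_in[OF assms(2)] m by blast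
        ultimately show False using m by blast
      qed
      then show "(if \<forall>x. x \<notin> b \<longrightarrow> \<mu> x = \<tau> x then F \<mu> else 0) = 0" by (rule if_not_P)
    qed
  qed (auto simp: glue_def)
  then show ?thesis by (simp add: sum.reindex[OF inj])
qed

text \<open>The embedding respects products. Together with its compatibility with adjoints this
  makes the restriction of a state positive.\<close>

lemma ext_mult:
  assumes "finite G" "b \<subseteq> G"
  shows "kernel_eq (configs n G) (opmult n G (ext b A) (ext b B)) (ext b (opmult n b A B))"
  unfolding kernel_eq_def
proof (intro ballI)
  fix \<sigma> \<tau> assume st: "\<sigma> \<in> configs n G" "\<tau> \<in> configs n G"
  have e: "ext b B (glue b \<sigma> \<alpha>) \<tau> = (if \<forall>x. x \<notin> b \<longrightarrow> \<sigma> x = \<tau> x then B \<alpha> (restr \<tau> b) else 0)" if "\<alpha> \<in> configs n b" for \<alpha>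
  proof -
    have "(\<forall>x. x \<notin> b \<longrightarrow> glue b \<sigma> \<alpha> x = \<tau> x) \<longleftrightarrow> (\<forall>x. x \<notin> b \<longrightarrow> \<sigma> x = \<tau> x)" by (auto simp: glue_def)
    then show ?thesis by (simp only: ext_def restr_glue[OF that])
  qed
  have "opmult n G (ext b A) (ext b B) \<sigma> \<tau> = (\<Sum>\<mu>\<in>configs n G. if \<forall>x. x \<notin> b \<longrightarrow> \<mu> x = \<sigma> x then A (restr \<sigma> b) (restr \<mu> b) * ext b B \<mu> \<tau> else 0)"
    unfolding opmult_def by (intro sum.cong refl) (auto simp: ext_def)
  also have "\<dots> = (\<Sum>\<alpha>\<in>configs n b. A (restr \<sigma> b) \<alpha> * (if \<forall>x. x \<notin> b \<longrightarrow> \<sigma> x = \<tau> x then B \<alpha> (restr \<tau> b) else 0))"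
    unfolding sum_glue[OF assms st(1)] by (intro sum.cong refl) (simp only: restr_glue e)
  also have "\<dots> = ext b (opmult n b A B) \<sigma> \<tau>"
  proof (cases "\<forall>x. x \<notin> b \<longrightarrow> \<sigma> x = \<tau> x")
    case True
    show ?thesis unfolding ext_def if_P[OF True] opmult_def ..
  next
    case False
    show ?thesis unfolding ext_def if_not_P[OF False] by simp
  qed
  finally show "opmult n G (ext b A) (ext b B) \<sigma> \<tau> = ext b (opmult n b A B) \<sigma> \<tau>" .
qed

lemma ext_adj: "opadj (ext b A) = ext b (opadj A)"
  by (auto simp: opadj_def ext_def fun_eq_iff)

lemma ext_opid: "ext b opid = opid"
proof (intro ext)
  fix \<sigma> \<tau> :: config
  have "\<sigma> = \<tau> \<longleftrightarrow> (\<forall>x. x \<notin> b \<longrightarrow> \<sigma> x = \<tau> x) \<and> restr \<sigma> b = restr \<tau> b"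
    by (auto simp: restr_def fun_eq_iff)
  then show "Defs.ext b opid \<sigma> \<tau> = opid \<sigma> \<tau>" unfolding ext_def opid_def by auto
qed

lemma ext_site: "x \<in> b \<Longrightarrow> ext b (site_op x s) = site_op x s"
proof (intro HOL.ext)
  fix \<sigma> \<tau> :: config assume x: "x \<in> b"
  have "(\<forall>z. z \<noteq> x \<longrightarrow> \<sigma> z = \<tau> z) \<longleftrightarrow> (\<forall>z. z \<notin> b \<longrightarrow> \<sigma> z = \<tau> z) \<and> (\<forall>z. z \<noteq> x \<longrightarrow> restr \<sigma> b z = restr \<tau> b z)"
    using x by (auto simp: restr_def)
  moreover have "restr \<sigma> b x = \<sigma> x" "restr \<tau> b x = \<tau> x" using x by (simp_all add: restr_def)
  ultimately show "ext b (site_op x s) \<sigma> \<tau> = site_op x s \<sigma> \<tau>" unfolding ext_def site_op_def by auto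
qed

lemma ext_pair: "x \<in> b \<Longrightarrow> y \<in> b \<Longrightarrow> ext b (pair_op x s y t) = pair_op x s y t"
proof (intro HOL.ext)
  fix \<sigma> \<tau> :: config assume x: "x \<in> b" "y \<in> b"
  have "(\<forall>z. z \<noteq> x \<and> z \<noteq> y \<longrightarrow> \<sigma> z = \<tau> z) \<longleftrightarrow> (\<forall>z. z \<notin> b \<longrightarrow> \<sigma> z = \<tau> z) \<and> (\<forall>z. z \<noteq> x \<and> z \<noteq> y \<longrightarrow> restr \<sigma> b z = restr \<tau> b z)"
    using x by (auto simp: restr_def)
  moreover have "restr \<sigma> b x = \<sigma> x" "restr \<tau> b x = \<tau> x" "restr \<sigma> b y = \<sigma> y" "restr \<tau> b y = \<tau> y" using x by (simp_all add: restr_def)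
  ultimately show "ext b (pair_op x s y t) \<sigma> \<tau> = pair_op x s y t \<sigma> \<tau>" unfolding ext_def pair_op_def by auto
qed

lemma ext_lin:
  "ext b (\<lambda>\<sigma> \<tau>. A \<sigma> \<tau> + B \<sigma> \<tau>) = (\<lambda>\<sigma> \<tau>. ext b A \<sigma> \<tau> + ext b B \<sigma> \<tau>)"
  "ext b (\<lambda>\<sigma> \<tau>. A \<sigma> \<tau> - B \<sigma> \<tau>) = (\<lambda>\<sigma> \<tau>. ext b A \<sigma> \<tau> - ext b B \<sigma> \<tau>)"
  "ext b (\<lambda>\<sigma> \<tau>. c * A \<sigma> \<tau>) = (\<lambda>\<sigma> \<tau>. c * ext b A \<sigma> \<tau>)"
  "ext b (\<lambda>\<sigma> \<tau>. \<Sum>i\<in>I. F i \<sigma> \<tau>) = (\<lambda>\<sigma> \<tau>. \<Sum>i\<in>I. ext b (F i) \<sigma> \<tau>)"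
  unfolding ext_def by (auto simp: fun_eq_iff intro!: sum.neutral)

lemma local_state_ext:
  assumes "finite G" "b \<subseteq> G" and p: "local_state n G \<phi>"
  shows "local_state n b (\<lambda>A. \<phi> (ext b A))"
  unfolding local_state_def
proof (intro conjI allI impI)
  fix A B assume "kernel_eq (configs n b) A B"
  then have "kernel_eq (configs n G) (ext b A) (ext b B)"
    using restr_in[OF assms(2)] unfolding kernel_eq_def ext_def by auto
  then show "\<phi> (ext b A) = \<phi> (ext b B)" by (rule local_stateD(1)[OF p])
next
  fix A B show "\<phi> (ext b (\<lambda>\<sigma> \<tau>. A \<sigma> \<tau> + B \<sigma> \<tau>)) = \<phi> (ext b A) + \<phi> (ext b B)"
    unfolding ext_lin by (rule local_stateD(2)[OF p])
next
  fix c A show "\<phi> (ext b (\<lambda>\<sigma> \<tau>. c * A \<sigma> \<tau>)) = c * \<phi> (ext b A)"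
    unfolding ext_lin by (rule local_stateD(3)[OF p])
next
  fix A
  have e: "\<phi> (ext b (opmult n b (opadj A) A)) = \<phi> (opmult n G (opadj (ext b A)) (ext b A))"
    unfolding ext_adj by (rule local_stateD(1)[OF p kernel_eq_sym[OF ext_mult[OF assms(1,2)]], symmetric, THEN sym])
  show "Im (\<phi> (ext b (opmult n b (opadj A) A))) = 0" "0 \<le> Re (\<phi> (ext b (opmult n b (opadj A) A)))"
    unfolding e by (rule local_stateD(4,5)[OF p])+
next
  show "\<phi> (ext b opid) = 1" unfolding ext_opid by (rule local_stateD(6)[OF p])
qed

text \<open>\<open>replace n b \<xi>\<close> is the Heisenberg picture of replacing the state in the block \<open>b\<close> by the vector state \<open>\<xi>\<close>;
  the \<open>kraus b \<xi> \<kappa>\<close> are its Kraus operators.\<close>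
definition kraus :: "site set \<Rightarrow> (config \<Rightarrow> complex) \<Rightarrow> config \<Rightarrow> obs" where
  "kraus b \<xi> \<kappa> = (\<lambda>\<alpha> \<beta>. \<xi> \<alpha> * (if \<beta> = \<kappa> then 1 else 0))"

definition replace :: "nat \<Rightarrow> site set \<Rightarrow> (config \<Rightarrow> complex) \<Rightarrow> obs \<Rightarrow> obs" where
  "replace n b \<xi> A = (\<lambda>\<rho> \<tau>. if restr \<rho> b = restr \<tau> b then
     (\<Sum>\<beta>\<in>configs n b. cnj (\<xi> \<beta>) * (\<Sum>\<alpha>\<in>configs n b. A (glue b \<rho> \<beta>) (glue b \<tau> \<alpha>) * \<xi> \<alpha>)) else 0)"

lemma opmult_kraus_right:
  assumes "finite G" "b \<subseteq> G" "\<tau> \<in> configs n G"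
  shows "opmult n G A (ext b (kraus b \<xi> \<kappa>)) \<rho> \<tau> = (if restr \<tau> b = \<kappa> then \<Sum>\<alpha>\<in>configs n b. A \<rho> (glue b \<tau> \<alpha>) * \<xi> \<alpha> else 0)"
proof -
  have "opmult n G A (ext b (kraus b \<xi> \<kappa>)) \<rho> \<tau> = (\<Sum>\<mu>\<in>configs n G. if \<forall>x. x \<notin> b \<longrightarrow> \<mu> x = \<tau> x then A \<rho> \<mu> * kraus b \<xi> \<kappa> (restr \<mu> b) (restr \<tau> b) else 0)"
    unfolding opmult_def ext_def by (intro sum.cong refl) auto
  also have "\<dots> = (\<Sum>\<alpha>\<in>configs n b. A \<rho> (glue b \<tau> \<alpha>) * kraus b \<xi> \<kappa> \<alpha> (restr \<tau> b))"
    unfolding sum_glue[OF assms] by (intro sum.cong refl) (simp only: restr_glue)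
  finally show ?thesis by (auto simp: kraus_def)
qed

lemma opmult_kraus_left:
  assumes "finite G" "b \<subseteq> G" "\<rho> \<in> configs n G"
  shows "opmult n G (opadj (ext b (kraus b \<xi> \<kappa>))) C \<rho> \<tau> = (if restr \<rho> b = \<kappa> then \<Sum>\<beta>\<in>configs n b. cnj (\<xi> \<beta>) * C (glue b \<rho> \<beta>) \<tau> else 0)"
proof -
  have "opmult n G (opadj (ext b (kraus b \<xi> \<kappa>))) C \<rho> \<tau> = (\<Sum>\<mu>\<in>configs n G. if \<forall>x. x \<notin> b \<longrightarrow> \<mu> x = \<rho> x then cnj (kraus b \<xi> \<kappa> (restr \<mu> b) (restr \<rho> b)) * C \<mu> \<tau> else 0)"
    unfolding opmult_def ext_def opadj_def by (intro sum.cong refl) auto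
  also have "\<dots> = (\<Sum>\<beta>\<in>configs n b. cnj (kraus b \<xi> \<kappa> \<beta> (restr \<rho> b)) * C (glue b \<rho> \<beta>) \<tau>)"
    unfolding sum_glue[OF assms] by (intro sum.cong refl) (simp only: restr_glue)
  finally show ?thesis by (auto simp: kraus_def)
qed

text \<open>This form serves twice: it shows that the replacement preserves positivity, and it
  supplies the local operators with which the ground state condition is tested.\<close>

lemma replace_kraus:
  assumes "finite G" "b \<subseteq> G"
  shows "kernel_eq (configs n G) (\<lambda>\<sigma> \<tau>. \<Sum>\<kappa>\<in>configs n b. opmult n G (opadj (ext b (kraus b \<xi> \<kappa>))) (opmult n G A (ext b (kraus b \<xi> \<kappa>))) \<sigma> \<tau>) (replace n b \<xi> A)"
  unfolding kernel_eq_def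
proof (intro ballI)
  fix \<rho> \<tau> assume st: "\<rho> \<in> configs n G" "\<tau> \<in> configs n G"
  have fin: "finite (configs n b)" using finite_configs assms finite_subset by metis
  have "opmult n G (opadj (ext b (kraus b \<xi> \<kappa>))) (opmult n G A (ext b (kraus b \<xi> \<kappa>))) \<rho> \<tau> =
    (if \<kappa> = restr \<rho> b then (if restr \<tau> b = restr \<rho> b then \<Sum>\<beta>\<in>configs n b. cnj (\<xi> \<beta>) * (\<Sum>\<alpha>\<in>configs n b. A (glue b \<rho> \<beta>) (glue b \<tau> \<alpha>) * \<xi> \<alpha>) else 0) else 0)" for \<kappa>
    unfolding opmult_kraus_left[OF assms st(1)] opmult_kraus_right[OF assms st(2)] by auto
  then show "(\<Sum>\<kappa>\<in>configs n b. opmult n G (opadj (ext b (kraus b \<xi> \<kappa>))) (opmult n G A (ext b (kraus b \<xi> \<kappa>))) \<rho> \<tau>) = replace n b \<xi> A \<rho> \<tau>"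
    using fin restr_in[OF assms(2) st(1)] by (auto simp: replace_def)
qed

text \<open>After the replacement, observables of the block are numbers, namely their expectations
  in \<xi>.\<close>

lemma replace_ext:
  assumes "finite G" "b \<subseteq> G"
  shows "kernel_eq (configs n G) (replace n b \<xi> (ext b A)) (\<lambda>\<sigma> \<tau>. ev (configs n b) \<xi> A * opid \<sigma> \<tau>)"
  unfolding kernel_eq_def
proof (intro ballI)
  fix \<rho> \<tau> assume st: "\<rho> \<in> configs n G" "\<tau> \<in> configs n G"
  have e: "ext b A (glue b \<rho> \<beta>) (glue b \<tau> \<alpha>) = (if \<forall>x. x \<notin> b \<longrightarrow> \<rho> x = \<tau> x then A \<beta> \<alpha> else 0)"
    if "\<alpha> \<in> configs n b" "\<beta> \<in> configs n b" for \<alpha> \<beta>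
  proof -
    have "(\<forall>x. x \<notin> b \<longrightarrow> glue b \<rho> \<beta> x = glue b \<tau> \<alpha> x) \<longleftrightarrow> (\<forall>x. x \<notin> b \<longrightarrow> \<rho> x = \<tau> x)" by (auto simp: glue_def)
    then show ?thesis by (simp only: ext_def restr_glue[OF that(1)] restr_glue[OF that(2)])
  qed
  have eq: "\<rho> = \<tau> \<longleftrightarrow> restr \<rho> b = restr \<tau> b \<and> (\<forall>x. x \<notin> b \<longrightarrow> \<rho> x = \<tau> x)"
    by (auto simp: restr_def fun_eq_iff)
  have "(\<Sum>\<beta>\<in>configs n b. cnj (\<xi> \<beta>) * (\<Sum>\<alpha>\<in>configs n b. ext b A (glue b \<rho> \<beta>) (glue b \<tau> \<alpha>) * \<xi> \<alpha>)) =
    (\<Sum>\<beta>\<in>configs n b. cnj (\<xi> \<beta>) * (\<Sum>\<alpha>\<in>configs n b. (if \<forall>x. x \<notin> b \<longrightarrow> \<rho> x = \<tau> x then A \<beta> \<alpha> else 0) * \<xi> \<alpha>))"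
    by (intro sum.cong refl arg_cong2[of _ _ _ _ "(*)"] e)
  also have "\<dots> = (if \<forall>x. x \<notin> b \<longrightarrow> \<rho> x = \<tau> x then ev (configs n b) \<xi> A else 0)"
  proof (cases "\<forall>x. x \<notin> b \<longrightarrow> \<rho> x = \<tau> x")
    case True
    show ?thesis unfolding if_P[OF True] ev_def cinn_def kapply_def ..
  next
    case False
    show ?thesis unfolding if_not_P[OF False] by simp
  qed
  finally show "replace n b \<xi> (ext b A) \<rho> \<tau> = ev (configs n b) \<xi> A * opid \<rho> \<tau>"
    unfolding replace_def opid_def eq by auto
qed

text \<open>The two hypotheses on \<open>A\<close> say that it acts as the identity inside the
  block.\<close>

lemma replace_out:
  assumes "finite b" "cinn (configs n b) \<xi> \<xi> = 1"
    and A: "\<And>\<rho> \<tau> \<alpha> \<beta>. \<alpha> \<in> configs n b \<Longrightarrow> \<beta> \<in> configs n b \<Longrightarrow> restr \<rho> b = restr \<tau> b \<Longrightarrow>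
      A (glue b \<rho> \<beta>) (glue b \<tau> \<alpha>) = (if \<beta> = \<alpha> then A \<rho> \<tau> else 0)"
    and A0: "\<And>\<rho> \<tau>. restr \<rho> b \<noteq> restr \<tau> b \<Longrightarrow> A \<rho> \<tau> = 0"
  shows "replace n b \<xi> A = A"
proof (intro HOL.ext)
  fix \<rho> \<tau>
  show "replace n b \<xi> A \<rho> \<tau> = A \<rho> \<tau>"
  proof (cases "restr \<rho> b = restr \<tau> b")
    case True
    have "(\<Sum>\<beta>\<in>configs n b. cnj (\<xi> \<beta>) * (\<Sum>\<alpha>\<in>configs n b. A (glue b \<rho> \<beta>) (glue b \<tau> \<alpha>) * \<xi> \<alpha>)) =
      (\<Sum>\<beta>\<in>configs n b. cnj (\<xi> \<beta>) * (\<Sum>\<alpha>\<in>configs n b. (if \<beta> = \<alpha> then A \<rho> \<tau> else 0) * \<xi> \<alpha>))"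
      by (intro sum.cong refl arg_cong2[of _ _ _ _ "(*)"] A True)
    also have "\<dots> = A \<rho> \<tau> * cinn (configs n b) \<xi> \<xi>"
      unfolding cinn_def sum_distrib_left using finite_configs[OF assms(1), of n]
      by (intro sum.cong refl) (simp add: if_distrib[of "\<lambda>z. z * _"] if_distrib[of "\<lambda>z. _ * z"] mult_ac cong: if_cong)
    finally show ?thesis using True assms(2) by (simp add: replace_def)
  next
    case False
    then show ?thesis using A0 by (simp add: replace_def)
  qed
qed

lemma glue_agree:
  assumes "\<alpha> \<in> configs n b" "\<beta> \<in> configs n b" "S \<inter> b = {}" "restr \<rho> b = restr \<tau> b"
  shows "(\<forall>z. z \<notin> S \<longrightarrow> glue b \<rho> \<beta> z = glue b \<tau> \<alpha> z) \<longleftrightarrow> \<beta> = \<alpha> \<and> (\<forall>z. z \<notin> S \<longrightarrow> \<rho> z = \<tau> z)"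
proof
  assume L: "\<forall>z. z \<notin> S \<longrightarrow> glue b \<rho> \<beta> z = glue b \<tau> \<alpha> z"
  have "\<beta> z = \<alpha> z" for z
  proof (cases "z \<in> b")
    case True
    then have "z \<notin> S" using assms(3) by auto
    then show ?thesis using L True by (auto simp: glue_def)
  qed (use assms in \<open>simp add: configs_def\<close>)
  moreover have "\<rho> z = \<tau> z" if "z \<notin> S" for z
  proof (cases "z \<in> b")
    case True
    then show ?thesis using assms(4) by (metis restr_def)
  next
    case False
    then show ?thesis using L that by (auto simp: glue_def)
  qed
  ultimately show "\<beta> = \<alpha> \<and> (\<forall>z. z \<notin> S \<longrightarrow> \<rho> z = \<tau> z)" by auto
qed (auto simp: glue_def)

lemma restr_agree: "S \<inter> b = {} \<Longrightarrow> (\<forall>z. z \<notin> S \<longrightarrow> \<rho> z = \<tau> z) \<Longrightarrow> restr \<rho> b = restr \<tau> b"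
  by (auto simp: restr_def fun_eq_iff)

lemma replace_site:
  assumes "finite b" "cinn (configs n b) \<xi> \<xi> = 1" "x \<notin> b"
  shows "replace n b \<xi> (site_op x s) = site_op x s"
proof (rule replace_out[OF assms(1,2)])
  have S: "{x} \<inter> b = {}" using assms by auto
  fix \<rho> \<tau> \<alpha> \<beta> assume ab: "\<alpha> \<in> configs n b" "\<beta> \<in> configs n b" "restr \<rho> b = restr \<tau> b"
  have A: "(\<forall>z. z \<noteq> x \<longrightarrow> glue b \<rho> \<beta> z = glue b \<tau> \<alpha> z) \<longleftrightarrow> \<beta> = \<alpha> \<and> (\<forall>z. z \<noteq> x \<longrightarrow> \<rho> z = \<tau> z)"
    using glue_agree[OF ab(1,2) S ab(3)] by simp
  have v: "glue b \<rho> \<beta> x = \<rho> x" "glue b \<tau> \<alpha> x = \<tau> x" using assms(3) by (auto simp: glue_def)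
  show "site_op x s (glue b \<rho> \<beta>) (glue b \<tau> \<alpha>) = (if \<beta> = \<alpha> then site_op x s \<rho> \<tau> else 0)"
    unfolding site_op_def A v by auto
next
  fix \<rho> \<tau> assume "restr \<rho> b \<noteq> restr \<tau> b"
  then have "\<not> (\<forall>z. z \<notin> {x} \<longrightarrow> \<rho> z = \<tau> z)" using restr_agree[of "{x}" b] assms(3) by blast
  then show "site_op x s \<rho> \<tau> = 0" unfolding site_op_def by auto
qed

lemma replace_pair:
  assumes "finite b" "cinn (configs n b) \<xi> \<xi> = 1" "x \<notin> b" "y \<notin> b"
  shows "replace n b \<xi> (pair_op x s y t) = pair_op x s y t"
proof (rule replace_out[OF assms(1,2)])
  have S: "{x,y} \<inter> b = {}" using assms by auto
  fix \<rho> \<tau> \<alpha> \<beta> assume ab: "\<alpha> \<in> configs n b" "\<beta> \<in> configs n b" "restr \<rho> b = restr \<tau> b"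
  have A: "(\<forall>z. z \<noteq> x \<and> z \<noteq> y \<longrightarrow> glue b \<rho> \<beta> z = glue b \<tau> \<alpha> z) \<longleftrightarrow> \<beta> = \<alpha> \<and> (\<forall>z. z \<noteq> x \<and> z \<noteq> y \<longrightarrow> \<rho> z = \<tau> z)"
    using glue_agree[OF ab(1,2) S ab(3)] by simp
  have v: "glue b \<rho> \<beta> x = \<rho> x" "glue b \<tau> \<alpha> x = \<tau> x" "glue b \<rho> \<beta> y = \<rho> y" "glue b \<tau> \<alpha> y = \<tau> y" using assms(3,4) by (auto simp: glue_def)
  show "pair_op x s y t (glue b \<rho> \<beta>) (glue b \<tau> \<alpha>) = (if \<beta> = \<alpha> then pair_op x s y t \<rho> \<tau> else 0)"
    unfolding pair_op_def A v by auto
next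
  fix \<rho> \<tau> assume "restr \<rho> b \<noteq> restr \<tau> b"
  then have "\<not> (\<forall>z. z \<notin> {x,y} \<longrightarrow> \<rho> z = \<tau> z)" using restr_agree[of "{x,y}" b] assms(3,4) by blast
  then show "pair_op x s y t \<rho> \<tau> = 0" unfolding pair_op_def by auto
qed

lemma replace_lin:
  "replace n b \<xi> (\<lambda>\<sigma> \<tau>. A \<sigma> \<tau> + B \<sigma> \<tau>) = (\<lambda>\<sigma> \<tau>. replace n b \<xi> A \<sigma> \<tau> + replace n b \<xi> B \<sigma> \<tau>)"
  "replace n b \<xi> (\<lambda>\<sigma> \<tau>. c * A \<sigma> \<tau>) = (\<lambda>\<sigma> \<tau>. c * replace n b \<xi> A \<sigma> \<tau>)"
  unfolding replace_def by (auto simp: fun_eq_iff sum.distrib sum_distrib_left algebra_simps)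

lemma opadj_mult: "opadj (opmult n G A B) = opmult n G (opadj B) (opadj A)"
  by (simp add: opadj_def opmult_def fun_eq_iff mult.commute)

lemma local_state_replace:
  assumes G: "finite G" "b \<subseteq> G" and p: "local_state n G \<phi>" and c: "cinn (configs n b) \<xi> \<xi> = 1"
  shows "local_state n G (\<lambda>A. \<phi> (replace n b \<xi> A))"
  unfolding local_state_def
proof (intro conjI allI impI)
  have fb: "finite b" using G finite_subset by blast
  fix A B assume "kernel_eq (configs n G) A B"
  then have "kernel_eq (configs n G) (replace n b \<xi> A) (replace n b \<xi> B)"
    using glue_in[OF G(2)] unfolding kernel_eq_def replace_def by (auto intro!: sum.cong)
  then show "\<phi> (replace n b \<xi> A) = \<phi> (replace n b \<xi> B)" by (rule local_stateD(1)[OF p])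
next
  fix A B show "\<phi> (replace n b \<xi> (\<lambda>\<sigma> \<tau>. A \<sigma> \<tau> + B \<sigma> \<tau>)) = \<phi> (replace n b \<xi> A) + \<phi> (replace n b \<xi> B)"
    unfolding replace_lin by (rule local_stateD(2)[OF p])
next
  fix c A show "\<phi> (replace n b \<xi> (\<lambda>\<sigma> \<tau>. c * A \<sigma> \<tau>)) = c * \<phi> (replace n b \<xi> A)"
    unfolding replace_lin by (rule local_stateD(3)[OF p])
next
  fix A
  have fin: "finite (configs n b)" using finite_configs G finite_subset by metis
  let ?a = "\<lambda>\<kappa>. ext b (kraus b \<xi> \<kappa>)"
  have "opmult n G (opadj (?a \<kappa>)) (opmult n G (opmult n G (opadj A) A) (?a \<kappa>)) = opmult n G (opadj (opmult n G A (?a \<kappa>))) (opmult n G A (?a \<kappa>))" for \<kappa>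
    unfolding opadj_mult opmult_assoc ..
  then have e: "\<phi> (replace n b \<xi> (opmult n G (opadj A) A)) = (\<Sum>\<kappa>\<in>configs n b. \<phi> (opmult n G (opadj (opmult n G A (?a \<kappa>))) (opmult n G A (?a \<kappa>))))"
    using local_stateD(1)[OF p kernel_eq_sym[OF replace_kraus[OF G]]] by (simp add: local_state_sum[OF p fin])
  show "Im (\<phi> (replace n b \<xi> (opmult n G (opadj A) A))) = 0" "0 \<le> Re (\<phi> (replace n b \<xi> (opmult n G (opadj A) A)))"
    unfolding e by (simp_all add: local_stateD(4,5)[OF p] sum_nonneg)
next
  have fb: "finite (configs n b)" using finite_configs G finite_subset by metis
  have "\<phi> (replace n b \<xi> opid) = \<phi> (\<lambda>\<sigma> \<tau>. ev (configs n b) \<xi> opid * opid \<sigma> \<tau>)"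
    using local_stateD(1)[OF p replace_ext[OF G, of n \<xi> opid]] unfolding ext_opid .
  also have "\<dots> = 1" unfolding local_stateD(3,6)[OF p] unfolding ev_def opid_rid cinn_kapply_rid[OF fb] c by simp
  finally show "\<phi> (replace n b \<xi> opid) = 1" .
qed

section \<open>The energy of a block and of its boundary\<close>

definition heis :: "nat \<Rightarrow> site \<Rightarrow> site \<Rightarrow> obs" where
  "heis n x y = (\<lambda>\<sigma> \<tau>. \<Sum>a\<in>{1,2,3}. pair_op x (spin n a) y (spin n a) \<sigma> \<tau>)"

definition stag3 :: "nat \<Rightarrow> site set \<Rightarrow> obs" where
  "stag3 n V = (\<lambda>\<sigma> \<tau>. \<Sum>x\<in>V. stag x * site_op x (spin n 3) \<sigma> \<tau>)"

abbreviation Hzero :: "nat \<Rightarrow> site set \<Rightarrow> (site \<Rightarrow> site \<Rightarrow> bool) \<Rightarrow> real \<Rightarrow> obs" where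
  "Hzero n V nb B \<equiv> Hfield n V nb B (\<lambda>_. 0)"

lemma Hzero_eq: "Hzero n V nb B = (\<lambda>\<sigma> \<tau>. 1/2 * (\<Sum>x\<in>V. \<Sum>y\<in>{y\<in>V. nb x y}. heis n x y \<sigma> \<tau>) - of_real B * stag3 n V \<sigma> \<tau>)"
  by (simp add: Hfield_def bond_def heis_def stag3_def)

lemma heis_sym: "heis n x y = heis n y x"
  by (simp add: heis_def pair_op_sym[of x])

lemma heis_bound:
  assumes "local_state n G \<phi>" "finite G" "x \<in> G" "y \<in> G" "x \<noteq> y"
  shows "\<bar>Re (\<phi> (heis n x y))\<bar> \<le> 3 * cas n"
proof -
  have "\<phi> (heis n x y) = (\<Sum>a\<in>{1,2,3}. \<phi> (pair_op x (spin n a) y (spin n a)))"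
    unfolding heis_def by (rule local_state_sum[OF assms(1)]) simp
  then have "\<bar>Re (\<phi> (heis n x y))\<bar> \<le> (\<Sum>a\<in>{1,2,3}. \<bar>Re (\<phi> (pair_op x (spin n a) y (spin n a)))\<bar>)"
    unfolding Re_sum by (simp only: Re_sum) (rule sum_abs)
  also have "\<dots> \<le> (\<Sum>a\<in>{1,2,3::nat}. cas n)" by (rule sum_mono) (rule pair_bound[OF assms])
  finally show ?thesis by simp
qed

lemma Hzero_split:
  assumes V: "finite V" "b \<subseteq> V" and sym: "\<And>x y. x \<in> V \<Longrightarrow> y \<in> V \<Longrightarrow> nb x y \<Longrightarrow> nb y x"
  shows "Hzero n V nb B = (\<lambda>\<sigma> \<tau>. Hzero n b nb B \<sigma> \<tau> + Hzero n (V - b) nb B \<sigma> \<tau> + (\<Sum>x\<in>b. \<Sum>y\<in>{y\<in>V - b. nb x y}. heis n x y \<sigma> \<tau>))"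
proof (intro HOL.ext)
  fix \<sigma> \<tau>
  have fb: "finite b" using V finite_subset by blast
  define g where "g x y = (if nb x y then heis n x y \<sigma> \<tau> else 0)" for x y
  have filt: "(\<Sum>y\<in>{y\<in>S. nb x y}. heis n x y \<sigma> \<tau>) = (\<Sum>y\<in>S. g x y)" if "finite S" for S x
    unfolding g_def by (rule sum.inter_filter[OF that])
  have part: "(\<Sum>x\<in>V. f x) = (\<Sum>x\<in>b. f x) + (\<Sum>x\<in>V - b. f x)" for f :: "site \<Rightarrow> complex"
    using sum.subset_diff[OF V(2,1), of f] by (simp add: add.commute)
  have "(\<Sum>x\<in>V - b. \<Sum>y\<in>b. g x y) = (\<Sum>y\<in>b. \<Sum>x\<in>V - b. g x y)" by (rule sum.swap)
  also have "\<dots> = (\<Sum>y\<in>b. \<Sum>x\<in>V - b. g y x)"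
    using sym V(2) by (intro sum.cong refl) (auto simp: g_def heis_sym)
  finally have sw: "(\<Sum>x\<in>V - b. \<Sum>y\<in>b. g x y) = (\<Sum>x\<in>b. \<Sum>y\<in>V - b. g x y)" .
  have "(\<Sum>x\<in>V. \<Sum>y\<in>V. g x y) = (\<Sum>x\<in>b. \<Sum>y\<in>b. g x y) + (\<Sum>x\<in>V - b. \<Sum>y\<in>V - b. g x y) + 2 * (\<Sum>x\<in>b. \<Sum>y\<in>V - b. g x y)"
    unfolding part sum.distrib sw by simp
  moreover have "stag3 n V \<sigma> \<tau> = stag3 n b \<sigma> \<tau> + stag3 n (V - b) \<sigma> \<tau>"
    unfolding stag3_def by (rule part)
  ultimately show "Hzero n V nb B \<sigma> \<tau> = Hzero n b nb B \<sigma> \<tau> + Hzero n (V - b) nb B \<sigma> \<tau> + (\<Sum>x\<in>b. \<Sum>y\<in>{y\<in>V - b. nb x y}. heis n x y \<sigma> \<tau>)"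
    unfolding Hzero_eq filt[OF V(1)] filt[OF fb] filt[OF finite_Diff[OF V(1)]] by (simp add: algebra_simps)
qed

lemma ext_stag3: "ext b (stag3 n b) = stag3 n b"
  unfolding stag3_def ext_lin by (auto simp: ext_site fun_eq_iff)

lemma ext_heis: "x \<in> b \<Longrightarrow> y \<in> b \<Longrightarrow> ext b (heis n x y) = heis n x y"
  unfolding heis_def ext_lin by (simp add: ext_pair)

lemma ext_Hzero: "ext b (Hzero n b nb B) = Hzero n b nb B"
  unfolding Hzero_eq ext_lin ext_stag3
  by (intro HOL.ext arg_cong2[of _ _ _ _ "(-)"] arg_cong2[of _ _ _ _ "(*)"] refl sum.cong) (simp add: ext_heis)

lemma replace_sum:
  assumes "finite I"
  shows "replace n b \<xi> (\<lambda>\<sigma> \<tau>. \<Sum>i\<in>I. F i \<sigma> \<tau>) = (\<lambda>\<sigma> \<tau>. \<Sum>i\<in>I. replace n b \<xi> (F i) \<sigma> \<tau>)"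
  using assms
proof (induction I)
  case empty
  show ?case by (simp add: replace_def fun_eq_iff)
next
  case (insert i I)
  then show ?case using replace_lin(1)[of n b \<xi> "F i" "\<lambda>\<sigma> \<tau>. \<Sum>i\<in>I. F i \<sigma> \<tau>"] by simp
qed

lemma replace_Hzero_out:
  assumes V: "finite V" "finite b" "V \<inter> b = {}" and c: "cinn (configs n b) \<xi> \<xi> = 1"
  shows "replace n b \<xi> (Hzero n V nb B) = Hzero n V nb B"
proof -
  have h: "replace n b \<xi> (heis n x y) = heis n x y" if "x \<in> V" "y \<in> V" for x y
  proof -
    have "x \<notin> b" "y \<notin> b" using that V(3) by auto
    then show ?thesis unfolding heis_def by (subst replace_sum) (simp_all add: replace_pair[OF V(2) c])
  qed
  have s: "replace n b \<xi> (\<lambda>\<sigma> \<tau>. stag x * site_op x (spin n 3) \<sigma> \<tau>) = (\<lambda>\<sigma> \<tau>. stag x * site_op x (spin n 3) \<sigma> \<tau>)" if "x \<in> V" for x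
  proof -
    have "x \<notin> b" using that V(3) by auto
    then show ?thesis unfolding replace_lin by (simp add: replace_site[OF V(2) c])
  qed
  have hs: "replace n b \<xi> (\<lambda>\<sigma> \<tau>. \<Sum>x\<in>V. \<Sum>y\<in>{y\<in>V. nb x y}. heis n x y \<sigma> \<tau>) = (\<lambda>\<sigma> \<tau>. \<Sum>x\<in>V. \<Sum>y\<in>{y\<in>V. nb x y}. heis n x y \<sigma> \<tau>)"
  proof -
    have "replace n b \<xi> (\<lambda>\<sigma> \<tau>. \<Sum>y\<in>{y\<in>V. nb x y}. heis n x y \<sigma> \<tau>) = (\<lambda>\<sigma> \<tau>. \<Sum>y\<in>{y\<in>V. nb x y}. heis n x y \<sigma> \<tau>)" if "x \<in> V" for x
      using V(1) h that by (subst replace_sum) (auto intro!: HOL.ext sum.cong)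
    then show ?thesis by (subst replace_sum[OF V(1)]) (auto intro!: HOL.ext sum.cong)
  qed
  have ss: "replace n b \<xi> (stag3 n V) = stag3 n V"
    unfolding stag3_def by (subst replace_sum[OF V(1)]) (auto intro!: HOL.ext sum.cong simp: s)
  have e: "Hzero n V nb B = (\<lambda>\<sigma> \<tau>. 1/2 * (\<Sum>x\<in>V. \<Sum>y\<in>{y\<in>V. nb x y}. heis n x y \<sigma> \<tau>) + (- of_real B) * stag3 n V \<sigma> \<tau>)"
    by (simp add: Hzero_eq)
  show ?thesis unfolding e replace_lin hs ss ..
qed

definition ncross :: "site set \<Rightarrow> (site \<Rightarrow> site \<Rightarrow> bool) \<Rightarrow> site set \<Rightarrow> real" where
  "ncross V nb b = (\<Sum>x\<in>b. real (card {y\<in>V - b. nb x y}))"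

text \<open>The replacement gives the block the energy of \<xi>, leaves the complement alone and can
  change each bond across the boundary by at most twice 3 S(S + 1).\<close>

lemma block_energy:
  assumes V: "finite V" "b \<subseteq> V" and sym: "\<And>x y. x \<in> V \<Longrightarrow> y \<in> V \<Longrightarrow> nb x y \<Longrightarrow> nb y x"
    and p: "local_state n V \<phi>" and c: "cinn (configs n b) \<xi> \<xi> = 1"
  shows "Re (\<phi> (replace n b \<xi> (Hzero n V nb B))) - Re (\<phi> (Hzero n V nb B))
    \<le> Re (ev (configs n b) \<xi> (Hzero n b nb B)) - Re (\<phi> (Hzero n b nb B)) + 6 * cas n * ncross V nb b"
proof -
  have fb: "finite b" using V finite_subset by blast
  define \<phi>' where "\<phi>' = (\<lambda>A. \<phi> (replace n b \<xi> A))"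
  have p': "local_state n V \<phi>'" unfolding \<phi>'_def by (rule local_state_replace[OF V p c])
  let ?C = "\<lambda>\<sigma> \<tau>. \<Sum>x\<in>b. \<Sum>y\<in>{y\<in>V - b. nb x y}. heis n x y \<sigma> \<tau>"
  have split: "\<psi> (Hzero n V nb B) = \<psi> (Hzero n b nb B) + \<psi> (Hzero n (V - b) nb B) + \<psi> ?C" if "local_state n V \<psi>" for \<psi>
  proof -
    have e: "Hzero n V nb B = (\<lambda>\<sigma> \<tau>. Hzero n b nb B \<sigma> \<tau> + Hzero n (V - b) nb B \<sigma> \<tau> + ?C \<sigma> \<tau>)"
      by (rule Hzero_split[OF V]) (rule sym)
    show ?thesis by (subst e) (simp only: local_stateD(2)[OF that])
  qed
  have C: "\<bar>Re (\<psi> ?C)\<bar> \<le> 3 * cas n * ncross V nb b" if s: "local_state n V \<psi>" for \<psi>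
  proof -
    have e: "\<psi> ?C = (\<Sum>x\<in>b. \<Sum>y\<in>{y\<in>V - b. nb x y}. \<psi> (heis n x y))"
      using V(1) by (subst local_state_sum[OF s fb], intro sum.cong refl local_state_sum[OF s]) auto
    have "\<bar>Re (\<psi> ?C)\<bar> \<le> (\<Sum>x\<in>b. \<bar>\<Sum>y\<in>{y\<in>V - b. nb x y}. Re (\<psi> (heis n x y))\<bar>)"
      unfolding e Re_sum by (rule sum_abs)
    also have "\<dots> \<le> (\<Sum>x\<in>b. \<Sum>y\<in>{y\<in>V - b. nb x y}. \<bar>Re (\<psi> (heis n x y))\<bar>)"
      by (intro sum_mono sum_abs)
    also have "\<dots> \<le> (\<Sum>x\<in>b. \<Sum>y\<in>{y\<in>V - b. nb x y}. 3 * cas n)"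
      using V(2) by (intro sum_mono heis_bound[OF s V(1)]) auto
    also have "\<dots> = 3 * cas n * ncross V nb b" by (simp add: ncross_def sum_distrib_left mult_ac)
    finally show ?thesis .
  qed
  have "\<phi>' (Hzero n b nb B) = \<phi> (\<lambda>\<sigma> \<tau>. ev (configs n b) \<xi> (Hzero n b nb B) * opid \<sigma> \<tau>)"
    unfolding \<phi>'_def using local_stateD(1)[OF p replace_ext[OF V, of n \<xi> "Hzero n b nb B"]] unfolding ext_Hzero .
  then have in_b: "\<phi>' (Hzero n b nb B) = ev (configs n b) \<xi> (Hzero n b nb B)"
    by (simp add: local_stateD(3,6)[OF p])
  have out: "\<phi>' (Hzero n (V - b) nb B) = \<phi> (Hzero n (V - b) nb B)"
    unfolding \<phi>'_def by (subst replace_Hzero_out[OF _ fb _ c]) (use V in auto)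
  have "Re (\<phi>' (Hzero n V nb B)) - Re (\<phi> (Hzero n V nb B)) = Re (ev (configs n b) \<xi> (Hzero n b nb B)) - Re (\<phi> (Hzero n b nb B)) + (Re (\<phi>' ?C) - Re (\<phi> ?C))"
    unfolding split[OF p'] split[OF p] in_b out by simp
  moreover have "Re (\<phi>' ?C) - Re (\<phi> ?C) \<le> 6 * cas n * ncross V nb b"
    using C[OF p'] C[OF p] by linarith
  ultimately show ?thesis unfolding \<phi>'_def by linarith
qed

lemma gs_vector:
  assumes "finite G" "herm_on (configs n G) H"
  obtains \<xi> where "cinn (configs n G) \<xi> \<xi> = 1" "ev (configs n G) \<xi> H = of_real (gs_energy n G H)"
proof -
  let ?X = "configs n G"
  obtain I :: "nat set" and e where I: "I \<noteq> {}"
    "\<forall>i\<in>I. \<forall>j\<in>I. cinn ?X (e i) (e j) = (if i = j then 1 else 0)"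
    "\<forall>i\<in>I. \<forall>\<sigma>\<in>?X. kapply ?X H (e i) \<sigma> = complex_of_real (gs_energy n G H) * e i \<sigma>"
    by (rule fv_gs_expand[OF assms]) blast
  then obtain i where i: "i \<in> I" by auto
  have "ev ?X (e i) H = cinn ?X (e i) (\<lambda>\<sigma>. of_real (gs_energy n G H) * e i \<sigma>)"
    unfolding ev_def using I(3) i by (intro cinn_cong) auto
  then show ?thesis using I(2) i by (intro that[of "e i"]) (auto simp: cinn_scale)
qed

lemma fv_gs_energy:
  assumes "finite G" "herm_on (configs n G) H"
  shows "fv_gs n G H H = of_real (gs_energy n G H)"
proof -
  let ?X = "configs n G"
  obtain I :: "nat set" and e where I: "finite I" "I \<noteq> {}"
    and on: "\<forall>i\<in>I. \<forall>j\<in>I. cinn ?X (e i) (e j) = (if i = j then 1 else 0)"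
    and gs: "\<forall>i\<in>I. \<forall>\<sigma>\<in>?X. kapply ?X H (e i) \<sigma> = complex_of_real (gs_energy n G H) * e i \<sigma>"
    and ex: "\<forall>A. fv_gs n G H A = (\<Sum>i\<in>I. ev ?X (e i) A) / of_nat (card I)"
    by (rule fv_gs_expand[OF assms])
  have "ev ?X (e i) H = of_real (gs_energy n G H)" if "i \<in> I" for i
  proof -
    have "ev ?X (e i) H = cinn ?X (e i) (\<lambda>\<sigma>. of_real (gs_energy n G H) * e i \<sigma>)"
      unfolding ev_def using gs that by (intro cinn_cong) auto
    then show ?thesis using on that by (simp add: cinn_scale)
  qed
  then show ?thesis using I ex by simp
qed

text \<open>Replacing the state in the block by a ground vector of the block changes only the bonds across its boundary.\<close>
lemma fv_gs_block_energy:
  assumes V: "finite V" "b \<subseteq> V" and sym: "\<And>x y. x \<in> V \<Longrightarrow> y \<in> V \<Longrightarrow> nb x y \<Longrightarrow> nb y x"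
  shows "Re (fv_gs n V (Hzero n V nb B) (Hzero n b nb B)) \<le> gs_energy n b (Hzero n b nb B) + 6 * cas n * ncross V nb b"
proof -
  have fb: "finite b" using V finite_subset by blast
  let ?\<phi> = "fv_gs n V (Hzero n V nb B)"
  have p: "local_state n V ?\<phi>" by (rule local_state_fv_gs[OF V(1) Hfield_herm])
  obtain \<xi> where c: "cinn (configs n b) \<xi> \<xi> = 1" "ev (configs n b) \<xi> (Hzero n b nb B) = of_real (gs_energy n b (Hzero n b nb B))"
    by (rule gs_vector[OF fb Hfield_herm])
  have "gs_energy n V (Hzero n V nb B) \<le> Re (?\<phi> (replace n b \<xi> (Hzero n V nb B)))"
    by (rule local_state_ge_gs[OF V(1) Hfield_herm local_state_replace[OF V p c(1)]])
  moreover have "Re (?\<phi> (replace n b \<xi> (Hzero n V nb B))) - Re (?\<phi> (Hzero n V nb B))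
      \<le> Re (ev (configs n b) \<xi> (Hzero n b nb B)) - Re (?\<phi> (Hzero n b nb B)) + 6 * cas n * ncross V nb b"
    by (rule block_energy[OF V _ p c(1)]) (rule sym)
  ultimately show ?thesis unfolding fv_gs_energy[OF V(1) Hfield_herm] c(2) by simp
qed

text \<open>A permutation of the sites, combined with a flip of all spins if \<open>f\<close> holds.
  The flip is needed because a translation by an odd vector exchanges the sublattices and thereby
  reverses the staggered field.\<close>

definition permute :: "nat \<Rightarrow> site set \<Rightarrow> (site \<Rightarrow> site) \<Rightarrow> bool \<Rightarrow> config \<Rightarrow> config" where
  "permute n V T f \<sigma> = (\<lambda>x. if x \<in> V then (if f then n - \<sigma> (T x) else \<sigma> (T x)) else 0)"

lemma permute_in: "bij_betw T V V \<Longrightarrow> \<sigma> \<in> configs n V \<Longrightarrow> permute n V T f \<sigma> \<in> configs n V"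
  by (auto simp: permute_def configs_def bij_betw_def)

lemma permute_bij:
  assumes V: "finite V" and T: "bij_betw T V V"
  shows "bij_betw (permute n V T f) (configs n V) (configs n V)"
proof -
  have "inj_on (permute n V T f) (configs n V)"
  proof (rule inj_onI)
    fix \<sigma> \<tau> assume st: "\<sigma> \<in> configs n V" "\<tau> \<in> configs n V" "permute n V T f \<sigma> = permute n V T f \<tau>"
    show "\<sigma> = \<tau>"
    proof
      fix y
      show "\<sigma> y = \<tau> y"
      proof (cases "y \<in> V")
        case True
        then obtain x where x: "x \<in> V" "y = T x" using T by (auto simp: bij_betw_def)
        have "permute n V T f \<sigma> x = permute n V T f \<tau> x" using st(3) by simp
        then show ?thesis using x configs_le[OF st(1), of y] configs_le[OF st(2), of y] by (auto simp: permute_def split: if_splits)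
      qed (use st in \<open>simp add: configs_def\<close>)
    qed
  qed
  moreover have "permute n V T f ` configs n V \<subseteq> configs n V" using permute_in[OF T] by auto
  ultimately show ?thesis using finite_configs[OF V] by (simp add: bij_betw_def endo_inj_surj)
qed

lemma permute_agree:
  assumes T: "bij_betw T V V" and st: "\<sigma> \<in> configs n V" "\<tau> \<in> configs n V" and S: "S \<subseteq> V"
  shows "(\<forall>z. z \<notin> S \<longrightarrow> permute n V T f \<sigma> z = permute n V T f \<tau> z) \<longleftrightarrow> (\<forall>z. z \<notin> T ` S \<longrightarrow> \<sigma> z = \<tau> z)"
proof
  assume L: "\<forall>z. z \<notin> S \<longrightarrow> permute n V T f \<sigma> z = permute n V T f \<tau> z"
  show "\<forall>z. z \<notin> T ` S \<longrightarrow> \<sigma> z = \<tau> z"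
  proof (intro allI impI)
    fix z assume z: "z \<notin> T ` S"
    show "\<sigma> z = \<tau> z"
    proof (cases "z \<in> V")
      case True
      then obtain x where x: "x \<in> V" "z = T x" using T by (auto simp: bij_betw_def)
      then have "x \<notin> S" using z by auto
      then have "permute n V T f \<sigma> x = permute n V T f \<tau> x" using L by blast
      then show ?thesis using x configs_le[OF st(1), of z] configs_le[OF st(2), of z] by (auto simp: permute_def split: if_splits)
    qed (use st in \<open>simp add: configs_def\<close>)
  qed
next
  assume R: "\<forall>z. z \<notin> T ` S \<longrightarrow> \<sigma> z = \<tau> z"
  show "\<forall>z. z \<notin> S \<longrightarrow> permute n V T f \<sigma> z = permute n V T f \<tau> z"
  proof (intro allI impI)
    fix z assume z: "z \<notin> S"
    have "\<sigma> (T z) = \<tau> (T z)" if "z \<in> V"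
    proof -
      have "T z \<notin> T ` S" using T z S that by (auto simp: bij_betw_def inj_on_def)
      then show ?thesis using R by blast
    qed
    then show "permute n V T f \<sigma> z = permute n V T f \<tau> z" by (simp add: permute_def)
  qed
qed

lemma permute_site:
  assumes T: "bij_betw T V V" and st: "\<sigma> \<in> configs n V" "\<tau> \<in> configs n V" and x: "x \<in> V"
  shows "site_op x (spin n 3) (permute n V T f \<sigma>) (permute n V T f \<tau>) = (if f then -1 else 1) * site_op (T x) (spin n 3) \<sigma> \<tau>"
proof -
  have A: "(\<forall>z. z \<noteq> x \<longrightarrow> permute n V T f \<sigma> z = permute n V T f \<tau> z) \<longleftrightarrow> (\<forall>z. z \<noteq> T x \<longrightarrow> \<sigma> z = \<tau> z)"
    using permute_agree[OF T st, of "{x}"] x by simp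
  show ?thesis
    unfolding site_op_def A using x spin_flip[OF configs_le[OF st(1), of "T x"] configs_le[OF st(2), of "T x"], of 3]
    by (auto simp: permute_def)
qed

lemma permute_heis:
  assumes T: "bij_betw T V V" and st: "\<sigma> \<in> configs n V" "\<tau> \<in> configs n V" and x: "x \<in> V" "y \<in> V"
  shows "heis n x y (permute n V T f \<sigma>) (permute n V T f \<tau>) = heis n (T x) (T y) \<sigma> \<tau>"
proof -
  have A: "(\<forall>z. z \<noteq> x \<and> z \<noteq> y \<longrightarrow> permute n V T f \<sigma> z = permute n V T f \<tau> z) \<longleftrightarrow> (\<forall>z. z \<noteq> T x \<and> z \<noteq> T y \<longrightarrow> \<sigma> z = \<tau> z)"
    using permute_agree[OF T st, of "{x,y}"] x by simp
  have "pair_op x (spin n a) y (spin n a) (permute n V T f \<sigma>) (permute n V T f \<tau>) = pair_op (T x) (spin n a) (T y) (spin n a) \<sigma> \<tau>" for a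
    unfolding pair_op_def A using x spin_flip[OF configs_le[OF st(1), of "T x"] configs_le[OF st(2), of "T x"], of a]
      spin_flip[OF configs_le[OF st(1), of "T y"] configs_le[OF st(2), of "T y"], of a]
    by (auto simp: permute_def)
  then show ?thesis by (simp add: heis_def)
qed

lemma permute_Hzero:
  fixes s :: real
  assumes T: "bij_betw T V V" and V: "finite V" and st: "\<sigma> \<in> configs n V" "\<tau> \<in> configs n V"
    and nb: "\<And>x y. x \<in> V \<Longrightarrow> y \<in> V \<Longrightarrow> nb (T x) (T y) \<longleftrightarrow> nb x y"
    and s: "\<And>x. x \<in> V \<Longrightarrow> stag (T x) = of_real s * stag x" "s * s = 1"
  shows "Hzero n V nb B (permute n V T f \<sigma>) (permute n V T f \<tau>) = Hzero n V nb ((if f then - s else s) * B) \<sigma> \<tau>"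
proof -
  define g where "g x y = (if nb x y then heis n x y \<sigma> \<tau> else 0)" for x y
  have "(\<Sum>x\<in>V. \<Sum>y\<in>{y\<in>V. nb x y}. heis n x y (permute n V T f \<sigma>) (permute n V T f \<tau>)) = (\<Sum>x\<in>V. \<Sum>y\<in>V. g (T x) (T y))"
    unfolding sum.inter_filter[OF V] by (intro sum.cong refl) (auto simp: g_def nb permute_heis[OF T st])
  also have "\<dots> = (\<Sum>x\<in>V. \<Sum>y\<in>V. g (T x) y)"
    by (intro sum.cong refl sum.reindex_bij_betw[OF T])
  also have "\<dots> = (\<Sum>x\<in>V. \<Sum>y\<in>V. g x y)"
    by (rule sum.reindex_bij_betw[OF T])
  also have "\<dots> = (\<Sum>x\<in>V. \<Sum>y\<in>{y\<in>V. nb x y}. heis n x y \<sigma> \<tau>)"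
    unfolding g_def by (intro sum.cong refl sum.inter_filter[symmetric] V)
  finally have 1: "(\<Sum>x\<in>V. \<Sum>y\<in>{y\<in>V. nb x y}. heis n x y (permute n V T f \<sigma>) (permute n V T f \<tau>)) = (\<Sum>x\<in>V. \<Sum>y\<in>{y\<in>V. nb x y}. heis n x y \<sigma> \<tau>)" .
  have s': "stag x = of_real s * stag (T x)" if "x \<in> V" for x
    using s(1)[OF that] s(2) by (simp flip: mult.assoc of_real_mult)
  have "stag3 n V (permute n V T f \<sigma>) (permute n V T f \<tau>) = (\<Sum>x\<in>V. of_real (if f then - s else s) * (stag (T x) * site_op (T x) (spin n 3) \<sigma> \<tau>))"
    unfolding stag3_def by (intro sum.cong refl) (simp add: permute_site[OF T st] s')
  also have "\<dots> = of_real (if f then - s else s) * stag3 n V \<sigma> \<tau>"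
    unfolding stag3_def sum_distrib_left[symmetric] by (rule arg_cong[OF sum.reindex_bij_betw[OF T]])
  finally show ?thesis unfolding Hzero_eq 1 by (auto simp: mult_ac)
qed

lemma local_state_cong_map:
  assumes V: "finite V" and T: "bij_betw T V V" and p: "local_state n V \<phi>"
  shows "local_state n V (\<lambda>A. \<phi> (\<lambda>\<sigma> \<tau>. A (permute n V T f \<sigma>) (permute n V T f \<tau>)))"
  unfolding local_state_def
proof (intro conjI allI impI)
  let ?\<pi> = "permute n V T f"
  fix A B assume "kernel_eq (configs n V) A B"
  then show "\<phi> (\<lambda>\<sigma> \<tau>. A (?\<pi> \<sigma>) (?\<pi> \<tau>)) = \<phi> (\<lambda>\<sigma> \<tau>. B (?\<pi> \<sigma>) (?\<pi> \<tau>))"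
    using permute_in[OF T] by (intro local_stateD(1)[OF p]) (auto simp: kernel_eq_def)
next
  fix A
  let ?\<pi> = "permute n V T f"
  have "opmult n V (opadj A) A (?\<pi> \<sigma>) (?\<pi> \<tau>) = opmult n V (opadj (\<lambda>\<sigma> \<tau>. A (?\<pi> \<sigma>) (?\<pi> \<tau>))) (\<lambda>\<sigma> \<tau>. A (?\<pi> \<sigma>) (?\<pi> \<tau>)) \<sigma> \<tau>" for \<sigma> \<tau>
    unfolding opmult_def opadj_def
    by (rule sum.reindex_bij_betw[OF permute_bij[OF V T], of "\<lambda>\<rho>. cnj (A \<rho> (?\<pi> \<sigma>)) * A \<rho> (?\<pi> \<tau>)", symmetric])
  then show "Im (\<phi> (\<lambda>\<sigma> \<tau>. opmult n V (opadj A) A (?\<pi> \<sigma>) (?\<pi> \<tau>))) = 0" "0 \<le> Re (\<phi> (\<lambda>\<sigma> \<tau>. opmult n V (opadj A) A (?\<pi> \<sigma>) (?\<pi> \<tau>)))"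
    using local_stateD(4,5)[OF p, of "\<lambda>\<sigma> \<tau>. A (?\<pi> \<sigma>) (?\<pi> \<tau>)"] by simp_all
next
  let ?\<pi> = "permute n V T f"
  have "kernel_eq (configs n V) (\<lambda>\<sigma> \<tau>. opid (?\<pi> \<sigma>) (?\<pi> \<tau>)) opid"
    using permute_bij[OF V T, of n f] by (auto simp: kernel_eq_def opid_def bij_betw_def inj_on_def)
  from local_stateD(1)[OF p this] show "\<phi> (\<lambda>\<sigma> \<tau>. opid (?\<pi> \<sigma>) (?\<pi> \<tau>)) = 1" by (simp add: local_stateD(6)[OF p])
qed (simp_all add: local_stateD(2,3)[OF p])

text \<open>Whenever the site permutation reverses the staggered field, flipping all spins restores
  it. The signs of \<open>stag\<close> and of the third component then compensate.\<close>

lemma fv_gs_stag_invariant: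
  assumes V: "finite V" and T: "bij_betw T V V" and nb: "\<And>x y. x \<in> V \<Longrightarrow> y \<in> V \<Longrightarrow> nb (T x) (T y) \<longleftrightarrow> nb x y"
    and s: "\<And>x. x \<in> V \<Longrightarrow> stag (T x) = of_real s * stag x" "s = 1 \<or> s = -1" and x: "x \<in> V"
  shows "stag (T x) * fv_gs n V (Hzero n V nb B) (site_op (T x) (spin n 3)) = stag x * fv_gs n V (Hzero n V nb B) (site_op x (spin n 3))"
proof -
  define f where "f = (s = -1)"
  have ss: "s * s = 1" "(if f then - s else s) = 1" using s(2) by (auto simp: f_def)
  let ?\<phi> = "fv_gs n V (Hzero n V nb B)"
  have p: "local_state n V ?\<phi>" by (rule local_state_fv_gs[OF V Hfield_herm])
  have "?\<phi> (\<lambda>\<sigma> \<tau>. site_op x (spin n 3) (permute n V T f \<sigma>) (permute n V T f \<tau>)) = ?\<phi> (site_op x (spin n 3))"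
  proof (rule fv_gs_symmetry[OF V Hfield_herm permute_bij[OF V T]])
    fix \<sigma> \<tau> assume st: "\<sigma> \<in> configs n V" "\<tau> \<in> configs n V"
    show "Hzero n V nb B (permute n V T f \<sigma>) (permute n V T f \<tau>) = Hzero n V nb B \<sigma> \<tau>"
    proof -
      have "Hzero n V nb B (permute n V T f \<sigma>) (permute n V T f \<tau>) = Hzero n V nb ((if f then - s else s) * B) \<sigma> \<tau>"
        by (rule permute_Hzero[OF T V st]) (use nb s(1) ss(1) in auto)
      then show ?thesis unfolding ss(2) by simp
    qed
  qed
  also have "?\<phi> (\<lambda>\<sigma> \<tau>. site_op x (spin n 3) (permute n V T f \<sigma>) (permute n V T f \<tau>)) = ?\<phi> (\<lambda>\<sigma> \<tau>. of_real s * site_op (T x) (spin n 3) \<sigma> \<tau>)"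
    using s(2) by (intro local_stateD(1)[OF p]) (auto simp: kernel_eq_def permute_site[OF T _ _ x] f_def)
  also have "\<dots> = of_real s * ?\<phi> (site_op (T x) (spin n 3))" by (rule local_stateD(3)[OF p])
  finally show ?thesis using s(1)[OF x] s(2) by auto
qed

text \<open>Comparison of the two minimisation properties: switching on the field lowers the energy of the block
  by at least the magnetization of any state that is almost a ground state of the block at zero field.\<close>
theorem block_magnetization:
  assumes V: "finite V" "b \<subseteq> V" and sym: "\<And>x y. x \<in> V \<Longrightarrow> y \<in> V \<Longrightarrow> nb x y \<Longrightarrow> nb y x"
    and p: "local_state n b \<psi>" and low: "Re (\<psi> (Hzero n b nb 0)) \<le> gs_energy n b (Hzero n b nb 0) + c"
    and B: "0 \<le> B"
  shows "B * \<bar>Re (\<psi> (stag3 n b))\<bar> - c - 6 * cas n * ncross V nb b \<le> B * Re (fv_gs n V (Hzero n V nb B) (stag3 n b))"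
proof -
  have fb: "finite b" using V finite_subset by blast
  let ?\<phi> = "fv_gs n V (Hzero n V nb B)"
  have q: "local_state n V ?\<phi>" by (rule local_state_fv_gs[OF V(1) Hfield_herm])
  have HB: "Hzero n b nb B = (\<lambda>\<sigma> \<tau>. Hzero n b nb 0 \<sigma> \<tau> - of_real B * stag3 n b \<sigma> \<tau>)" for B
    by (simp add: Hzero_eq)
  have up: "Re (?\<phi> (Hzero n b nb B)) \<le> gs_energy n b (Hzero n b nb B) + 6 * cas n * ncross V nb b"
    by (rule fv_gs_block_energy[OF V]) (rule sym)
  have "gs_energy n b (Hzero n b nb 0) \<le> Re (?\<phi> (ext b (Hzero n b nb 0)))"
    by (rule local_state_ge_gs[OF fb Hfield_herm local_state_ext[OF V q]])
  then have lo: "gs_energy n b (Hzero n b nb 0) \<le> Re (?\<phi> (Hzero n b nb 0))" unfolding ext_Hzero .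
  have e\<phi>: "Re (?\<phi> (Hzero n b nb B)) = Re (?\<phi> (Hzero n b nb 0)) - B * Re (?\<phi> (stag3 n b))"
    by (subst HB) (simp add: local_state_diff[OF q] local_stateD(3)[OF q])
  have e\<psi>: "Re (\<psi> (Hzero n b nb B)) = Re (\<psi> (Hzero n b nb 0)) - B * Re (\<psi> (stag3 n b))" for B
    by (subst HB) (simp add: local_state_diff[OF p] local_stateD(3)[OF p])
  have v1: "gs_energy n b (Hzero n b nb B) \<le> Re (\<psi> (Hzero n b nb B))"
    by (rule local_state_ge_gs[OF fb Hfield_herm p])
  have T: "bij_betw (\<lambda>x. x) b b" by (simp add: bij_betw_def)
  \<comment> \<open>The sign of the magnetization of \<psi> is unknown. Flipping all spins amounts
    to reversing B, and the better of the two variational bounds contains the absolute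
    value.\<close>
  have "gs_energy n b (Hzero n b nb B) \<le> Re (\<psi> (\<lambda>\<sigma> \<tau>. Hzero n b nb B (permute n b (\<lambda>x. x) True \<sigma>) (permute n b (\<lambda>x. x) True \<tau>)))"
    by (rule local_state_ge_gs[OF fb Hfield_herm local_state_cong_map[OF fb T p]])
  also have "\<psi> (\<lambda>\<sigma> \<tau>. Hzero n b nb B (permute n b (\<lambda>x. x) True \<sigma>) (permute n b (\<lambda>x. x) True \<tau>)) = \<psi> (Hzero n b nb (- B))"
  proof (rule local_stateD(1)[OF p], unfold kernel_eq_def, intro ballI)
    fix \<sigma> \<tau> assume "\<sigma> \<in> configs n b" "\<tau> \<in> configs n b"
    then have "Hzero n b nb B (permute n b (\<lambda>x. x) True \<sigma>) (permute n b (\<lambda>x. x) True \<tau>) = Hzero n b nb ((if True then - 1 else 1) * B) \<sigma> \<tau>"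
      by (intro permute_Hzero[OF T fb]) auto
    then show "Hzero n b nb B (permute n b (\<lambda>x. x) True \<sigma>) (permute n b (\<lambda>x. x) True \<tau>) = Hzero n b nb (- B) \<sigma> \<tau>" by simp
  qed
  finally have v2: "gs_energy n b (Hzero n b nb B) \<le> Re (\<psi> (Hzero n b nb (- B)))" .
  have "gs_energy n b (Hzero n b nb B) \<le> Re (\<psi> (Hzero n b nb 0)) - B * \<bar>Re (\<psi> (stag3 n b))\<bar>"
    using v1 v2 e\<psi>[of B] e\<psi>[of "- B"] by (cases "Re (\<psi> (stag3 n b)) \<ge> 0") (auto simp: abs_if)
  then show ?thesis using up lo low unfolding e\<phi> by linarith
qed

section \<open>Geometry of the torus\<close>

text \<open>The representative modulo \<open>2 L\<close> in \<open>{-L+1..L}\<close>.\<close>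
definition wrap :: "nat \<Rightarrow> int \<Rightarrow> int" where
  "wrap L z = (z + int L - 1) mod (2 * int L) - int L + 1"

lemma wrap_range: "L \<ge> 1 \<Longrightarrow> - int L + 1 \<le> wrap L z \<and> wrap L z \<le> int L"
proof -
  assume "L \<ge> 1"
  then have "0 \<le> (z + int L - 1) mod (2 * int L)" "(z + int L - 1) mod (2 * int L) < 2 * int L" by simp_all
  then show ?thesis by (simp add: wrap_def)
qed

lemma wrap_mult: "\<exists>k. wrap L z = z + 2 * int L * k"
proof -
  have "wrap L z = z + 2 * int L * (- ((z + int L - 1) div (2 * int L)))"
    using mult_div_mod_eq[of "2 * int L" "z + int L - 1"] by (simp add: wrap_def algebra_simps)
  then show ?thesis by blast
qed

lemma wrap_id: "- int L + 1 \<le> z \<Longrightarrow> z \<le> int L \<Longrightarrow> wrap L z = z"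
  by (simp add: wrap_def)

lemma wrap_diff_mod: "(wrap L p - wrap L q) mod (2 * int L) = (p - q) mod (2 * int L)"
proof -
  obtain k m where "wrap L p = p + 2 * int L * k" "wrap L q = q + 2 * int L * m" using wrap_mult by metis
  then have "wrap L p - wrap L q = (p - q) + (k - m) * (2 * int L)" by (simp add: algebra_simps)
  then show ?thesis by (metis mod_mult_self1)
qed

lemma wrap_eq_iff: "L \<ge> 1 \<Longrightarrow> wrap L p = wrap L q \<longleftrightarrow> (p - q) mod (2 * int L) = 0"
proof
  assume "wrap L p = wrap L q"
  then show "(p - q) mod (2 * int L) = 0" using wrap_diff_mod[of L p q] by simp
next
  assume L: "L \<ge> 1" and "(p - q) mod (2 * int L) = 0"
  then have "(wrap L p - wrap L q) mod (2 * int L) = 0" using wrap_diff_mod[of L p q] by simp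
  then have "2 * int L dvd wrap L p - wrap L q" by (simp add: dvd_eq_mod_eq_0)
  moreover have "\<bar>wrap L p - wrap L q\<bar> < 2 * int L" using wrap_range[OF L, of p] wrap_range[OF L, of q] by linarith
  ultimately have "wrap L p - wrap L q = 0" using zdvd_imp_le[of "2 * int L" "\<bar>wrap L p - wrap L q\<bar>"] by fastforce
  then show "wrap L p = wrap L q" by simp
qed

lemma wrap_even: "even (wrap L z - z)"
  using wrap_mult[of L z] by auto

section \<open>The box and its periodic neighbour relation\<close>

lemma box_lists: "box d L = {xs. set xs \<subseteq> {- int L + 1..int L} \<and> length xs = d}"
  unfolding box_def set_conv_nth by auto

lemma finite_box: "finite (box d L)"
  unfolding box_lists by (rule finite_lists_length_eq) simp

lemma card_box: "card (box d L) = (2 * L) ^ d"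
proof -
  have "card (box d L) = card {- int L + 1..int L} ^ d" unfolding box_lists by (rule card_lists_length_eq) simp
  also have "card {- int L + 1..int L} = 2 * L" by simp
  finally show ?thesis .
qed

lemma box_lattice: "box d L \<subseteq> lattice d"
  by (auto simp: box_def lattice_def)

lemma box_mono: "L \<le> L' \<Longrightarrow> box d L \<subseteq> box d L'"
  unfolding box_def by force

lemma boxD: "x \<in> box d L \<Longrightarrow> length x = d" "x \<in> box d L \<Longrightarrow> i < d \<Longrightarrow> - int L + 1 \<le> x ! i \<and> x ! i \<le> int L"
  by (auto simp: box_def)

lemma stag_sum: "length x = d \<Longrightarrow> stag x = (if even (\<Sum>k<d. x ! k) then 1 else -1)"
  by (simp add: stag_def sum_list_sum_nth atLeast0LessThan)

definition unitdiff :: "nat \<Rightarrow> int \<Rightarrow> bool" where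
  "unitdiff L z \<longleftrightarrow> z mod (2 * int L) = 1 \<or> z mod (2 * int L) = 2 * int L - 1"

lemma unitdiff_minus: "L \<ge> 1 \<Longrightarrow> unitdiff L (- z) \<longleftrightarrow> unitdiff L z"
  by (auto simp: unitdiff_def zmod_zminus1_eq_if)

lemma pnbr_iff: "length x = d \<Longrightarrow> pnbr L x y \<longleftrightarrow> (\<exists>i<d. unitdiff L (x ! i - y ! i) \<and> (\<forall>j<d. j \<noteq> i \<longrightarrow> x ! j = y ! j))"
  by (simp add: pnbr_def unitdiff_def)

lemma pnbr_sym: "L \<ge> 1 \<Longrightarrow> x \<in> box d L \<Longrightarrow> y \<in> box d L \<Longrightarrow> pnbr L x y \<Longrightarrow> pnbr L y x"
  unfolding pnbr_iff[OF boxD(1)] by (metis minus_diff_eq unitdiff_minus)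

lemma pnbr_irr: "L \<ge> 1 \<Longrightarrow> \<not> pnbr L x x"
  by (simp add: pnbr_def)

text \<open>One family of maps for translations and for reflections in coordinate hyperplanes, so
  that neighbours, bijectivity and staggering are treated once for both.\<close>

definition torus :: "nat \<Rightarrow> nat \<Rightarrow> (nat \<Rightarrow> int) \<Rightarrow> (nat \<Rightarrow> int) \<Rightarrow> site \<Rightarrow> site" where
  "torus d L s t u = map (\<lambda>k. wrap L (s k * u ! k + t k)) [0..<d]"

lemma torus_nth: "length (torus d L s t u) = d" "k < d \<Longrightarrow> torus d L s t u ! k = wrap L (s k * u ! k + t k)"
  by (simp_all add: torus_def)

lemma torus_in: "L \<ge> 1 \<Longrightarrow> torus d L s t u \<in> box d L"
  using wrap_range by (simp add: box_def torus_def)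

lemma dvd_sign: "s = 1 \<or> s = -1 \<Longrightarrow> m dvd s * z \<longleftrightarrow> m dvd z" for s m z :: int
  by auto

lemma torus_pnbr:
  assumes L: "L \<ge> 1" and s: "\<And>k. s k = 1 \<or> s k = -1" and uv: "u \<in> box d L" "v \<in> box d L"
  shows "pnbr L (torus d L s t u) (torus d L s t v) \<longleftrightarrow> pnbr L u v"
proof -
  have 1: "unitdiff L (torus d L s t u ! k - torus d L s t v ! k) \<longleftrightarrow> unitdiff L (u ! k - v ! k)" if "k < d" for k
  proof -
    have "unitdiff L (torus d L s t u ! k - torus d L s t v ! k) \<longleftrightarrow> unitdiff L (s k * (u ! k - v ! k))"
      unfolding torus_nth(2)[OF that] unitdiff_def wrap_diff_mod by (simp add: algebra_simps)
    also have "\<dots> \<longleftrightarrow> unitdiff L (u ! k - v ! k)"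
      using s[of k] unitdiff_minus[OF L, of "u ! k - v ! k"] by auto
    finally show ?thesis .
  qed
  have 2: "torus d L s t u ! k = torus d L s t v ! k \<longleftrightarrow> u ! k = v ! k" if k: "k < d" for k
  proof -
    have "torus d L s t u ! k = torus d L s t v ! k \<longleftrightarrow> (s k * (u ! k - v ! k)) mod (2 * int L) = 0"
      unfolding torus_nth(2)[OF k] wrap_eq_iff[OF L] by (simp add: algebra_simps)
    also have "\<dots> \<longleftrightarrow> (u ! k - v ! k) mod (2 * int L) = 0"
      unfolding dvd_eq_mod_eq_0[symmetric] by (rule dvd_sign[OF s])
    also have "\<dots> \<longleftrightarrow> wrap L (u ! k) = wrap L (v ! k)" unfolding wrap_eq_iff[OF L] ..
    also have "\<dots> \<longleftrightarrow> u ! k = v ! k" using boxD(2)[OF uv(1) k] boxD(2)[OF uv(2) k] by (simp add: wrap_id)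
    finally show ?thesis .
  qed
  show ?thesis
    unfolding pnbr_iff[OF torus_nth(1)] pnbr_iff[OF boxD(1)[OF uv(1)]] using 1 2 by auto
qed

lemma torus_inj:
  assumes L: "L \<ge> 1" and s: "\<And>k. s k = 1 \<or> s k = -1"
  shows "inj_on (torus d L s t) (box d L)"
proof (rule inj_onI)
  fix u v assume uv: "u \<in> box d L" "v \<in> box d L" "torus d L s t u = torus d L s t v"
  show "u = v"
  proof (rule nth_equalityI)
    show "length u = length v" using uv by (simp add: boxD)
    fix k assume "k < length u"
    then have k: "k < d" using uv by (simp add: boxD)
    have "wrap L (s k * u ! k + t k) = wrap L (s k * v ! k + t k)"
      using uv(3) torus_nth(2)[OF k] by metis
    then have "(s k * (u ! k - v ! k)) mod (2 * int L) = 0" unfolding wrap_eq_iff[OF L] by (simp add: algebra_simps)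
    then have "2 * int L dvd u ! k - v ! k" unfolding dvd_eq_mod_eq_0[symmetric] dvd_sign[OF s] .
    then have "wrap L (u ! k) = wrap L (v ! k)" unfolding wrap_eq_iff[OF L] by (simp add: dvd_eq_mod_eq_0)
    then show "u ! k = v ! k" using boxD(2)[OF uv(1) k] boxD(2)[OF uv(2) k] by (simp add: wrap_id)
  qed
qed

lemma torus_bij: "L \<ge> 1 \<Longrightarrow> (\<And>k. s k = 1 \<or> s k = -1) \<Longrightarrow> bij_betw (torus d L s t) (box d L) (box d L)"
  using torus_inj torus_in finite_box by (metis bij_betw_def endo_inj_surj image_subsetI)

text \<open>The side length 2L is even, so neither wrapping nor a change of sign affects parity;
  only the shift does.\<close>

lemma torus_stag:
  assumes L: "L \<ge> 1" and s: "\<And>k. s k = 1 \<or> s k = -1" and u: "u \<in> box d L"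
  shows "stag (torus d L s t u) = of_real (if even (\<Sum>k<d. t k) then 1 else -1) * stag u"
proof -
  have parity: "even (a - b) \<Longrightarrow> even a \<longleftrightarrow> even b" for a b :: int by presburger
  have "even ((\<Sum>k<d. torus d L s t u ! k) - (\<Sum>k<d. u ! k + t k))"
    unfolding sum_subtractf[symmetric]
  proof (rule dvd_sum)
    fix k assume "k \<in> {..<d}"
    then have k: "k < d" by simp
    have "even (s k * u ! k - u ! k)" using s[of k] by auto
    moreover have "even (wrap L (s k * u ! k + t k) - (s k * u ! k + t k))" by (rule wrap_even)
    ultimately have "even ((s k * u ! k - u ! k) + (wrap L (s k * u ! k + t k) - (s k * u ! k + t k)))"
      by (rule dvd_add)
    then show "even (torus d L s t u ! k - (u ! k + t k))" unfolding torus_nth(2)[OF k] by (simp add: algebra_simps)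
  qed
  then have "even (\<Sum>k<d. torus d L s t u ! k) \<longleftrightarrow> even ((\<Sum>k<d. u ! k) + (\<Sum>k<d. t k))"
    unfolding sum.distrib by (rule parity)
  then show ?thesis unfolding stag_sum[OF torus_nth(1)] stag_sum[OF boxD(1)[OF u]] by auto
qed

lemma torus_transitive:
  assumes L: "L \<ge> 1" and xy: "x \<in> box d L" "y \<in> box d L"
  obtains t where "torus d L (\<lambda>_. 1) t x = y"
proof (rule that[of "\<lambda>k. y ! k - x ! k"])
  show "torus d L (\<lambda>_. 1) (\<lambda>k. y ! k - x ! k) x = y"
  proof (rule nth_equalityI)
    show "length (torus d L (\<lambda>_. 1) (\<lambda>k. y ! k - x ! k) x) = length y" using xy by (simp add: torus_nth boxD)
    fix k assume "k < length (torus d L (\<lambda>_. 1) (\<lambda>k. y ! k - x ! k) x)"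
    then have k: "k < d" by (simp add: torus_nth)
    then show "torus d L (\<lambda>_. 1) (\<lambda>k. y ! k - x ! k) x ! k = y ! k"
      using boxD(2)[OF xy(2) k] by (simp add: torus_nth wrap_id)
  qed
qed

text \<open>Reflect in a plane halfway between x and y. With coordinates \<open>c\<close> counted
  from \<open>a\<close> along the direction of the bond, \<open>W\<close> is the half circle where c
  < L. The torus is cut in two places, between c = 2L - 1 and 0 and between c = L - 1 and L.\<close>

lemma torus_reflection:
  assumes L: "L \<ge> 1" and xy: "x \<in> box d L" "y \<in> box d L" "pnbr L x y"
  shows "\<exists>\<theta> W. reflection (box d L) (pnbr L) \<theta> W \<and> x \<in> W \<and> y \<notin> W"
proof -
  let ?m = "2 * int L"
  obtain i where i: "i < d" "unitdiff L (x ! i - y ! i)" "\<And>j. j < d \<Longrightarrow> j \<noteq> i \<Longrightarrow> x ! j = y ! j"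
    using xy(3) unfolding pnbr_iff[OF boxD(1)[OF xy(1)]] by blast
  \<comment> \<open>Puts the bond on one of the two cuts with x inside \<open>W\<close>: x is the
    first site of the half circle if y precedes it, and the last one if y follows it.\<close>
  define a where "a = (if (x ! i - y ! i) mod ?m = 1 then x ! i else x ! i - int L + 1)"
  define s where "s = (\<lambda>k. if k = i then -1 else 1 :: int)"
  define t where "t = (\<lambda>k. if k = i then 2 * a - 1 else 0)"
  define \<theta> where "\<theta> = torus d L s t"
  define c where "c u = (u ! i - a) mod ?m" for u :: site
  define W where "W = {u \<in> box d L. c u < int L}"
  have s: "\<And>k. s k = 1 \<or> s k = -1" by (simp add: s_def)
  have crange: "0 \<le> c u" "c u < ?m" for u using L by (simp_all add: c_def)
  have \<theta>in: "\<theta> u \<in> box d L" for u unfolding \<theta>_def by (rule torus_in[OF L])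
  have \<theta>i: "\<theta> u ! i = wrap L (2 * a - 1 - u ! i)" for u
    unfolding \<theta>_def torus_nth(2)[OF i(1)] by (simp add: s_def t_def algebra_simps)
  have \<theta>j: "\<theta> u ! j = u ! j" if "u \<in> box d L" "j < d" "j \<noteq> i" for u j
    unfolding \<theta>_def torus_nth(2)[OF that(2)] using that boxD(2)[OF that(1,2)] by (simp add: s_def t_def wrap_id)
  have c\<theta>: "c (\<theta> u) = ?m - 1 - c u" for u
  proof -
    obtain k where k: "wrap L (2 * a - 1 - u ! i) = 2 * a - 1 - u ! i + ?m * k" using wrap_mult by blast
    have "2 * a - 1 - u ! i + ?m * k - a = - (u ! i - a) - 1 + k * ?m" by (simp add: algebra_simps)
    then have "c (\<theta> u) = (- (u ! i - a) - 1 + k * ?m) mod ?m" unfolding c_def \<theta>i k by (simp only:)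
    also have "\<dots> = (- (u ! i - a) - 1) mod ?m" by (rule mod_mult_self1)
    also have "\<dots> = (- c u - 1) mod ?m" unfolding c_def by (metis mod_diff_left_eq mod_minus_eq)
    also have "\<dots> = (- c u - 1 + 1 * ?m) mod ?m" by (rule mod_mult_self1[symmetric])
    also have "\<dots> = - c u - 1 + 1 * ?m"
      using crange[of u] by (intro mod_pos_pos_trivial) linarith+
    also have "\<dots> = ?m - 1 - c u" by simp
    finally show ?thesis .
  qed
  have \<theta>\<theta>: "\<theta> (\<theta> u) = u" if u: "u \<in> box d L" for u
  proof (rule nth_equalityI)
    show "length (\<theta> (\<theta> u)) = length u" using boxD(1)[OF \<theta>in] boxD(1)[OF u] by simp
    fix k assume "k < length (\<theta> (\<theta> u))"
    then have k: "k < d" using boxD(1)[OF \<theta>in] by simp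
    show "\<theta> (\<theta> u) ! k = u ! k"
    proof (cases "k = i")
      case True
      obtain m where m: "wrap L (2 * a - 1 - u ! i) = 2 * a - 1 - u ! i + ?m * m" using wrap_mult by blast
      have "\<theta> (\<theta> u) ! i = wrap L (u ! i)"
        unfolding \<theta>i wrap_eq_iff[OF L] m by (simp add: algebra_simps)
      then show ?thesis using True boxD(2)[OF u i(1)] by (simp add: wrap_id)
    next
      case False
      then show ?thesis using \<theta>j[OF \<theta>in k] \<theta>j[OF u k] by simp
    qed
  qed
  \<comment> \<open>The mirror plane passes between lattice sites, so the shift 2a - 1 is odd and
    the sublattices are exchanged.\<close>
  have odd: "odd (\<Sum>k<d. t k)"
  proof -
    have "(\<Sum>k<d. t k) = 2 * a - 1" using i(1) by (simp add: t_def)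
    then show ?thesis by simp
  qed
  have stag: "stag (\<theta> u) = - stag u" if "u \<in> box d L" for u
    unfolding \<theta>_def torus_stag[OF L s that] using odd by simp
  have cross: "v = \<theta> u" if uv: "u \<in> W" "v \<in> box d L - W" "pnbr L u v" for u v
  proof -
    have u: "u \<in> box d L" "c u < int L" and v: "v \<in> box d L" "int L \<le> c v" using uv by (auto simp: W_def)
    obtain k where k: "k < d" "unitdiff L (u ! k - v ! k)" "\<And>j. j < d \<Longrightarrow> j \<noteq> k \<Longrightarrow> u ! j = v ! j"
      using uv(3) unfolding pnbr_iff[OF boxD(1)[OF u(1)]] by blast
    have "k = i"
    proof (rule ccontr)
      assume "k \<noteq> i"
      then have "c u = c v" using k(3)[OF i(1)] by (simp add: c_def)
      then show False using u(2) v(2) by simp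
    qed
    have "unitdiff L (c u - c v)" using k(2) unfolding \<open>k = i\<close> unitdiff_def c_def by (simp add: mod_diff_eq)
    moreover have "(c u - c v) mod ?m = c u - c v + ?m"
    proof -
      have "(c u - c v + ?m) mod ?m = c u - c v + ?m"
        using crange[of u] crange[of v] u(2) v(2) by (intro mod_pos_pos_trivial) linarith+
      then show ?thesis by simp
    qed
    \<comment> \<open>These are the two cuts; in both cases c u + c v = 2L - 1, the relation between
      mirror images.\<close>
    ultimately have "c u - c v = 1 - ?m \<or> c u - c v = - 1" unfolding unitdiff_def by auto
    then have cv: "c v = ?m - 1 - c u"
      using crange[of u] crange[of v] u(2) v(2) by auto
    show "v = \<theta> u"
    proof (rule nth_equalityI)
      show "length v = length (\<theta> u)" using boxD(1)[OF \<theta>in] boxD(1)[OF v(1)] by simp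
      fix j assume "j < length v"
      then have j: "j < d" using boxD(1)[OF v(1)] by simp
      show "v ! j = \<theta> u ! j"
      proof (cases "j = i")
        case True
        have "c v = c (\<theta> u)" using cv c\<theta> by simp
        then have "(v ! i - \<theta> u ! i) mod ?m = 0" unfolding c_def mod_eq_dvd_iff dvd_eq_mod_eq_0[symmetric] by simp
        then have "wrap L (v ! i) = wrap L (\<theta> u ! i)" unfolding wrap_eq_iff[OF L] .
        then show ?thesis using True boxD(2)[OF v(1) i(1)] boxD(2)[OF \<theta>in i(1)] by (simp add: wrap_id)
      next
        case False
        then show ?thesis using \<theta>j[OF u(1) j] k(3)[OF j] \<open>k = i\<close> by simp
      qed
    qed
  qed
  have "reflection (box d L) (pnbr L) \<theta> W"
    unfolding reflection_def
  proof (intro conjI ballI impI)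
    show "W \<subseteq> box d L" by (auto simp: W_def)
    fix u assume u: "u \<in> box d L"
    show "\<theta> u \<in> box d L" by (rule \<theta>in)
    show "\<theta> (\<theta> u) = u" by (rule \<theta>\<theta>[OF u])
    show "(\<theta> u \<in> W) = (u \<notin> W)" using u \<theta>in c\<theta>[of u] by (auto simp: W_def)
    show "stag (\<theta> u) = - stag u" by (rule stag[OF u])
    fix v assume v: "v \<in> box d L"
    show "pnbr L (\<theta> u) (\<theta> v) = pnbr L u v" unfolding \<theta>_def by (rule torus_pnbr[OF L s u v])
  next
    fix u v assume "u \<in> W" "v \<in> box d L - W" "pnbr L u v"
    then show "v = \<theta> u" by (rule cross)
  qed
  moreover have "c x < int L \<and> \<not> c y < int L"
  proof (cases "(x ! i - y ! i) mod ?m = 1")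
    case True
    have "c x = 0" using True by (simp add: c_def a_def)
    moreover have "c y = ?m - 1"
    proof -
      have "c y = (- (x ! i - y ! i)) mod ?m" using True by (simp add: c_def a_def)
      also have "\<dots> = ?m - 1" using True L by (simp add: zmod_zminus1_eq_if del: minus_diff_eq)
      finally show ?thesis .
    qed
    ultimately show ?thesis using L by simp
  next
    case False
    then have F: "(x ! i - y ! i) mod ?m = ?m - 1" using i(2) by (simp add: unitdiff_def)
    have "c x = int L - 1" using False L by (simp add: c_def a_def)
    moreover have "c y = int L"
    proof -
      have "c y = (int L - 1 - (x ! i - y ! i)) mod ?m" using False by (simp add: c_def a_def algebra_simps)
      also have "\<dots> = (int L - 1 - (x ! i - y ! i) mod ?m) mod ?m" by (rule mod_diff_right_eq[symmetric])
      also have "\<dots> = (int L + (-1) * ?m) mod ?m" unfolding F by (simp add: algebra_simps)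
      also have "\<dots> = int L mod ?m" by (rule mod_mult_self1)
      also have "\<dots> = int L" using L by simp
      finally show ?thesis .
    qed
    ultimately show ?thesis by simp
  qed
  ultimately show ?thesis using xy by (intro exI[of _ \<theta>] exI[of _ W]) (auto simp: W_def)
qed

text \<open>At the excluded distance 2L - 1 the points are neighbours around the torus.\<close>

lemma unitdiff_small:
  assumes "\<bar>z\<bar> < 2 * int L - 1"
  shows "unitdiff L z \<longleftrightarrow> \<bar>z\<bar> = 1"
proof (cases "z \<ge> 0")
  case True
  then have "z mod (2 * int L) = z" using assms by simp
  then show ?thesis using assms True by (auto simp: unitdiff_def)
next
  case False
  then have "(z + 2 * int L) mod (2 * int L) = z + 2 * int L"
    using assms by (intro mod_pos_pos_trivial) linarith+
  then have "z mod (2 * int L) = z + 2 * int L" by simp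
  then show ?thesis using assms False by (auto simp: unitdiff_def)
qed

text \<open>Coordinates differ by at most r + L - 1, which is below 2L - 1, so no bond at a site of
  the smaller box winds around the torus.\<close>

lemma pnbr_local:
  assumes "r < L" "x \<in> box d r" "y \<in> box d L"
  shows "pnbr L x y \<longleftrightarrow> (\<exists>i<d. \<bar>x ! i - y ! i\<bar> = 1 \<and> (\<forall>j<d. j \<noteq> i \<longrightarrow> x ! j = y ! j))"
proof -
  have "unitdiff L (x ! i - y ! i) \<longleftrightarrow> \<bar>x ! i - y ! i\<bar> = 1" if "i < d" for i
    using boxD(2)[OF assms(2) that] boxD(2)[OF assms(3) that] assms(1) by (intro unitdiff_small) linarith
  then show ?thesis unfolding pnbr_iff[OF boxD(1)[OF assms(2)]] by auto
qed

lemma pnbr_step: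
  assumes "r < L" "x \<in> box d r" "y \<in> box d L" "pnbr L x y"
  shows "y \<in> box d (Suc r)"
proof -
  obtain i where i: "i < d" "\<bar>x ! i - y ! i\<bar> = 1" "\<And>j. j < d \<Longrightarrow> j \<noteq> i \<Longrightarrow> x ! j = y ! j"
    using assms(4) unfolding pnbr_local[OF assms(1-3)] by blast
  have "- int (Suc r) + 1 \<le> y ! j \<and> y ! j \<le> int (Suc r)" if "j < d" for j
    using boxD(2)[OF assms(2) that] i(2) i(3)[OF that] by (cases "j = i") auto
  then show ?thesis using boxD(1)[OF assms(3)] by (simp add: box_def)
qed

text \<open>Only an inequality, because for L = 1 the two neighbours in a given direction
  coincide.\<close>

lemma pnbr_degree_le:
  assumes "L \<ge> 1" "x \<in> box d L"
  shows "card {y \<in> box d L. pnbr L x y} \<le> 2 * d"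
proof -
  have "{y \<in> box d L. pnbr L x y} \<subseteq> (\<lambda>(i, e). x[i := wrap L (x ! i + e)]) ` ({..<d} \<times> {-1, 1})"
  proof
    fix y assume y: "y \<in> {y \<in> box d L. pnbr L x y}"
    then obtain i where i: "i < d" "unitdiff L (x ! i - y ! i)" "\<And>j. j < d \<Longrightarrow> j \<noteq> i \<Longrightarrow> x ! j = y ! j"
      unfolding pnbr_iff[OF boxD(1)[OF assms(2)]] by auto
    have yb: "y \<in> box d L" using y by simp
    have "\<exists>e\<in>{-1,1}. wrap L (y ! i) = wrap L (x ! i + e)"
    proof (cases "(x ! i - y ! i) mod (2 * int L) = 1")
      case True
      then have "((x ! i - y ! i) mod (2 * int L) - 1) mod (2 * int L) = 0" by simp
      then have "(x ! i - y ! i - 1) mod (2 * int L) = 0" by (simp add: mod_diff_left_eq)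
      then have "wrap L (x ! i + -1) = wrap L (y ! i)" unfolding wrap_eq_iff[OF assms(1)] by (simp add: algebra_simps)
      then show ?thesis by auto
    next
      case False
      then have "(x ! i - y ! i) mod (2 * int L) = 2 * int L - 1" using i(2) by (simp add: unitdiff_def)
      then have "((x ! i - y ! i) mod (2 * int L) + 1) mod (2 * int L) = 0" by simp
      then have "(x ! i - y ! i + 1) mod (2 * int L) = 0" by (simp add: mod_add_left_eq)
      then have "wrap L (x ! i + 1) = wrap L (y ! i)" unfolding wrap_eq_iff[OF assms(1)] by (simp add: algebra_simps)
      then show ?thesis by auto
    qed
    moreover have "wrap L (y ! i) = y ! i" using boxD(2)[OF yb i(1)] by (simp add: wrap_id)
    ultimately obtain e where e: "e \<in> {-1,1}" "y ! i = wrap L (x ! i + e)" by metis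
    have "y = x[i := wrap L (x ! i + e)]"
    proof (rule nth_equalityI)
      show "length y = length (x[i := wrap L (x ! i + e)])" using boxD(1)[OF yb] boxD(1)[OF assms(2)] by simp
      fix j assume "j < length y"
      then show "y ! j = x[i := wrap L (x ! i + e)] ! j"
        using i(1) i(3)[of j] e(2) boxD(1)[OF yb] boxD(1)[OF assms(2)] by (cases "j = i") simp_all
    qed
    then show "y \<in> (\<lambda>(i, e). x[i := wrap L (x ! i + e)]) ` ({..<d} \<times> {-1, 1})"
      using i(1) e(1) by (intro image_eqI[of _ _ "(i, e)"]) auto
  qed
  then have "card {y \<in> box d L. pnbr L x y} \<le> card ((\<lambda>(i, e). x[i := wrap L (x ! i + e)]) ` ({..<d} \<times> {-1, 1}))"
    by (intro card_mono) auto
  also have "\<dots> \<le> card ({..<d} \<times> {-1, 1::int})" by (intro card_image_le) auto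
  finally show ?thesis by simp
qed

lemma pnbr_degree_const:
  assumes "L \<ge> 1" "x \<in> box d L" "y \<in> box d L"
  shows "card {z \<in> box d L. pnbr L x z} = card {z \<in> box d L. pnbr L y z}"
proof -
  have le: "card {z \<in> box d L. pnbr L x z} \<le> card {z \<in> box d L. pnbr L y z}" if xy: "x \<in> box d L" "y \<in> box d L" for x y
  proof -
    obtain t where t: "torus d L (\<lambda>_. 1) t x = y" by (rule torus_transitive[OF assms(1) xy])
    show ?thesis
    proof (rule card_inj_on_le)
      show "inj_on (torus d L (\<lambda>_. 1) t) {z \<in> box d L. pnbr L x z}"
        by (rule inj_on_subset[OF torus_inj[OF assms(1)]]) auto
      show "torus d L (\<lambda>_. 1) t ` {z \<in> box d L. pnbr L x z} \<subseteq> {z \<in> box d L. pnbr L y z}"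
        using torus_pnbr[OF assms(1) _ xy(1), of "\<lambda>_. 1" _ t] torus_in[OF assms(1)] t by auto
      show "finite {z \<in> box d L. pnbr L y z}" using finite_box by auto
    qed
  qed
  show ?thesis using le[OF assms(2,3)] le[OF assms(3,2)] by simp
qed

lemma pnbr_degree_pos:
  assumes "L \<ge> 1" "d \<ge> 1" "x \<in> box d L"
  shows "1 \<le> card {y \<in> box d L. pnbr L x y}"
proof -
  define y where "y = x[0 := wrap L (x ! 0 - 1)]"
  have "y \<in> box d L"
    using wrap_range[OF assms(1)] assms(2,3) unfolding y_def box_def by (auto simp: nth_list_update)
  moreover have "pnbr L x y"
    unfolding pnbr_iff[OF boxD(1)[OF assms(3)]]
  proof (intro exI[of _ 0] conjI allI impI)
    show "0 < d" using assms(2) by simp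
    have "x ! 0 - y ! 0 = wrap L (x ! 0) - wrap L (x ! 0 - 1)"
      using assms(2) boxD[OF assms(3)] by (simp add: y_def wrap_id)
    then show "unitdiff L (x ! 0 - y ! 0)" unfolding unitdiff_def using assms(1) by (simp add: wrap_diff_mod)
    fix j assume "j < d" "j \<noteq> 0" then show "x ! j = y ! j" by (simp add: y_def)
  qed
  ultimately have "y \<in> {y \<in> box d L. pnbr L x y}" by simp
  moreover have "finite {y \<in> box d L. pnbr L x y}" using finite_box by auto
  ultimately show ?thesis by (metis One_nat_def Suc_leI card_gt_0_iff empty_iff)
qed

text \<open>Only the outermost shell, the difference of the boxes of radius r and r - 1, has
  neighbours outside.\<close>

lemma ncross_box:
  assumes "r \<ge> 1" "r < L"
  shows "ncross (box d L) (pnbr L) (box d r) \<le> 2 * real d * ((2 * real r) ^ d - (2 * (real r - 1)) ^ d)"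
proof -
  have 0: "card {y \<in> box d L - box d r. pnbr L x y} = 0" if x: "x \<in> box d (r - 1)" for x
  proof -
    have "y \<in> box d r" if "y \<in> box d L" "pnbr L x y" for y
      using pnbr_step[OF _ x that] assms by simp
    then have "{y \<in> box d L - box d r. pnbr L x y} = {}" by auto
    then show ?thesis by (simp only: card.empty)
  qed
  have 1: "real (card {y \<in> box d L - box d r. pnbr L x y}) \<le> 2 * real d" if "x \<in> box d r" for x
  proof -
    have "x \<in> box d L" using that box_mono[of r L d] assms by auto
    then have "card {y \<in> box d L. pnbr L x y} \<le> 2 * d" using assms by (intro pnbr_degree_le) auto
    moreover have "card {y \<in> box d L - box d r. pnbr L x y} \<le> card {y \<in> box d L. pnbr L x y}"
      using finite_box by (intro card_mono) auto
    ultimately show ?thesis by linarith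
  qed
  have sub: "box d (r - 1) \<subseteq> box d r" by (rule box_mono) simp
  have "ncross (box d L) (pnbr L) (box d r) = (\<Sum>x\<in>box d r - box d (r - 1). real (card {y \<in> box d L - box d r. pnbr L x y}))"
    unfolding ncross_def using 0 finite_box by (intro sum.mono_neutral_right) auto
  also have "\<dots> \<le> (\<Sum>x\<in>box d r - box d (r - 1). 2 * real d)"
    using 1 by (intro sum_mono) auto
  also have "\<dots> = 2 * real d * real (card (box d r - box d (r - 1)))" by simp
  also have "card (box d r - box d (r - 1)) = (2 * r) ^ d - (2 * (r - 1)) ^ d"
    unfolding card_Diff_subset[OF finite_box sub] card_box ..
  also have "real ((2 * r) ^ d - (2 * (r - 1)) ^ d) = (2 * real r) ^ d - (2 * (real r - 1)) ^ d"
  proof -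
    have "(2 * (r - 1)) ^ d \<le> (2 * r) ^ d" by (intro power_mono) auto
    then have "real ((2 * r) ^ d - (2 * (r - 1)) ^ d) = real ((2 * r) ^ d) - real ((2 * (r - 1)) ^ d)" by (rule of_nat_diff)
    then show ?thesis using assms(1) by (simp only: of_nat_power of_nat_mult of_nat_numeral of_nat_diff of_nat_1)
  qed
  finally show ?thesis .
qed

section \<open>Counting lattice points\<close>

lemma card_coordinates:
  fixes S :: "int list set"
  assumes "\<And>y. y \<in> S \<Longrightarrow> length y = d" "\<And>y k. y \<in> S \<Longrightarrow> k < d \<Longrightarrow> y ! k \<in> A k" "\<And>k. k < d \<Longrightarrow> finite (A k)"
  shows "finite S \<and> card S \<le> (\<Prod>k<d. card (A k))"
proof -
  define F where "F y = (\<lambda>k\<in>{..<d}. y ! k)" for y :: "int list"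
  have inj: "inj_on F S"
  proof (rule inj_onI)
    fix y z assume yz: "y \<in> S" "z \<in> S" "F y = F z"
    show "y = z"
    proof (rule nth_equalityI)
      show "length y = length z" using assms(1) yz by simp
      fix k assume "k < length y"
      then show "y ! k = z ! k" using fun_cong[OF yz(3), of k] assms(1)[OF yz(1)] by (simp add: F_def)
    qed
  qed
  have sub: "F ` S \<subseteq> PiE {..<d} A" unfolding F_def using assms(2) by (auto simp: restrict_PiE_iff split: if_splits)
  have fin: "finite (PiE {..<d} A)" using assms(3) by (intro finite_PiE) auto
  have "finite S" using finite_imageD[OF finite_subset[OF sub fin] inj] .
  moreover have "card S \<le> card (PiE {..<d} A)" by (rule card_inj_on_le[OF inj sub fin])
  ultimately show ?thesis by (simp add: card_PiE)
qed

lemma dist_site_ge: "length x = d \<Longrightarrow> k < d \<Longrightarrow> \<bar>real_of_int (x ! k - y ! k)\<bar> \<le> dist_site x y"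
proof -
  assume x: "length x = d" and k: "k < d"
  have "(real_of_int (x ! k - y ! k))\<^sup>2 \<le> (\<Sum>i<d. (real_of_int (x ! i - y ! i))\<^sup>2)"
    using k by (intro member_le_sum) auto
  then have "sqrt ((real_of_int (x ! k - y ! k))\<^sup>2) \<le> dist_site x y"
    unfolding dist_site_def x by (rule real_sqrt_le_mono)
  then show ?thesis by simp
qed

lemma card_near:
  assumes "length x = d"
  shows "card {y \<in> box d R. dist_site x y < real m} \<le> (2 * m + 1) ^ d"
proof -
  have "card {y \<in> box d R. dist_site x y < real m} \<le> (\<Prod>k<d. card {x ! k - int m..x ! k + int m})"
  proof (rule conjunct2[OF card_coordinates])
    fix y k assume y: "y \<in> {y \<in> box d R. dist_site x y < real m}" and k: "k < d"
    have "\<bar>real_of_int (x ! k - y ! k)\<bar> < real m" using dist_site_ge[OF assms k, of y] y by simp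
    then show "y ! k \<in> {x ! k - int m..x ! k + int m}" by auto
  qed (auto simp: boxD)
  also have "\<dots> = (\<Prod>k<d. 2 * m + 1)" by (intro prod.cong refl) (simp add: nat_eq_iff)
  also have "\<dots> = (2 * m + 1) ^ d" by simp
  finally show ?thesis .
qed

lemma sum_UN_le:
  fixes f :: "'a \<Rightarrow> real"
  assumes "finite I" "\<And>i. i \<in> I \<Longrightarrow> finite (Y i)" "\<And>x. 0 \<le> f x"
  shows "sum f (\<Union>i\<in>I. Y i) \<le> (\<Sum>i\<in>I. sum f (Y i))"
  using assms(1,2)
proof (induction I)
  case (insert i I)
  have fin: "finite (Y i)" "finite (\<Union>i\<in>I. Y i)" using insert by auto
  have "sum f (Y i \<union> (\<Union>i\<in>I. Y i)) \<le> sum f (Y i) + sum f (\<Union>i\<in>I. Y i)"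
    unfolding sum_Un[OF fin] using assms(3) by (simp add: sum_nonneg)
  also have "sum f (\<Union>i\<in>I. Y i) \<le> (\<Sum>i\<in>I. sum f (Y i))" using insert by auto
  finally show ?case using insert by simp
qed simp

text \<open>The sum over shells of the supremum norm: the largest coordinate of \<open>y - x\<close> takes at most \<open>4 R\<close> values
  in each of the \<open>d\<close> directions.\<close>
lemma sum_inverse_dist:
  assumes x: "x \<in> box d R"
  shows "(\<Sum>y\<in>box d R - {x}. 1 / dist_site x y ^ (d - 1)) \<le> real d * (4 * real R) * 3 ^ (d - 1)"
proof -
  define Y where "Y k c = {y \<in> box d R. x ! k - y ! k = c \<and> (\<forall>j<d. \<bar>x ! j - y ! j\<bar> \<le> \<bar>c\<bar>)}" for k c
  define C where "C = {- 2 * int R..2 * int R} - {0}"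
  have finY: "finite (Y k c)" for k c unfolding Y_def using finite_box by auto
  have lx: "length x = d" using x by (rule boxD)
  have cover: "box d R - {x} \<subseteq> (\<Union>(k, c)\<in>{..<d} \<times> C. Y k c)"
  proof
    fix y assume y: "y \<in> box d R - {x}"
    have d: "d > 0" using y x by (cases d) (auto simp: box_def)
    define m where "m = Max ((\<lambda>j. \<bar>x ! j - y ! j\<bar>) ` {..<d})"
    have "m \<in> (\<lambda>j. \<bar>x ! j - y ! j\<bar>) ` {..<d}" unfolding m_def using d by (intro Max_in) auto
    then obtain k where k: "k < d" "m = \<bar>x ! k - y ! k\<bar>" by auto
    have le: "\<bar>x ! j - y ! j\<bar> \<le> m" if "j < d" for j unfolding m_def using that by (intro Max_ge) auto
    have "x ! k - y ! k \<noteq> 0"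
    proof
      assume "x ! k - y ! k = 0"
      then have "x ! j = y ! j" if "j < d" for j using le[OF that] k(2) by simp
      then have "x = y" using lx y by (intro nth_equalityI) (auto simp: boxD)
      then show False using y by simp
    qed
    then have "x ! k - y ! k \<in> C" using boxD(2)[OF x k(1)] boxD(2)[of y d R k] k(1) y by (auto simp: C_def)
    then show "y \<in> (\<Union>(k, c)\<in>{..<d} \<times> C. Y k c)" using k le y by (auto simp: Y_def intro!: bexI[of _ "(k, x ! k - y ! k)"])
  qed
  have shell: "(\<Sum>y\<in>Y k c. 1 / dist_site x y ^ (d - 1)) \<le> 3 ^ (d - 1)" if k: "k < d" and c: "c \<in> C" for k c
  proof -
    have c0: "1 \<le> \<bar>c\<bar>" using c by (auto simp: C_def)
    have "card (Y k c) \<le> (\<Prod>j<d. card (if j = k then {x ! k - c} else {x ! j - \<bar>c\<bar>..x ! j + \<bar>c\<bar>}))"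
    proof (rule conjunct2[OF card_coordinates])
      fix y j assume y: "y \<in> Y k c" and j: "j < d"
      then have "\<bar>x ! j - y ! j\<bar> \<le> \<bar>c\<bar>" "x ! k - y ! k = c" by (auto simp: Y_def)
      then show "y ! j \<in> (if j = k then {x ! k - c} else {x ! j - \<bar>c\<bar>..x ! j + \<bar>c\<bar>})" by auto
    qed (auto simp: Y_def boxD)
    also have "\<dots> = (\<Prod>j\<in>{..<d} - {k}. card {x ! j - \<bar>c\<bar>..x ! j + \<bar>c\<bar>})"
      using k by (subst prod.remove[of _ k]) auto
    also have "\<dots> = nat (2 * \<bar>c\<bar> + 1) ^ (d - 1)" using k by (simp add: card_Diff_singleton)
    finally have cY: "card (Y k c) \<le> nat (2 * \<bar>c\<bar> + 1) ^ (d - 1)" .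
    have "(\<Sum>y\<in>Y k c. 1 / dist_site x y ^ (d - 1)) \<le> (\<Sum>y\<in>Y k c. 1 / real_of_int \<bar>c\<bar> ^ (d - 1))"
    proof (rule sum_mono)
      fix y assume y: "y \<in> Y k c"
      have "real_of_int \<bar>c\<bar> \<le> dist_site x y" using dist_site_ge[OF lx k, of y] y by (auto simp: Y_def)
      then show "1 / dist_site x y ^ (d - 1) \<le> 1 / real_of_int \<bar>c\<bar> ^ (d - 1)"
        using c0 by (intro divide_left_mono power_mono mult_pos_pos zero_less_power) auto
    qed
    also have "\<dots> = real (card (Y k c)) / real_of_int \<bar>c\<bar> ^ (d - 1)" by simp
    also have "\<dots> \<le> real (nat (2 * \<bar>c\<bar> + 1) ^ (d - 1)) / real_of_int \<bar>c\<bar> ^ (d - 1)"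
      using cY c0 by (intro divide_right_mono) (auto simp del: of_nat_power)
    also have "real (nat (2 * \<bar>c\<bar> + 1) ^ (d - 1)) = (2 * real_of_int \<bar>c\<bar> + 1) ^ (d - 1)" by simp
    \<comment> \<open>Uses 2c + 1 \<le> 3c for the modulus c \<ge> 1, the origin of the factor 3^(d
      - 1).\<close>
    also have "(2 * real_of_int \<bar>c\<bar> + 1) ^ (d - 1) / real_of_int \<bar>c\<bar> ^ (d - 1) \<le> (3 * real_of_int \<bar>c\<bar>) ^ (d - 1) / real_of_int \<bar>c\<bar> ^ (d - 1)"
      using c0 by (intro divide_right_mono power_mono) auto
    also have "\<dots> = 3 ^ (d - 1)" unfolding power_mult_distrib using c0 by (intro nonzero_mult_div_cancel_right) auto
    finally show ?thesis .
  qed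
  have nonneg: "0 \<le> 1 / dist_site x y ^ (d - 1)" for y by (simp add: dist_site_def sum_nonneg)
  have "(\<Sum>y\<in>box d R - {x}. 1 / dist_site x y ^ (d - 1)) \<le> (\<Sum>y\<in>(\<Union>(k, c)\<in>{..<d} \<times> C. Y k c). 1 / dist_site x y ^ (d - 1))"
    using cover nonneg finY by (intro sum_mono2) (auto simp: C_def)
  also have "\<dots> \<le> (\<Sum>p\<in>{..<d} \<times> C. \<Sum>y\<in>(case p of (k, c) \<Rightarrow> Y k c). 1 / dist_site x y ^ (d - 1))"
    using finY nonneg by (intro sum_UN_le) (auto simp: C_def)
  also have "\<dots> \<le> (\<Sum>p\<in>{..<d} \<times> C. 3 ^ (d - 1))" using shell by (intro sum_mono) auto
  also have "\<dots> = real d * real (card C) * 3 ^ (d - 1)" by (simp add: card_cartesian_product)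
  also have "card C = 4 * R" by (simp add: C_def card_Diff_singleton)
  finally show ?thesis by simp
qed

section \<open>Staggered magnetization in a field\<close>

lemma Hp_eq: "Hp n d L B = Hzero n (box d L) (pnbr L) B"
  unfolding Hp_def H0p_def Oop_def Hzero_eq heis_def stag3_def spin_simps ..

lemma H0p_eq: "H0p n d L = Hzero n (box d L) (pnbr L) 0"
  unfolding H0p_def Hzero_eq heis_def by simp

lemma Oop_eq: "Oop n d L = stag3 n (box d L)"
  unfolding Oop_def stag3_def spin_simps ..

lemma Hzero_cong:
  assumes "\<And>x y. x \<in> V \<Longrightarrow> y \<in> V \<Longrightarrow> nb x y \<longleftrightarrow> nb' x y"
  shows "Hzero n V nb B = Hzero n V nb' B"
  unfolding Hzero_eq using assms
  by (intro HOL.ext arg_cong2[of _ _ _ _ "(-)"] arg_cong2[of _ _ _ _ "(*)"] refl sum.cong) auto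

text \<open>The Hamiltonian of a block does not depend on the surrounding torus. This lets tori of
  different sizes share one reference Hamiltonian for the block.\<close>

lemma Hzero_local:
  assumes "r < L" "r < L'"
  shows "Hzero n (box d r) (pnbr L) B = Hzero n (box d r) (pnbr L') B"
proof (rule Hzero_cong)
  fix x y assume xy: "x \<in> box d r" "y \<in> box d r"
  have "y \<in> box d L" "y \<in> box d L'" using xy(2) box_mono[of r L d] box_mono[of r L' d] assms by auto
  then show "pnbr L x y \<longleftrightarrow> pnbr L' x y"
    using pnbr_local[OF assms(1) xy(1)] pnbr_local[OF assms(2) xy(1)] by blast
qed

text \<open>Summed over \<kappa>, the products of the adjoint of a Kraus operator with the operator
  give the identity. The sum in question is thus the energy after the replacement minus the energy
  before it.\<close>

lemma kraus_commutator:
  assumes G: "finite G" "b \<subseteq> G" and p: "local_state n G \<phi>" and c: "cinn (configs n b) \<xi> \<xi> = 1"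
  shows "(\<Sum>\<kappa>\<in>configs n b. \<phi> (opmult n G (opadj (ext b (kraus b \<xi> \<kappa>))) (opcomm n G H (ext b (kraus b \<xi> \<kappa>)))))
    = \<phi> (replace n b \<xi> H) - \<phi> H"
proof -
  let ?X = "configs n G" and ?Y = "configs n b"
  let ?a = "\<lambda>\<kappa>. ext b (kraus b \<xi> \<kappa>)"
  have X: "finite ?X" and Y: "finite ?Y" using finite_configs G finite_subset by metis+
  have id: "kernel_eq ?X (opmult n G opid A) A" for A
    using X by (auto simp: kernel_eq_def opmult_def opid_def if_distrib[of "\<lambda>z. z * _"] cong: if_cong)
  have split: "opmult n G (opadj (?a \<kappa>)) (opcomm n G H (?a \<kappa>)) = (\<lambda>\<sigma> \<tau>. opmult n G (opadj (?a \<kappa>)) (opmult n G H (?a \<kappa>)) \<sigma> \<tau> - opmult n G (opmult n G (opadj (?a \<kappa>)) (?a \<kappa>)) H \<sigma> \<tau>)" for \<kappa>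
  proof -
    have "opcomm n G H (?a \<kappa>) = (\<lambda>\<sigma> \<tau>. opmult n G H (?a \<kappa>) \<sigma> \<tau> + (-1) * opmult n G (?a \<kappa>) H \<sigma> \<tau>)"
      by (simp add: opcomm_def)
    then show ?thesis unfolding opmult_assoc by (simp only: opmult_add opmult_scale) simp
  qed
  have 1: "(\<Sum>\<kappa>\<in>?Y. \<phi> (opmult n G (opadj (?a \<kappa>)) (opmult n G H (?a \<kappa>)))) = \<phi> (replace n b \<xi> H)"
    unfolding local_state_sum[OF p Y, symmetric] by (rule local_stateD(1)[OF p replace_kraus[OF G]])
  have "kernel_eq ?X (\<lambda>\<sigma> \<tau>. \<Sum>\<kappa>\<in>?Y. opmult n G (opadj (?a \<kappa>)) (?a \<kappa>) \<sigma> \<tau>) (\<lambda>\<sigma> \<tau>. \<Sum>\<kappa>\<in>?Y. opmult n G (opadj (?a \<kappa>)) (opmult n G opid (?a \<kappa>)) \<sigma> \<tau>)"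
    unfolding kernel_eq_def
  proof (intro ballI sum.cong refl)
    fix \<sigma> \<tau> \<kappa> assume st: "\<sigma> \<in> ?X" "\<tau> \<in> ?X"
    have "kernel_eq ?X (opmult n G (opadj (?a \<kappa>)) (?a \<kappa>)) (opmult n G (opadj (?a \<kappa>)) (opmult n G opid (?a \<kappa>)))"
      by (rule opmult_cong[OF kernel_eq_refl kernel_eq_sym[OF id]])
    then show "opmult n G (opadj (?a \<kappa>)) (?a \<kappa>) \<sigma> \<tau> = opmult n G (opadj (?a \<kappa>)) (opmult n G opid (?a \<kappa>)) \<sigma> \<tau>"
      using st unfolding kernel_eq_def by blast
  qed
  moreover have "kernel_eq ?X (replace n b \<xi> opid) opid"
    using replace_ext[OF G, of n \<xi> opid] unfolding ext_opid ev_def unfolding opid_rid cinn_kapply_rid[OF Y] c by simp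
  ultimately have "kernel_eq ?X (\<lambda>\<sigma> \<tau>. \<Sum>\<kappa>\<in>?Y. opmult n G (opadj (?a \<kappa>)) (?a \<kappa>) \<sigma> \<tau>) opid"
    using replace_kraus[OF G, of n \<xi> opid] kernel_eq_trans by blast
  then have "kernel_eq ?X (opmult n G (\<lambda>\<sigma> \<tau>. \<Sum>\<kappa>\<in>?Y. 1 * opmult n G (opadj (?a \<kappa>)) (?a \<kappa>) \<sigma> \<tau>) H) (opmult n G opid H)"
    by (intro opmult_cong kernel_eq_refl) simp
  from kernel_eq_trans[OF this id] have k: "kernel_eq ?X (\<lambda>\<sigma> \<tau>. \<Sum>\<kappa>\<in>?Y. opmult n G (opmult n G (opadj (?a \<kappa>)) (?a \<kappa>)) H \<sigma> \<tau>) H"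
    unfolding opmult_sum_left by simp
  have 2: "(\<Sum>\<kappa>\<in>?Y. \<phi> (opmult n G (opmult n G (opadj (?a \<kappa>)) (?a \<kappa>)) H)) = \<phi> H"
    unfolding local_state_sum[OF p Y, symmetric] by (rule local_stateD(1)[OF p k])
  show ?thesis unfolding split local_state_diff[OF p] sum_subtractf 1 2 ..
qed

lemma is_state_ext:
  assumes "is_state n d \<omega>" "finite b" "b \<subseteq> lattice d" "finite V" "b \<subseteq> V" "V \<subseteq> lattice d"
  shows "\<omega> V (ext b A) = \<omega> b A"
proof -
  have "\<forall>G' A. finite G' \<and> b \<subseteq> G' \<and> G' \<subseteq> lattice d \<longrightarrow> \<omega> G' (ext b A) = \<omega> b A"
    using assms(1)[unfolded is_state_def, THEN spec[of _ b], THEN mp, OF conjI[OF assms(2,3)]] by - (elim conjE, assumption)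
  then show ?thesis using assms(4-6) by simp
qed

text \<open>The bound on the number of bonds across the boundary of the box of radius r; it is the
  same for all larger tori.\<close>

definition bdry :: "nat \<Rightarrow> nat \<Rightarrow> real" where
  "bdry d r = 2 * real d * ((2 * real r) ^ d - (2 * (real r - 1)) ^ d)"

lemma cas_nonneg: "0 \<le> cas n" by (simp add: cas_def)

text \<open>The ground state condition is tested with the Kraus operators that put the block into its ground vector.\<close>
lemma iv_gs_block_energy:
  assumes st: "is_state n d \<omega>" and gs: "is_iv_gs n d \<omega>" and r: "r \<ge> 1"
  defines "b \<equiv> box d r" and "H \<equiv> Hzero n (box d r) (pnbr (Suc r)) 0"
  shows "Re (\<omega> b H) \<le> gs_energy n b H + 6 * cas n * bdry d r"
proof -
  have fb: "finite b" "b \<subseteq> lattice d" unfolding b_def by (rule finite_box, rule box_lattice)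
  obtain \<xi> where \<xi>: "cinn (configs n b) \<xi> \<xi> = 1" "ev (configs n b) \<xi> H = of_real (gs_energy n b H)"
    using gs_vector[OF fb(1), of n H] Hfield_herm unfolding H_def by metis
  define s where "s \<kappa> L = \<omega> (b \<union> box d L) (opmult n (b \<union> box d L) (opadj (ext b (kraus b \<xi> \<kappa>))) (opcomm n (b \<union> box d L) (H0p n d L) (ext b (kraus b \<xi> \<kappa>))))" for \<kappa> L
  have "\<forall>\<kappa>. \<exists>c. s \<kappa> \<longlonglongrightarrow> c \<and> Re c \<ge> 0"
  proof
    fix \<kappa>
    show "\<exists>c. s \<kappa> \<longlonglongrightarrow> c \<and> Re c \<ge> 0"
      using gs[unfolded is_iv_gs_def, rule_format, of b "kraus b \<xi> \<kappa>"] fb unfolding s_def by blast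
  qed
  then obtain c where c: "\<And>\<kappa>. s \<kappa> \<longlonglongrightarrow> c \<kappa>" "\<And>\<kappa>. Re (c \<kappa>) \<ge> 0" by metis
  have lim: "(\<lambda>L. Re (\<Sum>\<kappa>\<in>configs n b. s \<kappa> L)) \<longlonglongrightarrow> Re (\<Sum>\<kappa>\<in>configs n b. c \<kappa>)"
    by (intro tendsto_Re tendsto_sum c)
  \<comment> \<open>For fixed block the bound is the same for all L > r, hence it survives the limit
    in L, where the left side becomes non-negative.\<close>
  have "Re (\<Sum>\<kappa>\<in>configs n b. s \<kappa> L) \<le> gs_energy n b H - Re (\<omega> b H) + 6 * cas n * bdry d r" if L: "L > r" for L
  proof -
    let ?V = "box d L"
    have V: "finite ?V" "b \<subseteq> ?V" unfolding b_def using L by (simp_all add: finite_box box_mono)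
    have bV: "b \<union> ?V = ?V" using V by auto
    have p: "local_state n ?V (\<omega> ?V)" by (rule local_state_state[OF st V(1) box_lattice])
    have HL: "Hzero n b (pnbr L) 0 = H" unfolding b_def H_def using L by (intro Hzero_local) auto
    have "\<omega> ?V (ext b H) = \<omega> b H"
      by (rule is_state_ext[OF st fb V box_lattice])
    moreover have "ext b H = H" unfolding H_def b_def by (rule ext_Hzero)
    ultimately have \<omega>H: "\<omega> ?V H = \<omega> b H" by simp
    have psym: "pnbr L v u" if "u \<in> ?V" "v \<in> ?V" "pnbr L u v" for u v
      by (rule pnbr_sym[OF _ that]) (use L in simp)
    have comm: "(\<Sum>\<kappa>\<in>configs n b. s \<kappa> L) = \<omega> ?V (replace n b \<xi> (Hzero n ?V (pnbr L) 0)) - \<omega> ?V (Hzero n ?V (pnbr L) 0)"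
      unfolding s_def bV H0p_eq by (rule kraus_commutator[OF V p \<xi>(1)])
    have "Re (\<omega> ?V (replace n b \<xi> (Hzero n ?V (pnbr L) 0))) - Re (\<omega> ?V (Hzero n ?V (pnbr L) 0))
        \<le> Re (ev (configs n b) \<xi> (Hzero n b (pnbr L) 0)) - Re (\<omega> ?V (Hzero n b (pnbr L) 0)) + 6 * cas n * ncross ?V (pnbr L) b"
      by (rule block_energy[OF V _ p \<xi>(1)]) (rule psym)
    moreover have "6 * cas n * ncross ?V (pnbr L) b \<le> 6 * cas n * bdry d r"
        using ncross_box[OF r L, of d] cas_nonneg[of n] unfolding b_def bdry_def by (intro mult_left_mono) simp_all
    ultimately show ?thesis unfolding comm HL \<xi>(2) \<omega>H by simp
  qed
  then have "eventually (\<lambda>L. Re (\<Sum>\<kappa>\<in>configs n b. s \<kappa> L) \<le> gs_energy n b H - Re (\<omega> b H) + 6 * cas n * bdry d r) sequentially"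
    using eventually_gt_at_top[of r] by (rule eventually_mono[rotated])
  from tendsto_upperbound[OF lim this] have "Re (\<Sum>\<kappa>\<in>configs n b. c \<kappa>) \<le> gs_energy n b H - Re (\<omega> b H) + 6 * cas n * bdry d r" by simp
  moreover have "0 \<le> Re (\<Sum>\<kappa>\<in>configs n b. c \<kappa>)" unfolding Re_sum using c(2) by (intro sum_nonneg) auto
  ultimately show ?thesis by linarith
qed

text \<open>Translations act transitively on the torus, and those that exchange the sublattices are
  combined with a spin flip.\<close>

lemma stag_fv_gs_const:
  assumes L: "L \<ge> 1" and xy: "x \<in> box d L" "y \<in> box d L"
  shows "stag x * fv_gs n (box d L) (Hp n d L B) (site_op x (spin n 3)) = stag y * fv_gs n (box d L) (Hp n d L B) (site_op y (spin n 3))"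
proof -
  obtain t where t: "torus d L (\<lambda>_. 1) t x = y" by (rule torus_transitive[OF L xy])
  define s :: real where "s = (if even (\<Sum>k<d. t k) then 1 else -1)"
  have "stag (torus d L (\<lambda>_. 1) t x) * fv_gs n (box d L) (Hzero n (box d L) (pnbr L) B) (site_op (torus d L (\<lambda>_. 1) t x) (spin n 3))
     = stag x * fv_gs n (box d L) (Hzero n (box d L) (pnbr L) B) (site_op x (spin n 3))"
  proof (rule fv_gs_stag_invariant[OF finite_box])
    show "bij_betw (torus d L (\<lambda>_. 1) t) (box d L) (box d L)" using L by (intro torus_bij) auto
    show "pnbr L (torus d L (\<lambda>_. 1) t u) (torus d L (\<lambda>_. 1) t v) = pnbr L u v" if "u \<in> box d L" "v \<in> box d L" for u v
      using L that by (intro torus_pnbr) auto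
    show "stag (torus d L (\<lambda>_. 1) t u) = of_real s * stag u" if "u \<in> box d L" for u
      unfolding s_def using L that by (subst torus_stag) auto
    show "s = 1 \<or> s = -1" by (simp add: s_def)
  qed (rule xy)
  then show ?thesis unfolding t Hp_eq by simp
qed

lemma bdry_ratio: "(\<lambda>r. bdry d r / (2 * real r) ^ d) \<longlonglongrightarrow> 0"
proof -
  have "(\<lambda>r. 2 * real d * (1 - (1 - 1 / real r) ^ d)) \<longlonglongrightarrow> 2 * real d * (1 - (1 - 0) ^ d)"
    by (intro tendsto_intros lim_1_over_n)
  moreover have "eventually (\<lambda>r. 2 * real d * (1 - (1 - 1 / real r) ^ d) = bdry d r / (2 * real r) ^ d) sequentially"
    using eventually_gt_at_top[of 0]
  proof eventually_elim
    case (elim r)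
    have "(2 * (real r - 1)) ^ d / (2 * real r) ^ d = (1 - 1 / real r) ^ d"
      unfolding power_divide[symmetric] using elim by (intro arg_cong[of _ _ "\<lambda>z. z ^ d"]) (simp add: field_simps)
    moreover have "D * (c - m) / c = D * (1 - m / c)" if "c \<noteq> 0" for D c m :: real using that by (simp add: field_simps)
    moreover have "(2 * real r) ^ d \<noteq> 0" using elim by simp
    ultimately show ?case unfolding bdry_def by presburger
  qed
  ultimately show ?thesis by (simp add: tendsto_cong)
qed

text \<open>A block radius is needed for which the magnetization density of the given state is at
  least \<open>e\<close> in modulus and the boundary terms per site are small compared with B. It
  depends on B, whereas \<open>e\<close> does not, and this uniformity is what the limit of
  vanishing field requires.\<close>

theorem staggered_magnetization:
  assumes st: "is_state n d \<omega>" and gs: "is_iv_gs n d \<omega>" and mag: "magnetization n d \<omega> \<noteq> 0"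
  obtains e where "0 < e" "\<forall>B>0. \<exists>r. \<forall>L>r. \<forall>x\<in>box d L. e \<le> Re (stag x * fv_gs n (box d L) (Hp n d L B) (site_op x (spin n 3)))"
proof -
  define X where "X r = Re (\<omega> (box d r) (Oop n d r)) / real (card (box d r))" for r
  have "\<not> X \<longlonglongrightarrow> 0"
  proof
    assume "X \<longlonglongrightarrow> 0"
    then have "(\<lambda>r. ereal (X r)) \<longlonglongrightarrow> ereal 0" by (rule tendsto_ereal)
    then have "limsup (\<lambda>r. ereal (X r)) = 0" by (simp add: lim_imp_Limsup zero_ereal_def)
    then show False using mag by (simp add: magnetization_def X_def)
  qed
  \<comment> \<open>A non-vanishing limsup may be negative and is felt only along a subsequence;
    hence the modulus and the quantifier for infinitely many radii.\<close>
  then obtain e where e: "e > 0" "\<exists>\<^sub>F r in sequentially. e \<le> \<bar>X r\<bar>"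
    unfolding tendsto_iff by (auto simp: frequently_def not_le)
  show ?thesis
  proof (rule that[of "e / 2"])
    show "0 < e / 2" using e by simp
    show "\<forall>B>0. \<exists>r. \<forall>L>r. \<forall>x\<in>box d L. e / 2 \<le> Re (stag x * fv_gs n (box d L) (Hp n d L B) (site_op x (spin n 3)))"
    proof (intro allI impI)
      fix B :: real assume B: "B > 0"
      \<comment> \<open>The constant 12 collects 6 from the energy bound for the infinite-volume
        state and 6 from that for the torus.\<close>
      have "(\<lambda>r. 12 * cas n * (bdry d r / (2 * real r) ^ d)) \<longlonglongrightarrow> 12 * cas n * 0"
        by (intro tendsto_intros bdry_ratio)
      moreover have "0 < B * e / 2" using B e by simp
      ultimately have "\<forall>\<^sub>F r in sequentially. 12 * cas n * (bdry d r / (2 * real r) ^ d) < B * e / 2"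
        by (intro order_tendstoD(2)) auto
      moreover have "\<forall>\<^sub>F r in sequentially. r \<ge> 1" by (rule eventually_ge_at_top)
      ultimately have "\<exists>\<^sub>F r in sequentially. e \<le> \<bar>X r\<bar> \<and> (12 * cas n * (bdry d r / (2 * real r) ^ d) < B * e / 2 \<and> r \<ge> 1)"
        by (rule frequently_eventually_frequently[OF e(2) eventually_conj])
      then obtain r where r: "e \<le> \<bar>X r\<bar>" "12 * cas n * (bdry d r / (2 * real r) ^ d) < B * e / 2" "r \<ge> 1"
        by (auto dest: frequently_ex)
      show "\<exists>r. \<forall>L>r. \<forall>x\<in>box d L. e / 2 \<le> Re (stag x * fv_gs n (box d L) (Hp n d L B) (site_op x (spin n 3)))"
      proof (intro exI[of _ r] allI impI ballI)
        fix L x assume L: "r < L" and x: "x \<in> box d L"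
        let ?b = "box d r" and ?V = "box d L"
        let ?\<phi> = "fv_gs n ?V (Hzero n ?V (pnbr L) B)"
        have V: "finite ?V" "?b \<subseteq> ?V" using L by (simp_all add: finite_box box_mono)
        have q: "local_state n ?V ?\<phi>" by (rule local_state_fv_gs[OF V(1) Hfield_herm])
        have card: "real (card ?b) = (2 * real r) ^ d" by (simp add: card_box)
        have cpos: "0 < (2 * real r) ^ d" using r(3) by simp
        have HL: "Hzero n ?b (pnbr L) 0 = Hzero n ?b (pnbr (Suc r)) 0" using L by (intro Hzero_local) auto
        define \<mu> where "\<mu> = stag x * ?\<phi> (site_op x (spin n 3))"
        have "?\<phi> (stag3 n ?b) = (\<Sum>y\<in>?b. stag y * ?\<phi> (site_op y (spin n 3)))"
          unfolding stag3_def by (rule local_state_lincomb[OF q finite_box])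
        also have "\<dots> = (\<Sum>y\<in>?b. \<mu>)"
        proof (rule sum.cong[OF refl])
          fix y assume "y \<in> ?b"
          then have y: "y \<in> ?V" using V(2) by blast
          have L1: "L \<ge> 1" using L by simp
          show "stag y * ?\<phi> (site_op y (spin n 3)) = \<mu>"
            unfolding \<mu>_def by (rule stag_fv_gs_const[OF L1 y x, unfolded Hp_eq])
        qed
        finally have \<mu>: "Re (?\<phi> (stag3 n ?b)) = (2 * real r) ^ d * Re \<mu>" using card by simp
        have f1: "B * \<bar>Re (\<omega> ?b (stag3 n ?b))\<bar> - 6 * cas n * bdry d r - 6 * cas n * ncross ?V (pnbr L) ?b \<le> B * Re (?\<phi> (stag3 n ?b))"
        proof -
          have low: "Re (\<omega> ?b (Hzero n ?b (pnbr L) 0)) \<le> gs_energy n ?b (Hzero n ?b (pnbr L) 0) + 6 * cas n * bdry d r"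
            unfolding HL by (rule iv_gs_block_energy[OF st gs r(3)])
          have psym: "pnbr L v u" if "u \<in> ?V" "v \<in> ?V" "pnbr L u v" for u v
            by (rule pnbr_sym[OF _ that]) (use L in simp)
          show ?thesis
            by (rule block_magnetization[OF V _ local_state_state[OF st finite_box box_lattice] low less_imp_le[OF B]]) (rule psym)
        qed
        have f2: "6 * cas n * ncross ?V (pnbr L) ?b \<le> 6 * cas n * bdry d r"
          using ncross_box[OF r(3) L, of d] cas_nonneg[of n] by (intro mult_left_mono) (auto simp: bdry_def)
        have f3: "\<bar>Re (\<omega> ?b (stag3 n ?b))\<bar> = \<bar>X r\<bar> * (2 * real r) ^ d"
        proof -
          have "\<bar>a\<bar> = \<bar>a / c\<bar> * c" if "0 < c" for a c :: real using that by (simp add: abs_divide)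
          from this[OF cpos] show ?thesis unfolding X_def Oop_eq card .
        qed
        have "B * (\<bar>X r\<bar> * (2 * real r) ^ d) - 12 * cas n * bdry d r \<le> B * ((2 * real r) ^ d * Re \<mu>)"
          using f1 f2 unfolding f3 \<mu> by linarith
        moreover have "B * x - k * (D / c) \<le> B * m" if "0 < c" "B * (x * c) - k * D \<le> B * (c * m)" for x k D m c :: real
          using that by (simp add: field_simps)
        ultimately have "B * \<bar>X r\<bar> - 12 * cas n * (bdry d r / (2 * real r) ^ d) \<le> B * Re \<mu>"
          using cpos by blast
        moreover have "B * e \<le> B * \<bar>X r\<bar>" using r(1) B by (intro mult_left_mono) auto
        ultimately have "B * (e / 2) \<le> B * Re \<mu>" using r(2) by simp
        then have "e / 2 \<le> Re \<mu>" using B by simp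
        then show "e / 2 \<le> Re (stag x * fv_gs n ?V (Hp n d L B) (site_op x (spin n 3)))" unfolding \<mu>_def Hp_eq .
      qed
    qed
  qed
qed

section \<open>Decay of the transverse correlation\<close>

text \<open>A pyramid of height \<open>R\<close>: it has slope at most 1, so the energy cost stays of order \<open>R\<^sup>d\<close> while its sum is of
  order \<open>R\<^sup>(\<^sup>d\<^sup>+\<^sup>1\<^sup>)\<close>.\<close>
definition profile :: "nat \<Rightarrow> nat \<Rightarrow> site \<Rightarrow> real" where
  "profile d R x = real (card {r \<in> {1..R}. x \<in> box d r})"

lemma profile_bounds: "0 \<le> profile d R x" "profile d R x \<le> real R"
proof -
  have "card {r \<in> {1..R}. x \<in> box d r} \<le> card {1..R}" by (rule card_mono) auto
  then show "profile d R x \<le> real R" by (simp add: profile_def)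
qed (simp add: profile_def)

lemma profile_outside: "x \<notin> box d R \<Longrightarrow> profile d R x = 0"
proof -
  assume x: "x \<notin> box d R"
  have "x \<notin> box d r" if "r \<in> {1..R}" for r using x box_mono[of r R d] that by auto
  then have "{r \<in> {1..R}. x \<in> box d r} = {}" by blast
  then show ?thesis unfolding profile_def by (simp only: card.empty of_nat_0)
qed

text \<open>A step enlarges the required radius by at most one, so the radii counted at x, raised by
  one, are counted at y, except possibly R + 1.\<close>

lemma profile_step:
  assumes "R < L" "x \<in> box d L" "y \<in> box d L" "pnbr L x y"
  shows "profile d R x \<le> profile d R y + 1"
proof -
  have "Suc ` {r \<in> {1..R}. x \<in> box d r} \<subseteq> insert (Suc R) {r \<in> {1..R}. y \<in> box d r}"
  proof
    fix s assume "s \<in> Suc ` {r \<in> {1..R}. x \<in> box d r}"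
    then obtain r where r: "s = Suc r" "r \<in> {1..R}" "x \<in> box d r" by auto
    have "y \<in> box d s" unfolding r(1) by (rule pnbr_step[OF _ r(3) assms(3,4)]) (use r(2) assms(1) in auto)
    then show "s \<in> insert (Suc R) {r \<in> {1..R}. y \<in> box d r}" using r by auto
  qed
  then have "card (Suc ` {r \<in> {1..R}. x \<in> box d r}) \<le> card (insert (Suc R) {r \<in> {1..R}. y \<in> box d r})"
    by (rule card_mono[rotated]) auto
  then have "card {r \<in> {1..R}. x \<in> box d r} \<le> card {r \<in> {1..R}. y \<in> box d r} + 1"
    by (simp add: card_image card_insert_if split: if_splits)
  then show ?thesis by (simp add: profile_def)
qed

text \<open>Summing by layers gives the total volume of the boxes of radius 1 to 2K; the upper half
  of these radii already suffices.\<close>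

lemma sum_profile: "real K * (2 * real K) ^ d \<le> (\<Sum>x\<in>box d (2 * K). profile d (2 * K) x)"
proof -
  have "(\<Sum>x\<in>box d (2 * K). profile d (2 * K) x) = (\<Sum>x\<in>box d (2 * K). \<Sum>r\<in>{1..2 * K}. if x \<in> box d r then 1 else 0)"
    unfolding profile_def by (intro sum.cong refl) (simp add: sum.If_cases Int_def)
  also have "\<dots> = (\<Sum>r\<in>{1..2 * K}. \<Sum>x\<in>box d (2 * K). if x \<in> box d r then 1 else 0)" by (rule sum.swap)
  also have "\<dots> = (\<Sum>r\<in>{1..2 * K}. (2 * real r) ^ d)"
  proof (rule sum.cong[OF refl])
    fix r assume r: "r \<in> {1..2 * K}"
    have "box d (2 * K) \<inter> box d r = box d r" using box_mono[of r "2 * K" d] r by auto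
    then show "(\<Sum>x\<in>box d (2 * K). if x \<in> box d r then 1 else 0) = (2 * real r) ^ d"
      using finite_box[of d "2 * K"] by (simp add: sum.If_cases card_box)
  qed
  finally have eq: "(\<Sum>x\<in>box d (2 * K). profile d (2 * K) x) = (\<Sum>r\<in>{1..2 * K}. (2 * real r) ^ d)" .
  have "real K * (2 * real K) ^ d = (\<Sum>r\<in>{K + 1..2 * K}. (2 * real K) ^ d)" by simp
  also have "\<dots> \<le> (\<Sum>r\<in>{K + 1..2 * K}. (2 * real r) ^ d)" by (intro sum_mono power_mono) auto
  also have "\<dots> \<le> (\<Sum>r\<in>{1..2 * K}. (2 * real r) ^ d)" by (intro sum_mono2) auto
  finally show ?thesis unfolding eq .
qed

text \<open>All sites of the torus have the same degree, so \<open>f\<close> inherits the slope of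
  \<open>g\<close>: its differences along bonds stay bounded independently of R. Its support grows
  by one step, hence the box of radius R + 1.\<close>

lemma profile_field:
  assumes d: "d \<ge> 1" and L: "Suc R < L"
  defines "V \<equiv> box d L" and "g \<equiv> profile d R"
  defines "f \<equiv> dfield V (pnbr L) g"
  shows "x \<in> V \<Longrightarrow> g x \<le> f x" "x \<in> V \<Longrightarrow> \<bar>f x\<bar> \<le> 4 * real d * real R" "x \<in> V \<Longrightarrow> x \<notin> box d (Suc R) \<Longrightarrow> f x = 0"
    "x \<in> V \<Longrightarrow> y \<in> V \<Longrightarrow> pnbr L x y \<Longrightarrow> \<bar>f x - f y\<bar> \<le> 8 * real d"
proof -
  have L1: "L \<ge> 1" "R < L" using L by auto
  define N where "N x = {y \<in> V. pnbr L x y}" for x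
  have finN: "finite (N x)" for x unfolding N_def V_def using finite_box by auto
  have deg: "1 \<le> real (card (N x))" "real (card (N x)) \<le> 2 * real d" if "x \<in> V" for x
    using pnbr_degree_pos[OF L1(1) d, of x] pnbr_degree_le[OF L1(1), of x d] that unfolding N_def V_def by auto
  have degc: "card (N x) = card (N y)" if "x \<in> V" "y \<in> V" for x y
    using pnbr_degree_const[OF L1(1)] that unfolding N_def V_def by blast
  have f: "f x = (\<Sum>y\<in>N x. g x + g y)" for x unfolding f_def dfield_def N_def ..
  have g0: "0 \<le> g x" "g x \<le> real R" for x unfolding g_def by (rule profile_bounds)+
  have sym: "pnbr L y x" if "x \<in> V" "y \<in> V" "pnbr L x y" for x y
    using pnbr_sym[OF L1(1)] that unfolding V_def by blast
  have step: "\<bar>g x - g y\<bar> \<le> 1" if "x \<in> V" "y \<in> V" "pnbr L x y" for x y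
    using profile_step[OF L1(2), of x d y] profile_step[OF L1(2), of y d x] that sym[OF that] unfolding V_def g_def by auto
  \<comment> \<open>Twice the degree times \<open>g\<close>, up to an error bounded by the degree
    because \<open>g\<close> has slope at most 1.\<close>
  have f2: "f x = 2 * real (card (N x)) * g x + (\<Sum>y\<in>N x. g y - g x)" for x
    unfolding f by (simp add: sum.distrib sum_subtractf)
  have err: "\<bar>\<Sum>y\<in>N x. g y - g x\<bar> \<le> 2 * real d" if x: "x \<in> V" for x
  proof -
    have "\<bar>\<Sum>y\<in>N x. g y - g x\<bar> \<le> (\<Sum>y\<in>N x. \<bar>g y - g x\<bar>)" by (rule sum_abs)
    also have "\<dots> \<le> (\<Sum>y\<in>N x. 1)"
    proof (rule sum_mono)
      fix y assume "y \<in> N x"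
      then show "\<bar>g y - g x\<bar> \<le> 1" using step[OF x, of y] by (auto simp: N_def abs_minus_commute)
    qed
    also have "\<dots> \<le> 2 * real d" using deg[OF x] by simp
    finally show ?thesis .
  qed
  show "g x \<le> f x" if x: "x \<in> V"
  proof -
    have "g x * 1 \<le> g x * real (card (N x))" using deg[OF x] g0 by (intro mult_left_mono) auto
    also have "\<dots> = (\<Sum>y\<in>N x. g x)" by simp
    also have "\<dots> \<le> f x" unfolding f using g0 by (intro sum_mono) auto
    finally show ?thesis by simp
  qed
  show "\<bar>f x\<bar> \<le> 4 * real d * real R" if x: "x \<in> V"
  proof -
    have "\<bar>f x\<bar> = f x" unfolding f using g0 by (intro abs_of_nonneg sum_nonneg) (auto intro: add_nonneg_nonneg)
    also have "f x \<le> (\<Sum>y\<in>N x. 2 * real R)" unfolding f using g0 by (intro sum_mono) (smt (verit))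
    also have "\<dots> = real (card (N x)) * (2 * real R)" by simp
    also have "\<dots> \<le> (2 * real d) * (2 * real R)" using deg[OF x] by (intro mult_right_mono) auto
    finally show ?thesis by simp
  qed
  show "f x = 0" if x: "x \<in> V" and out: "x \<notin> box d (Suc R)"
  proof -
    have "x \<notin> box d R" using out box_mono[of R "Suc R" d] by auto
    then have gx: "g x = 0" unfolding g_def by (rule profile_outside)
    have "g y = 0" if y: "y \<in> N x" for y
    proof -
      have "y \<notin> box d R"
      proof
        assume yR: "y \<in> box d R"
        have "pnbr L y x" using sym[OF x, of y] y by (auto simp: N_def)
        then have "x \<in> box d (Suc R)" using pnbr_step[OF L1(2) yR] x unfolding V_def by blast
        then show False using out by blast
      qed
      then show ?thesis unfolding g_def by (rule profile_outside)
    qed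
    then show ?thesis unfolding f gx by simp
  qed
  show "\<bar>f x - f y\<bar> \<le> 8 * real d" if xy: "x \<in> V" "y \<in> V" "pnbr L x y"
  proof -
    have "f x - f y = 2 * real (card (N x)) * (g x - g y) + ((\<Sum>z\<in>N x. g z - g x) - (\<Sum>z\<in>N y. g z - g y))"
      unfolding f2[of x] f2[of y] degc[OF xy(2,1)] by (simp add: algebra_simps)
    moreover have "\<bar>2 * real (card (N x)) * (g x - g y)\<bar> \<le> 4 * real d * 1"
      unfolding abs_mult[of "2 * real (card (N x))"] using deg[OF xy(1)] step[OF xy] by (intro mult_mono) simp_all
    ultimately show ?thesis using err[OF xy(1)] err[OF xy(2)] by linarith
  qed
qed

lemma sum_bonds_swap_box:
  fixes h :: "site \<Rightarrow> site \<Rightarrow> real"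
  assumes "L \<ge> 1"
  shows "(\<Sum>x\<in>box d L. \<Sum>y\<in>{y\<in>box d L. pnbr L x y}. h x y) = (\<Sum>x\<in>box d L. \<Sum>y\<in>{y\<in>box d L. pnbr L x y}. h y x)"
  by (rule sum_nb_swap[OF finite_box]) (rule pnbr_sym[OF assms])

lemma sum_bonds_le:
  assumes L: "L \<ge> 1" and S: "S \<subseteq> box d L" and h: "\<And>x. x \<in> box d L \<Longrightarrow> x \<notin> S \<Longrightarrow> h x = 0" "\<And>x. x \<in> S \<Longrightarrow> h x \<le> c" and c: "0 \<le> c"
  shows "(\<Sum>x\<in>box d L. \<Sum>y\<in>{y\<in>box d L. pnbr L x y}. h x) \<le> real (card S) * (2 * real d * c)"
proof -
  have "(\<Sum>x\<in>box d L. \<Sum>y\<in>{y\<in>box d L. pnbr L x y}. h x) = (\<Sum>x\<in>S. \<Sum>y\<in>{y\<in>box d L. pnbr L x y}. h x)"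
    using S h(1) finite_box by (intro sum.mono_neutral_right) auto
  also have "\<dots> \<le> (\<Sum>x\<in>S. 2 * real d * c)"
  proof (rule sum_mono)
    fix x assume x: "x \<in> S"
    have "(\<Sum>y\<in>{y\<in>box d L. pnbr L x y}. h x) \<le> (\<Sum>y\<in>{y\<in>box d L. pnbr L x y}. c)" using h(2)[OF x] by (intro sum_mono)
    also have "\<dots> = real (card {y\<in>box d L. pnbr L x y}) * c" by simp
    also have "\<dots> \<le> (2 * real d) * c" using pnbr_degree_le[OF L, of x d] x S c by (intro mult_right_mono) auto
    finally show "(\<Sum>y\<in>{y\<in>box d L. pnbr L x y}. h x) \<le> 2 * real d * c" .
  qed
  finally show ?thesis by simp
qed

definition corr :: "nat \<Rightarrow> site \<Rightarrow> site \<Rightarrow> obs" where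
  "corr n x y = opmult n {x, y} (site_op x (spin2 n)) (site_op y (spin2 n))"

text \<open>Bounds, uniform in the volume, for the sums of \<open>(f\<^sub>x - f\<^sub>y)\<^sup>2\<close>, \<open>f\<^sub>x\<^sup>2\<close> and \<open>(g\<^sub>x + g\<^sub>y)\<^sup>2 / 4\<close> in the case that \<open>g\<close> is
  the profile of radius \<open>R\<close>.\<close>
definition gradsum :: "nat \<Rightarrow> nat \<Rightarrow> real" where
  "gradsum d R = 256 * real d ^ 3 * (2 * real (Suc R)) ^ d"

definition fieldsum :: "nat \<Rightarrow> nat \<Rightarrow> real" where
  "fieldsum d R = (4 * real d * real R)\<^sup>2 * (2 * real (Suc R)) ^ d"

definition potsum :: "nat \<Rightarrow> nat \<Rightarrow> real" where
  "potsum d R = 2 * real d * (real R)\<^sup>2 * (2 * real R) ^ d"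

lemma ext_corr:
  assumes p: "local_state n V \<phi>" and V: "finite V" "x \<in> V" "y \<in> V"
  shows "\<phi> (ext {x, y} (corr n x y)) = \<phi> (opmult n V (site_op x (spin n 2)) (site_op y (spin n 2)))"
proof -
  have "{x, y} \<subseteq> V" using V by auto
  from ext_mult[OF V(1) this, of n "site_op x (spin n 2)" "site_op y (spin n 2)"]
  have "kernel_eq (configs n V) (opmult n V (site_op x (spin n 2)) (site_op y (spin n 2))) (ext {x, y} (corr n x y))"
    by (simp add: ext_site corr_def spin_simps)
  from local_stateD(1)[OF p this] show ?thesis by simp
qed

lemma corr_bound:
  assumes p: "local_state n V \<phi>" and V: "finite V" "x \<in> V" "y \<in> V"
  shows "\<bar>Re (\<phi> (opmult n V (site_op x (spin n 2)) (site_op y (spin n 2))))\<bar> \<le> cas n"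
proof (cases "x = y")
  case True
  show ?thesis
    unfolding True local_stateD(1)[OF p opmult_site_same[OF V(1,3)]]
    using site_sq[OF p V(1,3), of 2] site_sq_le[OF p V(1,3), of 2] by simp
next
  case False
  show ?thesis
    unfolding local_stateD(1)[OF p opmult_site_diff[OF V(1,2) False]] by (rule pair_bound[OF p V False]) simp
qed

text \<open>The finite-volume inequality for the profile of radius 2K. Everything except the ground
  state expectations is now independent of L, which prepares the limits.\<close>

lemma volume_bound:
  assumes d: "d \<ge> 1" and L: "Suc (2 * K) < L" and B: "0 < B" and e: "0 < e"
    and mag: "\<And>x. x \<in> box d L \<Longrightarrow> e \<le> Re (stag x * fv_gs n (box d L) (Hp n d L B) (site_op x (spin n 3)))"
  shows "(e * (real K * (2 * real K) ^ d)) ^ 4 \<le> 8 * (cas n * gradsum d (2 * K) + B * ((cas n + 1) * fieldsum d (2 * K))) * potsum d (2 * K)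
     * (\<Sum>x\<in>box d (2 * K). \<Sum>y\<in>box d (2 * K). Re (stag x * stag y * fv_gs n (box d L) (Hp n d L B) (ext {x, y} (corr n x y))))\<^sup>2"
proof -
  let ?R = "2 * K"
  define V where "V = box d L"
  define g where "g = profile d ?R"
  define f where "f = dfield V (pnbr L) g"
  define \<phi> where "\<phi> = fv_gs n V (Hzero n V (pnbr L) B)"
  define T where "T = box d ?R"
  define S where "S = box d (Suc ?R)"
  have L1: "L \<ge> 1" using L by simp
  have finV: "finite V" unfolding V_def by (rule finite_box)
  have TV: "T \<subseteq> V" and SV: "S \<subseteq> V" unfolding T_def S_def V_def using L by (simp_all add: box_mono)
  note pf = profile_field[OF d L, folded V_def g_def, folded f_def]
  have p: "local_state n V \<phi>" unfolding \<phi>_def by (rule local_state_fv_gs[OF finV Hfield_herm])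
  define F where "F = (\<Sum>x\<in>T. f x * Re (stag x * \<phi> (site_op x (spin n 3))))"
  define W where "W = (\<Sum>x\<in>T. \<Sum>y\<in>T. Re (stag x * stag y * \<phi> (opmult n V (site_op x (spin n 2)) (site_op y (spin n 2)))))"
  have main: "F ^ 4 \<le> 8 * (cas n * (\<Sum>x\<in>V. \<Sum>y\<in>{y\<in>V. pnbr L x y}. (f x - f y)\<^sup>2) + B * (cas n + 1) * (\<Sum>x\<in>V. (f x)\<^sup>2)) * gfield V (pnbr L) g * W\<^sup>2"
    unfolding F_def W_def \<phi>_def f_def
  proof (rule finite_volume_bound[OF finV _ _ _ TV less_imp_le[OF B]])
    fix x y assume "x \<in> V" "y \<in> V" "pnbr L x y"
    then show "pnbr L y x" using pnbr_sym[OF L1] unfolding V_def by blast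
  next
    fix x show "\<not> pnbr L x x" by (rule pnbr_irr[OF L1])
  next
    fix x y assume "x \<in> V" "y \<in> V" "pnbr L x y"
    then show "\<exists>\<theta> W. reflection V (pnbr L) \<theta> W \<and> x \<in> W \<and> y \<notin> W" unfolding V_def by (rule torus_reflection[OF L1])
  qed
  have cardS: "real (card S) = (2 * real (Suc ?R)) ^ d" unfolding S_def card_box of_nat_power by simp
  have cardT: "real (card T) = (2 * real ?R) ^ d" unfolding T_def card_box of_nat_power by simp
  have c1: "(\<Sum>x\<in>V. \<Sum>y\<in>{y\<in>V. pnbr L x y}. (f x - f y)\<^sup>2) \<le> gradsum d ?R"
  proof -
    define q where "q = (8 * real d)\<^sup>2"
    define h where "h x = (if x \<in> S then q else 0)" for x
    have q: "0 \<le> q" by (simp add: q_def)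
    \<comment> \<open>A bond contributes only if one of its ends lies in the support, which the sum
      of the two indicator terms takes into account.\<close>
    have "(f x - f y)\<^sup>2 \<le> h x + h y" if xy: "x \<in> V" "y \<in> V" "pnbr L x y" for x y
    proof -
      have "(f x - f y)\<^sup>2 \<le> q" unfolding q_def using pf(4)[OF xy] abs_le_square_iff[of "f x - f y" "8 * real d"] by simp
      moreover have "f x = 0" if "x \<notin> S" using pf(3)[OF xy(1)] that unfolding S_def by blast
      moreover have "f y = 0" if "y \<notin> S" using pf(3)[OF xy(2)] that unfolding S_def by blast
      ultimately show ?thesis using q unfolding h_def by (cases "x \<in> S"; cases "y \<in> S") simp_all
    qed
    then have "(\<Sum>x\<in>V. \<Sum>y\<in>{y\<in>V. pnbr L x y}. (f x - f y)\<^sup>2) \<le> (\<Sum>x\<in>V. \<Sum>y\<in>{y\<in>V. pnbr L x y}. h x + h y)"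
      by (intro sum_mono) auto
    also have "\<dots> = (\<Sum>x\<in>V. \<Sum>y\<in>{y\<in>V. pnbr L x y}. h x) + (\<Sum>x\<in>V. \<Sum>y\<in>{y\<in>V. pnbr L x y}. h y)"
      by (simp add: sum.distrib)
    also have "(\<Sum>x\<in>V. \<Sum>y\<in>{y\<in>V. pnbr L x y}. h y) = (\<Sum>x\<in>V. \<Sum>y\<in>{y\<in>V. pnbr L x y}. h x)"
      unfolding V_def by (rule sum_bonds_swap_box[OF L1, where h = "\<lambda>x y. h y"])
    also have "(\<Sum>x\<in>V. \<Sum>y\<in>{y\<in>V. pnbr L x y}. h x) + (\<Sum>x\<in>V. \<Sum>y\<in>{y\<in>V. pnbr L x y}. h x) \<le> 2 * (real (card S) * (2 * real d * q))"
    proof -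
      have "(\<Sum>x\<in>V. \<Sum>y\<in>{y\<in>V. pnbr L x y}. h x) \<le> real (card S) * (2 * real d * q)"
        unfolding V_def by (rule sum_bonds_le[OF L1 SV[unfolded V_def] _ _ q]) (simp_all add: h_def)
      then show ?thesis by linarith
    qed
    also have "\<dots> = gradsum d ?R" unfolding cardS gradsum_def q_def by (simp add: power2_eq_square power3_eq_cube)
    finally show ?thesis .
  qed
  have c2: "(\<Sum>x\<in>V. (f x)\<^sup>2) \<le> fieldsum d ?R"
  proof -
    have "(\<Sum>x\<in>V. (f x)\<^sup>2) = (\<Sum>x\<in>S. (f x)\<^sup>2)"
      using pf(3) SV finV unfolding S_def by (intro sum.mono_neutral_right) auto
    also have "\<dots> \<le> (\<Sum>x\<in>S. (4 * real d * real ?R)\<^sup>2)"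
    proof (rule sum_mono)
      fix x assume "x \<in> S"
      then have "x \<in> V" using SV by auto
      from pf(2)[OF this] show "(f x)\<^sup>2 \<le> (4 * real d * real ?R)\<^sup>2" using abs_le_square_iff[of "f x" "4 * real d * real ?R"] by simp
    qed
    also have "\<dots> = fieldsum d ?R" unfolding fieldsum_def cardS[symmetric] by simp
    finally show ?thesis .
  qed
  have c3: "gfield V (pnbr L) g \<le> potsum d ?R"
  proof -
    have "(\<Sum>x\<in>V. \<Sum>y\<in>{y\<in>V. pnbr L x y}. (g x + g y)\<^sup>2) \<le> (\<Sum>x\<in>V. \<Sum>y\<in>{y\<in>V. pnbr L x y}. 2 * (g x)\<^sup>2 + 2 * (g y)\<^sup>2)"
    proof (intro sum_mono)
      fix x y
      have "0 \<le> (g x - g y)\<^sup>2" by simp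
      then show "(g x + g y)\<^sup>2 \<le> 2 * (g x)\<^sup>2 + 2 * (g y)\<^sup>2" by (simp add: power2_eq_square algebra_simps)
    qed
    also have "\<dots> = (\<Sum>x\<in>V. \<Sum>y\<in>{y\<in>V. pnbr L x y}. 2 * (g x)\<^sup>2) + (\<Sum>x\<in>V. \<Sum>y\<in>{y\<in>V. pnbr L x y}. 2 * (g y)\<^sup>2)"
      by (simp add: sum.distrib)
    also have "(\<Sum>x\<in>V. \<Sum>y\<in>{y\<in>V. pnbr L x y}. 2 * (g y)\<^sup>2) = (\<Sum>x\<in>V. \<Sum>y\<in>{y\<in>V. pnbr L x y}. 2 * (g x)\<^sup>2)"
      unfolding V_def by (rule sum_bonds_swap_box[OF L1, where h = "\<lambda>x y. 2 * (g y)\<^sup>2"])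
    also have "(\<Sum>x\<in>V. \<Sum>y\<in>{y\<in>V. pnbr L x y}. 2 * (g x)\<^sup>2) \<le> real (card T) * (2 * real d * (2 * (real ?R)\<^sup>2))"
      unfolding V_def
    proof (rule sum_bonds_le[OF L1 TV[unfolded V_def]])
      fix x assume "x \<notin> T" then show "2 * (g x)\<^sup>2 = 0" unfolding T_def g_def by (simp add: profile_outside)
    next
      fix x show "2 * (g x)\<^sup>2 \<le> 2 * (real ?R)\<^sup>2" unfolding g_def using profile_bounds[of d ?R x] by (intro mult_left_mono power_mono) simp_all
    qed simp
    finally show ?thesis unfolding gfield_def potsum_def cardT by (simp add: mult_ac)
  qed
  have Fge: "e * (real K * (2 * real K) ^ d) \<le> F"
  proof -
    have "real K * (2 * real K) ^ d \<le> (\<Sum>x\<in>T. f x)"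
      using sum_profile[of K d] sum_mono[of T g f] pf(1) TV unfolding T_def[symmetric] g_def[symmetric] by (meson order.trans subsetD)
    then have "e * (real K * (2 * real K) ^ d) \<le> e * (\<Sum>x\<in>T. f x)" using e by (intro mult_left_mono) auto
    also have "\<dots> = (\<Sum>x\<in>T. f x * e)" by (simp add: sum_distrib_left mult.commute)
    also have "\<dots> \<le> F" unfolding F_def
    proof (intro sum_mono mult_left_mono)
      fix x assume "x \<in> T"
      then have x: "x \<in> V" using TV by auto
      show "e \<le> Re (stag x * \<phi> (site_op x (spin n 3)))" using mag x unfolding V_def \<phi>_def Hp_eq by blast
      show "0 \<le> f x" using pf(1)[OF x] profile_bounds(1)[of d ?R x] unfolding g_def by linarith
    qed
    finally show ?thesis .
  qed
  have "W = (\<Sum>x\<in>T. \<Sum>y\<in>T. Re (stag x * stag y * \<phi> (ext {x, y} (corr n x y))))"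
  proof (unfold W_def, intro sum.cong refl)
    fix x y assume "x \<in> T" "y \<in> T"
    then have "x \<in> V" "y \<in> V" using TV by auto
    from ext_corr[OF p finV this] show "Re (stag x * stag y * \<phi> (opmult n V (site_op x (spin n 2)) (site_op y (spin n 2)))) = Re (stag x * stag y * \<phi> (ext {x, y} (corr n x y)))" by simp
  qed
  then have W: "W = (\<Sum>x\<in>box d ?R. \<Sum>y\<in>box d ?R. Re (stag x * stag y * fv_gs n (box d L) (Hp n d L B) (ext {x, y} (corr n x y))))"
    unfolding T_def \<phi>_def V_def Hp_eq .
  have gpos: "0 \<le> gfield V (pnbr L) g" by (simp add: gfield_def sum_nonneg)
  have cp: "0 \<le> cas n" by (rule cas_nonneg)
  have "(e * (real K * (2 * real K) ^ d)) ^ 4 \<le> F ^ 4" using Fge e by (intro power_mono) auto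
  also note main
  also have "8 * (cas n * (\<Sum>x\<in>V. \<Sum>y\<in>{y\<in>V. pnbr L x y}. (f x - f y)\<^sup>2) + B * (cas n + 1) * (\<Sum>x\<in>V. (f x)\<^sup>2)) * gfield V (pnbr L) g * W\<^sup>2
     \<le> 8 * (cas n * gradsum d ?R + B * ((cas n + 1) * fieldsum d ?R)) * potsum d ?R * W\<^sup>2"
  proof (intro mult_right_mono mult_mono mult_left_mono)
    have "B * (cas n + 1) * (\<Sum>x\<in>V. (f x)\<^sup>2) \<le> B * (cas n + 1) * fieldsum d ?R" using c2 B cp by (intro mult_left_mono) auto
    moreover have "cas n * (\<Sum>x\<in>V. \<Sum>y\<in>{y\<in>V. pnbr L x y}. (f x - f y)\<^sup>2) \<le> cas n * gradsum d ?R" using c1 cp by (rule mult_left_mono)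
    ultimately show "cas n * (\<Sum>x\<in>V. \<Sum>y\<in>{y\<in>V. pnbr L x y}. (f x - f y)\<^sup>2) + B * (cas n + 1) * (\<Sum>x\<in>V. (f x)\<^sup>2) \<le> cas n * gradsum d ?R + B * ((cas n + 1) * fieldsum d ?R)"
      by (simp add: mult.assoc)
    have "0 \<le> gradsum d ?R" "0 \<le> fieldsum d ?R" by (simp_all add: gradsum_def fieldsum_def)
    then show "0 \<le> 8 * (cas n * gradsum d ?R + B * ((cas n + 1) * fieldsum d ?R))" using cp B by simp
  qed (use c3 gpos cp B in \<open>auto intro!: add_nonneg_nonneg mult_nonneg_nonneg sum_nonneg\<close>)
  finally show ?thesis unfolding W .
qed

text \<open>For fixed K only finitely many correlations occur, so the inequality passes to the limit
  in L and then in B. The magnetic term is linear in B with a coefficient depending on K and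
  disappears.\<close>

lemma limit_bound:
  assumes d: "d \<ge> 1" and e: "0 < e" and B: "\<And>k. 0 < Bs k" "Bs \<longlonglongrightarrow> 0" and Ls: "\<And>k. strict_mono (Ls k :: nat \<Rightarrow> nat)"
    and mag: "\<And>B. 0 < B \<Longrightarrow> \<exists>r. \<forall>L>r. \<forall>x\<in>box d L. e \<le> Re (stag x * fv_gs n (box d L) (Hp n d L B) (site_op x (spin n 3)))"
    and lim: "\<And>k x y. x \<in> lattice d \<Longrightarrow> y \<in> lattice d \<Longrightarrow>
        (\<lambda>j. fv_gs n (box d (Ls k j)) (Hp n d (Ls k j) (Bs k)) (ext {x, y} (corr n x y))) \<longlonglongrightarrow> cB k x y"
      "\<And>x y. x \<in> lattice d \<Longrightarrow> y \<in> lattice d \<Longrightarrow> (\<lambda>k. cB k x y) \<longlonglongrightarrow> c0 x y"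
  shows "(e * (real K * (2 * real K) ^ d)) ^ 4 \<le> 8 * (cas n * gradsum d (2 * K)) * potsum d (2 * K)
      * (\<Sum>x\<in>box d (2 * K). \<Sum>y\<in>box d (2 * K). Re (stag x * stag y * c0 x y))\<^sup>2" (is "?l \<le> _")
    and "x \<in> box d (2 * K) \<Longrightarrow> y \<in> box d (2 * K) \<Longrightarrow> \<bar>Re (c0 x y)\<bar> \<le> cas n"
proof -
  let ?T = "box d (2 * K)"
  let ?M = "(cas n + 1) * fieldsum d (2 * K)"
  define \<phi> where "\<phi> k L x y = fv_gs n (box d L) (Hp n d L (Bs k)) (ext {x, y} (corr n x y))" for k L x y
  have latt: "x \<in> lattice d" if "x \<in> ?T" for x using that box_lattice by blast
  have lim1: "(\<lambda>j. \<phi> k (Ls k j) x y) \<longlonglongrightarrow> cB k x y" if "x \<in> ?T" "y \<in> ?T" for k x y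
    unfolding \<phi>_def by (rule lim(1)[OF latt[OF that(1)] latt[OF that(2)]])
  have lim2: "(\<lambda>k. cB k x y) \<longlonglongrightarrow> c0 x y" if "x \<in> ?T" "y \<in> ?T" for x y
    by (rule lim(2)[OF latt[OF that(1)] latt[OF that(2)]])
  have large: "\<exists>N. \<forall>j\<ge>N. m < Ls k j" for k m
  proof (intro exI[of _ "Suc m"] allI impI)
    fix j assume "Suc m \<le> j"
    then show "m < Ls k j" using seq_suble[OF Ls[of k], of j] by linarith
  qed
  have stepk: "?l \<le> 8 * (cas n * gradsum d (2 * K) + Bs k * ?M) * potsum d (2 * K) * (\<Sum>x\<in>?T. \<Sum>y\<in>?T. Re (stag x * stag y * cB k x y))\<^sup>2" for k
  proof (rule LIMSEQ_le_const)
    show "(\<lambda>j. 8 * (cas n * gradsum d (2 * K) + Bs k * ?M) * potsum d (2 * K) * (\<Sum>x\<in>?T. \<Sum>y\<in>?T. Re (stag x * stag y * \<phi> k (Ls k j) x y))\<^sup>2)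
      \<longlonglongrightarrow> 8 * (cas n * gradsum d (2 * K) + Bs k * ?M) * potsum d (2 * K) * (\<Sum>x\<in>?T. \<Sum>y\<in>?T. Re (stag x * stag y * cB k x y))\<^sup>2"
      by (intro tendsto_intros lim1)
    obtain r where r: "\<And>L x. r < L \<Longrightarrow> x \<in> box d L \<Longrightarrow> e \<le> Re (stag x * fv_gs n (box d L) (Hp n d L (Bs k)) (site_op x (spin n 3)))"
      using mag[OF B(1)[of k]] by blast
    obtain N where N: "\<And>j. N \<le> j \<Longrightarrow> max r (Suc (2 * K)) < Ls k j" using large by blast
    show "\<exists>N. \<forall>j\<ge>N. ?l \<le> 8 * (cas n * gradsum d (2 * K) + Bs k * ?M) * potsum d (2 * K) * (\<Sum>x\<in>?T. \<Sum>y\<in>?T. Re (stag x * stag y * \<phi> k (Ls k j) x y))\<^sup>2"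
    proof (intro exI[of _ N] allI impI)
      fix j assume "N \<le> j"
      from N[OF this] have L: "r < Ls k j" "Suc (2 * K) < Ls k j" by auto
      show "?l \<le> 8 * (cas n * gradsum d (2 * K) + Bs k * ?M) * potsum d (2 * K) * (\<Sum>x\<in>?T. \<Sum>y\<in>?T. Re (stag x * stag y * \<phi> k (Ls k j) x y))\<^sup>2"
        unfolding \<phi>_def by (rule volume_bound[OF d L(2) B(1) e]) (rule r[OF L(1)])
    qed
  qed
  have "?l \<le> 8 * (cas n * gradsum d (2 * K) + 0 * ?M) * potsum d (2 * K) * (\<Sum>x\<in>?T. \<Sum>y\<in>?T. Re (stag x * stag y * c0 x y))\<^sup>2"
  proof (rule LIMSEQ_le_const)
    show "(\<lambda>k. 8 * (cas n * gradsum d (2 * K) + Bs k * ?M) * potsum d (2 * K) * (\<Sum>x\<in>?T. \<Sum>y\<in>?T. Re (stag x * stag y * cB k x y))\<^sup>2)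
      \<longlonglongrightarrow> 8 * (cas n * gradsum d (2 * K) + 0 * ?M) * potsum d (2 * K) * (\<Sum>x\<in>?T. \<Sum>y\<in>?T. Re (stag x * stag y * c0 x y))\<^sup>2"
      by (intro tendsto_intros lim2 B(2))
  qed (use stepk in blast)
  then show "?l \<le> 8 * (cas n * gradsum d (2 * K)) * potsum d (2 * K) * (\<Sum>x\<in>?T. \<Sum>y\<in>?T. Re (stag x * stag y * c0 x y))\<^sup>2"
    by (simp only: mult_zero_left add_0_right)
  show "\<bar>Re (c0 x y)\<bar> \<le> cas n" if xy: "x \<in> ?T" "y \<in> ?T"
  proof -
    have bk: "\<bar>Re (cB k x y)\<bar> \<le> cas n" for k
    proof (rule LIMSEQ_le_const2)
      show "(\<lambda>j. \<bar>Re (\<phi> k (Ls k j) x y)\<bar>) \<longlonglongrightarrow> \<bar>Re (cB k x y)\<bar>" by (intro tendsto_intros lim1[OF xy])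
      obtain N where N: "\<And>j. N \<le> j \<Longrightarrow> 2 * K < Ls k j" using large by blast
      show "\<exists>N. \<forall>j\<ge>N. \<bar>Re (\<phi> k (Ls k j) x y)\<bar> \<le> cas n"
      proof (intro exI[of _ N] allI impI)
        fix j assume "N \<le> j"
        from box_mono[of "2 * K" "Ls k j" d] N[OF this] xy have V: "x \<in> box d (Ls k j)" "y \<in> box d (Ls k j)" by auto
        have p: "local_state n (box d (Ls k j)) (fv_gs n (box d (Ls k j)) (Hp n d (Ls k j) (Bs k)))"
          unfolding Hp_eq by (rule local_state_fv_gs[OF finite_box Hfield_herm])
        show "\<bar>Re (\<phi> k (Ls k j) x y)\<bar> \<le> cas n"
          unfolding \<phi>_def ext_corr[OF p finite_box V] by (rule corr_bound[OF p finite_box V])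
      qed
    qed
    show ?thesis
    proof (rule LIMSEQ_le_const2)
      show "(\<lambda>k. \<bar>Re (cB k x y)\<bar>) \<longlonglongrightarrow> \<bar>Re (c0 x y)\<bar>" by (intro tendsto_intros lim2[OF xy])
    qed (use bk in blast)
  qed
qed

lemma abs_Re_stag: "\<bar>Re (stag x * stag y * z)\<bar> = \<bar>Re z\<bar>"
  by (simp add: stag_def)

text \<open>In each row the pairs closer than m get the trivial bound, and there are at most (2m +
  1)^d of them. The others are summed by means of the decay and contribute \<epsilon> times a
  quantity of order R.\<close>

lemma corr_sum_le:
  fixes c :: "site \<Rightarrow> site \<Rightarrow> real"
  assumes a: "0 \<le> a" and ep: "0 \<le> \<epsilon>" and m: "1 \<le> m"
    and near: "\<And>x y. x \<in> box d R \<Longrightarrow> y \<in> box d R \<Longrightarrow> \<bar>c x y\<bar> \<le> a"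
    and far: "\<And>x y. x \<in> box d R \<Longrightarrow> y \<in> box d R \<Longrightarrow> real m \<le> dist_site x y \<Longrightarrow> \<bar>c x y\<bar> \<le> \<epsilon> * (1 / dist_site x y ^ (d - 1))"
  shows "\<bar>\<Sum>x\<in>box d R. \<Sum>y\<in>box d R. c x y\<bar> \<le> (2 * real R) ^ d * ((2 * real m + 1) ^ d * a + \<epsilon> * (real d * (4 * real R) * 3 ^ (d - 1)))"
proof -
  let ?T = "box d R"
  have finT: "finite ?T" by (rule finite_box)
  have row: "\<bar>\<Sum>y\<in>?T. c x y\<bar> \<le> (2 * real m + 1) ^ d * a + \<epsilon> * (real d * (4 * real R) * 3 ^ (d - 1))" if x: "x \<in> ?T" for x
  proof -
    have ptw: "\<bar>c x y\<bar> \<le> (if dist_site x y < real m then a else 0) + (if y \<in> ?T - {x} then \<epsilon> * (1 / dist_site x y ^ (d - 1)) else 0)" if y: "y \<in> ?T" for y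
    proof (cases "dist_site x y < real m")
      case True
      have "0 \<le> \<epsilon> * (1 / dist_site x y ^ (d - 1))" using ep by (simp add: dist_site_def sum_nonneg)
      then show ?thesis using near[OF x y] True by auto
    next
      case False
      have "y \<noteq> x"
      proof
        assume "y = x"
        then have "dist_site x y = 0" by (simp add: dist_site_def)
        then show False using False m by simp
      qed
      then show ?thesis using far[OF x y] False y by simp
    qed
    have "\<bar>\<Sum>y\<in>?T. c x y\<bar> \<le> (\<Sum>y\<in>?T. \<bar>c x y\<bar>)" by (rule sum_abs)
    also have "\<dots> \<le> (\<Sum>y\<in>?T. (if dist_site x y < real m then a else 0) + (if y \<in> ?T - {x} then \<epsilon> * (1 / dist_site x y ^ (d - 1)) else 0))"
      by (rule sum_mono) (rule ptw)
    also have "\<dots> = (\<Sum>y\<in>?T. if dist_site x y < real m then a else 0) + (\<Sum>y\<in>?T. if y \<in> ?T - {x} then \<epsilon> * (1 / dist_site x y ^ (d - 1)) else 0)"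
      by (rule sum.distrib)
    also have "(\<Sum>y\<in>?T. if dist_site x y < real m then a else 0) \<le> (2 * real m + 1) ^ d * a"
    proof -
      have "length x = d" using x by (simp add: box_def)
      from card_near[OF this, of R m] have "real (card {y\<in>?T. dist_site x y < real m}) \<le> (2 * real m + 1) ^ d"
        by (metis (no_types, lifting) of_nat_1 of_nat_add of_nat_le_iff of_nat_mult of_nat_numeral of_nat_power)
      moreover have "(\<Sum>y\<in>?T. if dist_site x y < real m then a else 0) = real (card {y\<in>?T. dist_site x y < real m}) * a"
        using finT by (simp add: sum.If_cases Int_def)
      ultimately show ?thesis using a by (simp add: mult_right_mono)
    qed
    also have "(\<Sum>y\<in>?T. if y \<in> ?T - {x} then \<epsilon> * (1 / dist_site x y ^ (d - 1)) else 0) = \<epsilon> * (\<Sum>y\<in>?T - {x}. 1 / dist_site x y ^ (d - 1))"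
    proof -
      have "(\<Sum>y\<in>?T. if y \<in> ?T - {x} then \<epsilon> * (1 / dist_site x y ^ (d - 1)) else 0) = (\<Sum>y\<in>?T - {x}. if y \<in> ?T - {x} then \<epsilon> * (1 / dist_site x y ^ (d - 1)) else 0)"
        using finT by (intro sum.mono_neutral_right) auto
      also have "\<dots> = (\<Sum>y\<in>?T - {x}. \<epsilon> * (1 / dist_site x y ^ (d - 1)))" by (rule sum.cong) simp_all
      finally show ?thesis by (simp only: sum_distrib_left)
    qed
    also have "\<epsilon> * (\<Sum>y\<in>?T - {x}. 1 / dist_site x y ^ (d - 1)) \<le> \<epsilon> * (real d * (4 * real R) * 3 ^ (d - 1))"
      using sum_inverse_dist[OF x] ep by (rule mult_left_mono)
    finally show ?thesis by simp
  qed
  have "\<bar>\<Sum>x\<in>?T. \<Sum>y\<in>?T. c x y\<bar> \<le> (\<Sum>x\<in>?T. \<bar>\<Sum>y\<in>?T. c x y\<bar>)" by (rule sum_abs)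
  also have "\<dots> \<le> (\<Sum>x\<in>?T. (2 * real m + 1) ^ d * a + \<epsilon> * (real d * (4 * real R) * 3 ^ (d - 1)))"
    by (rule sum_mono) (rule row)
  also have "\<dots> = real (card ?T) * ((2 * real m + 1) ^ d * a + \<epsilon> * (real d * (4 * real R) * 3 ^ (d - 1)))" by (simp only: sum_constant)
  also have "real (card ?T) = (2 * real R) ^ d" unfolding card_box of_nat_power by simp
  finally show ?thesis .
qed

text \<open>\<open>X\<close> stands for R^d and occurs to the fourth power on both sides. After
  division by R^2 X^4 a square root can be taken. The constant is 4096 = 8 * 256 * 2.\<close>

lemma volume_factors_cancel:
  fixes e K R X Y W p q a D G P :: real
  assumes "0 < X" "0 < R" "R = 2 * K" "0 \<le> a" "0 \<le> D" "0 \<le> p" "0 \<le> q" "0 \<le> Y"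
    and G: "G \<le> 256 * D ^ 3 * (p * X)" and P: "P = 2 * D * R\<^sup>2 * (q * X)" and W: "\<bar>W\<bar> \<le> q * X * Y"
    and le: "(e * (K * X)) ^ 4 \<le> 8 * (a * G) * P * W\<^sup>2"
  shows "e\<^sup>2 / 4 * R \<le> sqrt (4096 * D ^ 4 * a * (p * q ^ 3)) * Y"
proof -
  let ?C = "4096 * D ^ 4 * a * (p * q ^ 3)"
  have C: "0 \<le> ?C" using assms by simp
  have P0: "0 \<le> P" unfolding P using assms by simp
  have W2: "W\<^sup>2 \<le> (q * X * Y)\<^sup>2" using W abs_le_square_iff[of W "q * X * Y"] assms by simp
  have "(e * (K * X)) ^ 4 \<le> 8 * (a * G) * P * W\<^sup>2" by (rule le)
  also have "\<dots> \<le> 8 * (a * (256 * D ^ 3 * (p * X))) * P * W\<^sup>2"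
    using G P0 assms by (intro mult_right_mono mult_left_mono) auto
  also have "\<dots> \<le> 8 * (a * (256 * D ^ 3 * (p * X))) * P * (q * X * Y)\<^sup>2"
    using W2 P0 assms by (intro mult_left_mono) auto
  also have "\<dots> = (R\<^sup>2 * X ^ 4) * (?C * Y\<^sup>2)" unfolding P by (simp add: power2_eq_square power3_eq_cube power4_eq_xxxx)
  finally have "(R\<^sup>2 * X ^ 4) * (e\<^sup>2 / 4 * R)\<^sup>2 \<le> (R\<^sup>2 * X ^ 4) * (?C * Y\<^sup>2)"
    unfolding assms(3) by (simp add: power2_eq_square power4_eq_xxxx mult_ac)
  then have "(e\<^sup>2 / 4 * R)\<^sup>2 \<le> ?C * Y\<^sup>2" using assms(1,2) by (simp add: mult_le_cancel_left)
  also have "\<dots> = (sqrt ?C * Y)\<^sup>2" using C by (simp add: power_mult_distrib)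
  finally show ?thesis by (rule power2_le_imp_le) (use C assms in simp)
qed

theorem theorem2p3:
  fixes n d :: nat and \<omega>0 :: "site set \<Rightarrow> obs \<Rightarrow> complex"
  assumes "n \<ge> 1" and "d \<ge> 2"
    and "\<exists>\<omega>. is_state n d \<omega> \<and> is_iv_gs n d \<omega> \<and> magnetization n d \<omega> \<noteq> 0"
    and "\<exists>Bs Ls \<omega>B. (\<forall>k. Bs k > 0) \<and> Bs \<longlonglongrightarrow> 0 \<and> (\<forall>k. strict_mono (Ls k)) \<and>
          (\<forall>k G A. finite G \<and> G \<subseteq> lattice d \<longrightarrow>
             ((\<lambda>j. fv_gs n (box d (Ls k j)) (Hp n d (Ls k j) (Bs k)) (ext G A)) \<longlonglongrightarrow> \<omega>B k G A)) \<and>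
          (\<forall>G A. finite G \<and> G \<subseteq> lattice d \<longrightarrow> ((\<lambda>k. \<omega>B k G A) \<longlonglongrightarrow> \<omega>0 G A))"
  shows "\<not> (\<forall>\<epsilon>>0. \<exists>R. \<forall>x\<in>lattice d. \<forall>y\<in>lattice d. dist_site x y \<ge> R \<longrightarrow>
            dist_site x y ^ (d - 1) *
              cmod (\<omega>0 {x, y} (opmult n {x, y} (site_op x (spin2 n)) (site_op y (spin2 n)))) < \<epsilon>)"
proof
  assume decay: "\<forall>\<epsilon>>0. \<exists>R. \<forall>x\<in>lattice d. \<forall>y\<in>lattice d. dist_site x y \<ge> R \<longrightarrow>
            dist_site x y ^ (d - 1) *
              cmod (\<omega>0 {x, y} (opmult n {x, y} (site_op x (spin2 n)) (site_op y (spin2 n)))) < \<epsilon>"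
  have d: "d \<ge> 1" using assms(2) by simp
  obtain \<omega> where \<omega>: "is_state n d \<omega>" "is_iv_gs n d \<omega>" "magnetization n d \<omega> \<noteq> 0" using assms(3) by blast
  obtain e where e: "0 < e" and mag: "\<And>B. 0 < B \<Longrightarrow> \<exists>r. \<forall>L>r. \<forall>x\<in>box d L. e \<le> Re (stag x * fv_gs n (box d L) (Hp n d L B) (site_op x (spin n 3)))"
    using staggered_magnetization[OF \<omega>] by blast
  obtain Bs Ls \<omega>B where seq': "\<forall>k. Bs k > 0" "Bs \<longlonglongrightarrow> 0" "\<forall>k. strict_mono (Ls k)"
    and lim': "\<forall>k G A. finite G \<and> G \<subseteq> lattice d \<longrightarrow>
             ((\<lambda>j. fv_gs n (box d (Ls k j)) (Hp n d (Ls k j) (Bs k)) (ext G A)) \<longlonglongrightarrow> \<omega>B k G A)"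
      "\<forall>G A. finite G \<and> G \<subseteq> lattice d \<longrightarrow> ((\<lambda>k. \<omega>B k G A) \<longlonglongrightarrow> \<omega>0 G A)"
    using assms(4) by (elim exE conjE) (rule that; assumption)
  have seq: "0 < Bs k" "Bs \<longlonglongrightarrow> 0" "strict_mono (Ls k)" for k using seq' by simp_all
  have lim: "(\<lambda>j. fv_gs n (box d (Ls k j)) (Hp n d (Ls k j) (Bs k)) (ext G A)) \<longlonglongrightarrow> \<omega>B k G A"
      "(\<lambda>k. \<omega>B k G A) \<longlonglongrightarrow> \<omega>0 G A" if "finite G" "G \<subseteq> lattice d" for k G A
    using lim' that by simp_all
  define c0 where "c0 x y = \<omega>0 {x, y} (corr n x y)" for x y
  define a where "a = cas n"
  have a: "0 \<le> a" unfolding a_def by (rule cas_nonneg)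
  have bound: "(e * (real K * (2 * real K) ^ d)) ^ 4 \<le> 8 * (a * gradsum d (2 * K)) * potsum d (2 * K)
      * (\<Sum>x\<in>box d (2 * K). \<Sum>y\<in>box d (2 * K). Re (stag x * stag y * c0 x y))\<^sup>2" for K
    unfolding a_def by (rule limit_bound(1)[OF d e seq mag, where cB = "\<lambda>k x y. \<omega>B k {x, y} (corr n x y)"]) (auto simp: c0_def intro!: lim)
  have near: "\<bar>Re (c0 x y)\<bar> \<le> a" if "x \<in> box d (2 * K)" "y \<in> box d (2 * K)" for K x y
    unfolding a_def by (rule limit_bound(2)[OF d e seq mag _ _ that, where cB = "\<lambda>k x y. \<omega>B k {x, y} (corr n x y)"]) (auto simp: c0_def intro!: lim)
  \<comment> \<open>The constant of \<open>volume_factors_cancel\<close> for p = 3^d and q =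
    2^d.\<close>
  define C where "C = sqrt (4096 * real d ^ 4 * a * (3 ^ d * (2 ^ d) ^ 3))"
  have C: "0 \<le> C" unfolding C_def using a by simp
  define s where "s = real d * 4 * 3 ^ (d - 1)"
  have s: "0 \<le> s" by (simp add: s_def)
  \<comment> \<open>Makes the contribution of distant pairs at most half of the left side e^2/4 * R;
    the summand 1 keeps the denominator positive.\<close>
  define \<epsilon> where "\<epsilon> = e\<^sup>2 / (8 * (C * s + 1))"
  have ep: "0 < \<epsilon>" unfolding \<epsilon>_def using C s e by (intro divide_pos_pos) (auto intro: add_nonneg_pos)
  have eps: "C * (\<epsilon> * s) \<le> e\<^sup>2 / 8"
  proof -
    have "C * (\<epsilon> * s) = (e\<^sup>2 / 8) * (C * s / (C * s + 1))" unfolding \<epsilon>_def by simp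
    also have "\<dots> \<le> (e\<^sup>2 / 8) * 1" using C s by (intro mult_left_mono) (auto simp: divide_simps add_nonneg_pos intro: order.strict_implies_not_eq)
    finally show ?thesis by simp
  qed
  obtain R0 where R0: "\<And>x y. x \<in> lattice d \<Longrightarrow> y \<in> lattice d \<Longrightarrow> R0 \<le> dist_site x y \<Longrightarrow> dist_site x y ^ (d - 1) * cmod (c0 x y) < \<epsilon>"
    using decay ep unfolding c0_def corr_def by blast
  \<comment> \<open>Positive, so that distant pairs are distinct and one may divide by powers of
    their distance.\<close>
  define m where "m = Suc (nat \<lceil>R0\<rceil>)"
  have m: "1 \<le> m" "R0 \<le> real m" unfolding m_def by simp linarith
  have far: "\<bar>Re (c0 x y)\<bar> \<le> \<epsilon> * (1 / dist_site x y ^ (d - 1))"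
    if "x \<in> lattice d" "y \<in> lattice d" "real m \<le> dist_site x y" for x y
  proof -
    have pos: "0 < dist_site x y ^ (d - 1)" using that(3) m by simp
    have "cmod (c0 x y) \<le> \<epsilon> / dist_site x y ^ (d - 1)"
      using R0[OF that(1,2)] that(3) m(2) pos by (simp add: pos_le_divide_eq mult.commute)
    then show ?thesis using abs_Re_le_cmod[of "c0 x y"] by simp
  qed
  define N where "N = (2 * real m + 1) ^ d * a"
  have N: "0 \<le> N" unfolding N_def using a by simp
  have est: "e\<^sup>2 / 4 * real (2 * K) \<le> C * (N + \<epsilon> * s * real (2 * K))" if K: "1 \<le> K" for K
    unfolding C_def
  proof (rule volume_factors_cancel)
    let ?T = "box d (2 * K)"
    have "\<bar>\<Sum>x\<in>?T. \<Sum>y\<in>?T. Re (stag x * stag y * c0 x y)\<bar> \<le> (2 * real (2 * K)) ^ d * (N + \<epsilon> * (real d * (4 * real (2 * K)) * 3 ^ (d - 1)))"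
      unfolding N_def
    proof (rule corr_sum_le[OF a less_imp_le[OF ep] m(1)]; unfold abs_Re_stag)
      fix x y assume "x \<in> ?T" "y \<in> ?T"
      then show "\<bar>Re (c0 x y)\<bar> \<le> a" by (rule near)
    next
      fix x y assume "x \<in> ?T" "y \<in> ?T" "real m \<le> dist_site x y"
      then show "\<bar>Re (c0 x y)\<bar> \<le> \<epsilon> * (1 / dist_site x y ^ (d - 1))" using box_lattice by (intro far) auto
    qed
    then show "\<bar>\<Sum>x\<in>?T. \<Sum>y\<in>?T. Re (stag x * stag y * c0 x y)\<bar> \<le> 2 ^ d * real (2 * K) ^ d * (N + \<epsilon> * s * real (2 * K))"
      by (simp only: s_def power_mult_distrib mult_ac)
    show "(e * (real K * real (2 * K) ^ d)) ^ 4 \<le> 8 * (a * gradsum d (2 * K)) * potsum d (2 * K) * (\<Sum>x\<in>?T. \<Sum>y\<in>?T. Re (stag x * stag y * c0 x y))\<^sup>2"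
      using bound[of K] by (simp only: of_nat_mult of_nat_numeral)
    show "potsum d (2 * K) = 2 * real d * (real (2 * K))\<^sup>2 * (2 ^ d * real (2 * K) ^ d)"
      by (simp only: potsum_def power_mult_distrib)
    \<comment> \<open>For K \<ge> 1 one has 2 (2K + 1) \<le> 6K, which absorbs the additional layer
      into the factor 3^d.\<close>
    have "(2 * real (Suc (2 * K))) ^ d \<le> (3 * real (2 * K)) ^ d" using K by (intro power_mono) auto
    then show "gradsum d (2 * K) \<le> 256 * real d ^ 3 * (3 ^ d * real (2 * K) ^ d)"
      unfolding gradsum_def power_mult_distrib[of 3 "real (2 * K)" d, symmetric] by (intro mult_left_mono) auto
  qed (use K a N s ep in auto)
  \<comment> \<open>The near pairs contribute a constant while the left side grows linearly in K.
    This K exceeds twice what the inequality permits, so a contradiction follows even if C N =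
    0.\<close>
  obtain K where K: "C * N * 8 / e\<^sup>2 < real K" using reals_Archimedean2 by blast
  have "0 \<le> C * N * 8 / e\<^sup>2" using C N by simp
  then have K1: "1 \<le> K" using K by (cases K) auto
  have "e\<^sup>2 / 4 * real (2 * K) \<le> C * N + C * (\<epsilon> * s) * real (2 * K)" using est[OF K1] by (simp add: algebra_simps)
  also have "\<dots> \<le> C * N + e\<^sup>2 / 8 * real (2 * K)" using eps by (intro add_left_mono mult_right_mono) auto
  finally have "e\<^sup>2 * real K \<le> C * N * 4" by (simp add: field_simps)
  moreover have "C * N * 8 < e\<^sup>2 * real K" using K e by (simp add: pos_divide_less_eq mult.commute)
  moreover have "0 \<le> C * N" using C N by simp
  ultimately show False by linarith
qed

end
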